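(* Let $R,P>0$, $S=\{(x,y)\in\mathbb{R}^2:|y|\le R\}$, $a\ne0$, $k\ge0$ an integer and $\alpha\in(0,1)$. Suppose $\phi^\pm\in C^{k+2,\alpha}(\mathbb{R})$ satisfy $\phi^\pm(x+P)\equiv\phi^\pm(x)$. Then there exists a unique $v\in C^{k+2,\alpha}(S)$ satisfying $$\frac{\partial}{\partial x}\Bigl[(v^2+y^2+a^2)^{-1/2}\frac{\partial v}{\partial x}\Bigr]+2\frac{\partial^2v}{\partial y^2}=0,$$ $v(x+P,y)\equiv v(x,y)$, and $v(x,\pm R)\equiv\phi^\pm(x)$.
   Context: $C^{k,\alpha}$ denotes the Hölder space of $C^k$ functions whose derivatives up to order $k$ are bounded and whose $k$-th derivatives are uniformly $\alpha$-Hölder continuous. *)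

theory Defs
  imports "HOL-Analysis.Analysis"
begin

inductive pderiv_of :: "'a::euclidean_space set \<Rightarrow> ('a \<Rightarrow> real) \<Rightarrow> nat \<Rightarrow> ('a \<Rightarrow> real) \<Rightarrow> bool"
  for S :: "'a set" and f :: "'a \<Rightarrow> real" where
  base: "pderiv_of S f 0 f"
| step: "pderiv_of S f j g \<Longrightarrow> (\<forall>p\<in>S. (g has_derivative g' p) (at p within S)) \<Longrightarrow>
         b \<in> Basis \<Longrightarrow> pderiv_of S f (Suc j) (\<lambda>p. g' p b)"

definition hoelder_space :: "nat \<Rightarrow> real \<Rightarrow> 'a::euclidean_space set \<Rightarrow> ('a \<Rightarrow> real) \<Rightarrow> bool" where
  "hoelder_space k \<alpha> S f \<longleftrightarrow>
     (\<forall>j<k. \<forall>g. pderiv_of S f j g \<longrightarrow> (\<exists>g'. \<forall>p\<in>S. (g has_derivative g' p) (at p within S))) \<and>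
     (\<forall>j\<le>k. \<forall>g. pderiv_of S f j g \<longrightarrow> continuous_on S g \<and> bounded (g ` S)) \<and>
     (\<exists>C. \<forall>g. pderiv_of S f k g \<longrightarrow> (\<forall>p\<in>S. \<forall>q\<in>S. \<bar>g p - g q\<bar> \<le> C * dist p q powr \<alpha>))"

definition partial_x :: "(real \<times> real) set \<Rightarrow> (real \<times> real \<Rightarrow> real) \<Rightarrow> real \<times> real \<Rightarrow> real" where
  "partial_x S f p = frechet_derivative f (at p within S) (1, 0)"

definition partial_y :: "(real \<times> real) set \<Rightarrow> (real \<times> real \<Rightarrow> real) \<Rightarrow> real \<times> real \<Rightarrow> real" where
  "partial_y S f p = frechet_derivative f (at p within S) (0, 1)"

definition strip :: "real \<Rightarrow> (real \<times> real) set" where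
  "strip R = {(x, y). \<bar>y\<bar> \<le> R}"

definition solves_problem ::
  "real \<Rightarrow> real \<Rightarrow> real \<Rightarrow> (real \<Rightarrow> real) \<Rightarrow> (real \<Rightarrow> real) \<Rightarrow> (real \<times> real \<Rightarrow> real) \<Rightarrow> bool" where
  "solves_problem R P a \<phi>p \<phi>m v \<longleftrightarrow>
     (\<forall>p\<in>strip R.
        partial_x (strip R) (\<lambda>q. (v q ^ 2 + snd q ^ 2 + a ^ 2) powr (-1/2) * partial_x (strip R) v q) p
        + 2 * partial_y (strip R) (partial_y (strip R) v) p = 0) \<and>
     (\<forall>x y. (x, y) \<in> strip R \<longrightarrow> v (x + P, y) = v (x, y)) \<and>
     (\<forall>x. v (x, R) = \<phi>p x \<and> v (x, -R) = \<phi>m x)"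

end

theory Submission
  imports Defs "HOL-Complex_Analysis.Complex_Analysis"
begin

text \<open>
  With \<open>F(v, y) = arsinh (v / sqrt (y\<^sup>2 + a\<^sup>2))\<close> the equation is \<open>F(v, y)\<^sub>x\<^sub>x + 2 v\<^sub>y\<^sub>y = 0\<close>. Writing
  \<open>v = u\<^sub>x\<^sub>x + l\<close>, where \<open>l\<close> is the affine function of \<open>y\<close> that interpolates the mean values of the data,
  it follows from the fully nonlinear equation \<open>F(u\<^sub>x\<^sub>x + l, y) + 2 u\<^sub>y\<^sub>y = 0\<close> with twice integrated data.
  The latter is solved by continuation along multiples of the data, each step being a Newton iteration
  based on Schauder theory for \<open>A u\<^sub>x\<^sub>x + 2 u\<^sub>y\<^sub>y = f\<close> on the strip. The Schauder estimate is proved by blow-up,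
  which reduces it to Liouville theorems in the plane and in the half plane.

  The continuation needs an a priori bound for \<open>v\<close> in a Hoelder space. The maximum principle bounds \<open>v\<close>. If
  its gradient reaches a large value \<open>M\<close>, then the scaled Schauder estimate keeps it of that size on a square of side
  comparable to \<open>1/M\<close>, while a Caccioppoli inequality with a logarithmic cutoff function makes the energy on such
  a square small, as the problem is two-dimensional. Differentiating along the boundary and using the equation for
  the second normal derivative gives the higher regularity. Two solutions are compared by duality.
\<close>

subsection \<open>Limits along an ultrafilter\<close>

text \<open>Linearising the equation for \<open>v\<close> itself gives
  \<open>(A w)_xx + 2 w_yy\<close>. Its expansion has the zeroth order coefficient
  \<open>A_xx\<close>, which has no sign, so the maximum principle is out of reach. The equation for
  \<open>u\<close> linearises to the adjoint operator \<open>A q_xx + 2 q_yy\<close> without lower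
  order terms. This is why existence passes through \<open>u\<close>, and why uniqueness tests with
  a solution of the adjoint problem. Integrating the equation over a period shows that the mean of
  \<open>v\<close> is affine in \<open>y\<close>; only after its removal are two periodic
  integrations in \<open>x\<close> possible. The length of a continuation step depends on the
  current solution only through a Hoelder bound for \<open>v\<close>, which fixes the form of the a
  priori estimate. Scaling alone bounds second derivatives by a multiple of \<open>M^2\<close>,
  which is consistent with every size \<open>M\<close> of the gradient; the logarithm in the planar
  energy is what excludes large \<open>M\<close>. Compactness always means a pointwise limit along
  one fixed ultrafilter. It works because derivatives and Hoelder bounds are characterised by
  inequalities that survive such limits.\<close>

lemma exists_ultrafilter:
 "\<exists>U::nat filter. U \<noteq> bot \<and> U <= sequentially \<and> (\<forall>Q. eventually Q U \<or> eventually (%n. \<not> Q n) U)"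
proof -
 define S where "S = {F::nat filter. F \<noteq> bot \<and> F <= sequentially}"
 \<comment> \<open>\<open>r\<close> relates a filter to its refinements, so the maximal element
   supplied by Zorn's lemma is a minimal nontrivial filter.\<close>
 define r where "r = {(F,G). F \<in> S \<and> G \<in> S \<and> G <= F}"
 have Field: "Field r = S" unfolding r_def Field_def by auto
 have po: "Partial_order r"
  unfolding partial_order_on_def preorder_on_def refl_on_def trans_def antisym_def Field
  by (auto simp: r_def intro: order_trans)
 have "\<exists>m\<in>Field r. \<forall>a\<in>Field r. (m, a) \<in> r --> a = m"
 proof (rule Zorns_po_lemma[OF po])
  fix C assume C: "C \<in> Chains r"
  show "\<exists>u\<in>Field r. \<forall>a\<in>C. (a, u) \<in> r"
  proof (cases "C = {}")
   case True
   have "sequentially \<in> S" unfolding S_def by auto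
   then show ?thesis using True Field by auto
  next
   case False
   have CS: "C \<subseteq> S" using C unfolding Chains_def r_def by auto
   have dir: "\<exists>x\<in>C. x <= inf F G" if "F \<in> C" "G \<in> C" for F G
    using C that unfolding Chains_def r_def by auto
   \<comment> \<open>A chain is directed, so an event of the infimum is already an event of one
     member, and \<open>False\<close> is an event of none.\<close>
   have "Inf C \<noteq> bot"
   proof
    assume "Inf C = bot"
    then have "eventually (%_. False) (Inf C)" by simp
    then have "\<exists>b\<in>C. eventually (%_. False) b"
     using eventually_Inf_base[OF False dir] by blast
    then show False using CS unfolding S_def by (auto simp: eventually_False)
   qed
   moreover have "Inf C <= sequentially"
    using False CS unfolding S_def by (metis (no_types, lifting) Inf_lower all_not_in_conv mem_Collect_eq order_trans subsetD)
   ultimately have "Inf C \<in> S" unfolding S_def by auto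
   then show ?thesis using CS Field unfolding r_def by (auto intro!: bexI[of _ "Inf C"] Inf_lower)
  qed
 qed
 then obtain U where U: "U \<in> S" and max: "!!G. G \<in> S ==> G <= U ==> G = U"
  unfolding Field by (auto simp: r_def)
 have "eventually Q U \<or> eventually (%n. \<not> Q n) U" for Q
 proof (rule disjCI)
  assume n: "\<not> eventually (%n. \<not> Q n) U"
  have ev: "eventually X (inf U (principal {n. Q n})) \<longleftrightarrow> eventually (%n. Q n --> X n) U" for X
   by (simp add: eventually_inf_principal)
  \<comment> \<open>Refining \<open>U\<close> by \<open>Q\<close> keeps it nontrivial, since the
    negation of \<open>Q\<close> is no event of \<open>U\<close>. Minimality then says that
    \<open>Q\<close> is one.\<close>
  have "inf U (principal {n. Q n}) \<noteq> bot"
   using n ev[of "%_. False"] by (auto simp: eventually_False[symmetric])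
  then have "inf U (principal {n. Q n}) \<in> S" using U unfolding S_def by (auto intro: le_infI1)
  then have "inf U (principal {n. Q n}) = U" by (rule max) simp
  then show "eventually Q U" using ev[of Q] by simp
 qed
 then show ?thesis using U unfolding S_def by auto
qed

text \<open>One fixed ultrafilter replaces the extraction of subsequences: every bounded real
  sequence converges along it, so a sequence of functions acquires limits at uncountably many points
  at once, and alternatives depending on the index are decided.\<close>

definition uf :: "nat filter" where
 "uf = (SOME U. U \<noteq> bot \<and> U <= sequentially \<and> (\<forall>Q. eventually Q U \<or> eventually (%n. \<not> Q n) U))"

lemma uf_props:
 "uf \<noteq> bot \<and> uf <= sequentially \<and> (\<forall>Q. eventually Q uf \<or> eventually (%n. \<not> Q n) uf)"
 unfolding uf_def by (rule someI_ex[OF exists_ultrafilter])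

lemma uf_nontrivial [simp]: "uf \<noteq> bot" "bot \<noteq> uf"
 using uf_props by auto

lemma uf_ultra: "eventually Q uf \<or> eventually (%n. \<not> Q n) uf"
 using uf_props by auto

lemma eventually_uf: "eventually Q sequentially ==> eventually Q uf"
 using uf_props filter_leD by blast

lemma tendsto_uf: "X \<longlonglongrightarrow> l ==> (X \<longlongrightarrow> l) uf"
 using uf_props tendsto_mono by blast

text \<open>Compactness gives a cluster point. For an ultrafilter a cluster point is a limit, since
  each neighbourhood or its complement is an event.\<close>

lemma uf_compact_limit:
 fixes f :: "nat => 'a::topological_space"
 assumes K: "compact K" and ev: "eventually (%n. f n \<in> K) uf"
 shows "\<exists>l\<in>K. (f \<longlongrightarrow> l) uf"
proof -
 have "filtermap f uf \<noteq> bot" by (simp add: filtermap_bot_iff)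
 moreover have "eventually (%x. x \<in> K) (filtermap f uf)" using ev by (simp add: eventually_filtermap)
 ultimately obtain l where l: "l \<in> K" "inf (nhds l) (filtermap f uf) \<noteq> bot"
  using K unfolding compact_filter by blast
 have "(f \<longlongrightarrow> l) uf"
 proof (rule topological_tendstoI)
  fix T assume T: "open T" "l \<in> T"
  show "eventually (%n. f n \<in> T) uf"
  proof (rule ccontr)
   assume "\<not> eventually (%n. f n \<in> T) uf"
   then have "eventually (%n. f n \<notin> T) uf" using uf_ultra by blast
   then have "eventually (%x. x \<notin> T) (filtermap f uf)" by (simp add: eventually_filtermap)
   moreover have "eventually (%x. x \<in> T) (nhds l)" using T eventually_nhds by blast
   ultimately have "eventually (%x. False) (inf (nhds l) (filtermap f uf))"
    unfolding eventually_inf by (metis (mono_tags))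
   then show False using l(2) by (simp add: eventually_False)
  qed
 qed
 then show ?thesis using l by blast
qed

lemma uf_bounded_limit:
 fixes f :: "nat => real"
 assumes "eventually (%n. \<bar>f n\<bar> <= B) uf"
 shows "\<exists>l. (f \<longlongrightarrow> l) uf"
proof -
 have "eventually (%n. f n \<in> {-B..B}) uf" using assms by eventually_elim auto
 then show ?thesis using uf_compact_limit[of "{-B..B}" f] by auto
qed

lemma uf_lim_le:
 fixes f g :: "nat => real"
 assumes "(f \<longlongrightarrow> l) uf" "(g \<longlongrightarrow> m) uf" "eventually (%n. f n <= g n) uf"
 shows "l <= m"
 by (rule tendsto_le[OF uf_nontrivial(1) assms(2,1,3)])

lemma uf_lim_unique:
 fixes f :: "nat => real"
 assumes "(f \<longlongrightarrow> l) uf" "(f \<longlongrightarrow> m) uf"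
 shows "l = m"
 using tendsto_unique[OF uf_nontrivial(1) assms] .

subsection \<open>Gradients, Hoelder bounds and second-order jets\<close>

text \<open>Relational, so that partial derivatives travel as data and their uniqueness matters only
  where two of them are compared. Differentiation is within \<open>S\<close>, hence one-sided at the
  edges of the closed strip.\<close>

definition grad :: "(real \<times> real) set => (real \<times> real => real) => (real \<times> real => real) => (real \<times> real => real) => bool" where
 "grad S f f1 f2 \<longleftrightarrow> (\<forall>p\<in>S. (f has_derivative (%h. fst h * f1 p + snd h * f2 p)) (at p within S))"

definition hol :: "'a::metric_space set => real => real => ('a => real) => bool" where
 "hol S al K f \<longleftrightarrow> (\<forall>p\<in>S. \<forall>q\<in>S. \<bar>f p - f q\<bar> <= K * dist p q powr al)"

text \<open>A bound for the full Hoelder norm up to a factor 2, kept as one constant so that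
  estimates chain without pairs of constants.\<close>

definition hb :: "'a::metric_space set => real => real => ('a => real) => bool" where
 "hb S al K f \<longleftrightarrow> (\<forall>p\<in>S. \<bar>f p\<bar> <= K) \<and> hol S al K f"

text \<open>A jet lists \<open>u, u\<^sub>x, u\<^sub>y, u\<^sub>x\<^sub>x, u\<^sub>x\<^sub>y, u\<^sub>y\<^sub>y\<close> at the indices \<open>0, \<dots>, 5\<close>.\<close>
definition jet :: "(real \<times> real) set => (nat => real \<times> real => real) => bool" where
 "jet S J \<longleftrightarrow> grad S (J 0) (J 1) (J 2) \<and> grad S (J 1) (J 3) (J 4) \<and> grad S (J 2) (J 4) (J 5)"

lemma convex_strip: "convex (strip R)"
proof -
 have "strip R = {p. inner (0,1) p <= R} \<inter> {p. inner (0,1) p \<ge> -R}"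
  unfolding strip_def by (auto simp: inner_prod_def abs_le_iff)
 then show ?thesis by (simp add: convex_Int convex_halfspace_le convex_halfspace_ge)
qed

lemma mem_strip: "p \<in> strip R \<longleftrightarrow> \<bar>snd p\<bar> <= R"
 unfolding strip_def by (cases p) auto

text \<open>Points of the strip accumulate at \<open>p\<close> in each coordinate direction even on
  an edge, which makes derivatives within the closed strip unique. The vertical step is taken
  towards the axis.\<close>

lemma strip_approach:
 assumes "R > 0" "p \<in> strip R" "b \<in> Basis" "e > 0"
 shows "\<exists>d. 0 < \<bar>d\<bar> \<and> \<bar>d\<bar> < e \<and> p + d *\<^sub>R b \<in> strip R"
proof -
 have "b = (1,0) \<or> b = (0,1)" using assms(3) by (auto simp: Basis_prod_def)
 then show ?thesis
 proof
  assume "b = (1,0)"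
  then show ?thesis using assms by (intro exI[of _ "e/2"]) (auto simp: mem_strip)
 next
  assume b: "b = (0,1)"
  define d where "d = min (e/2) R"
  have d: "0 < d" "d < e" "d <= R" using assms by (auto simp: d_def)
  show ?thesis
  proof (cases "snd p <= 0")
   case True
   then show ?thesis using assms b d by (intro exI[of _ d]) (auto simp: mem_strip)
  next
   case False
   then show ?thesis using assms b d by (intro exI[of _ "-d"]) (auto simp: mem_strip)
  qed
 qed
qed

lemma has_derivative_unique_strip:
 fixes f :: "real \<times> real => real"
 assumes "R > 0" "p \<in> strip R" "(f has_derivative f') (at p within strip R)" "(f has_derivative f'') (at p within strip R)"
 shows "f' = f''"
 by (rule frechet_derivative_unique_within[OF assms(3,4)]) (use strip_approach assms in auto)

lemma grad_unique:
 assumes "R > 0" "grad (strip R) f f1 f2" "grad (strip R) g g1 g2" "!!p. p \<in> strip R ==> f p = g p" "p \<in> strip R"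
 shows "f1 p = g1 p" "f2 p = g2 p"
proof -
 have "(g has_derivative (%h. fst h * f1 p + snd h * f2 p)) (at p within strip R)"
  by (rule has_derivative_transform[where f=f]) (use assms(2,4,5) in \<open>auto simp: grad_def\<close>)
 then have e: "(%h. fst h * f1 p + snd h * f2 p) = (%h. fst h * g1 p + snd h * g2 p)"
  using has_derivative_unique_strip[OF assms(1,5)] assms(3,5) unfolding grad_def by blast
 show "f1 p = g1 p" "f2 p = g2 p" using fun_cong[OF e, of "(1,0)"] fun_cong[OF e, of "(0,1)"] by auto
qed

lemma grad_cong:
 assumes "grad S f f1 f2" "!!p. p \<in> S ==> g p = f p" "!!p. p \<in> S ==> g1 p = f1 p" "!!p. p \<in> S ==> g2 p = f2 p"
 shows "grad S g g1 g2"
 unfolding grad_def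
proof
 fix p assume p: "p \<in> S"
 have "(f has_derivative (%h. fst h * f1 p + snd h * f2 p)) (at p within S)"
  using assms(1) p unfolding grad_def by auto
 then have "(g has_derivative (%h. fst h * f1 p + snd h * f2 p)) (at p within S)"
  by (rule has_derivative_transform[rotated 2]) (use assms p in auto)
 then show "(g has_derivative (%h. fst h * g1 p + snd h * g2 p)) (at p within S)"
  using assms p by simp
qed

lemma grad_line:
 assumes "grad S f f1 f2" "!!s. s \<in> T ==> p + s *\<^sub>R e \<in> S" "t \<in> T"
 shows "((%s. f (p + s *\<^sub>R e)) has_real_derivative (fst e * f1 (p + t *\<^sub>R e) + snd e * f2 (p + t *\<^sub>R e))) (at t within T)"
proof -
 have 1: "((%s. p + s *\<^sub>R e) has_derivative (%s. s *\<^sub>R e)) (at t within T)"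
  by (auto intro!: derivative_eq_intros)
 have 2: "(f has_derivative (%h. fst h * f1 (p + t *\<^sub>R e) + snd h * f2 (p + t *\<^sub>R e))) (at (p + t *\<^sub>R e) within (%s. p + s *\<^sub>R e) ` T)"
  using assms unfolding grad_def by (meson has_derivative_subset image_subsetI)
 have "((%s. f (p + s *\<^sub>R e)) has_derivative (%s. fst (s *\<^sub>R e) * f1 (p + t *\<^sub>R e) + snd (s *\<^sub>R e) * f2 (p + t *\<^sub>R e))) (at t within T)"
  by (rule has_derivative_in_compose[OF 1 2])
 then show ?thesis unfolding has_field_derivative_def
  by (rule has_derivative_eq_rhs) (auto simp: algebra_simps)
qed

lemma grad_mvt:
 assumes "convex S" "grad S f f1 f2" "p \<in> S" "q \<in> S"
 shows "\<exists>t\<in>{0..1}. f q - f p = (fst q - fst p) * f1 (p + t *\<^sub>R (q - p)) + (snd q - snd p) * f2 (p + t *\<^sub>R (q - p))"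
proof -
 have seg: "p + s *\<^sub>R (q - p) \<in> S" if "s \<in> {0..1}" for s
 proof -
  have "p + s *\<^sub>R (q - p) = (1 - s) *\<^sub>R p + s *\<^sub>R q" by (simp add: algebra_simps)
  then show ?thesis using assms(1,3,4) that by (auto simp: convex_alt)
 qed
 define \<phi> where "\<phi> = (%s. f (p + s *\<^sub>R (q - p)))"
 define d where "d = (%s. fst (q - p) * f1 (p + s *\<^sub>R (q - p)) + snd (q - p) * f2 (p + s *\<^sub>R (q - p)))"
 have "\<exists>x\<in>{0..1}. \<phi> 1 - \<phi> 0 = (1 - 0) * d x"
 proof (rule mvt_very_simple[of 0 1 \<phi> "%x h. h * d x"])
  show "(0::real) <= 1" by simp
 next
  fix x :: real assume "0 <= x" "x <= 1"
  then show "(\<phi> has_derivative (%h. h * d x)) (at x within {0..1})"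
   using grad_line[OF assms(2), of "{0..1}" p "q - p" x] seg
   unfolding \<phi>_def d_def has_field_derivative_def by (simp add: mult_commute_abs)
 qed
 then show ?thesis unfolding \<phi>_def d_def by simp
qed

lemma seg_dist:
 fixes p q :: "'a::real_normed_vector"
 assumes "t \<in> {0..1}" shows "dist (p + t *\<^sub>R (q - p)) p <= dist p q"
proof -
 have "dist (p + t *\<^sub>R (q - p)) p = \<bar>t\<bar> * norm (q - p)" by (simp add: dist_norm)
 also have "\<dots> <= 1 * norm (q - p)" using assms by (intro mult_right_mono) auto
 finally show ?thesis by (simp add: dist_norm norm_minus_commute)
qed

lemma fst_snd_dist: "\<bar>fst q - fst p\<bar> <= dist p q" "\<bar>snd q - snd p\<bar> <= dist p (q::real\<times>real)"
 using dist_fst_le[of p q] dist_snd_le[of p q] by (auto simp: dist_real_def abs_minus_commute)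

text \<open>By the mean value theorem on the segment, the partial derivatives at an intermediate
  point replace those at \<open>p\<close> up to the Hoelder bound. The estimate contains no limit
  process and therefore passes to pointwise limits.\<close>

lemma grad_taylor:
 assumes "convex S" "grad S f f1 f2" "hol S al C f1" "hol S al C f2" "p \<in> S" "q \<in> S" "C \<ge> 0" "al > 0"
 shows "\<bar>f q - f p - ((fst q - fst p) * f1 p + (snd q - snd p) * f2 p)\<bar> <= 2 * C * (dist p q * dist p q powr al)"
proof -
 obtain t where t: "t \<in> {0..1}" "f q - f p = (fst q - fst p) * f1 (p + t *\<^sub>R (q - p)) + (snd q - snd p) * f2 (p + t *\<^sub>R (q - p))"
  using grad_mvt[OF assms(1,2,5,6)] by auto
 define z where "z = p + t *\<^sub>R (q - p)"
 have "z = (1 - t) *\<^sub>R p + t *\<^sub>R q" by (simp add: algebra_simps z_def)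
 then have zS: "z \<in> S" using assms(1,5,6) t(1) by (auto simp: convex_alt)
 have d: "dist z p <= dist p q" unfolding z_def using seg_dist[OF t(1)] .
 have pw: "C * dist z p powr al <= C * dist p q powr al" using d assms by (intro mult_left_mono powr_mono2) auto
 have b1: "\<bar>f1 z - f1 p\<bar> <= C * dist p q powr al" "\<bar>f2 z - f2 p\<bar> <= C * dist p q powr al"
  using assms(3,4,5) zS pw unfolding hol_def by fastforce+
 have "f q - f p - ((fst q - fst p) * f1 p + (snd q - snd p) * f2 p) = (fst q - fst p) * (f1 z - f1 p) + (snd q - snd p) * (f2 z - f2 p)"
  using t(2) unfolding z_def by (simp add: algebra_simps)
 also have "\<bar>\<dots>\<bar> <= \<bar>fst q - fst p\<bar> * \<bar>f1 z - f1 p\<bar> + \<bar>snd q - snd p\<bar> * \<bar>f2 z - f2 p\<bar>"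
  by (metis abs_mult abs_triangle_ineq)
 also have "\<dots> <= dist p q * (C * dist p q powr al) + dist p q * (C * dist p q powr al)"
  using b1 fst_snd_dist[of q p] assms by (intro add_mono mult_mono) auto
 finally show ?thesis by (simp add: algebra_simps)
qed

lemma has_derivative_remainder:
 fixes f :: "real \<times> real => real"
 assumes "al > 0" "!!q. q \<in> S ==> \<bar>f q - f p - ((fst q - fst p) * a + (snd q - snd p) * b)\<bar> <= C * (dist p q * dist p q powr al)"
 shows "(f has_derivative (%h. fst h * a + snd h * b)) (at p within S)"
proof -
 have bl: "bounded_linear (%h::real\<times>real. fst h * a + snd h * b)"
  by (intro bounded_linear_add bounded_linear_mult_const bounded_linear_fst bounded_linear_snd)
 have lim: "((%q. C * dist p q powr al) \<longlongrightarrow> 0) (at p within S)"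
 proof -
  have "((%q. dist p q) \<longlongrightarrow> dist p p) (at p within S)" by (intro tendsto_intros)
  then have "((%q. dist p q powr al) \<longlongrightarrow> 0) (at p within S)"
   using assms(1) tendsto_zero_powrI[of "%q. dist p q" _ "%_. al" al] by auto
  then show ?thesis by (auto intro: tendsto_mult_right_zero)
 qed
 show ?thesis
  unfolding has_derivative_within
 proof (intro conjI bl Lim_null_comparison[OF _ lim])
  show "eventually (%q. norm ((1 / norm (q - p)) *\<^sub>R (f q - (f p + (fst (q - p) * a + snd (q - p) * b)))) <= C * dist p q powr al) (at p within S)"
   unfolding eventually_at
  proof (intro exI[of _ 1] conjI ballI impI)
   fix q assume q: "q \<in> S" "q \<noteq> p \<and> dist q p < 1"
   then have n: "norm (q - p) > 0" by auto
   have "norm ((1 / norm (q - p)) *\<^sub>R (f q - (f p + (fst (q - p) * a + snd (q - p) * b))))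
    = \<bar>f q - f p - ((fst q - fst p) * a + (snd q - snd p) * b)\<bar> / norm (q - p)"
    by (simp add: abs_mult diff_diff_eq)
   also have "\<dots> <= C * (dist p q * dist p q powr al) / norm (q - p)"
    using assms(2)[OF q(1)] n by (intro divide_right_mono) auto
   also have "\<dots> = C * dist p q powr al" using n by (simp add: dist_norm norm_minus_commute)
   finally show "norm ((1 / norm (q - p)) *\<^sub>R (f q - (f p + (fst (q - p) * a + snd (q - p) * b)))) <= C * dist p q powr al" .
  qed auto
 qed
qed

lemma uf_hol:
 assumes "!!p. p \<in> D ==> eventually (%n. p \<in> Z n) uf"
  and "!!n. hol (Z n) al C (f n)" and "!!p. p \<in> D ==> ((%n. f n p) \<longlongrightarrow> g p) uf"
 shows "hol D al C g"
 unfolding hol_def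
proof (intro ballI)
 fix p q assume pq: "p \<in> D" "q \<in> D"
 have l: "((%n. \<bar>f n p - f n q\<bar>) \<longlongrightarrow> \<bar>g p - g q\<bar>) uf" using assms(3) pq by (intro tendsto_intros) auto
 have "eventually (%n. \<bar>f n p - f n q\<bar> <= C * dist p q powr al) uf"
  using assms(1)[OF pq(1)] assms(1)[OF pq(2)]
  by eventually_elim (use assms(2) in \<open>auto simp: hol_def\<close>)
 then show "\<bar>g p - g q\<bar> <= C * dist p q powr al" by (rule uf_lim_le[OF l tendsto_const])
qed

text \<open>The remainder bound of \<open>grad_taylor\<close> survives pointwise limits, and
  \<open>has_derivative_remainder\<close> turns it back into differentiability; no uniform
  convergence is involved. The domains \<open>Z n\<close> vary because blow-up domains grow to a
  half plane or to the plane.\<close>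

lemma uf_grad:
 assumes "!!p. p \<in> D ==> eventually (%n. p \<in> Z n) uf" "!!n. convex (Z n)" "al > 0" "C \<ge> 0"
  and "!!n. grad (Z n) (f n) (f1 n) (f2 n)" "!!n. hol (Z n) al C (f1 n)" "!!n. hol (Z n) al C (f2 n)"
  and "!!p. p \<in> D ==> ((%n. f n p) \<longlongrightarrow> g p) uf" "!!p. p \<in> D ==> ((%n. f1 n p) \<longlongrightarrow> g1 p) uf"
  and "!!p. p \<in> D ==> ((%n. f2 n p) \<longlongrightarrow> g2 p) uf"
 shows "grad D g g1 g2"
 unfolding grad_def
proof
 fix p assume p: "p \<in> D"
 show "(g has_derivative (%h. fst h * g1 p + snd h * g2 p)) (at p within D)"
 proof (rule has_derivative_remainder[OF assms(3)])
  fix q assume q: "q \<in> D"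
  have l: "((%n. \<bar>f n q - f n p - ((fst q - fst p) * f1 n p + (snd q - snd p) * f2 n p)\<bar>) \<longlongrightarrow>
   \<bar>g q - g p - ((fst q - fst p) * g1 p + (snd q - snd p) * g2 p)\<bar>) uf"
   using assms(8-10) p q by (intro tendsto_intros) auto
  have "eventually (%n. \<bar>f n q - f n p - ((fst q - fst p) * f1 n p + (snd q - snd p) * f2 n p)\<bar> <= (2 * C) * (dist p q * dist p q powr al)) uf"
   using assms(1)[OF p] assms(1)[OF q]
   by eventually_elim (rule grad_taylor[OF assms(2,5,6,7)], use assms(3,4) in auto)
  then show "\<bar>g q - g p - ((fst q - fst p) * g1 p + (snd q - snd p) * g2 p)\<bar> <= 2 * C * (dist p q * dist p q powr al)"
   by (rule uf_lim_le[OF l tendsto_const])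
 qed
qed

text \<open>Plays the part of the Arzela-Ascoli theorem, in the form needed later: the constant
  \<open>C\<close> is not enlarged in the limit.\<close>

lemma uf_jet:
 assumes "!!n. jet (strip R) (J n)" "!!n i. i <= 5 ==> hb (strip R) al C (J n i)" "al > 0" "C \<ge> 0"
 shows "\<exists>G. jet (strip R) G \<and> (\<forall>i\<le>5. hb (strip R) al C (G i)) \<and> (\<forall>i\<le>5. \<forall>p\<in>strip R. ((%n. J n i p) \<longlongrightarrow> G i p) uf)"
proof -
 have "\<exists>l. i <= 5 --> p \<in> strip R --> ((%n. J n i p) \<longlongrightarrow> l) uf" for i p
 proof (cases "i <= 5 \<and> p \<in> strip R")
  case True
  then have "!!n. \<bar>J n i p\<bar> <= C" using assms(2) unfolding hb_def by auto
  then show ?thesis using uf_bounded_limit[of "%n. J n i p" C] by auto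
 qed auto
 then obtain G where G: "!!i p. i <= 5 ==> p \<in> strip R ==> ((%n. J n i p) \<longlongrightarrow> G i p) uf" by metis
 have h: "hol (strip R) al C (J n i)" if "i <= 5" for n i using assms(2)[OF that] unfolding hb_def by auto
 have g: "grad (strip R) (G a) (G b) (G c)" if "a <= 5" "b <= 5" "c <= 5" "!!n. grad (strip R) (J n a) (J n b) (J n c)" for a b c
  by (rule uf_grad[where Z="%_. strip R" and al=al and C=C and f="%n. J n a" and ?f1.0="%n. J n b" and ?f2.0="%n. J n c"])
   (use that G h assms(3,4) convex_strip in auto)
 have "jet (strip R) G" using assms(1) unfolding jet_def by (auto intro!: g)
 moreover have "hb (strip R) al C (G i)" if "i <= 5" for i
  unfolding hb_def
 proof (intro conjI ballI)
  fix p assume p: "p \<in> strip R"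
  show "\<bar>G i p\<bar> <= C"
   by (rule uf_lim_le[OF tendsto_rabs[OF G[OF that p]] tendsto_const])
    (use assms(2)[OF that] p in \<open>auto simp: hb_def\<close>)
 next
  show "hol (strip R) al C (G i)"
   by (rule uf_hol[where Z="%_. strip R" and f="%n. J n i"]) (use that G h in auto)
 qed
 ultimately show ?thesis using G by blast
qed

section \<open>Calculus of Hoelder bounds\<close>

lemma hol_mono: "hol S al K f ==> K <= L ==> hol S al L f"
 unfolding hol_def
proof (intro ballI)
 fix p q assume a: "\<forall>p\<in>S. \<forall>q\<in>S. \<bar>f p - f q\<bar> <= K * dist p q powr al" "K <= L" "p \<in> S" "q \<in> S"
 have "K * dist p q powr al <= L * dist p q powr al" using a(2) by (intro mult_right_mono) simp_all
 then show "\<bar>f p - f q\<bar> <= L * dist p q powr al" using a(1,3,4) order_trans by blast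
qed

lemma hb_mono: "hb S al K f ==> K <= L ==> hb S al L f"
 unfolding hb_def by (meson hol_mono order_trans)

lemma hol_add: assumes "hol S al K f" "hol S al L g" shows "hol S al (K + L) (%p. f p + g p)"
 unfolding hol_def
proof (intro ballI)
 fix p q assume pq: "p \<in> S" "q \<in> S"
 have "\<bar>f p - f q\<bar> <= K * dist p q powr al" "\<bar>g p - g q\<bar> <= L * dist p q powr al"
  using assms pq unfolding hol_def by auto
 then show "\<bar>f p + g p - (f q + g q)\<bar> <= (K + L) * dist p q powr al"
  unfolding distrib_right by linarith
qed

lemma hol_cmult: assumes "hol S al K f" shows "hol S al (\<bar>c\<bar> * K) (%p. c * f p)"
 unfolding hol_def
proof (intro ballI)
 fix p q assume pq: "p \<in> S" "q \<in> S"
 have "\<bar>c\<bar> * \<bar>f p - f q\<bar> <= \<bar>c\<bar> * (K * dist p q powr al)"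
  using assms pq unfolding hol_def by (intro mult_left_mono) auto
 then show "\<bar>c * f p - c * f q\<bar> <= \<bar>c\<bar> * K * dist p q powr al"
  by (simp add: abs_mult[symmetric] right_diff_distrib mult.assoc)
qed

lemma hb_add: "hb S al K f ==> hb S al L g ==> hb S al (K + L) (%p. f p + g p)"
 unfolding hb_def by (fastforce intro: hol_add)

lemma hb_cmult: "hb S al K f ==> hb S al (\<bar>c\<bar> * K) (%p. c * f p)"
 unfolding hb_def by (auto simp: abs_mult intro: hol_cmult mult_left_mono)

lemma hb_minus: "hb S al K f ==> hb S al K (%p. - f p)"
 using hb_cmult[of S al K f "-1"] by simp

lemma hb_diff: "hb S al K f ==> hb S al L g ==> hb S al (K + L) (%p. f p - g p)"
 using hb_add[of S al K f L "%p. - g p"] hb_minus by auto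

lemma hol_mult:
 assumes "hol S al K f" "hol S al L g" "!!p. p \<in> S ==> \<bar>f p\<bar> <= k" "!!p. p \<in> S ==> \<bar>g p\<bar> <= l"
 shows "hol S al (k * L + l * K) (%p. f p * g p)"
 unfolding hol_def
proof (intro ballI)
 fix p q assume pq: "p \<in> S" "q \<in> S"
 have b: "\<bar>f p\<bar> <= k" "\<bar>g q\<bar> <= l" using assms pq by auto
 have "\<bar>f p * g p - f q * g q\<bar> = \<bar>f p * (g p - g q) + g q * (f p - f q)\<bar>" by (simp add: algebra_simps)
 also have "\<dots> <= \<bar>f p\<bar> * \<bar>g p - g q\<bar> + \<bar>g q\<bar> * \<bar>f p - f q\<bar>" by (metis abs_mult abs_triangle_ineq)
 also have "\<dots> <= k * (L * dist p q powr al) + l * (K * dist p q powr al)"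
  using assms pq b unfolding hol_def by (intro add_mono mult_mono) (auto intro: order_trans[OF abs_ge_zero b(1)] order_trans[OF abs_ge_zero b(2)])
 finally show "\<bar>f p * g p - f q * g q\<bar> <= (k * L + l * K) * dist p q powr al" by (simp add: algebra_simps)
qed

lemma hb_mult: assumes "hb S al K f" "hb S al L g" shows "hb S al (2 * K * L) (%p. f p * g p)"
proof (cases "S = {}")
 case True then show ?thesis unfolding hb_def hol_def by auto
next
 case False
 have K0: "K \<ge> 0" "L \<ge> 0" using False assms unfolding hb_def by (auto intro: order_trans[OF abs_ge_zero])
 have "hol S al (2 * K * L) (%p. f p * g p)"
  using hol_mult[of S al K f L g K L] assms unfolding hb_def by (simp add: algebra_simps)
 moreover have "\<bar>f p * g p\<bar> <= 2 * K * L" if "p \<in> S" for p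
 proof -
  have "\<bar>f p * g p\<bar> <= K * L" unfolding abs_mult using assms that K0 unfolding hb_def by (intro mult_mono) auto
  also have "\<dots> <= 2 * K * L" using K0 by simp
  finally show ?thesis .
 qed
 ultimately show ?thesis unfolding hb_def by auto
qed

text \<open>For distances up to 1 one has \<open>dist <= dist powr al\<close>; beyond 1 the
  oscillation \<open>2 * K\<close> suffices, as \<open>dist powr al\<close> is then at least
  1.\<close>

lemma hb_lipschitz:
 assumes "0 < al" "al <= 1" "!!p. p \<in> S ==> \<bar>f p\<bar> <= K" "!!p q. p \<in> S ==> q \<in> S ==> \<bar>f p - f q\<bar> <= L * dist p q" "L \<ge> 0" "K \<ge> 0"
 shows "hb S al (L + 2 * K) f"
proof -
 have "hol S al (L + 2 * K) f"
  unfolding hol_def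
 proof (intro ballI)
  fix p q assume pq: "p \<in> S" "q \<in> S"
  have nn: "0 <= dist p q powr al" by simp
  show "\<bar>f p - f q\<bar> <= (L + 2 * K) * dist p q powr al"
  proof (cases "dist p q <= 1")
   case True
   have "dist p q <= dist p q powr al"
   proof (cases "dist p q = 0")
    case False
    then have "dist p q powr 1 <= dist p q powr al" using True assms by (intro powr_mono') auto
    then show ?thesis using False by simp
   qed simp
   then have "L * dist p q <= (L + 2 * K) * dist p q powr al"
    using assms nn by (intro mult_mono) auto
   then show ?thesis using assms(4)[OF pq] by linarith
  next
   case False
   then have "1 <= dist p q powr al" using assms by (intro ge_one_powr_ge_zero) auto
   then have "(L + 2 * K) * 1 <= (L + 2 * K) * dist p q powr al" using assms by (intro mult_left_mono) auto
   then have "L + 2 * K <= (L + 2 * K) * dist p q powr al" by simp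
   moreover have "\<bar>f p - f q\<bar> <= L + 2 * K" using assms(3)[OF pq(1)] assms(3)[OF pq(2)] assms(5) by linarith
   ultimately show ?thesis by (rule order_trans[rotated])
  qed
 qed
 moreover have "\<bar>f p\<bar> <= L + 2 * K" if "p \<in> S" for p using assms(3)[OF that] assms(5,6) by linarith
 ultimately show ?thesis unfolding hb_def by auto
qed

lemma hol_continuous:
 assumes "hol S al K f" "al > 0" shows "continuous_on S f"
 unfolding continuous_on_def
proof
 fix p assume p: "p \<in> S"
 have "((%q. dist q p) \<longlongrightarrow> dist p p) (at p within S)" by (intro tendsto_intros)
 then have "((%q. dist q p powr al) \<longlongrightarrow> 0) (at p within S)"
  using assms(2) tendsto_zero_powrI[of "%q. dist q p" _ "%_. al" al] by auto
 then have lim: "((%q. K * dist q p powr al) \<longlongrightarrow> 0) (at p within S)" by (auto intro: tendsto_mult_right_zero)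
 have "((%q. f q - f p) \<longlongrightarrow> 0) (at p within S)"
  by (rule Lim_null_comparison[OF _ lim]) (use assms p in \<open>auto simp: hol_def eventually_at intro!: exI[of _ 1]\<close>)
 then show "(f \<longlongrightarrow> f p) (at p within S)" using Lim_null by blast
qed

lemma grad_continuous: "grad S f f1 f2 ==> continuous_on S f"
 unfolding grad_def continuous_on_eq_continuous_within by (auto intro: has_derivative_continuous)

lemma grad_lipschitz:
 assumes "convex S" "grad S f f1 f2" "!!p. p \<in> S ==> \<bar>f1 p\<bar> <= B" "!!p. p \<in> S ==> \<bar>f2 p\<bar> <= B" "p \<in> S" "q \<in> S"
 shows "\<bar>f p - f q\<bar> <= 2 * B * dist p q"
proof -
 obtain t where t: "t \<in> {0..1}" "f q - f p = (fst q - fst p) * f1 (p + t *\<^sub>R (q - p)) + (snd q - snd p) * f2 (p + t *\<^sub>R (q - p))"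
  using grad_mvt[OF assms(1,2,5,6)] by auto
 define z where "z = p + t *\<^sub>R (q - p)"
 have "z = (1 - t) *\<^sub>R p + t *\<^sub>R q" by (simp add: algebra_simps z_def)
 then have zS: "z \<in> S" using assms(1,5,6) t(1) by (auto simp: convex_alt)
 have "\<bar>f q - f p\<bar> <= \<bar>fst q - fst p\<bar> * \<bar>f1 z\<bar> + \<bar>snd q - snd p\<bar> * \<bar>f2 z\<bar>"
  unfolding t(2) z_def by (metis abs_mult abs_triangle_ineq)
 also have "\<dots> <= dist p q * B + dist p q * B"
  using assms(3,4)[OF zS] fst_snd_dist[of q p] by (intro add_mono mult_mono) auto
 finally show ?thesis by (simp add: abs_minus_commute algebra_simps)
qed

subsection \<open>Interpolation\<close>

lemma mvt_interval:
 fixes \<phi> :: "real => real"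
 assumes "a < b" "{a..b} \<subseteq> T" "!!t. t \<in> T ==> (\<phi> has_real_derivative \<phi>' t) (at t within T)"
 shows "\<exists>\<xi>\<in>{a..b}. \<phi> b - \<phi> a = (b - a) * \<phi>' \<xi>"
proof -
 have "\<exists>x\<in>{a..b}. \<phi> b - \<phi> a = \<phi>' x * (b - a)"
 proof (rule mvt_very_simple[of a b \<phi> "%x h. \<phi>' x * h"])
  fix x assume "a <= x" "x <= b"
  then have "x \<in> T" using assms(2) by auto
  from assms(3)[OF this, unfolded has_field_derivative_def]
  show "(\<phi> has_derivative (*) (\<phi>' x)) (at x within {a..b})" by (rule has_derivative_subset[OF _ assms(2)])
 qed (use assms in auto)
 then show ?thesis by (auto simp: mult.commute)
qed

text \<open>Two applications of the mean value theorem give \<open>r^2 * \<phi>'' \<eta> = \<phi>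
  (2*r) - 2 * \<phi> r + \<phi> 0\<close> for some \<open>\<eta>\<close>, and the oscillation
  \<open>B\<close> carries the bound from \<open>\<eta>\<close> to 0. Everything lies on one side of
  0, so the lemma also serves at boundary points.\<close>

lemma second_difference_bound:
 fixes \<phi> :: "real => real"
 assumes "r > 0" "!!t. t \<in> {0..2*r} ==> (\<phi> has_real_derivative \<phi>' t) (at t within {0..2*r})"
  "!!t. t \<in> {0..2*r} ==> (\<phi>' has_real_derivative \<phi>'' t) (at t within {0..2*r})"
  "!!t. t \<in> {0..2*r} ==> \<bar>\<phi> t\<bar> <= e" "!!t. t \<in> {0..2*r} ==> \<bar>\<phi>'' t - \<phi>'' 0\<bar> <= B"
 shows "\<bar>\<phi>'' 0\<bar> <= 4 * e / r\<^sup>2 + B"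
proof -
 have "((%t. \<phi> (t + r) - \<phi> t) has_real_derivative \<phi>' (t + r) - \<phi>' t) (at t within {0..r})" if t: "t \<in> {0..r}" for t
 proof -
  have sub: "(%t. t + r) ` {0..r} \<subseteq> {0..2*r}" by auto
  have "(\<phi> has_real_derivative \<phi>' (t + r)) (at (t + r) within (%t. t + r) ` {0..r})"
   by (rule has_field_derivative_subset[OF assms(2) sub]) (use t in auto)
  then have "((%t. \<phi> (t + r)) has_real_derivative \<phi>' (t + r) * 1) (at t within {0..r})"
   by (rule DERIV_image_chain[of \<phi> _ "%t. t + r", unfolded o_def]) (auto intro!: derivative_eq_intros)
  moreover have "(\<phi> has_real_derivative \<phi>' t) (at t within {0..r})"
   by (rule has_field_derivative_subset[OF assms(2)]) (use t assms(1) in auto)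
  ultimately show ?thesis by (simp add: DERIV_diff)
 qed
 then have "\<exists>\<xi>\<in>{0..r}. (\<phi> (r + r) - \<phi> r) - (\<phi> (0 + r) - \<phi> 0) = (r - 0) * (\<phi>' (\<xi> + r) - \<phi>' \<xi>)"
  by (intro mvt_interval[where \<phi>="%t. \<phi> (t + r) - \<phi> t" and T="{0..r}"] assms(1) order_refl)
 then obtain \<xi> where \<xi>: "\<xi> \<in> {0..r}" "(\<phi> (r + r) - \<phi> r) - (\<phi> (0 + r) - \<phi> 0) = (r - 0) * (\<phi>' (\<xi> + r) - \<phi>' \<xi>)"
  by blast
 have "\<exists>\<eta>\<in>{\<xi>..\<xi>+r}. \<phi>' (\<xi> + r) - \<phi>' \<xi> = (\<xi> + r - \<xi>) * \<phi>'' \<eta>"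
  by (rule mvt_interval[where T="{0..2*r}"]) (use assms(1) \<xi>(1) in \<open>auto intro: assms(3)\<close>)
 then obtain \<eta> where \<eta>: "\<eta> \<in> {\<xi>..\<xi>+r}" "\<phi>' (\<xi> + r) - \<phi>' \<xi> = (\<xi> + r - \<xi>) * \<phi>'' \<eta>"
  by blast
 have e: "r\<^sup>2 * \<phi>'' \<eta> = \<phi> (2 * r) - 2 * \<phi> r + \<phi> 0"
  using \<xi>(2) \<eta>(2) by (simp add: power2_eq_square mult.assoc flip: mult_2)
 have "\<bar>\<phi> (2*r)\<bar> <= e" "\<bar>\<phi> r\<bar> <= e" "\<bar>\<phi> 0\<bar> <= e" using assms(1,4) by auto
 then have "r\<^sup>2 * \<bar>\<phi>'' \<eta>\<bar> <= 4 * e" proof -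
  assume b: "\<bar>\<phi> (2*r)\<bar> <= e" "\<bar>\<phi> r\<bar> <= e" "\<bar>\<phi> 0\<bar> <= e"
  have "r\<^sup>2 * \<bar>\<phi>'' \<eta>\<bar> = \<bar>\<phi> (2 * r) - 2 * \<phi> r + \<phi> 0\<bar>" unfolding e[symmetric] by (simp add: abs_mult)
  then show ?thesis using b by linarith
 qed
 then have "\<bar>\<phi>'' \<eta>\<bar> <= 4 * e / r\<^sup>2" using assms(1) by (simp add: field_simps)
 moreover have "\<bar>\<phi>'' \<eta> - \<phi>'' 0\<bar> <= B" using \<eta>(1) \<xi>(1) by (intro assms(5)) auto
 ultimately show ?thesis by linarith
qed

lemma strip_line:
 assumes "p \<in> strip R" "p + s *\<^sub>R e \<in> strip R" "t \<in> {0..s}"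
 shows "p + t *\<^sub>R e \<in> strip R"
proof (cases "s = 0")
 case True then show ?thesis using assms by auto
next
 case False
 then have s: "s > 0" using assms(3) by auto
 have "p + t *\<^sub>R e = (1 - t/s) *\<^sub>R p + (t/s) *\<^sub>R (p + s *\<^sub>R e)" using s by (simp add: algebra_simps)
 then show ?thesis using convex_strip[of R] assms s by (auto simp: convex_alt)
qed

text \<open>The factor \<open>4 * N\<close> counts the four terms of the second directional
  derivative, and \<open>4 * r\<close> bounds the length of the segment because
  \<open>norm e <= 2\<close>.\<close>

lemma jet_second_direction:
 assumes J: "jet (strip R) J" and r: "r > 0" and p: "p \<in> strip R" "p + (2 * r) *\<^sub>R e \<in> strip R"
  and e: "\<bar>fst e\<bar> <= 1" "\<bar>snd e\<bar> <= 1" and \<epsilon>: "!!q. q \<in> strip R ==> \<bar>J 0 q\<bar> <= \<epsilon>"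
  and h: "!!i. i \<in> {3,4,5} ==> hol (strip R) al N (J i)" and al: "al > 0" and N: "N \<ge> 0"
 shows "\<bar>(fst e)\<^sup>2 * J 3 p + 2 * fst e * snd e * J 4 p + (snd e)\<^sup>2 * J 5 p\<bar> <= 4 * \<epsilon> / r\<^sup>2 + 4 * N * (4 * r) powr al"
proof -
 have mem: "p + t *\<^sub>R e \<in> strip R" if "t \<in> {0..2*r}" for t by (rule strip_line[OF p that])
 define \<phi>'' where "\<phi>'' = (%t. fst e * (fst e * J 3 (p + t *\<^sub>R e) + snd e * J 4 (p + t *\<^sub>R e)) + snd e * (fst e * J 4 (p + t *\<^sub>R e) + snd e * J 5 (p + t *\<^sub>R e)))"
 have g: "grad (strip R) (J 0) (J 1) (J 2)" "grad (strip R) (J 1) (J 3) (J 4)" "grad (strip R) (J 2) (J 4) (J 5)"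
  using J unfolding jet_def by auto
 have "\<bar>\<phi>'' 0\<bar> <= 4 * \<epsilon> / r\<^sup>2 + 4 * N * (4 * r) powr al"
 proof (rule second_difference_bound[OF r, of "%t. J 0 (p + t *\<^sub>R e)" "%t. fst e * J 1 (p + t *\<^sub>R e) + snd e * J 2 (p + t *\<^sub>R e)" \<phi>''])
  fix t assume t: "t \<in> {0..2*r}"
  show "((%t. J 0 (p + t *\<^sub>R e)) has_real_derivative fst e * J 1 (p + t *\<^sub>R e) + snd e * J 2 (p + t *\<^sub>R e)) (at t within {0..2*r})"
   by (rule grad_line[OF g(1) mem t])
  have "((%t. J 1 (p + t *\<^sub>R e)) has_real_derivative fst e * J 3 (p + t *\<^sub>R e) + snd e * J 4 (p + t *\<^sub>R e)) (at t within {0..2*r})"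
   by (rule grad_line[OF g(2) mem t])
  moreover have "((%t. J 2 (p + t *\<^sub>R e)) has_real_derivative fst e * J 4 (p + t *\<^sub>R e) + snd e * J 5 (p + t *\<^sub>R e)) (at t within {0..2*r})"
   by (rule grad_line[OF g(3) mem t])
  ultimately show "((%t. fst e * J 1 (p + t *\<^sub>R e) + snd e * J 2 (p + t *\<^sub>R e)) has_real_derivative \<phi>'' t) (at t within {0..2*r})"
   unfolding \<phi>''_def by (intro DERIV_add DERIV_cmult)
  show "\<bar>J 0 (p + t *\<^sub>R e)\<bar> <= \<epsilon>" by (rule \<epsilon>[OF mem[OF t]])
  have "norm e <= 2"
  proof -
   have "norm e <= \<bar>fst e\<bar> + \<bar>snd e\<bar>" using norm_prod_def norm_Pair_le[of "fst e" "snd e"] by (metis prod.collapse real_norm_def)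
   then show ?thesis using e by linarith
  qed
  then have "dist (p + t *\<^sub>R e) p <= 4 * r"
   using t mult_mono[of "t" "2*r" "norm e" 2] by (auto simp: dist_norm)
  then have pw: "N * dist (p + t *\<^sub>R e) p powr al <= N * (4 * r) powr al"
   using al N by (intro mult_left_mono powr_mono2) auto
  define X where "X = N * (4 * r) powr al"
  have d: "\<bar>J i (p + t *\<^sub>R e) - J i p\<bar> <= X" if "i \<in> {3,4,5}" for i
   using h[OF that] mem[OF t] p(1) pw unfolding hol_def X_def by (meson order_trans)
  have X0: "X \<ge> 0" using N unfolding X_def by simp
  have m: "\<bar>a * b * c\<bar> <= X" if "\<bar>a\<bar> <= 1" "\<bar>b\<bar> <= 1" "\<bar>c\<bar> <= X" for a b c :: real
   using mult_mono[of "\<bar>a\<bar> * \<bar>b\<bar>" 1 "\<bar>c\<bar>" X] mult_mono[of "\<bar>a\<bar>" 1 "\<bar>b\<bar>" 1] that X0 by (simp add: abs_mult)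
  have "\<phi>'' t - \<phi>'' 0 = fst e * fst e * (J 3 (p + t *\<^sub>R e) - J 3 p) + fst e * snd e * (J 4 (p + t *\<^sub>R e) - J 4 p)
    + snd e * fst e * (J 4 (p + t *\<^sub>R e) - J 4 p) + snd e * snd e * (J 5 (p + t *\<^sub>R e) - J 5 p)"
   unfolding \<phi>''_def by (simp add: algebra_simps)
  moreover have "\<bar>fst e * fst e * (J 3 (p + t *\<^sub>R e) - J 3 p)\<bar> <= X" "\<bar>fst e * snd e * (J 4 (p + t *\<^sub>R e) - J 4 p)\<bar> <= X"
   "\<bar>snd e * fst e * (J 4 (p + t *\<^sub>R e) - J 4 p)\<bar> <= X" "\<bar>snd e * snd e * (J 5 (p + t *\<^sub>R e) - J 5 p)\<bar> <= X"
   using e d by (auto intro!: m)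
  ultimately have "\<bar>\<phi>'' t - \<phi>'' 0\<bar> <= 4 * X" by linarith
  then show "\<bar>\<phi>'' t - \<phi>'' 0\<bar> <= 4 * N * (4 * r) powr al" unfolding X_def by simp
 qed
 moreover have "\<phi>'' 0 = (fst e)\<^sup>2 * J 3 p + 2 * fst e * snd e * J 4 p + (snd e)\<^sup>2 * J 5 p"
  unfolding \<phi>''_def by (simp add: algebra_simps power2_eq_square)
 ultimately show ?thesis by simp
qed

text \<open>Vertical direction towards the axis: from any point of the strip a step of length at
  most \<open>R\<close> along it stays inside.\<close>

definition inward :: "real \<times> real => real" where "inward p = (if snd p <= 0 then 1 else -1)"

lemma inward_mem:
 assumes "p \<in> strip R" "0 <= t" "t <= R" shows "p + t *\<^sub>R (c, inward p) \<in> strip R" "p + t *\<^sub>R (c, 0) \<in> strip R"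
 using assms by (auto simp: mem_strip inward_def)

text \<open>The directions \<open>(1,0)\<close>, \<open>(0,s)\<close> and the diagonal
  \<open>(1,s)\<close> point into the strip, and the mixed derivative comes from the diagonal by
  polarisation. For small \<open>r\<close> the seminorm enters with a small factor; absorption and
  blow-up rely on this.\<close>

lemma jet_interpolation2:
 assumes J: "jet (strip R) J" and r: "r > 0" "2 * r <= R" and p: "p \<in> strip R"
  and \<epsilon>: "!!q. q \<in> strip R ==> \<bar>J 0 q\<bar> <= \<epsilon>"
  and h: "!!i. i \<in> {3,4,5} ==> hol (strip R) al N (J i)" and al: "al > 0" and N: "N \<ge> 0" and i: "i \<in> {3,4,5}"
 shows "\<bar>J i p\<bar> <= 2 * (4 * \<epsilon> / r\<^sup>2 + 4 * N * (4 * r) powr al)"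
proof -
 define X where "X = 4 * \<epsilon> / r\<^sup>2 + 4 * N * (4 * r) powr al"
 note D = jet_second_direction[OF J r(1) p _ _ _ \<epsilon> h al N, folded X_def]
 define s where "s = inward p"
 have s: "s * s = 1" "\<bar>s\<bar> = 1" unfolding s_def inward_def by auto
 have m: "p + (2 * r) *\<^sub>R (1, 0) \<in> strip R" "p + (2 * r) *\<^sub>R (0, s) \<in> strip R" "p + (2 * r) *\<^sub>R (1, s) \<in> strip R"
  using inward_mem(2)[OF p, of "2*r" 1] inward_mem(1)[OF p, of "2*r" 0] inward_mem(1)[OF p, of "2*r" 1] r unfolding s_def by auto
 have 3: "\<bar>J 3 p\<bar> <= X" using D[OF m(1)] by simp
 have 5: "\<bar>J 5 p\<bar> <= X" using D[OF m(2)] s by (simp add: power2_eq_square)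
 have "\<bar>J 3 p + 2 * s * J 4 p + J 5 p\<bar> <= X" using D[OF m(3)] s by (simp add: power2_eq_square)
 then have "\<bar>2 * s * J 4 p\<bar> <= 3 * X" using 3 5 by linarith
 then have 4: "2 * \<bar>J 4 p\<bar> <= 3 * X" using s by (simp add: abs_mult)
 show ?thesis using i 3 4 5 unfolding X_def[symmetric] by auto
qed

text \<open>The mean value theorem finds a point within distance \<open>r\<close> where the
  derivative is at most \<open>2 * \<epsilon> / r\<close>; the bound \<open>B\<close> on second
  derivatives carries this back to \<open>p\<close>.\<close>

lemma jet_interpolation1:
 assumes J: "jet (strip R) J" and r: "r > 0" "r <= R" and p: "p \<in> strip R"
  and \<epsilon>: "!!q. q \<in> strip R ==> \<bar>J 0 q\<bar> <= \<epsilon>"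
  and B: "!!i q. i \<in> {3,4,5} ==> q \<in> strip R ==> \<bar>J i q\<bar> <= B" and i: "i \<in> {1,2}"
 shows "\<bar>J i p\<bar> <= 2 * \<epsilon> / r + 2 * B * r"
proof -
 have g: "grad (strip R) (J 0) (J 1) (J 2)" "grad (strip R) (J 1) (J 3) (J 4)" "grad (strip R) (J 2) (J 4) (J 5)"
  using J unfolding jet_def by auto
 have L: "\<bar>J i p - J i q\<bar> <= 2 * B * dist p q" if "i \<in> {1,2}" "q \<in> strip R" for i q
 proof (cases "i = 1")
  case True
  show ?thesis unfolding True by (rule grad_lipschitz[OF convex_strip g(2) B B p that(2)]) simp_all
 next
  case False
  then have "i = 2" using that(1) by simp
  show ?thesis unfolding \<open>i = 2\<close> by (rule grad_lipschitz[OF convex_strip g(3) B B p that(2)]) simp_all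
 qed
 have B0: "B \<ge> 0" using B[of 3 p] p by auto
 have gen: "\<bar>J i p\<bar> <= 2 * \<epsilon> / r + 2 * B * r" if e: "\<bar>fst e\<bar> + \<bar>snd e\<bar> = 1" "norm e = 1" "!!q. fst e * J 1 q + snd e * J 2 q = s * J i q" "\<bar>s\<bar> = 1" "i \<in> {1,2}"
  "p + r *\<^sub>R e \<in> strip R" for e i s
 proof -
  have mem: "p + t *\<^sub>R e \<in> strip R" if "t \<in> {0..r}" for t by (rule strip_line[OF p e(6) that])
  have "((%t. J 0 (p + t *\<^sub>R e)) has_real_derivative s * J i (p + t *\<^sub>R e)) (at t within {0..r})" if "t \<in> {0..r}" for t
   using grad_line[OF g(1) mem that] unfolding e(3) .
  then have "\<exists>\<xi>\<in>{0..r}. J 0 (p + r *\<^sub>R e) - J 0 (p + 0 *\<^sub>R e) = (r - 0) * (s * J i (p + \<xi> *\<^sub>R e))"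
   by (intro mvt_interval[where \<phi>="%t. J 0 (p + t *\<^sub>R e)" and T="{0..r}"] r(1) order_refl)
  then obtain \<xi> where \<xi>: "\<xi> \<in> {0..r}" "J 0 (p + r *\<^sub>R e) - J 0 (p + 0 *\<^sub>R e) = (r - 0) * (s * J i (p + \<xi> *\<^sub>R e))"
   by blast
  have "\<bar>J 0 (p + r *\<^sub>R e) - J 0 p\<bar> <= 2 * \<epsilon>" using \<epsilon>[OF e(6)] \<epsilon>[OF p] by linarith
  then have "r * \<bar>J i (p + \<xi> *\<^sub>R e)\<bar> <= 2 * \<epsilon>" using \<xi>(2) e(4) r by (simp add: abs_mult)
  then have 1: "\<bar>J i (p + \<xi> *\<^sub>R e)\<bar> <= 2 * \<epsilon> / r" using r by (simp add: field_simps)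
  have "\<bar>J i p - J i (p + \<xi> *\<^sub>R e)\<bar> <= 2 * B * dist p (p + \<xi> *\<^sub>R e)" by (rule L[OF e(5) mem[OF \<xi>(1)]])
  also have "\<dots> <= 2 * B * r" using \<xi> e(2) B0 by (intro mult_left_mono) (auto simp: dist_norm)
  finally show ?thesis using 1 by linarith
 qed
 show ?thesis
 proof (cases "i = 1")
  case True
  have "p + r *\<^sub>R (1,0) \<in> strip R" by (rule inward_mem(2)[OF p]) (use r in auto)
  then show ?thesis using gen[of "(1,0)" 1 1] True by (auto simp: norm_prod_def)
 next
  case False
  then have "i = 2" using i by auto
  have "p + r *\<^sub>R (0,inward p) \<in> strip R" by (rule inward_mem(1)[OF p]) (use r in auto)
  then show ?thesis using gen[of "(0,inward p)" "inward p" 2] \<open>i = 2\<close> by (auto simp: norm_prod_def inward_def)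
 qed
qed

lemma hb_jet:
 assumes J: "jet (strip R) J" and al: "0 < al" "al <= 1" and B: "!!i p. i <= 5 ==> p \<in> strip R ==> \<bar>J i p\<bar> <= B"
  and h: "!!i. i \<in> {3,4,5} ==> hol (strip R) al N (J i)" and "B \<ge> 0" "N \<ge> 0" and i: "i <= 5"
 shows "hb (strip R) al (4 * B + N) (J i)"
proof -
 have g: "grad (strip R) (J 0) (J 1) (J 2)" "grad (strip R) (J 1) (J 3) (J 4)" "grad (strip R) (J 2) (J 4) (J 5)"
  using J unfolding jet_def by auto
 consider "i = 0" | "i = 1" | "i = 2" | "i \<in> {3,4,5}" using i by fastforce
 then show ?thesis
 proof cases
  case 1
  have "hb (strip R) al (2 * B + 2 * B) (J 0)"
   by (rule hb_lipschitz[OF al]) (rule B, simp, assumption, rule grad_lipschitz[OF convex_strip g(1)], simp_all add: B \<open>B \<ge> 0\<close>)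
  then show ?thesis unfolding 1 by (rule hb_mono) (use assms(7) in simp)
 next
  case 2
  have "hb (strip R) al (2 * B + 2 * B) (J 1)"
   by (rule hb_lipschitz[OF al]) (rule B, simp, assumption, rule grad_lipschitz[OF convex_strip g(2)], simp_all add: B \<open>B \<ge> 0\<close>)
  then show ?thesis unfolding 2 by (rule hb_mono) (use assms(7) in simp)
 next
  case 3
  have "hb (strip R) al (2 * B + 2 * B) (J 2)"
   by (rule hb_lipschitz[OF al]) (rule B, simp, assumption, rule grad_lipschitz[OF convex_strip g(3)], simp_all add: B \<open>B \<ge> 0\<close>)
  then show ?thesis unfolding 3 by (rule hb_mono) (use assms(7) in simp)
 next
  case 4
  have "hol (strip R) al (4 * B + N) (J i)" using hol_mono[OF h[OF 4]] \<open>B \<ge> 0\<close> by auto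
  moreover have "\<bar>J i p\<bar> <= 4 * B + N" if "p \<in> strip R" for p using B[OF i that] assms(6,7) by linarith
  ultimately show ?thesis unfolding hb_def by auto
 qed
qed

subsection \<open>Liouville theorem on the plane and on half planes\<close>

text \<open>Cauchy's inequality on discs of radius \<open>r\<close> bounds the derivative by a
  multiple of \<open>r powr (al - 1)\<close>, so \<open>E\<close> is constant. The constant is 0
  because the growth bound at the origin reads \<open>E 0 = 0\<close>.\<close>

lemma entire_sublinear_zero:
 assumes E: "E holomorphic_on UNIV" and al: "0 < al" "al < 1" and C: "!!z. norm (E z) <= C * norm z powr al"
 shows "E z = 0"
proof -
 have C0: "C \<ge> 0" using C[of 1] by (simp add: order_trans[OF norm_ge_zero])
 have der0: "deriv E \<xi> = 0" for \<xi>
 proof -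
  have b: "norm (deriv E \<xi>) <= C * 2 powr al * r powr (al - 1)" if r: "r \<ge> norm \<xi>" "r > 0" for r
  proof -
   have "norm ((deriv ^^ 1) E \<xi>) <= fact 1 * (C * (2 * r) powr al) / r ^ 1"
   proof (rule Cauchy_inequality)
    show "E holomorphic_on ball \<xi> r" using E holomorphic_on_subset by blast
    show "continuous_on (cball \<xi> r) E" using E holomorphic_on_imp_continuous_on continuous_on_subset by blast
    fix x assume "norm (\<xi> - x) = r"
    then have "norm x <= 2 * r" using r norm_triangle_ineq4[of \<xi> "\<xi> - x"] by simp
    then show "norm (E x) <= C * (2 * r) powr al"
     using C[of x] C0 al by (meson mult_left_mono norm_ge_zero order_trans powr_mono2 less_imp_le)
   qed (use r in auto)
   then show ?thesis using r al by (simp add: powr_mult powr_diff)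
  qed
  have "((%r. C * 2 powr al * r powr (al - 1)) \<longlongrightarrow> C * 2 powr al * 0) at_top"
   using al by (intro tendsto_intros tendsto_neg_powr filterlim_ident) auto
  moreover have "eventually (%r. norm (deriv E \<xi>) <= C * 2 powr al * r powr (al - 1)) at_top"
   unfolding eventually_at_top_linorder
  proof (intro exI[of _ "norm \<xi> + 1"] allI impI)
   fix r assume "norm \<xi> + 1 <= r"
   then show "norm (deriv E \<xi>) <= C * 2 powr al * r powr (al - 1)"
    using norm_ge_zero[of \<xi>] by (intro b) linarith+
  qed
  ultimately have "norm (deriv E \<xi>) <= C * 2 powr al * 0"
   by (rule tendsto_lowerbound) simp
  then show ?thesis by simp
 qed
 have dE: "(E has_field_derivative 0) (at x)" for x
  using holomorphic_derivI[OF E open_UNIV UNIV_I, of x] unfolding der0 by simp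
 have "\<exists>c. \<forall>x\<in>UNIV. E x = c"
  by (rule has_field_derivative_zero_constant[OF convex_UNIV dE])
 moreover have "E 0 = 0" using C[of 0] by simp
 ultimately show ?thesis by (metis UNIV_I)
qed

text \<open>Here \<open>g1\<close>, \<open>g2\<close> stand for the first and \<open>h3\<close>,
  \<open>h4\<close>, \<open>h5\<close> for the second derivatives of a function. After stretching
  \<open>x\<close> by \<open>sqrt (c / 2)\<close>, the equation and the equality of the mixed
  derivatives are the Cauchy-Riemann equations for \<open>f\<close>, and its derivative
  \<open>H\<close> grows sublinearly. On a half plane, \<open>h3 = 0\<close> makes
  \<open>\<i> * H\<close> real on the real axis, so Schwarz reflection extends it to an entire
  function.\<close>

lemma liouville_aux:
 assumes D: "D = UNIV \<or> D = {z. snd z \<ge> 0}" and al: "0 < al" "al < 1" and c: "c > 0"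
  and g: "grad D g1 h3 h4" "grad D g2 h4 h5"
  and hol: "hol D al 1 h3" "hol D al 1 h4"
  and zero: "h3 0 = 0" "h4 0 = 0"
  and eq: "!!z. z \<in> D ==> c * h3 z + 2 * h5 z = 0"
  and bd: "!!z. D \<noteq> UNIV ==> snd z = 0 ==> h3 z = 0"
  and z: "z \<in> D"
 shows "h3 z = 0 \<and> h4 z = 0"
proof -
 define \<kappa> where "\<kappa> = sqrt (c / 2)"
 have \<kappa>: "\<kappa> > 0" "\<kappa> * \<kappa> = c / 2" using c unfolding \<kappa>_def by auto
 define T where "T = (%z::complex. (\<kappa> * Re z, Im z))"
 define W where "W = {z. T z \<in> D}"
 define O' where "O' = (if D = UNIV then UNIV else {z::complex. Im z > 0})"
 have Oop: "open O'" unfolding O'_def by (auto simp: open_halfspace_Im_gt)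
 have OD: "T ` O' \<subseteq> interior D"
 proof (cases "D = UNIV")
  case False
  then have Dh: "D = {z. snd z \<ge> 0}" using D by auto
  have "{z::real\<times>real. snd z > 0} \<subseteq> interior D"
  proof (rule interior_maximal)
   show "open {z::real\<times>real. 0 < snd z}" by (intro open_Collect_less continuous_intros)
  qed (auto simp: Dh)
  moreover have "T ` O' \<subseteq> {z. snd z > 0}" using False by (auto simp: O'_def T_def)
  ultimately show ?thesis by blast
 qed auto
 define f where "f = (%z. complex_of_real (\<kappa> * g1 (T z)) - \<i> * complex_of_real (g2 (T z)))"
 define H where "H = (%z. complex_of_real (\<kappa> * \<kappa> * h3 (T z)) - \<i> * complex_of_real (\<kappa> * h4 (T z)))"
 have T': "(T has_derivative T) (at z)" for z
  by (rule bounded_linear_imp_has_derivative) (unfold T_def, intro bounded_linear_Pair bounded_linear_const_mult bounded_linear_Re bounded_linear_Im)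
 have fd: "(f has_field_derivative H z) (at z)" if z: "z \<in> O'" for z
 proof -
  have zi: "T z \<in> interior D" using OD z by auto
  then have zD: "T z \<in> D" using interior_subset by auto
  have d1: "(g1 has_derivative (%h. fst h * h3 (T z) + snd h * h4 (T z))) (at (T z))"
   and d2: "(g2 has_derivative (%h. fst h * h4 (T z) + snd h * h5 (T z))) (at (T z))"
   using bspec[OF g(1)[unfolded grad_def] zD] bspec[OF g(2)[unfolded grad_def] zD] unfolding at_within_interior[OF zi] by simp_all
  have c1: "((%z. g1 (T z)) has_derivative (%w. fst (T w) * h3 (T z) + snd (T w) * h4 (T z))) (at z)"
   by (rule has_derivative_compose[OF T' d1])
  have c2: "((%z. g2 (T z)) has_derivative (%w. fst (T w) * h4 (T z) + snd (T w) * h5 (T z))) (at z)"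
   by (rule has_derivative_compose[OF T' d2])
  have h5: "h5 (T z) = - (\<kappa> * \<kappa> * h3 (T z))" using eq[OF zD] unfolding \<kappa>(2) by (simp add: field_simps)
  have "(f has_derivative (%w. complex_of_real (\<kappa> * (fst (T w) * h3 (T z) + snd (T w) * h4 (T z))) - \<i> * complex_of_real (fst (T w) * h4 (T z) + snd (T w) * h5 (T z)))) (at z)"
   unfolding f_def
   by (rule has_derivative_diff[OF has_derivative_of_real[OF has_derivative_mult_right[OF c1]] has_derivative_mult_right[OF has_derivative_of_real[OF c2]]])
  moreover have "(%w. complex_of_real (\<kappa> * (fst (T w) * h3 (T z) + snd (T w) * h4 (T z))) - \<i> * complex_of_real (fst (T w) * h4 (T z) + snd (T w) * h5 (T z))) = (*) (H z)"
   unfolding H_def h5 by (rule ext) (simp add: complex_eq_iff T_def algebra_simps)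
  ultimately show ?thesis unfolding has_field_derivative_def by simp
 qed
 \<comment> \<open>\<open>h3\<close> and \<open>h4\<close> are only known to be Hoelder continuous;
   \<open>H\<close> is holomorphic because it is the derivative of a holomorphic function.\<close>
 have holH: "H holomorphic_on O'"
 proof -
  have "f holomorphic_on O'" unfolding holomorphic_on_open[OF Oop] using fd by blast
  then have "deriv f holomorphic_on O'" by (rule holomorphic_deriv[OF _ Oop])
  then show ?thesis by (rule holomorphic_transform) (rule DERIV_imp_deriv[OF fd])
 qed
 have contH: "continuous_on W H"
 proof -
  have ch: "continuous_on D h3" "continuous_on D h4" by (rule hol_continuous[OF hol(1) al(1)], rule hol_continuous[OF hol(2) al(1)])
  have cT: "continuous_on W T" unfolding T_def by (intro continuous_intros)
  have WD: "T ` W \<subseteq> D" unfolding W_def by auto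
  have "continuous_on W (%z. h3 (T z))" "continuous_on W (%z. h4 (T z))"
   by (rule continuous_on_compose2[OF ch(1) cT WD], rule continuous_on_compose2[OF ch(2) cT WD])
  then show ?thesis unfolding H_def by (intro continuous_intros)
 qed
 have D0: "0 \<in> D" using D by auto
 define C where "C = (\<kappa> * \<kappa> + \<kappa>) * (\<kappa> + 1) powr al"
 have bnd: "norm (H z) <= C * norm z powr al" if "T z \<in> D" for z
 proof -
  have "norm (T z) <= \<bar>\<kappa> * Re z\<bar> + \<bar>Im z\<bar>" unfolding T_def using norm_Pair_le[of "\<kappa> * Re z" "Im z"] by simp
  also have "\<dots> <= \<kappa> * norm z + norm z" using \<kappa> abs_Re_le_cmod[of z] abs_Im_le_cmod[of z] by (intro add_mono) (auto simp: abs_mult)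
  finally have nT: "norm (T z) <= (\<kappa> + 1) * norm z" by (simp add: algebra_simps)
  have hz: "\<bar>h3 (T z)\<bar> <= norm (T z) powr al" "\<bar>h4 (T z)\<bar> <= norm (T z) powr al"
   using bspec[OF bspec[OF hol(1)[unfolded hol_def] that] D0] bspec[OF bspec[OF hol(2)[unfolded hol_def] that] D0] zero by (simp_all add: dist_norm)
  have pw: "norm (T z) powr al <= ((\<kappa> + 1) * norm z) powr al" using nT al by (intro powr_mono2) auto
  have "norm (H z) <= norm (complex_of_real (\<kappa> * \<kappa> * h3 (T z))) + norm (\<i> * complex_of_real (\<kappa> * h4 (T z)))"
   unfolding H_def by (rule norm_triangle_ineq4)
  also have "\<dots> = \<kappa> * \<kappa> * \<bar>h3 (T z)\<bar> + \<kappa> * \<bar>h4 (T z)\<bar>" using \<kappa> by (simp add: norm_mult abs_mult)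
  also have "\<dots> <= \<kappa> * \<kappa> * ((\<kappa> + 1) * norm z) powr al + \<kappa> * ((\<kappa> + 1) * norm z) powr al"
   using hz pw \<kappa> by (intro add_mono mult_left_mono) auto
  also have "\<dots> = C * norm z powr al" unfolding C_def using \<kappa> by (simp only: powr_mult) (simp add: algebra_simps)
  finally show ?thesis .
 qed
 have H0: "H z = 0" if "T z \<in> D" for z
 proof (cases "D = UNIV")
  case True
  have "H holomorphic_on UNIV" using holH True by (simp add: O'_def)
  then show ?thesis by (rule entire_sublinear_zero[OF _ al]) (rule bnd, simp add: True)
 next
  case False
  then have Dh: "D = {z. snd z \<ge> 0}" using D by auto
  define E where "E = (%z. if 0 <= Im z then \<i> * H z else cnj (\<i> * H (cnj z)))"
  have "E holomorphic_on UNIV"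
   unfolding E_def
  proof (rule Schwarz_reflection[where S=UNIV and f="%z. \<i> * H z"])
   show "(%z. \<i> * H z) holomorphic_on UNIV \<inter> {z. 0 < Im z}"
    using holH False by (simp add: O'_def holomorphic_on_mult)
   show "continuous_on (UNIV \<inter> {z. 0 <= Im z}) (%z. \<i> * H z)"
    using contH by (simp add: W_def Dh T_def continuous_on_mult_left)
   fix z :: complex assume "z \<in> UNIV" "z \<in> \<real>"
   then have "snd (T z) = 0" unfolding T_def by (simp add: complex_is_Real_iff)
   then have "h3 (T z) = 0" using bd False by auto
   then show "\<i> * H z \<in> \<real>" unfolding H_def by (simp add: mult.assoc[symmetric])
  qed auto
  moreover have "norm (E z) <= C * norm z powr al" for z
   using bnd[of z] bnd[of "cnj z"] by (cases "0 <= Im z") (simp_all add: E_def Dh T_def norm_mult)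
  ultimately have "E z = 0" by (rule entire_sublinear_zero[OF _ al])
  then show ?thesis using that by (simp add: E_def Dh T_def)
 qed
 define w where "w = Complex (fst z / \<kappa>) (snd z)"
 have w: "T w = z" unfolding T_def w_def using \<kappa> by (cases z) auto
 then have "H w = 0" using H0 z by auto
 then have "\<kappa> * \<kappa> * h3 z = 0" "\<kappa> * h4 z = 0" unfolding H_def w by (auto simp: complex_eq_iff)
 then show ?thesis using \<kappa> by auto
qed

text \<open>The lower half plane reduces to the upper one by \<open>y -> -y\<close>, under which
  \<open>g2\<close> and \<open>h4\<close> change sign.\<close>

lemma liouville:
 assumes D: "D = UNIV \<or> D = {z. snd z \<ge> 0} \<or> D = {z. snd z <= 0}" and al: "0 < al" "al < 1" and c: "c > 0"
  and g: "grad D g1 h3 h4" "grad D g2 h4 h5"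
  and hol: "hol D al 1 h3" "hol D al 1 h4"
  and zero: "h3 0 = 0" "h4 0 = 0"
  and eq: "!!z. z \<in> D ==> c * h3 z + 2 * h5 z = 0"
  and bd: "!!z. D \<noteq> UNIV ==> snd z = 0 ==> h3 z = 0"
  and z: "z \<in> D"
 shows "h3 z = 0 \<and> h4 z = 0 \<and> h5 z = 0"
proof -
 have "h3 z = 0 \<and> h4 z = 0"
 proof (cases "D = {z. snd z <= 0}")
  case False
  then have D2: "D = UNIV \<or> D = {z. snd z \<ge> 0}" using D by simp
  show ?thesis by (rule liouville_aux[OF D2 al c g hol zero eq bd z])
 next
  case True
  define m where "m = (%z::real\<times>real. (fst z, - snd z))"
  have "(0,1) \<notin> D" unfolding True by simp
  then have DN: "D \<noteq> UNIV" by (metis UNIV_I)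
  define D' where "D' = {z::real\<times>real. snd z \<ge> 0}"
  have mD: "m p \<in> D" if "p \<in> D'" for p using that unfolding m_def D'_def True by auto
  have md: "(m has_derivative m) (at p within D')" for p
   by (rule bounded_linear_imp_has_derivative) (unfold m_def, intro bounded_linear_Pair bounded_linear_fst bounded_linear_minus bounded_linear_snd)
  have gr: "((%p. f (m p)) has_derivative (%h. fst h * f1 (m p) + snd h * (- f2 (m p)))) (at p within D')" if "grad D f f1 f2" "p \<in> D'" for f f1 f2 p
  proof -
   have "(f has_derivative (%h. fst h * f1 (m p) + snd h * f2 (m p))) (at (m p) within m ` D')"
    by (rule has_derivative_subset[OF bspec[OF that(1)[unfolded grad_def] mD[OF that(2)]]]) (rule image_subsetI, erule mD)
   from has_derivative_in_compose[OF md this]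
   show ?thesis by (simp add: m_def)
  qed
  have m0: "m 0 = 0" by (simp add: m_def zero_prod_def)
  have dm: "dist (m p) (m q) = dist p q" for p q unfolding m_def dist_prod_def by (simp add: dist_real_def power2_commute)
  have "h3 (m (m z)) = 0 \<and> - h4 (m (m z)) = 0"
  proof (rule liouville_aux[of D' al c "%p. g1 (m p)" "%p. h3 (m p)" "%p. - h4 (m p)" "%p. - g2 (m p)" "%p. h5 (m p)"])
   show "grad D' (%p. g1 (m p)) (%p. h3 (m p)) (%p. - h4 (m p))" unfolding grad_def by (rule ballI) (rule gr[OF g(1)])
   show "grad D' (%p. - g2 (m p)) (%p. - h4 (m p)) (%p. h5 (m p))" unfolding grad_def
   proof
    fix p assume "p \<in> D'"
    from has_derivative_minus[OF gr[OF g(2) this]]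
    show "((%p. - g2 (m p)) has_derivative (%h. fst h * - h4 (m p) + snd h * h5 (m p))) (at p within D')"
     by simp
   qed
   show "hol D' al 1 (%p. h3 (m p))" unfolding hol_def
   proof (intro ballI)
    fix p q assume pq: "p \<in> D'" "q \<in> D'"
    have "\<bar>h3 (m p) - h3 (m q)\<bar> <= 1 * dist (m p) (m q) powr al"
     by (rule bspec[OF bspec[OF hol(1)[unfolded hol_def] mD[OF pq(1)]] mD[OF pq(2)]])
    then show "\<bar>h3 (m p) - h3 (m q)\<bar> <= 1 * dist p q powr al" unfolding dm .
   qed
   show "hol D' al 1 (%p. - h4 (m p))" unfolding hol_def
   proof (intro ballI)
    fix p q assume pq: "p \<in> D'" "q \<in> D'"
    have "\<bar>h4 (m p) - h4 (m q)\<bar> <= 1 * dist (m p) (m q) powr al"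
     by (rule bspec[OF bspec[OF hol(2)[unfolded hol_def] mD[OF pq(1)]] mD[OF pq(2)]])
    then show "\<bar>- h4 (m p) - - h4 (m q)\<bar> <= 1 * dist p q powr al" unfolding dm by (simp add: abs_minus_commute)
   qed
   show "h3 (m 0) = 0" "- h4 (m 0) = 0" using zero by (simp_all add: m0)
   show "c * h3 (m z) + 2 * h5 (m z) = 0" if "z \<in> D'" for z by (rule eq[OF mD[OF that]])
   show "h3 (m z) = 0" if "snd z = 0" for z using bd[OF DN, of "m z"] that unfolding m_def by simp
   show "m z \<in> D'" using z unfolding m_def D'_def True by auto
  qed (simp_all add: al c D'_def)
  then show ?thesis by (simp add: m_def)
 qed
 then show ?thesis using eq[OF z] by simp
qed


subsection \<open>The Schauder estimate by blow-up\<close>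

lemma grad_affine:
 assumes "grad S f f1 f2"
 shows "grad {z. b + \<rho> *\<^sub>R z \<in> S} (%z. f (b + \<rho> *\<^sub>R z)) (%z. \<rho> * f1 (b + \<rho> *\<^sub>R z)) (%z. \<rho> * f2 (b + \<rho> *\<^sub>R z))"
 unfolding grad_def
proof
 fix z assume z: "z \<in> {z. b + \<rho> *\<^sub>R z \<in> S}"
 let ?Z = "{z. b + \<rho> *\<^sub>R z \<in> S}"
 have 1: "((%z. b + \<rho> *\<^sub>R z) has_derivative (%h. \<rho> *\<^sub>R h)) (at z within ?Z)"
  by (rule has_derivative_eq_rhs[OF has_derivative_add[OF has_derivative_const has_derivative_scaleR_right[OF has_derivative_ident]]]) simp
 have 2: "(f has_derivative (%h. fst h * f1 (b + \<rho> *\<^sub>R z) + snd h * f2 (b + \<rho> *\<^sub>R z))) (at (b + \<rho> *\<^sub>R z) within (%z. b + \<rho> *\<^sub>R z) ` ?Z)"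
  by (rule has_derivative_subset[OF bspec[OF assms[unfolded grad_def]]]) (use z in auto)
 show "((%z. f (b + \<rho> *\<^sub>R z)) has_derivative (%h. fst h * (\<rho> * f1 (b + \<rho> *\<^sub>R z)) + snd h * (\<rho> * f2 (b + \<rho> *\<^sub>R z)))) (at z within ?Z)"
  by (rule has_derivative_eq_rhs[OF has_derivative_in_compose[OF 1 2]]) (simp add: mult_ac)
qed

lemma bounded_linear_pair_form: "bounded_linear (%h::real\<times>real. fst h * a + snd h * b)"
 by (intro bounded_linear_add bounded_linear_mult_const bounded_linear_fst bounded_linear_snd)

lemma grad_linear_combination:
 assumes "grad S f f1 f2"
 shows "grad S (%z. k * (f z - (fst z * a + snd z * b) - c)) (%z. k * (f1 z - a)) (%z. k * (f2 z - b))"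
 unfolding grad_def
proof
 fix z assume z: "z \<in> S"
 have F: "(f has_derivative (%h. fst h * f1 z + snd h * f2 z)) (at z within S)"
  by (rule bspec[OF assms[unfolded grad_def] z])
 have L: "((%z::real\<times>real. fst z * a + snd z * b) has_derivative (%h. fst h * a + snd h * b)) (at z within S)"
  by (rule bounded_linear_imp_has_derivative[OF bounded_linear_pair_form])
 show "((%z. k * (f z - (fst z * a + snd z * b) - c)) has_derivative (%h. fst h * (k * (f1 z - a)) + snd h * (k * (f2 z - b)))) (at z within S)"
  by (rule has_derivative_eq_rhs[OF has_derivative_mult_right[OF has_derivative_diff[OF has_derivative_diff[OF F L] has_derivative_const]]])
   (simp add: fun_eq_iff algebra_simps)
qed

lemma convex_affine_preimage:
 assumes "convex S" shows "convex {z::'a::real_vector. b + \<rho> *\<^sub>R z \<in> S}"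
 unfolding convex_alt
proof (intro ballI allI impI)
 fix x y :: 'a and u :: real assume a: "x \<in> {z. b + \<rho> *\<^sub>R z \<in> S}" "y \<in> {z. b + \<rho> *\<^sub>R z \<in> S}" "0 <= u \<and> u <= 1"
 have "b + \<rho> *\<^sub>R ((1 - u) *\<^sub>R x + u *\<^sub>R y) = (1 - u) *\<^sub>R (b + \<rho> *\<^sub>R x) + u *\<^sub>R (b + \<rho> *\<^sub>R y)" by (simp add: algebra_simps)
 also have "\<dots> \<in> S" using a assms unfolding convex_alt by simp
 finally show "(1 - u) *\<^sub>R x + u *\<^sub>R y \<in> {z. b + \<rho> *\<^sub>R z \<in> S}" by simp
qed

text \<open>Rescaling by \<open>\<rho> n\<close> about \<open>b n\<close> turns the second
  derivatives into functions of seminorm 1 that vanish at 0. In the limit the coefficient freezes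
  and the data vanish, so the Liouville theorem makes the limit zero, and \<open>sep\<close> becomes
  \<open>1/2 <= 0\<close>. In the application \<open>\<rho> n\<close> is the distance of two points
  at which half of the best Hoelder constant is exceeded, and \<open>D\<close> reflects their
  position relative to the edges.\<close>

lemma blowup_core:
 fixes J :: "nat => nat => real \<times> real => real" and b P Q :: "nat => real \<times> real"
 assumes al: "0 < al" "al < 1" and lam: "0 < \<mu>"
  and J: "!!n. jet (strip (R n)) (J n)"
  and hJ: "!!n i. i \<in> {3,4,5} ==> hol (strip (R n)) al 1 (J n i)"
  and A: "!!n p. p \<in> strip (R n) ==> \<mu> <= A n p \<and> A n p <= \<Lambda>"
  and hA: "!!n. hol (strip (R n)) al Ka (A n)"
  and eq: "!!n p. p \<in> strip (R n) ==> A n p * J n 3 p + 2 * J n 5 p = f n p"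
  and hf: "!!n. hol (strip (R n)) al (\<epsilon> n) (f n)" and \<epsilon>: "\<epsilon> \<longlonglongrightarrow> 0"
  and bd: "!!n x x' s. s \<in> {R n, - R n} ==> \<bar>J n 3 (x, s) - J n 3 (x', s)\<bar> <= \<epsilon> n * \<bar>x - x'\<bar> powr al"
  and D2: "!!n i p. i \<in> {3,4,5} ==> p \<in> strip (R n) ==> \<bar>J n i p\<bar> <= \<omega> n" and \<omega>: "(\<omega> \<longlongrightarrow> 0) uf"
  and \<rho>: "!!n. \<rho> n > 0" and b: "!!n. b n \<in> strip (R n)"
  and D: "D = UNIV \<or> D = {z. snd z \<ge> 0} \<or> D = {z. snd z <= 0}"
  and Z: "!!z. z \<in> D ==> eventually (%n. b n + \<rho> n *\<^sub>R z \<in> strip (R n)) uf"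
  and bdD: "D \<noteq> UNIV ==> (!!n. snd (b n) \<in> {R n, - R n})"
  and PQ: "!!n. b n + \<rho> n *\<^sub>R P n \<in> strip (R n)" "!!n. b n + \<rho> n *\<^sub>R Q n \<in> strip (R n)"
  and PQB: "eventually (%n. P n \<in> D \<inter> cball 0 B) uf" "eventually (%n. Q n \<in> D \<inter> cball 0 B) uf"
  and sep: "!!n. (1/2) * \<rho> n powr al <= (\<Sum>i\<in>{3,4,5}. \<bar>J n i (b n + \<rho> n *\<^sub>R P n) - J n i (b n + \<rho> n *\<^sub>R Q n)\<bar>)"
 shows False
proof -
 define Zn where "Zn = (%n. {z. b n + \<rho> n *\<^sub>R z \<in> strip (R n)})"
 define h where "h = (%i n z. (1 / \<rho> n powr al) * (J n i (b n + \<rho> n *\<^sub>R z) - J n i (b n)))"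
 \<comment> \<open>The rescaled first derivative minus its first order Taylor polynomial at
   \<open>b n\<close>. For \<open>j = 1, 2\<close> the jet entries \<open>j + 2\<close> and
   \<open>j + 3\<close> are the \<open>x\<close> and \<open>y\<close> derivatives of entry
   \<open>j\<close>, so the gradient of \<open>g j n\<close> consists of functions
   \<open>h\<close>.\<close>
 define g where "g = (%j n z. (1 / (\<rho> n * \<rho> n powr al)) * (J n j (b n + \<rho> n *\<^sub>R z) - (fst z * (\<rho> n * J n (j + 2) (b n)) + snd z * (\<rho> n * J n (j + 3) (b n))) - J n j (b n)))"
 have \<rho>a: "\<rho> n powr al > 0" for n using \<rho>[of n] by simp
 have Z0: "0 \<in> Zn n" for n using b unfolding Zn_def by simp
 have cZ: "convex (Zn n)" for n unfolding Zn_def by (rule convex_affine_preimage[OF convex_strip])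
 have gg: "grad (Zn n) (g j n) (h (j + 2) n) (h (j + 3) n)" if j: "j \<in> {1,2}" for j n
 proof -
  have "grad (strip (R n)) (J n j) (J n (j + 2)) (J n (j + 3))" using J[of n] j unfolding jet_def by (auto simp: eval_nat_numeral)
  from grad_linear_combination[OF grad_affine[OF this, of "b n" "\<rho> n"]]
  have "grad (Zn n) (g j n) (%z. (1 / (\<rho> n * \<rho> n powr al)) * (\<rho> n * J n (j + 2) (b n + \<rho> n *\<^sub>R z) - \<rho> n * J n (j + 2) (b n)))
   (%z. (1 / (\<rho> n * \<rho> n powr al)) * (\<rho> n * J n (j + 3) (b n + \<rho> n *\<^sub>R z) - \<rho> n * J n (j + 3) (b n)))"
   unfolding g_def Zn_def .
  then show ?thesis
   by (rule grad_cong) (use \<rho>[of n] \<rho>a[of n] in \<open>simp_all add: h_def field_simps\<close>)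
 qed
 have dZ: "dist (b n + \<rho> n *\<^sub>R z) (b n + \<rho> n *\<^sub>R z') powr al = \<rho> n powr al * dist z z' powr al" for n z z'
 proof -
  have "dist (b n + \<rho> n *\<^sub>R z) (b n + \<rho> n *\<^sub>R z') = \<rho> n * dist z z'"
   using \<rho>[of n] by (simp add: dist_norm flip: scaleR_diff_right)
  then show ?thesis using \<rho>[of n] by (simp add: powr_mult)
 qed
 have hh: "hol (Zn n) al 1 (h i n)" if i: "i \<in> {3,4,5}" for i n
  unfolding hol_def
 proof (intro ballI)
  fix z z' assume zz: "z \<in> Zn n" "z' \<in> Zn n"
  have "\<bar>J n i (b n + \<rho> n *\<^sub>R z) - J n i (b n + \<rho> n *\<^sub>R z')\<bar> <= 1 * dist (b n + \<rho> n *\<^sub>R z) (b n + \<rho> n *\<^sub>R z') powr al"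
   by (rule bspec[OF bspec[OF hJ[OF i, unfolded hol_def]]]) (use zz in \<open>simp_all add: Zn_def\<close>)
  then have le: "\<bar>J n i (b n + \<rho> n *\<^sub>R z) - J n i (b n + \<rho> n *\<^sub>R z')\<bar> <= \<rho> n powr al * dist z z' powr al" unfolding dZ by simp
  have "h i n z - h i n z' = (1 / \<rho> n powr al) * (J n i (b n + \<rho> n *\<^sub>R z) - J n i (b n + \<rho> n *\<^sub>R z'))"
   unfolding h_def by (simp add: algebra_simps)
  then have "\<bar>h i n z - h i n z'\<bar> = (1 / \<rho> n powr al) * \<bar>J n i (b n + \<rho> n *\<^sub>R z) - J n i (b n + \<rho> n *\<^sub>R z')\<bar>"
   using \<rho>a[of n] by (simp add: abs_mult)
  also have "\<dots> <= (1 / \<rho> n powr al) * (\<rho> n powr al * dist z z' powr al)" using le \<rho>a[of n] by (intro mult_left_mono) auto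
  also have "\<dots> = 1 * dist z z' powr al" using \<rho>a[of n] by simp
  finally show "\<bar>h i n z - h i n z'\<bar> <= 1 * dist z z' powr al" .
 qed
 have h0: "h i n 0 = 0" for i n unfolding h_def by simp
 have hbound: "\<bar>h i n z\<bar> <= norm z powr al" if "i \<in> {3,4,5}" "z \<in> Zn n" for i n z
  using bspec[OF bspec[OF hh[OF that(1), unfolded hol_def] that(2)] Z0] h0 by (simp add: dist_norm)
 have gbound: "\<bar>g j n z\<bar> <= 2 * (norm z * norm z powr al)" if j: "j \<in> {1,2}" and z: "z \<in> Zn n" for j n z
 proof -
  have i: "j + 2 \<in> {3,4,5}" "j + 3 \<in> {3,4,5}" using j by auto
  have "g j n 0 = 0" unfolding g_def by simp
  then show ?thesis using grad_taylor[OF cZ gg[OF j] hh[OF i(1)] hh[OF i(2)] Z0 z] al h0 by simp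
 qed
 have evZ: "eventually (%n. z \<in> Zn n) uf" if "z \<in> D" for z using Z[OF that] unfolding Zn_def by simp
 have "\<exists>l. i \<in> {3,4,5} --> z \<in> D --> ((%n. h i n z) \<longlongrightarrow> l) uf" for i z
 proof (cases "i \<in> {3,4,5} \<and> z \<in> D")
  case True
  have "eventually (%n. \<bar>h i n z\<bar> <= norm z powr al) uf"
   using evZ by (rule eventually_mono) (use True hbound in blast)+
  from uf_bounded_limit[OF this] show ?thesis by blast
 qed blast
 then obtain hl where hl: "!!i z. i \<in> {3,4,5} ==> z \<in> D ==> ((%n. h i n z) \<longlongrightarrow> hl i z) uf" by metis
 have "\<exists>l. j \<in> {1,2} --> z \<in> D --> ((%n. g j n z) \<longlongrightarrow> l) uf" for j z
 proof (cases "j \<in> {1,2} \<and> z \<in> D")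
  case True
  have "eventually (%n. \<bar>g j n z\<bar> <= 2 * (norm z * norm z powr al)) uf"
   using evZ by (rule eventually_mono) (use True gbound in blast)+
  from uf_bounded_limit[OF this] show ?thesis by blast
 qed blast
 then obtain gl where gl: "!!j z. j \<in> {1,2} ==> z \<in> D ==> ((%n. g j n z) \<longlongrightarrow> gl j z) uf" by metis
 have grl: "grad D (gl j) (hl (j + 2)) (hl (j + 3))" if j: "j \<in> {1,2}" for j
 proof -
  have i: "j + 2 \<in> {3,4,5}" "j + 3 \<in> {3,4,5}" using j by auto
  show ?thesis
   by (rule uf_grad[OF evZ cZ al(1) zero_le_one gg[OF j] hh[OF i(1)] hh[OF i(2)] gl[OF j] hl[OF i(1)] hl[OF i(2)]])
 qed
 have hol_l: "hol D al 1 (hl i)" if "i \<in> {3,4,5}" for i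
  by (rule uf_hol[OF evZ hh[OF that] hl[OF that]])
 have D0: "0 \<in> D" using D by auto
 have hl0: "hl i 0 = 0" if "i \<in> {3,4,5}" for i
  using uf_lim_unique[OF hl[OF that D0, unfolded h0] tendsto_const] .
 have "eventually (%n. \<bar>A n (b n)\<bar> <= \<Lambda>) uf"
 proof (rule always_eventually, rule allI)
  fix n show "\<bar>A n (b n)\<bar> <= \<Lambda>" using A[OF b[of n]] lam by linarith
 qed
 from uf_bounded_limit[OF this] obtain a where a: "((%n. A n (b n)) \<longlongrightarrow> a) uf" by blast
 have "\<mu> <= a" by (rule uf_lim_le[OF tendsto_const a]) (use A b in simp)
 then have a0: "a > 0" using lam by linarith
 have \<epsilon>': "(\<epsilon> \<longlongrightarrow> 0) uf" by (rule tendsto_uf[OF \<epsilon>])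
 have eql: "a * hl 3 z + 2 * hl 5 z = 0" if z: "z \<in> D" for z
 proof -
  have l1: "((%n. A n (b n) * h 3 n z + 2 * h 5 n z) \<longlongrightarrow> a * hl 3 z + 2 * hl 5 z) uf"
   by (intro tendsto_add tendsto_mult tendsto_const a hl z) simp_all
  have l0: "((%n. (\<epsilon> n + Ka * \<omega> n) * norm z powr al) \<longlongrightarrow> (0 + Ka * 0) * norm z powr al) uf"
   by (intro tendsto_add tendsto_mult tendsto_const \<epsilon>' \<omega>)
  have "((%n. A n (b n) * h 3 n z + 2 * h 5 n z) \<longlongrightarrow> 0) uf"
  proof (rule Lim_null_comparison[OF eventually_mono[OF evZ[OF z]] l0[simplified]])
   fix n assume zn: "z \<in> Zn n"
   then have m: "b n + \<rho> n *\<^sub>R z \<in> strip (R n)" unfolding Zn_def by simp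
   let ?z = "b n + \<rho> n *\<^sub>R z"
   define k where "k = \<rho> n powr al"
   have k: "k > 0" using \<rho>a unfolding k_def .
   have dz: "dist ?z (b n) powr al = k * norm z powr al" using dZ[of n z 0] by (simp add: dist_norm k_def)
   have f1: "\<bar>f n ?z - f n (b n)\<bar> <= \<epsilon> n * (k * norm z powr al)"
    using bspec[OF bspec[OF hf[unfolded hol_def] m] b] unfolding dz .
   have A1: "\<bar>A n ?z - A n (b n)\<bar> <= Ka * (k * norm z powr al)"
    using bspec[OF bspec[OF hA[unfolded hol_def] m] b] unfolding dz .
   have J1: "\<bar>J n 3 ?z\<bar> <= \<omega> n" by (rule D2[OF _ m]) simp
   have "k * (A n (b n) * h 3 n z + 2 * h 5 n z) = A n (b n) * (J n 3 ?z - J n 3 (b n)) + 2 * (J n 5 ?z - J n 5 (b n))"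
    using k unfolding h_def k_def[symmetric] by (simp add: field_simps)
   also have "\<dots> = (f n ?z - f n (b n)) - (A n ?z - A n (b n)) * J n 3 ?z"
    using eq[OF m] eq[OF b[of n]] by (simp add: algebra_simps)
   finally have e: "k * (A n (b n) * h 3 n z + 2 * h 5 n z) = (f n ?z - f n (b n)) - (A n ?z - A n (b n)) * J n 3 ?z" .
   have "\<bar>(A n ?z - A n (b n)) * J n 3 ?z\<bar> <= (Ka * (k * norm z powr al)) * \<omega> n"
    unfolding abs_mult using A1 J1 by (intro mult_mono) (auto intro: order_trans[OF abs_ge_zero])
   then have "\<bar>k * (A n (b n) * h 3 n z + 2 * h 5 n z)\<bar> <= \<epsilon> n * (k * norm z powr al) + (Ka * (k * norm z powr al)) * \<omega> n"
    unfolding e using f1 by linarith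
   also have "\<dots> = k * ((\<epsilon> n + Ka * \<omega> n) * norm z powr al)" by (simp add: algebra_simps)
   finally have "k * \<bar>A n (b n) * h 3 n z + 2 * h 5 n z\<bar> <= k * ((\<epsilon> n + Ka * \<omega> n) * norm z powr al)"
    using k by (simp add: abs_mult)
   then show "norm (A n (b n) * h 3 n z + 2 * h 5 n z) <= (\<epsilon> n + Ka * \<omega> n) * norm z powr al"
    using k by simp
  qed
  then show ?thesis by (rule uf_lim_unique[OF l1])
 qed
 \<comment> \<open>With \<open>b n\<close> on an edge, the line \<open>snd z = 0\<close> corresponds
   to that edge for every \<open>n\<close>, and there the tangential second derivative has seminorm
   \<open>\<epsilon> n\<close>.\<close>
 have bdl: "hl 3 z = 0" if DU: "D \<noteq> UNIV" and z: "snd z = 0" for z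
 proof -
  have zD: "z \<in> D" using D z by auto
  have l0: "((%n. \<epsilon> n * \<bar>fst z\<bar> powr al) \<longlongrightarrow> 0 * \<bar>fst z\<bar> powr al) uf" by (intro tendsto_mult tendsto_const \<epsilon>')
  have "((%n. h 3 n z) \<longlongrightarrow> 0) uf"
  proof (rule Lim_null_comparison[OF always_eventually l0[simplified]], rule allI)
   fix n
   have s: "b n + \<rho> n *\<^sub>R z = (fst (b n) + \<rho> n * fst z, snd (b n))" using z by (simp add: prod_eq_iff)
   have "\<bar>J n 3 (fst (b n) + \<rho> n * fst z, snd (b n)) - J n 3 (fst (b n), snd (b n))\<bar> <= \<epsilon> n * \<bar>fst (b n) + \<rho> n * fst z - fst (b n)\<bar> powr al"
    by (rule bd[OF bdD[OF DU]])
   also have "\<dots> = \<rho> n powr al * (\<epsilon> n * \<bar>fst z\<bar> powr al)" using \<rho>[of n] by (simp add: abs_mult powr_mult)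
   finally have "\<bar>J n 3 (b n + \<rho> n *\<^sub>R z) - J n 3 (b n)\<bar> <= \<rho> n powr al * (\<epsilon> n * \<bar>fst z\<bar> powr al)" unfolding s by simp
   moreover have "norm (h 3 n z) = \<bar>J n 3 (b n + \<rho> n *\<^sub>R z) - J n 3 (b n)\<bar> / \<rho> n powr al"
    unfolding h_def using \<rho>a[of n] by (simp add: abs_mult)
   ultimately show "norm (h 3 n z) <= \<epsilon> n * \<bar>fst z\<bar> powr al" using \<rho>a[of n] by (simp add: divide_le_eq mult.commute)
  qed
  then show ?thesis by (rule uf_lim_unique[OF hl[OF _ zD], rotated]) simp
 qed
 have g1: "grad D (gl 1) (hl 3) (hl 4)" using grl[of 1] by (simp add: eval_nat_numeral)
 have g2: "grad D (gl 2) (hl 4) (hl 5)" using grl[of 2] by (simp add: eval_nat_numeral)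
 have zero: "hl i z = 0" if "i \<in> {3,4,5}" "z \<in> D" for i z
 proof -
  have "hl 3 z = 0 \<and> hl 4 z = 0 \<and> hl 5 z = 0"
   by (rule liouville[OF D al a0 g1 g2 hol_l hol_l hl0 hl0 eql bdl that(2)]) simp_all
  then show ?thesis using that(1) by auto
 qed
 have Dcl: "closed D"
 proof -
  have "closed {z::real\<times>real. 0 <= snd z}" "closed {z::real\<times>real. snd z <= 0}"
   by (intro closed_Collect_le continuous_on_const continuous_on_snd continuous_on_id)+
  then show ?thesis using D by auto
 qed
 \<comment> \<open>The points \<open>X n\<close> move with \<open>n\<close>. The common Hoelder
   bound 1 permits replacing them by their limit point, where the limit function is 0.\<close>
 have conv: "((%n. h i n (X n)) \<longlongrightarrow> 0) uf" if i: "i \<in> {3,4,5}" and X: "!!n. X n \<in> Zn n" "eventually (%n. X n \<in> D \<inter> cball 0 B) uf" for i X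
 proof -
  have "compact (D \<inter> cball 0 B)" by (intro closed_Int_compact Dcl compact_cball)
  then obtain l where l: "l \<in> D \<inter> cball 0 B" "(X \<longlongrightarrow> l) uf" using uf_compact_limit[OF _ X(2)] by blast
  then have lD: "l \<in> D" by simp
  have "((%n. dist (X n) l) \<longlongrightarrow> dist l l) uf" by (intro tendsto_intros l(2))
  then have "((%n. dist (X n) l powr al) \<longlongrightarrow> 0) uf"
   using tendsto_zero_powrI[of "%n. dist (X n) l" _ "%_. al" al] al by simp
  then have "((%n. h i n (X n) - h i n l) \<longlongrightarrow> 0) uf"
  proof (rule Lim_null_comparison[OF eventually_mono[OF evZ[OF lD]], rotated])
   fix n assume "l \<in> Zn n"
   then show "norm (h i n (X n) - h i n l) <= dist (X n) l powr al"
    using bspec[OF bspec[OF hh[OF i, unfolded hol_def] X(1)], of l n] by simp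
  qed
  from tendsto_add[OF this hl[OF i lD]] show ?thesis using zero[OF i lD] by simp
 qed
 have PZ: "!!n. P n \<in> Zn n" "!!n. Q n \<in> Zn n" using PQ unfolding Zn_def by simp_all
 have lim: "((%n. \<Sum>i\<in>{3,4,5}. \<bar>h i n (P n) - h i n (Q n)\<bar>) \<longlongrightarrow> (\<Sum>i\<in>{3,4,5::nat}. \<bar>0 - 0\<bar>)) uf"
  by (intro tendsto_sum tendsto_rabs tendsto_diff conv PZ PQB)
 have "1/2 <= (\<Sum>i\<in>{3,4,5::nat}. \<bar>0 - 0::real\<bar>)"
 proof (rule uf_lim_le[OF tendsto_const lim], rule always_eventually, rule allI)
  fix n
  have "\<bar>h i n (P n) - h i n (Q n)\<bar> = \<bar>J n i (b n + \<rho> n *\<^sub>R P n) - J n i (b n + \<rho> n *\<^sub>R Q n)\<bar> / \<rho> n powr al" for i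
  proof -
   have "h i n (P n) - h i n (Q n) = (J n i (b n + \<rho> n *\<^sub>R P n) - J n i (b n + \<rho> n *\<^sub>R Q n)) / \<rho> n powr al"
    unfolding h_def using \<rho>a[of n] by (simp add: field_simps)
   then show ?thesis using \<rho>a[of n] by simp
  qed
  then have "(\<Sum>i\<in>{3,4,5}. \<bar>h i n (P n) - h i n (Q n)\<bar>) = (\<Sum>i\<in>{3,4,5}. \<bar>J n i (b n + \<rho> n *\<^sub>R P n) - J n i (b n + \<rho> n *\<^sub>R Q n)\<bar>) / \<rho> n powr al"
   by (simp only: sum_divide_distrib)
  then show "1/2 <= (\<Sum>i\<in>{3,4,5}. \<bar>h i n (P n) - h i n (Q n)\<bar>)"
   by (simp only:) (rule iffD2[OF pos_le_divide_eq[OF \<rho>a] sep])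
 qed
 then show False by simp
qed

text \<open>Interpolation between the small sup norm and the seminorm 1 forces all second
  derivatives to 0, and by \<open>sep\<close> the two points then approach each other. The blow-up
  is centred at \<open>p n\<close> or at its projection to an edge, depending on whether the
  distance to that edge is of the order of \<open>\<rho> n\<close>.\<close>

lemma schauder_sequence:
 fixes J :: "nat => nat => real \<times> real => real" and p q :: "nat => real \<times> real"
 assumes al: "0 < al" "al < 1" and mu: "0 < \<mu>" and R0: "0 < R0" "!!n. R0 <= R n"
  and J: "!!n. jet (strip (R n)) (J n)"
  and hJ: "!!n i. i \<in> {3,4,5} ==> hol (strip (R n)) al 1 (J n i)"
  and A: "!!n p. p \<in> strip (R n) ==> \<mu> <= A n p \<and> A n p <= \<Lambda>"
  and hA: "!!n. hol (strip (R n)) al Ka (A n)"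
  and eq: "!!n p. p \<in> strip (R n) ==> A n p * J n 3 p + 2 * J n 5 p = f n p"
  and hf: "!!n. hol (strip (R n)) al (\<epsilon> n) (f n)" and \<epsilon>: "\<epsilon> \<longlonglongrightarrow> 0" "!!n. 0 < \<epsilon> n" "!!n. \<epsilon> n <= 1"
  and J0: "!!n p. p \<in> strip (R n) ==> \<bar>J n 0 p\<bar> <= \<epsilon> n"
  and bd: "!!n x x' s. s \<in> {R n, - R n} ==> \<bar>J n 3 (x, s) - J n 3 (x', s)\<bar> <= \<epsilon> n * \<bar>x - x'\<bar> powr al"
  and pq: "!!n. p n \<in> strip (R n)" "!!n. q n \<in> strip (R n)" "!!n. p n \<noteq> q n"
  and sep: "!!n. (1/2) * dist (p n) (q n) powr al <= (\<Sum>i\<in>{3,4,5}. \<bar>J n i (p n) - J n i (q n)\<bar>)"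
 shows False
proof -
 \<comment> \<open>The fourth root of \<open>\<epsilon> n\<close> balances the interpolation:
   \<open>r n\<close> tends to 0, and \<open>\<epsilon> n / (r n)^2\<close> is still a multiple of
   \<open>sqrt (\<epsilon> n)\<close>.\<close>
 define r where "r = (%n. (R0 / 2) * sqrt (sqrt (\<epsilon> n)))"
 define \<omega> where "\<omega> = (%n. 2 * (4 * \<epsilon> n / (r n)\<^sup>2 + 4 * 1 * (4 * r n) powr al))"
 have r0: "r n > 0" for n unfolding r_def using R0(1) \<epsilon>(2)[of n] by simp
 have rR: "2 * r n <= R n" for n
 proof -
  have "sqrt (sqrt (\<epsilon> n)) <= 1" using \<epsilon>(3)[of n] by simp
  then have "R0 * sqrt (sqrt (\<epsilon> n)) <= R0 * 1" using R0(1) by (intro mult_left_mono) auto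
  then show ?thesis unfolding r_def using R0(2)[of n] by simp
 qed
 have D2: "\<bar>J n i p\<bar> <= \<omega> n" if "i \<in> {3,4,5}" "p \<in> strip (R n)" for n i p
  unfolding \<omega>_def by (rule jet_interpolation2[OF J r0 rR that(2) J0 hJ al(1) zero_le_one that(1)])
 have s\<epsilon>: "(%n. sqrt (\<epsilon> n)) \<longlonglongrightarrow> 0" using tendsto_real_sqrt[OF \<epsilon>(1)] by simp
 have rl: "r \<longlonglongrightarrow> 0"
  unfolding r_def using tendsto_mult[OF tendsto_const[of "R0 / 2"] tendsto_real_sqrt[OF s\<epsilon>]] by simp
 have \<omega>l: "\<omega> \<longlonglongrightarrow> 0"
 proof -
  have "4 * \<epsilon> n / (r n)\<^sup>2 = (16 / R0\<^sup>2) * sqrt (\<epsilon> n)" for n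
  proof -
   have "(r n)\<^sup>2 = (R0\<^sup>2 / 4) * sqrt (\<epsilon> n)" unfolding r_def using \<epsilon>(2)[of n] by (simp add: power_mult_distrib power_divide)
   moreover have "\<epsilon> n = sqrt (\<epsilon> n) * sqrt (\<epsilon> n)" using \<epsilon>(2)[of n] by simp
   moreover have "4 * (s * s) / ((R0\<^sup>2 / 4) * s) = (16 / R0\<^sup>2) * s" if "s > 0" for s
    using that R0(1) by (simp add: field_simps)
   ultimately show ?thesis using \<epsilon>(2)[of n] by (metis real_sqrt_gt_zero)
  qed
  moreover have "(%n. (16 / R0\<^sup>2) * sqrt (\<epsilon> n)) \<longlonglongrightarrow> (16 / R0\<^sup>2) * 0" by (intro tendsto_mult tendsto_const s\<epsilon>)
  moreover have "(%n. (4 * r n) powr al) \<longlonglongrightarrow> 0"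
  proof (rule tendsto_zero_powrI[OF _ tendsto_const _ al(1)])
   show "(%n. 4 * r n) \<longlonglongrightarrow> 0" using tendsto_mult[OF tendsto_const[of 4] rl] by simp
  qed (intro always_eventually allI, use r0 in \<open>simp add: less_imp_le\<close>)
  ultimately have "(%n. 2 * (4 * \<epsilon> n / (r n)\<^sup>2 + 4 * 1 * (4 * r n) powr al)) \<longlonglongrightarrow> 2 * ((16 / R0\<^sup>2) * 0 + 4 * 1 * 0)"
   by (intro tendsto_mult tendsto_add tendsto_const) simp_all
  then show ?thesis unfolding \<omega>_def by simp
 qed
 define \<rho> where "\<rho> = (%n. dist (p n) (q n))"
 have \<rho>0: "\<rho> n > 0" for n unfolding \<rho>_def using pq(3) by simp
 have \<rho>l: "\<rho> \<longlonglongrightarrow> 0"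
 proof -
  have b: "\<rho> n powr al <= 12 * \<omega> n" for n
  proof -
   have "\<bar>J n i (p n) - J n i (q n)\<bar> <= 2 * \<omega> n" if "i \<in> {3,4,5}" for i
    using D2[OF that pq(1)] D2[OF that pq(2)] by (smt (verit))
   then have "(\<Sum>i\<in>{3,4,5}. \<bar>J n i (p n) - J n i (q n)\<bar>) <= (\<Sum>i\<in>{3,4,5::nat}. 2 * \<omega> n)" by (intro sum_mono)
   then show ?thesis using sep[of n] unfolding \<rho>_def by simp
  qed
  have "(%n. \<rho> n powr al) \<longlonglongrightarrow> 0"
  proof (rule tendsto_sandwich[OF _ _ tendsto_const])
   show "(%n. 12 * \<omega> n) \<longlonglongrightarrow> 0" using tendsto_mult[OF tendsto_const[of 12] \<omega>l] by simp
   show "eventually (%n. 0 <= \<rho> n powr al) sequentially" by simp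
   show "eventually (%n. \<rho> n powr al <= 12 * \<omega> n) sequentially" using b by simp
  qed
  then have "(%n. (\<rho> n powr al) powr (1 / al)) \<longlonglongrightarrow> 0"
   by (rule tendsto_zero_powrI[OF _ tendsto_const]) (use al in auto)
  moreover have "(\<rho> n powr al) powr (1 / al) = \<rho> n" for n using al \<rho>0[of n] by (simp add: powr_powr)
  ultimately show ?thesis by simp
 qed
 have core: False
  if b: "!!n. b n \<in> strip (R n)" and D: "D = UNIV \<or> D = {z. snd z \<ge> 0} \<or> D = {z. snd z <= 0}"
   and Z: "!!z. z \<in> D ==> eventually (%n. b n + \<rho> n *\<^sub>R z \<in> strip (R n)) uf"
   and bdD: "D \<noteq> UNIV ==> (!!n. snd (b n) \<in> {R n, - R n})"
   and B: "eventually (%n. norm (p n - b n) <= B * \<rho> n) uf"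
   and inD: "!!n. (1 / \<rho> n) *\<^sub>R (p n - b n) \<in> D" "!!n. (1 / \<rho> n) *\<^sub>R (q n - b n) \<in> D" for b D B
 proof -
  have e: "b n + \<rho> n *\<^sub>R ((1 / \<rho> n) *\<^sub>R (x - b n)) = x" for n x using \<rho>0[of n] by simp
  have sep': "(1/2) * \<rho> n powr al <= (\<Sum>i\<in>{3,4,5}. \<bar>J n i (p n) - J n i (q n)\<bar>)" for n using sep[of n] unfolding \<rho>_def .
  have PB: "eventually (%n. (1 / \<rho> n) *\<^sub>R (p n - b n) \<in> D \<inter> cball 0 (B + 1)) uf"
   using B
  proof (rule eventually_mono)
   fix n assume "norm (p n - b n) <= B * \<rho> n"
   then have "norm ((1 / \<rho> n) *\<^sub>R (p n - b n)) <= B" using \<rho>0[of n] by (simp add: divide_le_eq)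
   then show "(1 / \<rho> n) *\<^sub>R (p n - b n) \<in> D \<inter> cball 0 (B + 1)" using inD(1)[of n] by simp
  qed
  have QB: "eventually (%n. (1 / \<rho> n) *\<^sub>R (q n - b n) \<in> D \<inter> cball 0 (B + 1)) uf"
   using B
  proof (rule eventually_mono)
   fix n assume a: "norm (p n - b n) <= B * \<rho> n"
   have "norm (q n - b n) <= norm (q n - p n) + norm (p n - b n)" using norm_triangle_ineq[of "q n - p n" "p n - b n"] by simp
   also have "norm (q n - p n) = \<rho> n" unfolding \<rho>_def by (simp add: dist_norm norm_minus_commute)
   finally have "norm (q n - b n) <= (B + 1) * \<rho> n" using a by (simp add: algebra_simps)
   then have "norm ((1 / \<rho> n) *\<^sub>R (q n - b n)) <= B + 1" using \<rho>0[of n] by (simp add: divide_le_eq)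
   then show "(1 / \<rho> n) *\<^sub>R (q n - b n) \<in> D \<inter> cball 0 (B + 1)" using inD(2)[of n] by simp
  qed
  show False
   by (rule blowup_core[OF al mu J hJ A hA eq hf \<epsilon>(1) bd D2 tendsto_uf[OF \<omega>l] \<rho>0 b D Z bdD _ _ PB QB])
    (simp_all only: e pq sep' not_False_eq_True)
 qed
 have small: "eventually (%n. \<rho> n * t <= R0) uf" for t
 proof -
  have "(%n. \<rho> n * t) \<longlonglongrightarrow> 0" using tendsto_mult[OF \<rho>l tendsto_const[of t]] by simp
  then have "eventually (%n. \<rho> n * t < R0) sequentially" using R0(1) by (rule order_tendstoD(2))
  then show ?thesis by (intro eventually_uf) (auto elim: eventually_mono)
 qed
 have sp: "\<bar>snd (p n)\<bar> <= R n" "\<bar>snd (q n)\<bar> <= R n" for n using pq(1,2)[of n] by (auto simp: mem_strip)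
 have nn: "norm ((x::real\<times>real) - (fst x, s)) = \<bar>snd x - s\<bar>" for x s by (cases x) (simp add: norm_prod_def)
 have nl: "norm (p n - (fst (p n), - R n)) = snd (p n) + R n" for n unfolding nn using sp(1)[of n] by linarith
 have nu: "norm (p n - (fst (p n), R n)) = R n - snd (p n)" for n unfolding nn using sp(1)[of n] by linarith
 \<comment> \<open>The ultrafilter decides, for each \<open>B\<close>, whether an edge lies within
   \<open>B * \<rho> n\<close>. If this fails for every \<open>B\<close> and both edges, the
   rescaled strips exhaust the plane.\<close>
 consider (lower) B where "eventually (%n. snd (p n) + R n <= B * \<rho> n) uf"
  | (upper) B where "eventually (%n. R n - snd (p n) <= B * \<rho> n) uf"
  | (int) "!!B. eventually (%n. \<not> snd (p n) + R n <= B * \<rho> n) uf" "!!B. eventually (%n. \<not> R n - snd (p n) <= B * \<rho> n) uf"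
  using uf_ultra by metis
 then show False
 proof cases
  case lower
  show False
  proof (rule core[of "%n. (fst (p n), - R n)" "{z. snd z \<ge> 0}" B])
   show "(fst (p n), - R n) \<in> strip (R n)" for n using R0(1) R0(2)[of n] by (simp add: mem_strip)
   show "eventually (%n. (fst (p n), - R n) + \<rho> n *\<^sub>R z \<in> strip (R n)) uf" if "z \<in> {z. 0 <= snd z}" for z
    using small[of "snd z"]
   proof (rule eventually_mono)
    fix n assume "\<rho> n * snd z <= R0"
    moreover have "0 <= \<rho> n * snd z" using that \<rho>0[of n] by simp
    ultimately show "(fst (p n), - R n) + \<rho> n *\<^sub>R z \<in> strip (R n)" using R0(1) R0(2)[of n] by (simp add: mem_strip)
   qed
   show "eventually (%n. norm (p n - (fst (p n), - R n)) <= B * \<rho> n) uf"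
    using lower by (simp only: nl)
   show "(1 / \<rho> n) *\<^sub>R (p n - (fst (p n), - R n)) \<in> {z. 0 <= snd z}" for n
    using sp(1)[of n] \<rho>0[of n] by (simp add: abs_le_iff)
   show "(1 / \<rho> n) *\<^sub>R (q n - (fst (p n), - R n)) \<in> {z. 0 <= snd z}" for n
    using sp(2)[of n] \<rho>0[of n] by (simp add: abs_le_iff)
  qed simp_all
 next
  case upper
  show False
  proof (rule core[of "%n. (fst (p n), R n)" "{z. snd z <= 0}" B])
   show "(fst (p n), R n) \<in> strip (R n)" for n using R0(1) R0(2)[of n] by (simp add: mem_strip)
   show "eventually (%n. (fst (p n), R n) + \<rho> n *\<^sub>R z \<in> strip (R n)) uf" if "z \<in> {z. snd z <= 0}" for z
    using small[of "- snd z"]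
   proof (rule eventually_mono)
    fix n assume "\<rho> n * - snd z <= R0"
    moreover have "\<rho> n * snd z <= 0" using that \<rho>0[of n] by (simp add: mult_nonneg_nonpos)
    ultimately show "(fst (p n), R n) + \<rho> n *\<^sub>R z \<in> strip (R n)" using R0(1) R0(2)[of n] by (simp add: mem_strip abs_le_iff)
   qed
   show "eventually (%n. norm (p n - (fst (p n), R n)) <= B * \<rho> n) uf"
    using upper by (simp only: nu)
   show "(1 / \<rho> n) *\<^sub>R (p n - (fst (p n), R n)) \<in> {z. snd z <= 0}" for n
    using sp(1)[of n] \<rho>0[of n] by (simp add: abs_le_iff divide_le_0_iff)
   show "(1 / \<rho> n) *\<^sub>R (q n - (fst (p n), R n)) \<in> {z. snd z <= 0}" for n
    using sp(2)[of n] \<rho>0[of n] by (simp add: abs_le_iff divide_le_0_iff)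
  qed simp_all
 next
  case int
  show False
  proof (rule core[of p UNIV 0])
   show "p n \<in> strip (R n)" for n by (rule pq)
   show "eventually (%n. p n + \<rho> n *\<^sub>R z \<in> strip (R n)) uf" for z
    using eventually_conj[OF int(1)[of "- snd z"] int(2)[of "snd z"]]
   proof (rule eventually_mono)
    fix n assume "\<not> snd (p n) + R n <= - snd z * \<rho> n \<and> \<not> R n - snd (p n) <= snd z * \<rho> n"
    then show "p n + \<rho> n *\<^sub>R z \<in> strip (R n)" by (simp add: mem_strip abs_le_iff mult.commute)
   qed
  qed simp_all
 qed
qed

text \<open>The infimum of the admissible constants is itself admissible. Half of a positive infimum
  fails at some pair of points, which starts the blow-up; and an estimate of the data by the infimum
  bounds the infimum in turn, which permits absorption.\<close>

lemma best_hoelder_constant: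
 assumes "!!i. i \<in> I ==> hol S al K (f i)" "K \<ge> 0"
 obtains N where "N \<ge> 0" "!!i. i \<in> I ==> hol S al N (f i)" "!!M. M \<ge> 0 ==> (!!i. i \<in> I ==> hol S al M (f i)) ==> N <= M"
proof -
 define X where "X = {M. M \<ge> 0 \<and> (\<forall>i\<in>I. hol S al M (f i))}"
 have K: "K \<in> X" using assms unfolding X_def by simp
 have lb: "bdd_below X" unfolding X_def by (rule bdd_belowI[of _ 0]) simp
 have 1: "Inf X \<ge> 0" using K by (intro cInf_greatest) (auto simp: X_def)
 have 2: "hol S al (Inf X) (f i)" if i: "i \<in> I" for i
  unfolding hol_def
 proof (intro ballI)
  fix p q assume pq: "p \<in> S" "q \<in> S"
  show "\<bar>f i p - f i q\<bar> <= Inf X * dist p q powr al"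
  proof (cases "p = q")
   case True then show ?thesis by simp
  next
   case False
   then have d: "dist p q powr al > 0" by simp
   have "\<bar>f i p - f i q\<bar> / dist p q powr al <= Inf X"
   proof (rule cInf_greatest)
    show "X \<noteq> {}" using K by auto
    fix M assume "M \<in> X"
    then have "\<bar>f i p - f i q\<bar> <= M * dist p q powr al" using i pq unfolding X_def hol_def by blast
    then show "\<bar>f i p - f i q\<bar> / dist p q powr al <= M" using d by (simp add: divide_le_eq)
   qed
   then show ?thesis using d by (simp add: divide_le_eq)
  qed
 qed
 have 3: "Inf X <= M" if "M \<ge> 0" "!!i. i \<in> I ==> hol S al M (f i)" for M
  by (rule cInf_lower[OF _ lb]) (use that in \<open>simp add: X_def\<close>)
 show ?thesis using that[OF 1 2 3] by blast
qed

lemma grad_cmult: assumes "grad S f f1 f2" shows "grad S (%p. c * f p) (%p. c * f1 p) (%p. c * f2 p)"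
 using grad_linear_combination[OF assms, of c 0 0 0] by simp

lemma grad_add:
 assumes "grad S f f1 f2" "grad S g g1 g2" shows "grad S (%p. f p + g p) (%p. f1 p + g1 p) (%p. f2 p + g2 p)"
 unfolding grad_def
proof
 fix p assume p: "p \<in> S"
 show "((%p. f p + g p) has_derivative (%h. fst h * (f1 p + g1 p) + snd h * (f2 p + g2 p))) (at p within S)"
  by (rule has_derivative_eq_rhs[OF has_derivative_add[OF bspec[OF assms(1)[unfolded grad_def] p] bspec[OF assms(2)[unfolded grad_def] p]]])
   (simp add: fun_eq_iff algebra_simps)
qed

lemma jet_cmult: "jet S J ==> jet S (%i p. c * J i p)"
 unfolding jet_def by (simp add: grad_cmult)

lemma jet_add: "jet S J ==> jet S G ==> jet S (%i p. J i p + G i p)"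
 unfolding jet_def by (simp add: grad_add)

lemma jet_diff: assumes "jet S J" "jet S G" shows "jet S (%i p. J i p - G i p)"
 using jet_add[OF assms(1) jet_cmult[OF assms(2), of "-1"]] by simp

text \<open>The unspecified \<open>K\<close> only makes the best Hoelder constant finite. The single
  number \<open>G\<close> measures all data: the right-hand side, the sup of the solution, and the
  tangential second derivatives on the edges.\<close>

definition schauder_setting where
 "schauder_setting al \<mu> \<Lambda> Ka G R J A f \<longleftrightarrow> jet (strip R) J \<and> (\<exists>K. \<forall>i\<in>{3,4,5}. hol (strip R) al K (J i)) \<and>
   (\<forall>p\<in>strip R. \<mu> <= A p \<and> A p <= \<Lambda>) \<and> hol (strip R) al Ka A \<and>
   (\<forall>p\<in>strip R. A p * J 3 p + 2 * J 5 p = f p) \<and> hol (strip R) al G f \<and>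
   (\<forall>p\<in>strip R. \<bar>J 0 p\<bar> <= G) \<and>
   (\<forall>s\<in>{R,-R}. \<forall>x x'. \<bar>J (3::nat) (x, s) - J 3 (x', s)\<bar> <= G * \<bar>x - x'\<bar> powr al)"

text \<open>If no constant works, there are best Hoelder constants \<open>N\<close> above
  \<open>(n + 1) * G\<close>; dividing by \<open>N\<close> gives seminorm 1 with data at most
  \<open>1 / (n + 1)\<close>, and \<open>schauder_sequence\<close> applies. The constant is uniform
  in \<open>R >= R0\<close> because the gradient estimate enlarges the strip by scaling.\<close>

lemma schauder_estimate:
 assumes al: "0 < al" "al < 1" and mu: "0 < \<mu>" and R0: "0 < R0"
 shows "\<exists>C>0. \<forall>R J A f G. R \<ge> R0 --> schauder_setting al \<mu> \<Lambda> Ka G R J A f --> (\<forall>i\<in>{3,4,5}. hol (strip R) al (C * G) (J i))"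
proof (rule ccontr)
 assume neg: "\<not> ?thesis"
 define NC where "NC = (%e R J A f p q. R0 <= R \<and> schauder_setting al \<mu> \<Lambda> Ka e R J A f \<and> (\<forall>i\<in>{3,4,5}. hol (strip R) al 1 (J i))
  \<and> p \<in> strip R \<and> q \<in> strip R \<and> p \<noteq> q \<and> (1/2) * dist p q powr al <= (\<Sum>i\<in>{3,4,5}. \<bar>J i p - J i q\<bar>))"
 have "\<exists>R J A f p q. NC (1 / (real n + 1)) R J A f p q" for n
 proof -
  have "real n + 1 > 0" by simp
  then obtain R J A f G i0 where R: "R \<ge> R0" and S: "schauder_setting al \<mu> \<Lambda> Ka G R J A f"
   and i0: "i0 \<in> {3,4,5}" "\<not> hol (strip R) al ((real n + 1) * G) (J i0)" using neg by blast
  obtain K where K: "\<forall>i\<in>{3,4,5}. hol (strip R) al K (J i)" using S unfolding schauder_setting_def by blast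
  have "hol (strip R) al (max K 0) (J i)" if "i \<in> {3,4,5}" for i using K that by (meson hol_mono max.cobounded1)
  then obtain N where N: "N \<ge> 0" "!!i. i \<in> {3,4,5} ==> hol (strip R) al N (J i)"
   "!!M. M \<ge> 0 ==> (!!i. i \<in> {3,4,5} ==> hol (strip R) al M (J i)) ==> N <= M"
   using best_hoelder_constant[of "{3,4,5}" "strip R" al "max K 0" J] by (metis max.cobounded2)
  have "(0,0) \<in> strip R" using R R0 by (simp add: mem_strip)
  then have G0: "G \<ge> 0" using S unfolding schauder_setting_def by (meson abs_ge_zero order_trans)
  have NG: "N > (real n + 1) * G"
  proof (rule ccontr)
   assume "\<not> N > (real n + 1) * G"
   then have "hol (strip R) al ((real n + 1) * G) (J i0)" using hol_mono[OF N(2)[OF i0(1)]] by simp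
   then show False using i0 by simp
  qed
  have N0: "N > 0"
  proof -
   have "0 <= (real n + 1) * G" using G0 by simp
   then show ?thesis using NG by linarith
  qed
  have "\<not> (\<forall>i\<in>{3,4,5}. hol (strip R) al (N / 2) (J i))" using N(3)[of "N / 2"] N0 by force
  then obtain i1 p q where pq: "i1 \<in> {3,4,5}" "p \<in> strip R" "q \<in> strip R" "\<not> \<bar>J i1 p - J i1 q\<bar> <= N / 2 * dist p q powr al"
   unfolding hol_def by blast
  define J' where "J' = (%i p. (1 / N) * J i p)"
  define f' where "f' = (%p. (1 / N) * f p)"
  have GN: "(1 / N) * G <= 1 / (real n + 1)" using NG N0 by (simp add: field_simps)
  have sc: "\<bar>(1/N) * a - (1/N) * b\<bar> = (1/N) * \<bar>a - b\<bar>" for a b by (simp only: right_diff_distrib[symmetric] abs_mult) (use N0 in simp)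
  have "schauder_setting al \<mu> \<Lambda> Ka (1 / (real n + 1)) R J' A f'"
   unfolding schauder_setting_def
  proof (intro conjI)
   show "jet (strip R) J'" unfolding J'_def by (rule jet_cmult) (use S in \<open>simp add: schauder_setting_def\<close>)
   show "\<exists>K. \<forall>i\<in>{3, 4, 5}. hol (strip R) al K (J' i)" unfolding J'_def using hol_cmult N(2) by blast
   show "\<forall>p\<in>strip R. \<mu> <= A p \<and> A p <= \<Lambda>" "hol (strip R) al Ka A" using S unfolding schauder_setting_def by blast+
   show "\<forall>p\<in>strip R. A p * J' 3 p + 2 * J' 5 p = f' p"
   proof
    fix p assume "p \<in> strip R"
    then have "A p * J 3 p + 2 * J 5 p = f p" using S unfolding schauder_setting_def by blast
    then show "A p * J' 3 p + 2 * J' 5 p = f' p" unfolding J'_def f'_def by (metis (no_types, opaque_lifting) distrib_left mult.left_commute)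
   qed
   have "hol (strip R) al (\<bar>1/N\<bar> * G) f'" unfolding f'_def by (rule hol_cmult) (use S in \<open>simp add: schauder_setting_def\<close>)
   then show "hol (strip R) al (1 / (real n + 1)) f'" by (rule hol_mono) (use GN N0 in simp)
   show "\<forall>p\<in>strip R. \<bar>J' 0 p\<bar> <= 1 / (real n + 1)"
   proof
    fix p assume "p \<in> strip R"
    then have "\<bar>J 0 p\<bar> <= G" using S unfolding schauder_setting_def by blast
    then have "(1 / N) * \<bar>J 0 p\<bar> <= (1 / N) * G" using N0 by (intro mult_left_mono) auto
    moreover have "\<bar>J' 0 p\<bar> = (1 / N) * \<bar>J 0 p\<bar>" unfolding J'_def using N0 by (simp add: abs_mult)
    ultimately show "\<bar>J' 0 p\<bar> <= 1 / (real n + 1)" using GN by linarith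
   qed
   show "\<forall>s\<in>{R, - R}. \<forall>x x'. \<bar>J' 3 (x, s) - J' 3 (x', s)\<bar> <= 1 / (real n + 1) * \<bar>x - x'\<bar> powr al"
   proof (intro ballI allI)
    fix s x x' assume "s \<in> {R, - R}"
    then have "\<bar>J 3 (x, s) - J 3 (x', s)\<bar> <= G * \<bar>x - x'\<bar> powr al" using S unfolding schauder_setting_def by blast
    then have "(1 / N) * \<bar>J 3 (x, s) - J 3 (x', s)\<bar> <= (1 / N) * (G * \<bar>x - x'\<bar> powr al)" using N0 by (intro mult_left_mono) auto
    also have "\<dots> <= 1 / (real n + 1) * \<bar>x - x'\<bar> powr al"
     using mult_right_mono[OF GN, of "\<bar>x - x'\<bar> powr al"] by (simp add: mult.assoc)
    finally show "\<bar>J' 3 (x, s) - J' 3 (x', s)\<bar> <= 1 / (real n + 1) * \<bar>x - x'\<bar> powr al" unfolding J'_def sc .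
   qed
  qed
  moreover have "hol (strip R) al 1 (J' i)" if "i \<in> {3,4,5}" for i
   using hol_cmult[OF N(2)[OF that], of "1 / N"] N0 unfolding J'_def by simp
  moreover have "p \<noteq> q" using pq(4) by auto
  moreover have "(1/2) * dist p q powr al <= (\<Sum>i\<in>{3,4,5}. \<bar>J' i p - J' i q\<bar>)"
  proof -
   have "(1/N) * (N / 2 * dist p q powr al) <= (1/N) * \<bar>J i1 p - J i1 q\<bar>" using pq(4) N0 by (intro mult_left_mono) auto
   then have "(1/2) * dist p q powr al <= \<bar>J' i1 p - J' i1 q\<bar>" unfolding J'_def sc using N0 by simp
   also have "\<dots> <= (\<Sum>i\<in>{3,4,5}. \<bar>J' i p - J' i q\<bar>)" using pq(1) by (intro member_le_sum) auto
   finally show ?thesis .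
  qed
  ultimately have "NC (1 / (real n + 1)) R J' A f' p q" unfolding NC_def using R pq(2,3) by blast
  then show ?thesis by blast
 qed
 then obtain R J A f p q where NC: "!!n. NC (1 / (real n + 1)) (R n) (J n) (A n) (f n) (p n) (q n)" by metis
 have lim: "(%n. 1 / (real n + 1)) \<longlonglongrightarrow> 0" using LIMSEQ_inverse_real_of_nat by (simp add: inverse_eq_divide add.commute)
 have SS: "schauder_setting al \<mu> \<Lambda> Ka (1 / (real n + 1)) (R n) (J n) (A n) (f n)" for n using NC[of n] unfolding NC_def by blast
 show False
 proof (rule schauder_sequence[where R=R and J=J and A=A and f=f and p=p and q=q and \<epsilon>="%n. 1 / (real n + 1)", OF al mu R0])
  show "R0 <= R n" for n using NC[of n] unfolding NC_def by blast
  show "jet (strip (R n)) (J n)" for n using SS[of n] unfolding schauder_setting_def by blast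
  show "hol (strip (R n)) al 1 (J n i)" if "i \<in> {3,4,5}" for n i using NC[of n] that unfolding NC_def by blast
  show "\<mu> <= A n p \<and> A n p <= \<Lambda>" if "p \<in> strip (R n)" for n p using SS[of n] that unfolding schauder_setting_def by blast
  show "hol (strip (R n)) al Ka (A n)" for n using SS[of n] unfolding schauder_setting_def by blast
  show "A n p * J n 3 p + 2 * J n 5 p = f n p" if "p \<in> strip (R n)" for n p using SS[of n] that unfolding schauder_setting_def by blast
  show "hol (strip (R n)) al (1 / (real n + 1)) (f n)" for n using SS[of n] unfolding schauder_setting_def by blast
  show "\<bar>J n 0 p\<bar> <= 1 / (real n + 1)" if "p \<in> strip (R n)" for n p using SS[of n] that unfolding schauder_setting_def by blast
  show "\<bar>J n 3 (x, s) - J n 3 (x', s)\<bar> <= 1 / (real n + 1) * \<bar>x - x'\<bar> powr al" if "s \<in> {R n, - R n}" for n x x' s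
   using SS[of n] that unfolding schauder_setting_def by blast
  show "p n \<in> strip (R n)" "q n \<in> strip (R n)" "p n \<noteq> q n" "(1/2) * dist (p n) (q n) powr al <= (\<Sum>i\<in>{3,4,5}. \<bar>J n i (p n) - J n i (q n)\<bar>)" for n
   using NC[of n] unfolding NC_def by blast+
 qed (use lim in simp_all)
qed

text \<open>Interpolation with the fixed step \<open>R0 / 2\<close> recovers all lower order norms
  from the seminorm of the second derivatives and the sup norm.\<close>

lemma schauder_full:
 assumes al: "0 < al" "al < 1" and mu: "0 < \<mu>" and R0: "0 < R0"
 shows "\<exists>C>0. \<forall>R J A f G. R \<ge> R0 --> schauder_setting al \<mu> \<Lambda> Ka G R J A f --> (\<forall>i\<le>5. hb (strip R) al (C * G) (J i))"
proof -
 obtain C where C: "C > 0" "!!R J A f G i. R \<ge> R0 ==> schauder_setting al \<mu> \<Lambda> Ka G R J A f ==> i \<in> {3,4,5} ==> hol (strip R) al (C * G) (J i)"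
  using schauder_estimate[OF al mu R0, of \<Lambda> Ka] by blast
 define r where "r = R0 / 2"
 have r: "r > 0" using R0 unfolding r_def by simp
 define c2 where "c2 = 2 * (4 / r\<^sup>2 + 4 * C * (4 * r) powr al)"
 define c1 where "c1 = 2 / r + 2 * c2 * r"
 define B where "B = c1 + c2 + 1"
 have c20: "c2 \<ge> 0" unfolding c2_def using r C(1) by simp
 have c10: "c1 \<ge> 0" unfolding c1_def using r c20 by simp
 have "hb (strip R) al ((4 * B + C) * G) (J i)" if R: "R \<ge> R0" and S: "schauder_setting al \<mu> \<Lambda> Ka G R J A f" and i: "i <= 5" for R J A f G i
 proof -
  have J: "jet (strip R) J" and J0: "!!p. p \<in> strip R ==> \<bar>J 0 p\<bar> <= G" using S unfolding schauder_setting_def by blast+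
  have "(0,0) \<in> strip R" using R R0 by (simp add: mem_strip)
  from J0[OF this] have G0: "G \<ge> 0" by linarith
  have CG: "C * G \<ge> 0" using C(1) G0 by simp
  have rR: "2 * r <= R" "r <= R" using R R0 unfolding r_def by auto
  have b2: "\<bar>J i p\<bar> <= c2 * G" if "i \<in> {3,4,5}" "p \<in> strip R" for i p
  proof -
   have "\<bar>J i p\<bar> <= 2 * (4 * G / r\<^sup>2 + 4 * (C * G) * (4 * r) powr al)"
    by (rule jet_interpolation2[OF J r rR(1) that(2) J0 C(2)[OF R S] al(1) CG that(1)])
   also have "\<dots> = c2 * G" unfolding c2_def by (simp add: algebra_simps)
   finally show ?thesis .
  qed
  have b1: "\<bar>J i p\<bar> <= c1 * G" if "i \<in> {1,2}" "p \<in> strip R" for i p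
  proof -
   have "\<bar>J i p\<bar> <= 2 * G / r + 2 * (c2 * G) * r"
    by (rule jet_interpolation1[OF J r rR(2) that(2) J0 b2 that(1)])
   also have "\<dots> = c1 * G" unfolding c1_def by (simp add: algebra_simps)
   finally show ?thesis .
  qed
  have mB: "c1 * G <= B * G" "c2 * G <= B * G" "1 * G <= B * G"
   unfolding B_def using c10 c20 by (intro mult_right_mono G0; linarith)+
  have b: "\<bar>J i p\<bar> <= B * G" if i: "i <= 5" and p: "p \<in> strip R" for i p
  proof -
   consider "i = 0" | "i \<in> {1,2}" | "i \<in> {3,4,5}" using i by fastforce
   then show ?thesis
   proof cases
    case 1 then show ?thesis using J0[OF p] mB(3) by simp
   next
    case 2 then show ?thesis using b1[OF 2 p] mB(1) by linarith
   next
    case 3 then show ?thesis using b2[OF 3 p] mB(2) by linarith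
   qed
  qed
  have BG: "B * G \<ge> 0" using mB(3) G0 by linarith
  have "hb (strip R) al (4 * (B * G) + C * G) (J i)"
   by (rule hb_jet[OF J al(1) _ b C(2)[OF R S] BG CG i]) (use al in simp)
  then show ?thesis by (simp add: algebra_simps)
 qed
 moreover have "4 * B + C > 0" unfolding B_def using C(1) c10 c20 by simp
 ultimately show ?thesis by blast
qed

subsection \<open>Periodic functions and the maximum principle\<close>

definition per :: "real => real => (real \<times> real => real) => bool" where
 "per R P f \<longleftrightarrow> (\<forall>p\<in>strip R. f (p + (P, 0)) = f p)"

lemma strip_shift [simp]: "p + (s, 0) \<in> strip R \<longleftrightarrow> p \<in> strip R"
 by (simp add: mem_strip)

lemma add_zero_pair [simp]: "(p::real\<times>real) + (0, 0) = p"
 by (simp add: zero_prod_def[symmetric])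

lemma perD: "per R P f ==> p \<in> strip R ==> f (p + (P, 0)) = f p"
 unfolding per_def by blast

lemma per_nat: assumes "per R P f" "p \<in> strip R" shows "f (p + (real n * P, 0)) = f p"
proof (induction n)
 case 0 show ?case by (simp add: zero_prod_def[symmetric])
next
 case (Suc n)
 have "f (p + (real (Suc n) * P, 0)) = f ((p + (real n * P, 0)) + (P, 0))" by (simp add: algebra_simps)
 also have "\<dots> = f (p + (real n * P, 0))" by (rule perD[OF assms(1)]) (simp add: assms(2))
 finally show ?case using Suc by simp
qed

lemma per_int: assumes "per R P f" "p \<in> strip R" shows "f (p + (real_of_int n * P, 0)) = f p"
proof (cases "n \<ge> 0")
 case True
 then show ?thesis using per_nat[OF assms, of "nat n"] by simp
next
 case False
 have "f ((p + (real_of_int n * P, 0)) + (real (nat (- n)) * P, 0)) = f (p + (real_of_int n * P, 0))"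
  by (rule per_nat[OF assms(1)]) (simp add: assms(2))
 moreover have "(p + (real_of_int n * P, 0)) + (real (nat (- n)) * P, 0) = p" using False by (simp add: prod_eq_iff)
 ultimately show ?thesis by simp
qed

lemma per_reduce:
 assumes "per R P f" "P > 0" "(x, y) \<in> strip R" obtains x' where "x' \<in> {c..c + P}" "f (x', y) = f (x, y)"
proof -
 define n where "n = \<lfloor>(x - c) / P\<rfloor>"
 have 1: "real_of_int n <= (x - c) / P" "(x - c) / P < real_of_int n + 1" unfolding n_def by linarith+
 then have 2: "real_of_int n * P <= x - c" "x - c < (real_of_int n + 1) * P" using assms(2) by (simp_all add: field_simps)
 have "f ((x, y) + (real_of_int (- n) * P, 0)) = f (x, y)" by (rule per_int[OF assms(1,3)])
 then have "f (x - real_of_int n * P, y) = f (x, y)" by simp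
 moreover have "x - real_of_int n * P \<in> {c..c + P}" using 2 by (simp add: algebra_simps)
 ultimately show ?thesis using that by blast
qed

lemma per_grad:
 assumes R: "R > 0" and g: "grad (strip R) f f1 f2" and p: "per R P f"
 shows "per R P f1" "per R P f2"
proof -
 have "grad {z. (P,0) + 1 *\<^sub>R z \<in> strip R} (%z. f ((P,0) + 1 *\<^sub>R z)) (%z. 1 * f1 ((P,0) + 1 *\<^sub>R z)) (%z. 1 * f2 ((P,0) + 1 *\<^sub>R z))"
  by (rule grad_affine[OF g])
 moreover have "{z. (P,0) + 1 *\<^sub>R z \<in> strip R} = strip R" by (simp add: mem_strip set_eq_iff)
 ultimately have g': "grad (strip R) (%z. f (z + (P,0))) (%z. f1 (z + (P,0))) (%z. f2 (z + (P,0)))" by (simp add: add.commute)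
 have e: "f (z + (P,0)) = f z" if "z \<in> strip R" for z by (rule perD[OF p that])
 show "per R P f1" "per R P f2" unfolding per_def
  using grad_unique(1)[OF R g' g e] grad_unique(2)[OF R g' g e] by blast+
qed

lemma per_jet:
 assumes R: "R > 0" and J: "jet (strip R) J" and p: "per R P (J 0)" and i: "i <= 5"
 shows "per R P (J i)"
proof -
 have g: "grad (strip R) (J 0) (J 1) (J 2)" "grad (strip R) (J 1) (J 3) (J 4)" "grad (strip R) (J 2) (J 4) (J 5)"
  using J unfolding jet_def by auto
 note 1 = per_grad[OF R g(1) p]
 note 2 = per_grad[OF R g(2) 1(1)]
 note 3 = per_grad[OF R g(3) 1(2)]
 have "i = 0 \<or> i = 1 \<or> i = 2 \<or> i = 3 \<or> i = 4 \<or> i = 5" using i by linarith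
 then show ?thesis using p 1 2 3 by blast
qed

section \<open>The maximum principle\<close>

lemma second_derivative_max:
 fixes \<phi> :: "real => real"
 assumes d: "d > 0" and D: "!!t. \<bar>t\<bar> < d ==> (\<phi> has_real_derivative \<phi>' t) (at t)"
  and D2: "(\<phi>' has_real_derivative c) (at 0)" and m: "!!t. \<bar>t\<bar> < d ==> \<phi> t <= \<phi> 0"
 shows "\<phi>' 0 = 0" "c <= 0"
proof -
 show z: "\<phi>' 0 = 0"
  by (rule DERIV_local_max[OF D[of 0] d]) (use d m in \<open>auto simp: abs_minus_commute\<close>)
 show "c <= 0"
 proof (rule ccontr)
  assume "\<not> c <= 0"
  then obtain e where e: "e > 0" "!!h. h > 0 ==> h < e ==> \<phi>' 0 < \<phi>' (0 + h)"
   using DERIV_pos_inc_right[OF D2] by force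
  define s where "s = min (d/2) (e/2)"
  have s: "s > 0" "s < d" "s < e" using d e(1) unfolding s_def by auto
  have "\<exists>z>0. z < s \<and> \<phi> s - \<phi> 0 = (s - 0) * \<phi>' z"
   by (rule MVT2[OF s(1)]) (use D s in auto)
  then obtain w where w: "w > 0" "w < s" "\<phi> s - \<phi> 0 = (s - 0) * \<phi>' w" by blast
  have "\<phi>' w > 0" using e(2)[of w] w s z by simp
  then have "(s - 0) * \<phi>' w > 0" using s by simp
  then show False using w m[of s] s by simp
 qed
qed

text \<open>Periodicity reduces the maximum to a compact rectangle; away from the edges the second
  derivative test is applied separately along the two axes.\<close>

lemma strip_max:
 assumes R: "R > 0" and P: "P > 0" and J: "jet (strip R) J" and per: "per R P (J 0)"
 obtains p where "p \<in> strip R" "!!q. q \<in> strip R ==> J 0 q + \<kappa> * (snd q)\<^sup>2 <= J 0 p + \<kappa> * (snd p)\<^sup>2"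
  "\<bar>snd p\<bar> = R \<or> (J 1 p = 0 \<and> J 3 p <= 0 \<and> J 5 p + 2 * \<kappa> <= 0)"
proof -
 have g: "grad (strip R) (J 0) (J 1) (J 2)" "grad (strip R) (J 1) (J 3) (J 4)" "grad (strip R) (J 2) (J 4) (J 5)"
  using J unfolding jet_def by auto
 define w where "w = (%q. J 0 q + \<kappa> * (snd q)\<^sup>2)"
 have sub: "cbox (0, -R) (P, R) \<subseteq> strip R" by (auto simp: mem_strip cbox_Pair_eq abs_le_iff)
 have "continuous_on (cbox (0, -R) (P, R)) w"
  unfolding w_def by (intro continuous_intros continuous_on_subset[OF grad_continuous[OF g(1)] sub])
 moreover have "cbox (0, -R) (P, R) \<noteq> {}" using R P by (simp add: cbox_Pair_eq)
 ultimately obtain p where p: "p \<in> cbox (0, -R) (P, R)" "!!q. q \<in> cbox (0, -R) (P, R) ==> w q <= w p"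
  using continuous_attains_sup[OF compact_cbox] by metis
 have pS: "p \<in> strip R" using p(1) sub by blast
 have mx: "w q <= w p" if q: "q \<in> strip R" for q
 proof -
  obtain x y where xy: "q = (x, y)" by (cases q)
  obtain x' where x': "x' \<in> {0..0 + P}" "J 0 (x', y) = J 0 (x, y)" using per_reduce[OF per P] q unfolding xy by metis
  have "(x', y) \<in> cbox (0, -R) (P, R)" using x'(1) q unfolding xy by (auto simp: cbox_Pair_eq mem_strip)
  from p(2)[OF this] show ?thesis unfolding w_def xy using x'(2) by simp
 qed
 have "J 1 p = 0 \<and> J 3 p <= 0 \<and> J 5 p + 2 * \<kappa> <= 0" if "\<bar>snd p\<bar> \<noteq> R"
 proof -
  define d where "d = R - \<bar>snd p\<bar>"
  have d: "d > 0" using that pS unfolding d_def by (simp add: mem_strip)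
  have mem1: "p + s *\<^sub>R (1, 0) \<in> strip R" for s using pS by (simp add: mem_strip)
  have mem2: "p + s *\<^sub>R (0, 1) \<in> strip R" if "s \<in> {-d<..<d}" for s using that unfolding d_def by (auto simp: mem_strip)
  have D1: "((%s. J i (p + s *\<^sub>R (1,0))) has_real_derivative J k (p + t *\<^sub>R (1,0))) (at t)"
   if "grad (strip R) (J i) (J k) (J l)" for i k l t
   using grad_line[OF that, of UNIV p "(1,0)" t] mem1 by simp
  have D2: "((%s. J i (p + s *\<^sub>R (0,1))) has_real_derivative J l (p + t *\<^sub>R (0,1))) (at t)"
   if "grad (strip R) (J i) (J k) (J l)" "\<bar>t\<bar> < d" for i k l t
  proof -
   have t: "t \<in> {-d<..<d}" using that(2) by auto
   have "((%s. J i (p + s *\<^sub>R (0,1))) has_real_derivative fst (0::real,1::real) * J k (p + t *\<^sub>R (0,1)) + snd (0::real,1::real) * J l (p + t *\<^sub>R (0,1))) (at t within {-d<..<d})"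
    by (rule grad_line[OF that(1) mem2 t])
   then show ?thesis unfolding at_within_open[OF t open_greaterThanLessThan] by simp
  qed
  have m1: "J 0 (p + t *\<^sub>R (1,0)) <= J 0 (p + 0 *\<^sub>R (1,0))" for t
   using mx[OF mem1[of t]] unfolding w_def by simp
  have a: "J 1 (p + 0 *\<^sub>R (1,0)) = 0" "J 3 (p + 0 *\<^sub>R (1,0)) <= 0"
   using second_derivative_max[OF zero_less_one, of "%t. J 0 (p + t *\<^sub>R (1,0))" "%t. J 1 (p + t *\<^sub>R (1,0))", OF D1[OF g(1)] D1[OF g(2)] m1] by blast+
  have m2: "J 0 (p + t *\<^sub>R (0,1)) + \<kappa> * (snd p + t)\<^sup>2 <= J 0 (p + 0 *\<^sub>R (0,1)) + \<kappa> * (snd p + 0)\<^sup>2" if "\<bar>t\<bar> < d" for t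
   using mx[OF mem2[of t]] that unfolding w_def abs_less_iff by simp
  have q: "((%t. \<kappa> * (snd p + t)\<^sup>2) has_real_derivative \<kappa> * (2 * (snd p + t))) (at t)" for t
   by (auto intro!: derivative_eq_intros)
  have q2: "((%t. \<kappa> * (2 * (snd p + t))) has_real_derivative 2 * \<kappa>) (at t)" for t
   by (auto intro!: derivative_eq_intros)
  have d0: "\<bar>0\<bar> < d" using d by simp
  have "J 5 (p + 0 *\<^sub>R (0,1)) + 2 * \<kappa> <= 0"
   by (rule second_derivative_max(2)[OF d, where \<phi>="%t. J 0 (p + t *\<^sub>R (0,1)) + \<kappa> * (snd p + t)\<^sup>2" and \<phi>'="%t. J 2 (p + t *\<^sub>R (0,1)) + \<kappa> * (2 * (snd p + t))"])
    (rule DERIV_add[OF D2[OF g(1)] q], assumption, rule DERIV_add[OF D2[OF g(3) d0] q2], rule m2)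
  then show ?thesis using a by simp
 qed
 then show ?thesis using that[OF pS] mx unfolding w_def by blast
qed

text \<open>The inequality is assumed only where \<open>J 1\<close> vanishes, so that a term
  quadratic in the \<open>x\<close> derivative may be present. The barrier
  \<open>\<kappa> * y^2\<close> with \<open>4 * \<kappa> > F\<close> excludes a maximum off the
  edges, since there \<open>A * J 3 + 2 * J 5 <= - 4 * \<kappa>\<close>.\<close>

lemma max_principle_upper:
 assumes R: "R > 0" and P: "P > 0" and J: "jet (strip R) J" and per: "per R P (J 0)"
  and A: "!!p. p \<in> strip R ==> A p \<ge> 0" and eq: "!!p. p \<in> strip R ==> J 1 p = 0 ==> - F <= A p * J 3 p + 2 * J 5 p"
  and bd: "!!x s. s \<in> {R, -R} ==> J 0 (x, s) <= G" and F: "F \<ge> 0" and p: "p \<in> strip R"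
 shows "J 0 p <= G + F * R\<^sup>2 / 4"
proof (rule field_le_epsilon)
 fix e :: real assume e: "e > 0"
 define \<kappa> where "\<kappa> = F / 4 + e / R\<^sup>2"
 have k: "4 * \<kappa> > F" "\<kappa> > 0" unfolding \<kappa>_def using e R F by (auto simp: add_nonneg_pos)
 obtain q where q: "q \<in> strip R" "!!q'. q' \<in> strip R ==> J 0 q' + \<kappa> * (snd q')\<^sup>2 <= J 0 q + \<kappa> * (snd q)\<^sup>2"
  "\<bar>snd q\<bar> = R \<or> (J 1 q = 0 \<and> J 3 q <= 0 \<and> J 5 q + 2 * \<kappa> <= 0)"
  using strip_max[OF R P J per] by metis
 have "\<bar>snd q\<bar> = R"
 proof (rule ccontr)
  assume "\<bar>snd q\<bar> \<noteq> R"
  then have c: "J 1 q = 0" "J 3 q <= 0" "J 5 q + 2 * \<kappa> <= 0" using q(3) by blast+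
  have "A q * J 3 q <= 0" using A[OF q(1)] c(2) by (rule mult_nonneg_nonpos)
  then show False using eq[OF q(1) c(1)] c(3) k by linarith
 qed
 then have "snd q \<in> {R, -R}" using R by (auto simp: abs_if split: if_splits)
 then have "J 0 q <= G" using bd[of "snd q" "fst q"] by simp
 moreover have "\<kappa> * (snd q)\<^sup>2 = F * R\<^sup>2 / 4 + e" using \<open>\<bar>snd q\<bar> = R\<close> R unfolding \<kappa>_def
  by (simp add: distrib_right flip: power2_abs[of "snd q"])
 moreover have "\<kappa> * (snd p)\<^sup>2 \<ge> 0" using k by simp
 ultimately show "J 0 p <= G + F * R\<^sup>2 / 4 + e" using q(2)[OF p] by linarith
qed

lemma max_principle:
 assumes R: "R > 0" and P: "P > 0" and J: "jet (strip R) J" and per: "per R P (J 0)"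
  and A: "!!p. p \<in> strip R ==> A p \<ge> 0" and eq: "!!p. p \<in> strip R ==> J 1 p = 0 ==> \<bar>A p * J 3 p + 2 * J 5 p\<bar> <= F"
  and bd: "!!x s. s \<in> {R, -R} ==> \<bar>J 0 (x, s)\<bar> <= G" and F: "F \<ge> 0" and p: "p \<in> strip R"
 shows "\<bar>J 0 p\<bar> <= G + F * R\<^sup>2 / 4"
proof -
 have "J 0 p <= G + F * R\<^sup>2 / 4"
 proof (rule max_principle_upper[OF R P J per A _ _ F p])
  show "- F <= A q * J 3 q + 2 * J 5 q" if "q \<in> strip R" "J 1 q = 0" for q using eq[OF that] by linarith
  show "J 0 (x, s) <= G" if "s \<in> {R, -R}" for x s using bd[OF that, of x] by linarith
 qed
 moreover have "- J 0 p <= G + F * R\<^sup>2 / 4"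
 proof -
  have "-1 * J 0 p <= G + F * R\<^sup>2 / 4"
  proof (rule max_principle_upper[where J="%i p. -1 * J i p", OF R P jet_cmult[OF J] _ A _ _ F p])
   show "per R P (%p. -1 * J 0 p)" using per unfolding per_def by simp
   show "- F <= A q * (-1 * J 3 q) + 2 * (-1 * J 5 q)" if "q \<in> strip R" "-1 * J 1 q = 0" for q using eq[of q] that by (simp add: abs_le_iff)
   show "-1 * J 0 (x, s) <= G" if "s \<in> {R, -R}" for x s using bd[OF that, of x] by linarith
  qed
  then show ?thesis by simp
 qed
 ultimately show ?thesis by linarith
qed

subsection \<open>The linear Dirichlet problem\<close>

definition solves_linear where
 "solves_linear R P al A f J \<longleftrightarrow> jet (strip R) J \<and> (\<exists>K. \<forall>i\<le>5. hb (strip R) al K (J i)) \<and> per R P (J 0) \<and>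
  (\<forall>p\<in>strip R. A p * J (3::nat) p + 2 * J 5 p = f p) \<and> (\<forall>x. J 0 (x, R) = 0 \<and> J 0 (x, -R) = 0)"

lemma boundary_derivative:
 assumes g: "grad (strip R) f f1 f2" and R: "R > 0" and s: "s \<in> {R, -R}" and f: "!!x. f (x, s) = g x" and g': "(g has_real_derivative g') (at x)"
 shows "f1 (x, s) = g'"
proof -
 have "((%t. f ((0, s) + t *\<^sub>R (1, 0))) has_real_derivative fst (1::real,0::real) * f1 ((0, s) + x *\<^sub>R (1, 0)) + snd (1::real,0::real) * f2 ((0, s) + x *\<^sub>R (1, 0))) (at x within UNIV)"
  by (rule grad_line[OF g]) (use s R in \<open>auto simp: mem_strip\<close>)
 then have "(g has_real_derivative f1 (x, s)) (at x)" using f by simp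
 then show ?thesis using g' DERIV_unique by blast
qed

text \<open>The maximum principle bounds the sup norm in the Schauder data by
  \<open>G * R^2 / 4\<close>, and the zero boundary values make \<open>J 3\<close> vanish on the
  edges, so the right-hand side alone controls the solution.\<close>

lemma linear_estimate:
 assumes R: "R > 0" and P: "P > 0" and al: "0 < al" "al < 1" and mu: "0 < \<mu>"
 shows "\<exists>C>0. \<forall>A f J G. (\<forall>p\<in>strip R. \<mu> <= A p \<and> A p <= \<Lambda>) --> hol (strip R) al Ka A --> hb (strip R) al G f --> solves_linear R P al A f J
  --> (\<forall>i\<le>5. hb (strip R) al (C * G) (J i))"
proof -
 obtain C where C: "C > 0" "!!J A f G i. schauder_setting al \<mu> \<Lambda> Ka G R J A f ==> i <= 5 ==> hb (strip R) al (C * G) (J i)"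
  using schauder_full[OF al mu R, of \<Lambda> Ka] by blast
 define c where "c = 1 + R\<^sup>2 / 4"
 have "hb (strip R) al ((C * c) * G) (J i)" if A: "\<forall>p\<in>strip R. \<mu> <= A p \<and> A p <= \<Lambda>" "hol (strip R) al Ka A" and f: "hb (strip R) al G f" and S: "solves_linear R P al A f J" and i: "i <= 5" for A f J G i
 proof -
  have J: "jet (strip R) J" "per R P (J 0)" and bd: "!!x s. s \<in> {R,-R} ==> J 0 (x, s) = 0"
   and eq: "!!p. p \<in> strip R ==> A p * J 3 p + 2 * J 5 p = f p" using S unfolding solves_linear_def by auto
  have g: "grad (strip R) (J 0) (J 1) (J 2)" "grad (strip R) (J 1) (J 3) (J 4)" using J unfolding jet_def by auto
  have "(0,0) \<in> strip R" using R by (simp add: mem_strip)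
  then have G0: "G \<ge> 0" using f unfolding hb_def by (meson abs_ge_zero order_trans)
  have J0: "\<bar>J 0 p\<bar> <= 0 + G * R\<^sup>2 / 4" if "p \<in> strip R" for p
  proof (rule max_principle[OF R P J _ _ _ G0 that])
   show "A q \<ge> 0" if "q \<in> strip R" for q using A(1) that mu by (meson less_imp_le order_trans)
   show "\<bar>A q * J 3 q + 2 * J 5 q\<bar> <= G" if "q \<in> strip R" for q unfolding eq[OF that] using f that unfolding hb_def by blast
  qed (simp add: bd)
  have J1: "J 1 (x, s) = 0" if "s \<in> {R,-R}" for x s
   by (rule boundary_derivative[OF g(1) R that bd[OF that]]) simp
  have J3: "J 3 (x, s) = 0" if "s \<in> {R,-R}" for x s
   by (rule boundary_derivative[OF g(2) R that J1[OF that]]) simp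
  have cG: "G <= c * G" "G * R\<^sup>2 / 4 <= c * G" "0 <= c * G" using G0 unfolding c_def by (auto simp: algebra_simps)
  have "schauder_setting al \<mu> \<Lambda> Ka (c * G) R J A f"
   unfolding schauder_setting_def
  proof (intro conjI)
   show "\<exists>K. \<forall>i\<in>{3, 4, 5}. hol (strip R) al K (J i)"
   proof -
    obtain K where "\<forall>i\<le>5. hb (strip R) al K (J i)" using S unfolding solves_linear_def by blast
    then show ?thesis unfolding hb_def by (intro exI[of _ K]) simp
   qed
   show "hol (strip R) al (c * G) f" using f cG(1) unfolding hb_def by (blast intro: hol_mono)
   show "\<forall>p\<in>strip R. \<bar>J 0 p\<bar> <= c * G" using J0 cG(2) by force
   show "\<forall>s\<in>{R, - R}. \<forall>x x'. \<bar>J 3 (x, s) - J 3 (x', s)\<bar> <= c * G * \<bar>x - x'\<bar> powr al" using J3 cG(3) by simp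
  qed (use J A eq in blast)+
  from C(2)[OF this i] show ?thesis by (simp add: algebra_simps)
 qed
 moreover have "C * c > 0" using C(1) unfolding c_def by (simp add: add_pos_nonneg)
 ultimately show ?thesis by blast
qed

section \<open>Constant coefficients: separated solutions\<close>

lemma grad_snd:
 assumes "!!y. y \<in> {-R..R} ==> (a has_real_derivative a' y) (at y within {-R..R})"
 shows "grad (strip R) (%p. a (snd p)) (%_. 0) (%p. a' (snd p))"
 unfolding grad_def
proof
 fix p assume p: "p \<in> strip R"
 have sub: "snd ` strip R \<subseteq> {-R..R}" by (auto simp: mem_strip abs_le_iff)
 have "(a has_derivative (*) (a' (snd p))) (at (snd p) within {-R..R})"
  using assms[of "snd p"] p sub unfolding has_field_derivative_def by auto
 from has_derivative_in_compose[OF has_derivative_snd[OF has_derivative_ident] has_derivative_subset[OF this sub]]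
 show "((%p. a (snd p)) has_derivative (%h. fst h * 0 + snd h * a' (snd p))) (at p within strip R)"
  by (rule has_derivative_eq_rhs) (simp add: fun_eq_iff mult.commute)
qed

lemma grad_fst:
 assumes "!!x. (a has_real_derivative a' x) (at x)"
 shows "grad S (%p. a (fst p)) (%p. a' (fst p)) (%_. 0)"
 unfolding grad_def
proof
 fix p assume p: "p \<in> S"
 have "(a has_derivative (*) (a' (fst p))) (at (fst p))" using assms unfolding has_field_derivative_def by blast
 from has_derivative_in_compose[OF has_derivative_fst[OF has_derivative_ident] has_derivative_subset[OF this subset_UNIV]]
 show "((%p. a (fst p)) has_derivative (%h. fst h * a' (fst p) + snd h * 0)) (at p within S)"
  by (rule has_derivative_eq_rhs) (simp add: fun_eq_iff mult.commute)
qed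

lemma grad_mult:
 assumes "grad S f f1 f2" "grad S g g1 g2"
 shows "grad S (%p. f p * g p) (%p. f p * g1 p + f1 p * g p) (%p. f p * g2 p + f2 p * g p)"
 unfolding grad_def
proof
 fix p assume p: "p \<in> S"
 show "((%p. f p * g p) has_derivative (%h. fst h * (f p * g1 p + f1 p * g p) + snd h * (f p * g2 p + f2 p * g p))) (at p within S)"
  by (rule has_derivative_eq_rhs[OF has_derivative_mult[OF bspec[OF assms(1)[unfolded grad_def] p] bspec[OF assms(2)[unfolded grad_def] p]]])
   (simp add: fun_eq_iff algebra_simps)
qed

lemma grad_product:
 assumes "!!y. y \<in> {-R..R} ==> (a has_real_derivative a' y) (at y within {-R..R})" "!!x. (T has_real_derivative T' x) (at x)"
 shows "grad (strip R) (%p. a (snd p) * T (fst p)) (%p. a (snd p) * T' (fst p)) (%p. a' (snd p) * T (fst p))"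
 using grad_mult[OF grad_snd[OF assms(1)] grad_fst[OF assms(2)]] by simp

text \<open>Variation of constants from the left end, that is, \<open>1 / \<kappa>\<close> times the
  integral of \<open>sinh (\<kappa> * (y - s)) * g s\<close>, corrected by a multiple of
  \<open>sinh (\<kappa> * (y + R))\<close>, which vanishes at \<open>-R\<close>. Splitting
  \<open>sinh\<close> into exponentials lets the fundamental theorem of calculus act on each
  integral.\<close>

lemma ode_dirichlet:
 fixes g :: "real => real"
 assumes R: "R > 0" and g: "continuous_on {-R..R} g" and k: "\<kappa> \<ge> 0"
 shows "\<exists>w w1. (\<forall>y\<in>{-R..R}. (w has_real_derivative w1 y) (at y within {-R..R})) \<and>
  (\<forall>y\<in>{-R..R}. (w1 has_real_derivative \<kappa>\<^sup>2 * w y + g y) (at y within {-R..R})) \<and> w R = 0 \<and> w (-R) = 0"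
proof -
 let ?I = "{-R..R}"
 have FTC: "((%x. integral {-R..x} h) has_real_derivative h t) (at t within ?I)" if "continuous_on ?I h" "t \<in> ?I" for h t
  by (rule integral_has_real_derivative[OF that])
 show ?thesis
 proof (cases "\<kappa> = 0")
  case True
  define G1 where "G1 = (%y. integral {-R..y} g)"
  have d1: "(G1 has_real_derivative g t) (at t within ?I)" if "t \<in> ?I" for t unfolding G1_def by (rule FTC[OF g that])
  have c1: "continuous_on ?I G1" by (rule DERIV_continuous_on[OF d1])
  define G2 where "G2 = (%y. integral {-R..y} G1)"
  have d2: "(G2 has_real_derivative G1 t) (at t within ?I)" if "t \<in> ?I" for t unfolding G2_def by (rule FTC[OF c1 that])
  define c where "c = G2 R / (2 * R)"
  have a: "((%y. G2 y - c * (y + R)) has_real_derivative G1 y - c) (at y within ?I)" if "y \<in> ?I" for y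
   by (rule DERIV_cong[OF DERIV_diff[OF d2[OF that] DERIV_cmult[OF DERIV_add[OF DERIV_ident DERIV_const]]]]) simp
  have b: "((%y. G1 y - c) has_real_derivative \<kappa>\<^sup>2 * (G2 y - c * (y + R)) + g y) (at y within ?I)" if "y \<in> ?I" for y
   by (rule DERIV_cong[OF DERIV_diff[OF d1[OF that] DERIV_const]]) (simp add: True)
  have c1: "G2 R - c * (R + R) = 0" unfolding c_def using R by simp
  have c2: "G2 (-R) - c * (-R + R) = 0" unfolding G2_def by simp
  show ?thesis
   by (rule exI[of _ "%y. G2 y - c * (y + R)"], rule exI[of _ "%y. G1 y - c"]) (intro conjI ballI a b c1 c2)
 next
  case False
  then have k0: "\<kappa> > 0" using k by simp
  define E1 where "E1 = (%y. integral {-R..y} (%s. exp (- \<kappa> * s) * g s))"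
  define E2 where "E2 = (%y. integral {-R..y} (%s. exp (\<kappa> * s) * g s))"
  have d1: "(E1 has_real_derivative exp (- \<kappa> * t) * g t) (at t within ?I)" if "t \<in> ?I" for t
   unfolding E1_def by (rule FTC[OF _ that]) (intro continuous_intros g)
  have d2: "(E2 has_real_derivative exp (\<kappa> * t) * g t) (at t within ?I)" if "t \<in> ?I" for t
   unfolding E2_def by (rule FTC[OF _ that]) (intro continuous_intros g)
  have ex: "((%y. exp (c * y)) has_real_derivative c * exp (c * y)) (at y within ?I)" for c y :: real
   by (auto intro!: derivative_eq_intros)
  have inv: "exp (\<kappa> * y) * exp (- \<kappa> * y) = 1" for y by (simp add: exp_add[symmetric])
  define wp where "wp = (%y. (1 / (2 * \<kappa>)) * (exp (\<kappa> * y) * E1 y - exp (- \<kappa> * y) * E2 y))"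
  define wp1 where "wp1 = (%y. (1 / 2) * (exp (\<kappa> * y) * E1 y + exp (- \<kappa> * y) * E2 y))"
  have w1: "(wp has_real_derivative wp1 y) (at y within ?I)" if y: "y \<in> ?I" for y
  proof -
   have "(wp has_real_derivative (1 / (2 * \<kappa>)) * ((\<kappa> * exp (\<kappa> * y) * E1 y + exp (- \<kappa> * y) * g y * exp (\<kappa> * y)) - (- \<kappa> * exp (- \<kappa> * y) * E2 y + exp (\<kappa> * y) * g y * exp (- \<kappa> * y)))) (at y within ?I)"
    unfolding wp_def by (intro DERIV_cmult DERIV_diff DERIV_mult ex d1[OF y] d2[OF y])
   then show ?thesis by (rule DERIV_cong) (use k0 in \<open>simp add: wp1_def field_simps\<close>)
  qed
  have w2: "(wp1 has_real_derivative \<kappa>\<^sup>2 * wp y + g y) (at y within ?I)" if y: "y \<in> ?I" for y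
  proof -
   have "(wp1 has_real_derivative (1 / 2) * ((\<kappa> * exp (\<kappa> * y) * E1 y + exp (- \<kappa> * y) * g y * exp (\<kappa> * y)) + (- \<kappa> * exp (- \<kappa> * y) * E2 y + exp (\<kappa> * y) * g y * exp (- \<kappa> * y)))) (at y within ?I)"
    unfolding wp1_def by (intro DERIV_cmult DERIV_add DERIV_mult ex d1[OF y] d2[OF y])
   moreover have "exp (- \<kappa> * y) * g y * exp (\<kappa> * y) = g y" "exp (\<kappa> * y) * g y * exp (- \<kappa> * y) = g y"
    using inv[of y] by (metis mult.commute mult.left_commute mult_1_right)+
   ultimately show ?thesis
    by (elim DERIV_cong) (use k0 in \<open>simp add: wp_def field_simps power2_eq_square\<close>)
  qed
  define s where "s = (%y. sinh (\<kappa> * (y + R)))"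
  define s1 where "s1 = (%y. \<kappa> * cosh (\<kappa> * (y + R)))"
  have ds: "(s has_real_derivative s1 y) (at y within ?I)" for y
   unfolding s_def s1_def by (auto intro!: derivative_eq_intros)
  have ds1: "(s1 has_real_derivative \<kappa>\<^sup>2 * s y) (at y within ?I)" for y
   unfolding s_def s1_def by (auto intro!: derivative_eq_intros simp: power2_eq_square)
  have sR: "s R > 0" unfolding s_def using k0 R by simp
  define c where "c = wp R / s R"
  have a: "((%y. wp y - c * s y) has_real_derivative wp1 y - c * s1 y) (at y within ?I)" if "y \<in> ?I" for y
   by (intro DERIV_diff DERIV_cmult w1[OF that] ds)
  have b: "((%y. wp1 y - c * s1 y) has_real_derivative \<kappa>\<^sup>2 * (wp y - c * s y) + g y) (at y within ?I)" if "y \<in> ?I" for y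
   by (rule DERIV_cong[OF DERIV_diff[OF w2[OF that] DERIV_cmult[OF ds1]]]) (simp add: algebra_simps)
  have c1: "wp R - c * s R = 0" unfolding c_def using sR by simp
  have c2: "wp (-R) - c * s (-R) = 0" unfolding wp_def E1_def E2_def s_def by simp
  show ?thesis
   by (rule exI[of _ "%y. wp y - c * s y"], rule exI[of _ "%y. wp1 y - c * s1 y"]) (intro conjI ballI a b c1 c2)
 qed
qed

lemma hb_snd: assumes "hb {-R..R} al K a" "al > 0" "K \<ge> 0" shows "hb (strip R) al K (%p. a (snd p))"
 unfolding hb_def hol_def
proof (intro conjI ballI)
 have m: "snd p \<in> {-R..R}" if "p \<in> strip R" for p using that by (auto simp: mem_strip abs_le_iff)
 show "\<bar>a (snd p)\<bar> <= K" if "p \<in> strip R" for p using assms(1) m[OF that] unfolding hb_def by blast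
 fix p q assume pq: "p \<in> strip R" "q \<in> strip R"
 have "\<bar>a (snd p) - a (snd q)\<bar> <= K * dist (snd p) (snd q) powr al" using assms(1) m[OF pq(1)] m[OF pq(2)] unfolding hb_def hol_def by blast
 also have "\<dots> <= K * dist p q powr al" using assms(2,3) dist_snd_le[of p q] by (intro mult_left_mono powr_mono2) auto
 finally show "\<bar>a (snd p) - a (snd q)\<bar> <= K * dist p q powr al" .
qed

lemma hb_fst:
 fixes S :: "(real \<times> real) set"
 assumes "hb UNIV al K a" "al > 0" "K \<ge> 0" shows "hb S al K (%p. a (fst p))"
 unfolding hb_def hol_def
proof (intro conjI ballI)
 show "\<bar>a (fst p)\<bar> <= K" for p using assms(1) unfolding hb_def by blast
 fix p q :: "real \<times> real"
 have "\<bar>a (fst p) - a (fst q)\<bar> <= K * dist (fst p) (fst q) powr al" using assms(1) unfolding hb_def hol_def by blast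
 also have "\<dots> <= K * dist p q powr al" using assms(2,3) dist_fst_le[of p q] by (intro mult_left_mono powr_mono2) auto
 finally show "\<bar>a (fst p) - a (fst q)\<bar> <= K * dist p q powr al" .
qed

lemma real_lipschitz:
 fixes w :: "real => real"
 assumes "is_interval S" "!!y. y \<in> S ==> (w has_real_derivative w1 y) (at y within S)" "!!y. y \<in> S ==> \<bar>w1 y\<bar> <= L" "x \<in> S" "y \<in> S"
 shows "\<bar>w x - w y\<bar> <= L * dist x y"
 using field_differentiable_bound[of S w w1 L x y] assms by (simp add: is_interval_convex_1 dist_real_def)

lemma hb_C1_interval:
 fixes w :: "real => real"
 assumes al: "0 < al" "al <= 1" and d: "!!y. y \<in> {-R..R} ==> (w has_real_derivative w1 y) (at y within {-R..R})" and c: "continuous_on {-R..R} w1"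
 shows "\<exists>K\<ge>0. hb {-R..R} al K w"
proof -
 have cw: "continuous_on {-R..R} w" by (rule DERIV_continuous_on[OF d])
 obtain L where L: "\<forall>y\<in>{-R..R}. \<bar>w1 y\<bar> <= L" "L > 0"
  using compact_imp_bounded[OF compact_continuous_image[OF c compact_Icc]] unfolding bounded_pos by auto
 obtain M where M: "\<forall>y\<in>{-R..R}. \<bar>w y\<bar> <= M" "M > 0"
  using compact_imp_bounded[OF compact_continuous_image[OF cw compact_Icc]] unfolding bounded_pos by auto
 have "hb {-R..R} al (L + 2 * M) w"
  by (rule hb_lipschitz[OF al bspec[OF M(1)] real_lipschitz[OF is_interval_cc d bspec[OF L(1)]]])
   (use L(2) M(2) in simp_all)
 then show ?thesis using L(2) M(2) by (intro exI[of _ "L + 2 * M"]) simp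
qed

text \<open>The product \<open>w (snd p) * T (fst p)\<close> with
  \<open>w'' = \<kappa>^2 * w + g\<close> works because \<open>T'' = - \<kappa>^2 * T\<close>. The
  factor 2 on the right matches the coefficient 2 of both second derivatives.\<close>

lemma solves_linear_mode:
 fixes T :: "real => real"
 assumes R: "R > 0" and al: "0 < al" "al < 1" and k: "\<kappa> \<ge> 0" and g: "hb {-R..R} al K g" "K \<ge> 0"
  and T: "!!x. (T has_real_derivative T' x) (at x)" "!!x. (T' has_real_derivative - \<kappa>\<^sup>2 * T x) (at x)" "!!x. T (x + P) = T x"
  and Tb: "!!x. \<bar>T x\<bar> <= 1" "!!x. \<bar>T' x\<bar> <= \<kappa>"
 shows "\<exists>J. solves_linear R P al (%_. 2) (%p. 2 * g (snd p) * T (fst p)) J"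
proof -
 have cg: "continuous_on {-R..R} g" using g al(1) hol_continuous unfolding hb_def by blast
 obtain w w1 where w: "!!y. y \<in> {-R..R} ==> (w has_real_derivative w1 y) (at y within {-R..R})"
  "!!y. y \<in> {-R..R} ==> (w1 has_real_derivative \<kappa>\<^sup>2 * w y + g y) (at y within {-R..R})" "w R = 0" "w (-R) = 0"
  using ode_dirichlet[OF R cg k] by blast
 define w2 where "w2 = (%y. \<kappa>\<^sup>2 * w y + g y)"
 define J where "J = (%i p. case i of 0 => w (snd p) * T (fst p) | Suc 0 => w (snd p) * T' (fst p) | Suc (Suc 0) => w1 (snd p) * T (fst p)
   | Suc (Suc (Suc 0)) => w (snd p) * (- \<kappa>\<^sup>2 * T (fst p)) | Suc (Suc (Suc (Suc 0))) => w1 (snd p) * T' (fst p) | _ => w2 (snd p) * T (fst p))"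
 have Ji: "J 0 = (%p. w (snd p) * T (fst p))" "J 1 = (%p. w (snd p) * T' (fst p))" "J 2 = (%p. w1 (snd p) * T (fst p))"
  "J 3 = (%p. w (snd p) * (- \<kappa>\<^sup>2 * T (fst p)))" "J 4 = (%p. w1 (snd p) * T' (fst p))" "J 5 = (%p. w2 (snd p) * T (fst p))"
  unfolding J_def by (simp_all add: eval_nat_numeral)
 have jet: "jet (strip R) J"
  unfolding jet_def Ji using grad_product[OF w(1) T(1)] grad_product[OF w(1) T(2)] grad_product[OF w(2) T(1)] unfolding w2_def by simp
 have cw1: "continuous_on {-R..R} w1" by (rule DERIV_continuous_on[OF w(2)])
 have cw: "continuous_on {-R..R} w" by (rule DERIV_continuous_on[OF w(1)])
 have cw2: "continuous_on {-R..R} (%y. \<kappa>\<^sup>2 * w y + g y)" by (intro continuous_intros cw cg)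
 have al1: "al <= 1" using al by simp
 obtain K0 where K0: "K0 \<ge> 0" "hb {-R..R} al K0 w" using hb_C1_interval[OF al(1) al1 w(1) cw1] by blast
 obtain K1 where K1: "K1 \<ge> 0" "hb {-R..R} al K1 w1" using hb_C1_interval[OF al(1) al1 w(2) cw2] by blast
 have K2: "hb {-R..R} al (\<bar>\<kappa>\<^sup>2\<bar> * K0 + K) w2" unfolding w2_def by (intro hb_add hb_cmult K0(2) g(1))
 have hT1: "hb UNIV al (\<kappa> + 2 * 1) T"
  by (rule hb_lipschitz[OF al(1) al1 Tb(1) real_lipschitz[of UNIV T T', OF is_interval_univ T(1) Tb(2)]]) (use k in simp_all)
 have hT2: "hb UNIV al (\<kappa>\<^sup>2 + 2 * \<kappa>) T'"
 proof (rule hb_lipschitz[OF al(1) al1 Tb(2)])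
  have b: "\<bar>- \<kappa>\<^sup>2 * T x\<bar> <= \<kappa>\<^sup>2" for x using mult_left_mono[OF Tb(1), of "\<kappa>\<^sup>2" x] by (simp add: abs_mult)
  show "\<bar>T' x - T' y\<bar> <= \<kappa>\<^sup>2 * dist x y" for x y
   by (rule real_lipschitz[of UNIV T' "%x. - \<kappa>\<^sup>2 * T x", OF is_interval_univ T(2) b UNIV_I UNIV_I])
 qed (use k in auto)
 have hT: "hb (strip R) al (\<kappa> + 2 * 1) (%p. T (fst p))" "hb (strip R) al (\<kappa>\<^sup>2 + 2 * \<kappa>) (%p. T' (fst p))"
  by (rule hb_fst[OF hT1 al(1)], use k in simp, rule hb_fst[OF hT2 al(1)], use k in simp)
 note hw = hb_snd[OF K0(2) al(1) K0(1)] hb_snd[OF K1(2) al(1) K1(1)]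
 have hw2: "hb (strip R) al (\<bar>\<kappa>\<^sup>2\<bar> * K0 + K) (%p. w2 (snd p))" by (rule hb_snd[OF K2 al(1)]) (use K0 g in simp)
 have ex: "\<exists>K. hb (strip R) al K (J i)" if "i <= 5" for i
 proof -
  have "i = 0 \<or> i = 1 \<or> i = 2 \<or> i = 3 \<or> i = 4 \<or> i = 5" using that by linarith
  moreover have "\<exists>K. hb (strip R) al K (J 3)" unfolding Ji(4) using hb_mult[OF hw(1) hb_cmult[OF hT(1)]] by blast
  moreover have "\<exists>K. hb (strip R) al K (J 0)" "\<exists>K. hb (strip R) al K (J 1)" "\<exists>K. hb (strip R) al K (J 2)" "\<exists>K. hb (strip R) al K (J 4)" "\<exists>K. hb (strip R) al K (J 5)"
   unfolding Ji using hb_mult[OF hw(1) hT(1)] hb_mult[OF hw(1) hT(2)] hb_mult[OF hw(2) hT(1)] hb_mult[OF hw(2) hT(2)] hb_mult[OF hw2 hT(1)] by blast+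
  ultimately show ?thesis by blast
 qed
 then obtain KK where KK: "!!i. i <= 5 ==> hb (strip R) al (KK i) (J i)" by metis
 have "hb (strip R) al (Max (KK ` {..5})) (J i)" if "i <= 5" for i
  by (rule hb_mono[OF KK[OF that]]) (use that in \<open>simp add: Max_ge\<close>)
 then have "\<exists>K. \<forall>i\<le>5. hb (strip R) al K (J i)" by blast
 moreover have "per R P (J 0)" unfolding per_def Ji using T(3) by simp
 moreover have "2 * J 3 p + 2 * J 5 p = 2 * g (snd p) * T (fst p)" for p unfolding Ji w2_def by (simp add: algebra_simps)
 moreover have "J 0 (x, R) = 0 \<and> J 0 (x, -R) = 0" for x unfolding Ji using w(3,4) by simp
 ultimately show ?thesis unfolding solves_linear_def using jet by blast
qed

lemma solves_linear_add:
 assumes "solves_linear R P al A f J" "solves_linear R P al A g H"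
 shows "solves_linear R P al A (%p. f p + g p) (%i p. J i p + H i p)"
proof -
 obtain K L where KL: "!!i. i <= 5 ==> hb (strip R) al K (J i)" "!!i. i <= 5 ==> hb (strip R) al L (H i)"
  using assms unfolding solves_linear_def by blast
 have "hb (strip R) al (K + L) (%p. J i p + H i p)" if "i <= 5" for i by (rule hb_add[OF KL(1)[OF that] KL(2)[OF that]])
 moreover have "A p * (J 3 p + H 3 p) + 2 * (J 5 p + H 5 p) = f p + g p" if "p \<in> strip R" for p
 proof -
  have "A p * J 3 p + 2 * J 5 p = f p" "A p * H 3 p + 2 * H 5 p = g p" using assms that unfolding solves_linear_def by blast+
  then show ?thesis by (simp add: distrib_left)
 qed
 ultimately show ?thesis using assms unfolding solves_linear_def per_def by (auto intro: jet_add)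
qed

lemma solves_linear_cmult:
 assumes "solves_linear R P al A f J"
 shows "solves_linear R P al A (%p. c * f p) (%i p. c * J i p)"
proof -
 obtain K where K: "!!i. i <= 5 ==> hb (strip R) al K (J i)" using assms unfolding solves_linear_def by blast
 have "hb (strip R) al (\<bar>c\<bar> * K) (%p. c * J i p)" if "i <= 5" for i by (rule hb_cmult[OF K[OF that]])
 moreover have "A p * (c * J 3 p) + 2 * (c * J 5 p) = c * f p" if "p \<in> strip R" for p
 proof -
  have "A p * J 3 p + 2 * J 5 p = f p" using assms that unfolding solves_linear_def by blast
  then show ?thesis by (metis distrib_left mult.left_commute)
 qed
 ultimately show ?thesis using assms unfolding solves_linear_def per_def by (auto intro: jet_cmult)
qed

section \<open>Approximation by convolution with trigonometric kernels\<close>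

inductive trig_poly :: "real => (real => real) => bool" for w :: real where
 cos: "trig_poly w (%t. cos (real k * w * t))"
| add: "trig_poly w f ==> trig_poly w g ==> trig_poly w (%t. f t + g t)"
| cmult: "trig_poly w f ==> trig_poly w (%t. c * f t)"

text \<open>The product formula for cosines stays within cosines, so the powers of
  \<open>1 + cos (w * t)\<close> need no sines.\<close>

lemma trig_poly_times_cos: "trig_poly w f ==> trig_poly w (%t. cos (w * t) * f t)"
proof (induction rule: trig_poly.induct)
 case (cos k)
 show ?case
 proof (cases k)
  case 0
  then show ?thesis using trig_poly.cos[of w 1] by simp
 next
  case (Suc m)
  have "cos (w * t) * cos (real k * w * t) = (1/2) * cos (real (Suc k) * w * t) + (1/2) * cos (real m * w * t)" for t
  proof -
   have "real (Suc k) * w * t = real k * w * t + w * t" "real m * w * t = real k * w * t - w * t"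
    unfolding Suc by (simp_all add: algebra_simps)
   then show ?thesis by (simp only: cos_add cos_diff) (simp add: field_simps)
  qed
  moreover have "trig_poly w (%t. (1/2) * cos (real (Suc k) * w * t) + (1/2) * cos (real m * w * t))"
   by (intro trig_poly.add trig_poly.cmult trig_poly.cos)
  ultimately show ?thesis by simp
 qed
next
 case (add f g)
 then show ?case using trig_poly.add[OF add.IH] by (simp add: distrib_left)
next
 case (cmult f c)
 then show ?case using trig_poly.cmult[OF cmult.IH, of c] by (simp add: mult.left_commute)
qed

lemma trig_poly_power: "trig_poly w (%t. (1 + cos (w * t)) ^ N)"
proof (induction N)
 case 0 then show ?case using trig_poly.cos[of w 0] by simp
next
 case (Suc N)
 then show ?case using trig_poly.add[OF Suc trig_poly_times_cos[OF Suc]] by (simp add: distrib_right)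
qed

lemma trig_poly_continuous: "trig_poly w f ==> continuous_on S f"
 by (induction rule: trig_poly.induct) (intro continuous_intros; assumption)+

lemma hb_parameter_integral:
 fixes f :: "real \<times> real => real"
 assumes al: "al > 0" and P: "P > 0" and f: "hb (strip R) al K f" and c: "continuous_on {0..P} c" "!!s. s \<in> {0..P} ==> \<bar>c s\<bar> <= 1"
  and R: "R > 0"
 shows "hb {-R..R} al (P * K) (%y. integral {0..P} (%s. f (s, y) * c s))"
proof -
 have cf: "continuous_on (strip R) f" using f al hol_continuous unfolding hb_def by blast
 have m: "(s, y) \<in> strip R" if "y \<in> {-R..R}" for s y using that by (auto simp: mem_strip abs_le_iff)
 have cy: "continuous_on {0..P} (%s. f (s, y) * c s)" if y: "y \<in> {-R..R}" for y
  by (intro continuous_on_mult c(1) continuous_on_compose2[OF cf, of _ "%s. (s, y)"] continuous_intros) (use m[OF y] in auto)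
 have "(0,0) \<in> strip R" using R by (simp add: mem_strip)
 then have K0: "K \<ge> 0" using f unfolding hb_def by (meson abs_ge_zero order_trans)
 have bound: "\<bar>integral {0..P} h\<bar> <= B * P" if "continuous_on {0..P} h" "!!s. s \<in> {0..P} ==> \<bar>h s\<bar> <= B" for h B
  using integral_bound[of 0 P h B] that P by simp
 have mul: "\<bar>a * c s\<bar> <= B" if "\<bar>a\<bar> <= B" "s \<in> {0..P}" for a s B
  using mult_mono[of "\<bar>a\<bar>" B "\<bar>c s\<bar>" 1] that c(2)[OF that(2)] by (simp add: abs_mult)
 show ?thesis
  unfolding hb_def hol_def
 proof (intro conjI ballI)
  fix y assume y: "y \<in> {-R..R}"
  have "\<bar>integral {0..P} (%s. f (s, y) * c s)\<bar> <= K * P"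
   by (rule bound[OF cy[OF y] mul]) (use f m[OF y] in \<open>auto simp: hb_def\<close>)
  then show "\<bar>integral {0..P} (%s. f (s, y) * c s)\<bar> <= P * K" by (simp add: mult.commute)
 next
  fix y z assume y: "y \<in> {-R..R}" and z: "z \<in> {-R..R}"
  have "integral {0..P} (%s. f (s, y) * c s) - integral {0..P} (%s. f (s, z) * c s) = integral {0..P} (%s. f (s, y) * c s - f (s, z) * c s)"
   by (rule integral_diff[symmetric]) (use cy[OF y] cy[OF z] integrable_continuous_real in auto)
  also have "\<bar>\<dots>\<bar> <= (K * dist y z powr al) * P"
  proof (rule bound)
   show "continuous_on {0..P} (%s. f (s, y) * c s - f (s, z) * c s)" by (intro continuous_on_diff cy y z)
   fix s assume s: "s \<in> {0..P}"
   have "\<bar>f (s, y) - f (s, z)\<bar> <= K * dist (s, y) (s, z) powr al" using f m[OF y] m[OF z] unfolding hb_def hol_def by blast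
   also have "dist (s, y) (s, z) = dist y z" by (simp add: dist_prod_def)
   finally have "\<bar>(f (s, y) - f (s, z)) * c s\<bar> <= K * dist y z powr al" by (rule mul[OF _ s])
   then show "\<bar>f (s, y) * c s - f (s, z) * c s\<bar> <= K * dist y z powr al" by (simp add: left_diff_distrib)
  qed
  finally show "\<bar>integral {0..P} (%s. f (s, y) * c s) - integral {0..P} (%s. f (s, z) * c s)\<bar> <= P * K * dist y z powr al" by (simp add: algebra_simps)
 qed
qed

lemma solves_linear_cong:
 assumes "solves_linear R P al A f J" "!!p. p \<in> strip R ==> A p = B p" "!!p. p \<in> strip R ==> f p = g p"
 shows "solves_linear R P al B g J"
proof -
 have "B p * J 3 p + 2 * J 5 p = g p" if "p \<in> strip R" for p
 proof -
  have "A p * J 3 p + 2 * J 5 p = f p" using assms(1) that unfolding solves_linear_def by blast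
  then show ?thesis using assms(2,3)[OF that] by simp
 qed
 then show ?thesis using assms(1) unfolding solves_linear_def by blast
qed

lemma hb_nonneg: assumes "hb (strip R) al K f" "R > 0" shows "K \<ge> 0"
proof -
 have "(0,0) \<in> strip R" using assms by (simp add: mem_strip)
 then show ?thesis using assms unfolding hb_def by (meson abs_ge_zero order_trans)
qed

lemma hb_continuous: "hb S al K f ==> al > 0 ==> continuous_on S f"
 unfolding hb_def using hol_continuous by blast

lemma continuous_on_row:
 assumes "continuous_on (strip R) f" "y \<in> {-R..R}"
 shows "continuous_on S (%s. f (s, y))"
proof (rule continuous_on_compose2[OF assms(1), of _ "%s. (s, y)"])
 show "continuous_on S (%s. (s, y))" by (intro continuous_on_Pair continuous_on_id continuous_on_const)
 show "(%s. (s, y)) ` S \<subseteq> strip R" using assms(2) by (auto simp: mem_strip abs_le_iff)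
qed

lemma cos_shift_nat: "cos (x + real k * (2 * pi)) = cos x" and sin_shift_nat: "sin (x + real k * (2 * pi)) = sin x"
 using cos.plus_of_nat[of x k] sin.plus_of_nat[of x k] by simp_all

text \<open>The addition theorem splits \<open>cos (\<kappa> * (x - s))\<close> into two separated
  modes whose \<open>y\<close> profiles are Fourier coefficients of the rows of \<open>f\<close>; by
  \<open>hb_parameter_integral\<close> these profiles inherit Hoelder continuity.\<close>

lemma solves_linear_convolution:
 assumes R: "R > 0" and P: "P > 0" and al: "0 < al" "al < 1" and f: "hb (strip R) al K f" and t: "trig_poly (2 * pi / P) \<phi>"
 shows "\<exists>J. solves_linear R P al (%_. 2) (%p. integral {0..P} (%s. f (s, snd p) * \<phi> (fst p - s))) J"
 using t
proof (induction rule: trig_poly.induct)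
 case (cos k)
 define \<kappa> where "\<kappa> = real k * (2 * pi / P)"
 have k: "\<kappa> \<ge> 0" unfolding \<kappa>_def using P by simp
 have cf: "continuous_on (strip R) f" by (rule hb_continuous[OF f al(1)])
 have K0: "K \<ge> 0" by (rule hb_nonneg[OF f R])
 define a where "a = (%y. (1/2) * integral {0..P} (%s. f (s, y) * cos (\<kappa> * s)))"
 define b where "b = (%y. (1/2) * integral {0..P} (%s. f (s, y) * sin (\<kappa> * s)))"
 have ha: "hb {-R..R} al (\<bar>1/2\<bar> * (P * K)) a"
  unfolding a_def by (intro hb_cmult hb_parameter_integral[OF al(1) P f _ _ R] continuous_intros) simp
 have hb: "hb {-R..R} al (\<bar>1/2\<bar> * (P * K)) b"
  unfolding b_def by (intro hb_cmult hb_parameter_integral[OF al(1) P f _ _ R] continuous_intros) simp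
 have PK: "0 <= \<bar>1/2\<bar> * (P * K)" using P K0 by simp
 have kP: "\<kappa> * (x + P) = \<kappa> * x + real k * (2 * pi)" for x unfolding \<kappa>_def using P by (simp add: field_simps)
 have "\<exists>J. solves_linear R P al (%_. 2) (%p. 2 * a (snd p) * cos (\<kappa> * fst p)) J"
 proof (rule solves_linear_mode[OF R al k ha PK, of "%x. cos (\<kappa> * x)" "%x. - \<kappa> * sin (\<kappa> * x)"])
  show "((%x. cos (\<kappa> * x)) has_real_derivative - \<kappa> * sin (\<kappa> * x)) (at x)" for x by (auto intro!: derivative_eq_intros)
  show "((%x. - \<kappa> * sin (\<kappa> * x)) has_real_derivative - \<kappa>\<^sup>2 * cos (\<kappa> * x)) (at x)" for x by (auto intro!: derivative_eq_intros simp: power2_eq_square)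
  show "cos (\<kappa> * (x + P)) = cos (\<kappa> * x)" for x unfolding kP by (rule cos_shift_nat)
  show "\<bar>- \<kappa> * sin (\<kappa> * x)\<bar> <= \<kappa>" for x using k mult_left_mono[OF abs_sin_le_one[of "\<kappa> * x"] k] by (simp add: abs_mult)
 qed simp
 then obtain J1 where J1: "solves_linear R P al (%_. 2) (%p. 2 * a (snd p) * cos (\<kappa> * fst p)) J1" by blast
 have "\<exists>J. solves_linear R P al (%_. 2) (%p. 2 * b (snd p) * sin (\<kappa> * fst p)) J"
 proof (rule solves_linear_mode[OF R al k hb PK, of "%x. sin (\<kappa> * x)" "%x. \<kappa> * cos (\<kappa> * x)"])
  show "((%x. sin (\<kappa> * x)) has_real_derivative \<kappa> * cos (\<kappa> * x)) (at x)" for x by (auto intro!: derivative_eq_intros)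
  show "((%x. \<kappa> * cos (\<kappa> * x)) has_real_derivative - \<kappa>\<^sup>2 * sin (\<kappa> * x)) (at x)" for x by (auto intro!: derivative_eq_intros simp: power2_eq_square)
  show "sin (\<kappa> * (x + P)) = sin (\<kappa> * x)" for x unfolding kP by (rule sin_shift_nat)
  show "\<bar>\<kappa> * cos (\<kappa> * x)\<bar> <= \<kappa>" for x using k mult_left_mono[OF abs_cos_le_one[of "\<kappa> * x"] k] by (simp add: abs_mult)
 qed simp
 then obtain J2 where J2: "solves_linear R P al (%_. 2) (%p. 2 * b (snd p) * sin (\<kappa> * fst p)) J2" by blast
 have e: "2 * a (snd p) * cos (\<kappa> * fst p) + 2 * b (snd p) * sin (\<kappa> * fst p) = integral {0..P} (%s. f (s, snd p) * cos (real k * (2 * pi / P) * (fst p - s)))"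
  if p: "p \<in> strip R" for p
 proof -
  have y: "snd p \<in> {-R..R}" using p by (auto simp: mem_strip abs_le_iff)
  have i1: "(%s. f (s, snd p) * cos (\<kappa> * s)) integrable_on {0..P}" "(%s. f (s, snd p) * sin (\<kappa> * s)) integrable_on {0..P}"
   by (intro integrable_continuous_real continuous_intros continuous_on_row[OF cf y])+
  have "integral {0..P} (%s. f (s, snd p) * cos (\<kappa> * (fst p - s))) = integral {0..P} (%s. cos (\<kappa> * fst p) * (f (s, snd p) * cos (\<kappa> * s)) + sin (\<kappa> * fst p) * (f (s, snd p) * sin (\<kappa> * s)))"
   by (simp add: right_diff_distrib cos_diff distrib_left mult_ac)
  also have "\<dots> = cos (\<kappa> * fst p) * integral {0..P} (%s. f (s, snd p) * cos (\<kappa> * s)) + sin (\<kappa> * fst p) * integral {0..P} (%s. f (s, snd p) * sin (\<kappa> * s))"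
   by (subst integral_add) (use integrable_cmul[OF i1(1), of "cos (\<kappa> * fst p)"] integrable_cmul[OF i1(2), of "sin (\<kappa> * fst p)"] in simp_all)
  finally show ?thesis unfolding a_def b_def \<kappa>_def[symmetric] by (simp add: mult_ac)
 qed
 show ?case by (rule exI, rule solves_linear_cong[OF solves_linear_add[OF J1 J2] refl e])
next
 case (add \<phi> \<psi>)
 then obtain J1 J2 where J: "solves_linear R P al (%_. 2) (%p. integral {0..P} (%s. f (s, snd p) * \<phi> (fst p - s))) J1"
  "solves_linear R P al (%_. 2) (%p. integral {0..P} (%s. f (s, snd p) * \<psi> (fst p - s))) J2" by blast
 have cf: "continuous_on (strip R) f" by (rule hb_continuous[OF f al(1)])
 have e: "integral {0..P} (%s. f (s, snd p) * \<phi> (fst p - s)) + integral {0..P} (%s. f (s, snd p) * \<psi> (fst p - s)) = integral {0..P} (%s. f (s, snd p) * (\<phi> (fst p - s) + \<psi> (fst p - s)))"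
  if p: "p \<in> strip R" for p
 proof -
  have y: "snd p \<in> {-R..R}" using p by (auto simp: mem_strip abs_le_iff)
  have c: "continuous_on {0..P} (%s. \<phi> (fst p - s))" if "trig_poly (2 * pi / P) \<phi>" for \<phi>
   by (rule continuous_on_compose2[OF trig_poly_continuous[OF that, of UNIV]], intro continuous_intros, simp)
  have i1: "(%s. f (s, snd p) * \<phi> (fst p - s)) integrable_on {0..P}" "(%s. f (s, snd p) * \<psi> (fst p - s)) integrable_on {0..P}"
   by (intro integrable_continuous_real continuous_on_mult c add continuous_on_row[OF cf y])+
  show ?thesis unfolding distrib_left by (rule integral_add[OF i1, symmetric])
 qed
 show ?case by (rule exI, rule solves_linear_cong[OF solves_linear_add[OF J] refl e])
next
 case (cmult \<phi> c)
 then obtain J where J: "solves_linear R P al (%_. 2) (%p. integral {0..P} (%s. f (s, snd p) * \<phi> (fst p - s))) J" by blast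
 have e: "c * integral {0..P} (%s. f (s, snd p) * \<phi> (fst p - s)) = integral {0..P} (%s. f (s, snd p) * (c * \<phi> (fst p - s)))" for p
  unfolding mult.left_commute[of _ c] by simp
 show ?case by (rule exI, rule solves_linear_cong[OF solves_linear_cmult[OF J, of c] refl e])
qed

lemma periodic_integral:
 fixes h :: "real => real"
 assumes P: "P > 0" and c: "continuous_on UNIV h" and per: "!!s. h (s + P) = h s"
 shows "integral {a..a + P} h = integral {0..P} h"
proof -
 have perZ: "h (s + real_of_int n * P) = h s" for s n
 proof -
  have pn: "h (s + real m * P) = h s" for s m
  proof (induction m)
   case (Suc m)
   have "h (s + real (Suc m) * P) = h ((s + real m * P) + P)" by (simp add: algebra_simps)
   then show ?case using per Suc by simp
  qed simp
  show ?thesis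
  proof (cases "n \<ge> 0")
   case True then show ?thesis using pn[of s "nat n"] by simp
  next
   case False
   then show ?thesis using pn[of "s + real_of_int n * P" "nat (- n)"] by simp
  qed
 qed
 have int: "h integrable_on {u..v}" for u v by (intro integrable_continuous_real continuous_on_subset[OF c]) simp
 have base: "integral {a..a + P} h = integral {0..P} h" if a: "0 <= a" "a <= P" for a
 proof -
  have "integral {a..a + P} h = integral {a..P} h + integral {P..a + P} h"
   using a P int by (intro Henstock_Kurzweil_Integration.integral_combine[symmetric]) auto
  also have "integral {P..a + P} h = integral {0..a} (h \<circ> (+) P)" using integral_shift_Icc_real[of 0 a h P] by simp
  also have "h \<circ> (+) P = h" using per by (simp add: fun_eq_iff add.commute)
  also have "integral {a..P} h + integral {0..a} h = integral {0..a} h + integral {a..P} h" by simp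
  also have "\<dots> = integral {0..P} h" using a P int by (intro Henstock_Kurzweil_Integration.integral_combine) auto
  finally show ?thesis .
 qed
 define n where "n = \<lfloor>a / P\<rfloor>"
 have 1: "real_of_int n <= a / P" "a / P < real_of_int n + 1" unfolding n_def by linarith+
 then have 2: "0 <= a - real_of_int n * P" "a - real_of_int n * P <= P" using P by (simp_all add: field_simps)
 have "h \<circ> (+) (real_of_int n * P) = h" using perZ by (simp add: fun_eq_iff add.commute)
 then have "integral {a - real_of_int n * P..(a - real_of_int n * P) + P} h = integral {a..a + P} h"
  using integral_shift_Icc_real[of "a - real_of_int n * P" "(a - real_of_int n * P) + P" h "real_of_int n * P"] by simp
 then show ?thesis using base[OF 2] by simp
qed

text \<open>Up to normalisation the de la Vallee-Poussin kernel. It is a nonnegative cosine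
  polynomial, so averaging against it keeps sup and Hoelder bounds, and it concentrates at the
  multiples of \<open>P\<close>.\<close>

definition kernel :: "real => nat => real => real" where
 "kernel P N t = (1 + cos (2 * pi / P * t)) ^ N"

lemma kernel_nonneg: "kernel P N t \<ge> 0"
 unfolding kernel_def using cos_ge_minus_one[of "2 * pi / P * t"] by (intro zero_le_power) linarith

lemma kernel_continuous: "continuous_on S (kernel P N)"
 unfolding kernel_def by (intro continuous_intros)

text \<open>On \<open>{0..d/2}\<close> the cosine decreases, so the kernel is at least its value at
  \<open>d/2\<close>.\<close>

lemma kernel_lower:
 assumes P: "P > 0" and d: "0 < d" "d <= P / 2"
 shows "(d/2) * (1 + cos (2 * pi / P * (d/2))) ^ N <= integral {0..P} (kernel P N)"
proof -
 have "(d/2) * (1 + cos (2 * pi / P * (d/2))) ^ N = integral {0..d/2} (%_. (1 + cos (2 * pi / P * (d/2))) ^ N)"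
  using d by simp
 also have "\<dots> <= integral {0..d/2} (kernel P N)"
 proof (rule integral_le)
  fix t assume t: "t \<in> {0..d/2}"
  have "cos (2 * pi / P * (d/2)) <= cos (2 * pi / P * t)"
  proof (rule cos_monotone_0_pi_le)
   show "0 <= 2 * pi / P * t" using t P by simp
   show "2 * pi / P * t <= 2 * pi / P * (d/2)" using t P by (intro mult_left_mono) auto
   have "2 * pi / P * (d/2) <= 2 * pi / P * (P / 4)" using d P by (intro mult_left_mono) auto
   also have "\<dots> = pi / 2" using P by simp
   also have "\<dots> <= pi" using pi_gt_zero by linarith
   finally show "2 * pi / P * (d/2) <= pi" .
  qed
  then show "(1 + cos (2 * pi / P * (d/2))) ^ N <= kernel P N t"
   unfolding kernel_def using cos_ge_minus_one[of "2 * pi / P * (d/2)"] by (intro power_mono) linarith+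
 qed (intro integrable_continuous_real kernel_continuous continuous_intros)+
 also have "\<dots> <= integral {0..P} (kernel P N)"
  by (rule integral_subset_le) (use d P kernel_nonneg integrable_continuous_real[OF kernel_continuous] in simp_all)
 finally show ?thesis .
qed

lemma kernel_mass: assumes P: "P > 0" shows "integral {0..P} (kernel P N) > 0"
proof -
 have "cos (2 * pi / P * (P / 2 / 2)) = 0" using P by simp
 then have "(P / 2 / 2) * (1 + 0) ^ N <= integral {0..P} (kernel P N)" using kernel_lower[OF P, of "P/2" N] P by simp
 then show ?thesis using P by simp
qed

lemma kernel_average:
 assumes P: "P > 0" and h: "continuous_on {0..P} h" "!!s. s \<in> {0..P} ==> \<bar>h s\<bar> <= B"
 shows "\<bar>(1 / integral {0..P} (kernel P N)) * integral {0..P} (%s. h s * kernel P N s)\<bar> <= B"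
proof -
 have "\<bar>integral {0..P} (%s. h s * kernel P N s)\<bar> <= integral {0..P} (%s. B * kernel P N s)"
 proof -
  have "norm (integral {0..P} (%s. h s * kernel P N s)) <= integral {0..P} (%s. B * kernel P N s)"
  proof (rule integral_norm_bound_integral)
   fix s assume "s \<in> {0..P}"
   then show "norm (h s * kernel P N s) <= B * kernel P N s"
    using h(2) kernel_nonneg[of P N s] by (simp add: abs_mult mult_right_mono)
  qed (intro integrable_continuous_real continuous_intros kernel_continuous h(1))+
  then show ?thesis by simp
 qed
 then have "\<bar>integral {0..P} (%s. h s * kernel P N s)\<bar> <= B * integral {0..P} (kernel P N)" by simp
 then show ?thesis using kernel_mass[OF P, of N] by (simp add: abs_mult divide_le_eq)
qed

text \<open>Away from the ends of the period the kernel is at most \<open>q1 ^ N\<close>, while its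
  total mass is at least \<open>(d/2) * q2 ^ N\<close> with \<open>q2 > q1\<close>, so the
  contribution from there decays geometrically. The kernel peaks at both ends, hence the two
  conditions \<open>h 0 = 0\<close> and \<open>h P = 0\<close>.\<close>

lemma kernel_limit:
 assumes P: "P > 0" and h: "continuous_on {0..P} h" "h 0 = 0" "h P = 0"
 shows "(%N. (1 / integral {0..P} (kernel P N)) * integral {0..P} (%s. h s * kernel P N s)) \<longlonglongrightarrow> 0"
proof (rule LIMSEQ_I)
 fix e :: real assume e: "e > 0"
 obtain B where B: "\<forall>s\<in>{0..P}. \<bar>h s\<bar> <= B" "B > 0"
  using compact_imp_bounded[OF compact_continuous_image[OF h(1) compact_Icc]] unfolding bounded_pos by auto
 have near: "\<exists>d>0. \<forall>s\<in>{0..P}. dist s x < d --> dist (h s) (h x) < e/2" if "x \<in> {0..P}" for x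
  by (rule mp[OF spec[OF bspec[OF h(1)[unfolded continuous_on_iff] that]]]) (use e in simp)
 obtain d1 where d1: "d1 > 0" "!!s. s \<in> {0..P} ==> dist s 0 < d1 ==> dist (h s) (h 0) < e/2"
  using near[of 0] P by auto
 obtain d2 where d2: "d2 > 0" "!!s. s \<in> {0..P} ==> dist s P < d2 ==> dist (h s) (h P) < e/2"
  using near[of P] P by auto
 define d where "d = min (min (d1/2) (d2/2)) (P/2)"
 have d: "d > 0" "d < d1" "d < d2" "d <= P/2" unfolding d_def using d1 d2 P by auto
 define w where "w = 2 * pi / P"
 have w: "w > 0" "w * P = 2 * pi" unfolding w_def using P by auto
 define q1 where "q1 = 1 + cos (w * d)"
 define q2 where "q2 = 1 + cos (w * (d/2))"
 have wd: "0 < w * (d/2)" "w * (d/2) < w * d" "w * d <= pi"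
 proof -
  have "w * d <= w * (P/2)" using w d by (intro mult_left_mono) auto
  then show "w * d <= pi" using w by simp
 qed (use w d in auto)
 have q: "0 <= q1" "q1 < q2"
 proof -
  show "0 <= q1" unfolding q1_def using cos_ge_minus_one[of "w * d"] by linarith
  have "cos (w * d) < cos (w * (d/2))" by (rule cos_monotone_0_pi) (use wd in linarith)+
  then show "q1 < q2" unfolding q1_def q2_def by simp
 qed
 have pt: "\<bar>h s\<bar> * kernel P N s <= e/2 * kernel P N s + B * q1 ^ N" if s: "s \<in> {0..P}" for s N
 proof (cases "s < d \<or> P - s < d")
  case True
  then have "\<bar>h s\<bar> <= e/2" using d1(2)[OF s] d2(2)[OF s] d s h by (auto simp: dist_real_def)
  then have "\<bar>h s\<bar> * kernel P N s <= e/2 * kernel P N s" by (intro mult_right_mono kernel_nonneg)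
  moreover have "0 <= B * q1 ^ N" using B q by simp
  ultimately show ?thesis by linarith
 next
  case False
  have "cos (w * s) <= cos (w * d)"
  proof (cases "w * s <= pi")
   case True
   show ?thesis by (rule cos_monotone_0_pi_le) (use wd w False d True in \<open>auto intro: mult_left_mono\<close>)
  next
   case F2: False
   have e1: "cos (w * s) = cos (w * (P - s))"
   proof -
    have "w * (P - s) = 2 * pi - w * s" using w by (simp add: right_diff_distrib)
    then show ?thesis by simp
   qed
   have "cos (w * (P - s)) <= cos (w * d)"
   proof (rule cos_monotone_0_pi_le)
    show "w * d <= w * (P - s)" using False w by (intro mult_left_mono) auto
    show "w * (P - s) <= pi" using F2 w by (simp add: right_diff_distrib)
   qed (use wd w d in auto)
   then show ?thesis using e1 by simp
  qed
  then have "kernel P N s <= q1 ^ N" unfolding kernel_def q1_def w_def[symmetric] using cos_ge_minus_one[of "w * s"] by (intro power_mono) linarith+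
  then have "\<bar>h s\<bar> * kernel P N s <= B * q1 ^ N" using B s kernel_nonneg[of P N s] by (intro mult_mono) auto
  moreover have "0 <= e/2 * kernel P N s" using e kernel_nonneg[of P N s] by simp
  ultimately show ?thesis by linarith
 qed
 have main: "\<bar>(1 / integral {0..P} (kernel P N)) * integral {0..P} (%s. h s * kernel P N s)\<bar> <= e/2 + (2 * B * P / d) * (q1 / q2) ^ N" for N
 proof -
  define c where "c = integral {0..P} (kernel P N)"
  have c0: "c > 0" unfolding c_def by (rule kernel_mass[OF P])
  have ik: "kernel P N integrable_on {0..P}" by (intro integrable_continuous_real kernel_continuous)
  have "norm (integral {0..P} (%s. h s * kernel P N s)) <= integral {0..P} (%s. e/2 * kernel P N s + B * q1 ^ N)"
  proof (rule integral_norm_bound_integral)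
   fix s assume "s \<in> {0..P}"
   from pt[OF this, of N] show "norm (h s * kernel P N s) <= e/2 * kernel P N s + B * q1 ^ N"
    using kernel_nonneg[of P N s] by (simp add: abs_mult)
  qed (intro integrable_continuous_real continuous_intros kernel_continuous h(1))+
  also have "\<dots> = e/2 * c + B * q1 ^ N * P"
  proof -
   have "integral {0..P} (%s. e/2 * kernel P N s + B * q1 ^ N) = integral {0..P} (%s. e/2 * kernel P N s) + integral {0..P} (%s. B * q1 ^ N)"
    by (rule integral_add) (intro integrable_continuous_real continuous_intros kernel_continuous)+
   then show ?thesis unfolding c_def using P by simp
  qed
  finally have le: "\<bar>integral {0..P} (%s. h s * kernel P N s)\<bar> <= e/2 * c + B * q1 ^ N * P" by simp
  have lower: "(d/2) * q2 ^ N <= c" using kernel_lower[OF P d(1,4), of N] unfolding q2_def w_def c_def .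
  have q2N: "(d/2) * q2 ^ N > 0" using d q by simp
  have "B * q1 ^ N * P / c <= B * q1 ^ N * P / ((d/2) * q2 ^ N)"
   using lower q2N B P q by (intro divide_left_mono) (auto intro!: mult_pos_pos mult_nonneg_nonneg simp: c0)
  also have "\<dots> = (2 * B * P / d) * (q1 / q2) ^ N" by (simp add: power_divide field_simps)
  finally have r: "B * q1 ^ N * P / c <= (2 * B * P / d) * (q1 / q2) ^ N" .
  have "\<bar>(1 / c) * integral {0..P} (%s. h s * kernel P N s)\<bar> = \<bar>integral {0..P} (%s. h s * kernel P N s)\<bar> / c" using c0 by (simp add: abs_mult)
  also have "\<dots> <= (e/2 * c + B * q1 ^ N * P) / c" using le c0 by (intro divide_right_mono) auto
  also have "\<dots> = e/2 + B * q1 ^ N * P / c" using c0 by (simp add: add_divide_distrib)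
  finally show ?thesis using r unfolding c_def by linarith
 qed
 have "(%N. (2 * B * P / d) * (q1 / q2) ^ N) \<longlonglongrightarrow> (2 * B * P / d) * 0"
  using q by (intro tendsto_mult tendsto_const LIMSEQ_realpow_zero) auto
 then have "eventually (%N. (2 * B * P / d) * (q1 / q2) ^ N < e/2) sequentially" using e by (intro order_tendstoD(2)) auto
 then obtain N0 where N0: "!!N. N \<ge> N0 ==> (2 * B * P / d) * (q1 / q2) ^ N < e/2" unfolding eventually_sequentially by blast
 show "\<exists>no. \<forall>n\<ge>no. norm ((1 / integral {0..P} (kernel P n)) * integral {0..P} (%s. h s * kernel P n s) - 0) < e"
 proof (intro exI[of _ N0] allI impI)
  fix n assume "N0 <= n"
  from N0[OF this] main[of n] show "norm ((1 / integral {0..P} (kernel P n)) * integral {0..P} (%s. h s * kernel P n s) - 0) < e" by simp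
 qed
qed

text \<open>Pointwise convergence of coefficients and right-hand sides suffices, as the common bound
  on the jets supplies the compactness.\<close>

lemma solves_linear_limit:
 assumes al: "al > 0" and S: "!!n. solves_linear R P al (A n) (f n) (J n)" and B: "!!n i. i <= 5 ==> hb (strip R) al B (J n i)" "B \<ge> 0"
  and A: "!!p. p \<in> strip R ==> (%n. A n p) \<longlonglongrightarrow> A' p" and f: "!!p. p \<in> strip R ==> (%n. f n p) \<longlonglongrightarrow> f' p" and R: "R > 0"
 shows "\<exists>G. solves_linear R P al A' f' G \<and> (\<forall>i\<le>5. hb (strip R) al B (G i))"
proof -
 have J: "jet (strip R) (J n)" for n using S[of n] unfolding solves_linear_def by blast
 have "\<exists>G. jet (strip R) G \<and> (\<forall>i\<le>5. hb (strip R) al B (G i)) \<and> (\<forall>i\<le>5. \<forall>p\<in>strip R. ((%n. J n i p) \<longlongrightarrow> G i p) uf)"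
  by (rule uf_jet[OF J _ al B(2)]) (rule B(1))
 then obtain G where G: "jet (strip R) G" "\<forall>i\<le>5. hb (strip R) al B (G i)" and G': "\<forall>i\<le>5. \<forall>p\<in>strip R. ((%n. J n i p) \<longlongrightarrow> G i p) uf"
  by (rule exE) (elim conjE, rule that)
 note Gl = bspec[OF mp[OF spec[OF G']]]
 have "per R P (G 0)" unfolding per_def
 proof
  fix p assume p: "p \<in> strip R"
  have "J n 0 (p + (P, 0)) = J n 0 p" for n using S[of n] p unfolding solves_linear_def per_def by blast
  then have "((%n. J n 0 p) \<longlongrightarrow> G 0 (p + (P, 0))) uf" using Gl[of 0 "p + (P, 0)"] p by simp
  then show "G 0 (p + (P, 0)) = G 0 p" using uf_lim_unique Gl[of 0 p] p by simp
 qed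
 moreover have "A' p * G 3 p + 2 * G 5 p = f' p" if p: "p \<in> strip R" for p
 proof (rule uf_lim_unique)
  show "((%n. A n p * J n 3 p + 2 * J n 5 p) \<longlongrightarrow> A' p * G 3 p + 2 * G 5 p) uf"
   by (intro tendsto_add tendsto_mult tendsto_const tendsto_uf[OF A[OF p]] Gl p) simp_all
  have "A n p * J n 3 p + 2 * J n 5 p = f n p" for n using S[of n] p unfolding solves_linear_def by blast
  then show "((%n. A n p * J n 3 p + 2 * J n 5 p) \<longlongrightarrow> f' p) uf" using tendsto_uf[OF f[OF p]] by simp
 qed
 moreover have "G 0 (x, R) = 0 \<and> G 0 (x, -R) = 0" for x
 proof -
  have m: "(x, R) \<in> strip R" "(x, -R) \<in> strip R" using R by (simp_all add: mem_strip)
  have "J n 0 (x, R) = 0 \<and> J n 0 (x, -R) = 0" for n using S[of n] unfolding solves_linear_def by blast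
  then have z: "((%n. 0) \<longlongrightarrow> G 0 (x, R)) uf" "((%n. 0) \<longlongrightarrow> G 0 (x, -R)) uf" using Gl[OF _ m(1), of 0] Gl[OF _ m(2), of 0] by simp_all
  then show ?thesis using uf_lim_unique[OF tendsto_const z(1)] uf_lim_unique[OF tendsto_const z(2)] by simp
 qed
 ultimately show ?thesis unfolding solves_linear_def using G(1,2) by blast
qed

text \<open>The averages \<open>g N\<close> of \<open>f\<close> in \<open>x\<close> are finite sums
  of solvable modes and keep the bound \<open>K\<close> of \<open>f\<close>, so their solutions are
  uniformly bounded and a limit solves the problem for \<open>f\<close>.\<close>

lemma solves_laplace:
 assumes R: "R > 0" and P: "P > 0" and al: "0 < al" "al < 1" and f: "hb (strip R) al K f" "per R P f"
 shows "\<exists>J. solves_linear R P al (%_. 2) f J"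
proof -
 define c where "c = (%N. integral {0..P} (kernel P N))"
 have c0: "c N > 0" for N unfolding c_def by (rule kernel_mass[OF P])
 define g where "g = (%N p. (1 / c N) * integral {0..P} (%s. f (s, snd p) * kernel P N (fst p - s)))"
 have cf: "continuous_on (strip R) f" by (rule hb_continuous[OF f(1) al(1)])
 have K0: "K \<ge> 0" by (rule hb_nonneg[OF f(1) R])
 have yI: "snd p \<in> {-R..R}" if "p \<in> strip R" for p using that by (auto simp: mem_strip abs_le_iff)
 have ms: "(s, snd p) \<in> strip R" if "p \<in> strip R" for s p using that by (simp add: mem_strip)
 have cs: "continuous_on S (%s. f (x - s, snd p))" if p: "p \<in> strip R" for S x p
  by (rule continuous_on_compose2[OF continuous_on_row[OF cf yI[OF p], of UNIV]], intro continuous_intros, simp)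
 \<comment> \<open>Moving the translation from the kernel to \<open>f\<close> exhibits
   \<open>g N\<close> as an average of translates of \<open>f\<close>, which is what preserves the
   bounds.\<close>
 have geq: "g N p = (1 / c N) * integral {0..P} (%s. f (fst p - s, snd p) * kernel P N s)" if p: "p \<in> strip R" for N p
 proof -
  define h where "h = (%s. f (s, snd p) * kernel P N (fst p - s))"
  have "continuous_on UNIV h" unfolding h_def
   by (intro continuous_on_mult continuous_on_row[OF cf yI[OF p]] continuous_on_compose2[OF kernel_continuous[of UNIV]] continuous_intros) simp
  moreover have "h (s + P) = h s" for s
  proof -
   have "f (s + P, snd p) = f (s, snd p)" using perD[OF f(2) ms[OF p, of s]] by simp
   moreover have "kernel P N (fst p - (s + P)) = kernel P N (fst p - s)"
   proof -
    have "2 * pi / P * (fst p - s) = 2 * pi / P * (fst p - (s + P)) + real 1 * (2 * pi)" using P by (simp add: field_simps)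
    then have "cos (2 * pi / P * (fst p - s)) = cos (2 * pi / P * (fst p - (s + P)))" by (simp only: cos_shift_nat)
    then show ?thesis unfolding kernel_def by simp
   qed
   ultimately show ?thesis unfolding h_def by simp
  qed
  ultimately have "integral {fst p - P..(fst p - P) + P} h = integral {0..P} h" by (rule periodic_integral[OF P])
  then have "integral {0..P} h = integral {fst p - P..fst p} h" by simp
  also have "\<dots> = integral {- P..0} (h \<circ> (+) (fst p))" using integral_shift_Icc_real[of "-P" 0 h "fst p"] by (simp add: add.commute)
  also have "\<dots> = integral {0..P} (%s. (h \<circ> (+) (fst p)) (- s))"
   using Henstock_Kurzweil_Integration.integral_reflect_real[of P 0 "%s. (h \<circ> (+) (fst p)) (- s)"] by (simp add: o_def)
  also have "\<dots> = integral {0..P} (%s. f (fst p - s, snd p) * kernel P N s)" unfolding h_def by simp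
  finally show ?thesis unfolding g_def h_def by simp
 qed
 have fb: "\<bar>f q\<bar> <= K" if "q \<in> strip R" for q using f(1) that unfolding hb_def by blast
 have hg: "hb (strip R) al K (g N)" for N
  unfolding hb_def hol_def
 proof (intro conjI ballI)
  fix p assume p: "p \<in> strip R"
  show "\<bar>g N p\<bar> <= K" unfolding geq[OF p] c_def by (rule kernel_average[OF P cs[OF p] fb[OF ms[OF p]]])
 next
  fix p q assume p: "p \<in> strip R" and q: "q \<in> strip R"
  have i: "(%s. f (fst p - s, snd p) * kernel P N s) integrable_on {0..P}" "(%s. f (fst q - s, snd q) * kernel P N s) integrable_on {0..P}"
   by (intro integrable_continuous_real continuous_on_mult cs p q kernel_continuous)+
  have "g N p - g N q = (1 / c N) * (integral {0..P} (%s. f (fst p - s, snd p) * kernel P N s) - integral {0..P} (%s. f (fst q - s, snd q) * kernel P N s))"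
   unfolding geq[OF p] geq[OF q] right_diff_distrib ..
  also have "\<dots> = (1 / c N) * integral {0..P} (%s. (f (fst p - s, snd p) - f (fst q - s, snd q)) * kernel P N s)"
   unfolding integral_diff[OF i, symmetric] left_diff_distrib ..
  also have "\<bar>\<dots>\<bar> <= K * dist p q powr al"
   unfolding c_def
  proof (rule kernel_average[OF P])
   show "continuous_on {0..P} (%s. f (fst p - s, snd p) - f (fst q - s, snd q))" by (intro continuous_on_diff cs p q)
   fix s
   have "\<bar>f (fst p - s, snd p) - f (fst q - s, snd q)\<bar> <= K * dist (fst p - s, snd p) (fst q - s, snd q) powr al"
    using f(1) ms[OF p] ms[OF q] unfolding hb_def hol_def by blast
   moreover have "dist (fst p - s, snd p) (fst q - s, snd q) = dist p q" by (simp add: dist_prod_def dist_real_def)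
   ultimately show "\<bar>f (fst p - s, snd p) - f (fst q - s, snd q)\<bar> <= K * dist p q powr al" by simp
  qed
  finally show "\<bar>g N p - g N q\<bar> <= K * dist p q powr al" .
 qed
 have lim: "(%N. g N p) \<longlonglongrightarrow> f p" if p: "p \<in> strip R" for p
 proof -
  define h where "h = (%s. f (fst p - s, snd p) - f p)"
  have "(%N. (1 / c N) * integral {0..P} (%s. h s * kernel P N s)) \<longlonglongrightarrow> 0"
   unfolding c_def
  proof (rule kernel_limit[OF P])
   show "continuous_on {0..P} h" unfolding h_def by (intro continuous_on_diff cs p continuous_on_const)
   show "h 0 = 0" unfolding h_def by simp
   have "f ((fst p - P, snd p) + (P, 0)) = f (fst p - P, snd p)" by (rule perD[OF f(2) ms[OF p]])
   then show "h P = 0" unfolding h_def by simp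
  qed
  moreover have "(1 / c N) * integral {0..P} (%s. h s * kernel P N s) = g N p - f p" for N
  proof -
   have i: "(%s. f (fst p - s, snd p) * kernel P N s) integrable_on {0..P}" "(%s. f p * kernel P N s) integrable_on {0..P}"
    by (intro integrable_continuous_real continuous_on_mult cs p kernel_continuous continuous_on_const)+
   have "integral {0..P} (%s. h s * kernel P N s) = integral {0..P} (%s. f (fst p - s, snd p) * kernel P N s) - f p * c N"
    unfolding h_def left_diff_distrib integral_diff[OF i] c_def by simp
   then show ?thesis unfolding geq[OF p] using c0[of N] by (simp add: right_diff_distrib)
  qed
  ultimately have "(%N. g N p - f p) \<longlonglongrightarrow> 0" by simp
  then show ?thesis using Lim_null by blast
 qed
 have "\<exists>J. solves_linear R P al (%_. 2) (g N) J" for N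
 proof -
  have "trig_poly (2 * pi / P) (kernel P N)" unfolding kernel_def by (rule trig_poly_power)
  from solves_linear_convolution[OF R P al f(1) this] obtain J where
   "solves_linear R P al (%_. 2) (%p. integral {0..P} (%s. f (s, snd p) * kernel P N (fst p - s))) J" by (rule exE)
  from solves_linear_cmult[OF this, of "1 / c N"] show ?thesis unfolding g_def by (rule exI[where x="%i p. 1 / c N * J i p"])
 qed
 then obtain J where J: "!!N. solves_linear R P al (%_. 2) (g N) (J N)" by metis
 have two: "(0::real) < 2" by simp
 obtain C where C: "C > 0" "!!A f J G i. (\<forall>p\<in>strip R. 2 <= A p \<and> A p <= 2) ==> hol (strip R) al 0 A ==> hb (strip R) al G f ==> solves_linear R P al A f J ==> i <= 5 ==> hb (strip R) al (C * G) (J i)"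
  using linear_estimate[OF R P al two, of 2 0] by blast
 have hJ: "hb (strip R) al (C * K) (J N i)" if "i <= 5" for N i
  by (rule C(2)[OF _ _ hg J that]) (simp_all add: hol_def)
 have "\<exists>G. solves_linear R P al (%_. 2) f G \<and> (\<forall>i\<le>5. hb (strip R) al (C * K) (G i))"
  by (rule solves_linear_limit[OF al(1) J hJ _ tendsto_const lim R]) (use C(1) K0 in simp_all)
 then show ?thesis by blast
qed

text \<open>Method of continuity along \<open>As s = (1 - s) * 2 + s * A\<close>. The step
  \<open>\<tau>\<close> depends only on the constant \<open>C\<close> of
  \<open>linear_estimate\<close> and on the bound \<open>Q\<close> for \<open>A - 2\<close>, so
  finitely many steps lead from 0 to 1.\<close>

lemma linear_solvable:
 assumes R: "R > 0" and P: "P > 0" and al: "0 < al" "al < 1" and mu: "0 < \<mu>"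
  and A: "\<forall>p\<in>strip R. \<mu> <= A p \<and> A p <= \<Lambda>" "hol (strip R) al Ka A" "per R P A"
  and f: "hb (strip R) al K f" "per R P f"
 shows "\<exists>J. solves_linear R P al A f J"
proof -
 define As where "As = (%s p. (1 - s) * 2 + s * A p)"
 define m where "m = min 2 \<mu>"
 define M where "M = max 2 \<Lambda>"
 define H where "H = max Ka 0"
 have m0: "m > 0" using mu unfolding m_def by simp
 have Ab: "\<forall>p\<in>strip R. m <= As s p \<and> As s p <= M" if s: "0 <= s" "s <= 1" for s
 proof
  fix p assume "p \<in> strip R"
  then have a: "m <= A p" "A p <= M" using A(1) unfolding m_def M_def by force+
  have b: "m <= 2" "2 <= M" unfolding m_def M_def by auto
  have "(1 - s) * m + s * m <= As s p" unfolding As_def using a b s by (intro add_mono mult_left_mono) auto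
  moreover have "As s p <= (1 - s) * M + s * M" unfolding As_def using a b s by (intro add_mono mult_left_mono) auto
  ultimately show "m <= As s p \<and> As s p <= M" by (simp add: algebra_simps)
 qed
 have Ah: "hol (strip R) al H (As s)" if s: "0 <= s" "s <= 1" for s
 proof -
  have h0: "hol (strip R) al 0 (%p. (1 - s) * 2)" unfolding hol_def by simp
  have "hol (strip R) al H A" by (rule hol_mono[OF A(2)]) (simp add: H_def)
  from hol_add[OF h0 hol_cmult[OF this, of s]] have "hol (strip R) al (0 + \<bar>s\<bar> * H) (As s)" unfolding As_def .
  moreover have "0 + \<bar>s\<bar> * H <= H" using s mult_right_mono[of s 1 H] unfolding H_def by simp
  ultimately show ?thesis by (rule hol_mono)
 qed
 obtain C where C: "C > 0" "!!A f J G i. (\<forall>p\<in>strip R. m <= A p \<and> A p <= M) ==> hol (strip R) al H A ==> hb (strip R) al G f ==> solves_linear R P al A f J ==> i <= 5 ==> hb (strip R) al (C * G) (J i)"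
  using linear_estimate[OF R P al m0, of M H] by blast
 define Q where "Q = M + 2 + H"
 have Q0: "Q > 0" unfolding Q_def M_def H_def by simp
 have AQ: "hb (strip R) al Q (%p. A p - 2)"
  unfolding hb_def
 proof (intro conjI ballI)
  fix p assume "p \<in> strip R"
  then have "\<mu> <= A p" "A p <= \<Lambda>" using A(1) by blast+
  moreover have "\<Lambda> <= M" "2 <= M" "0 <= H" unfolding M_def H_def by auto
  ultimately show "\<bar>A p - 2\<bar> <= Q" unfolding Q_def using mu by linarith
 next
  have "hol (strip R) al (H + 0) (%p. A p + - 2)"
   by (intro hol_add hol_mono[OF A(2)]) (simp_all add: H_def hol_def)
  moreover have "0 <= M" unfolding M_def by simp
  ultimately show "hol (strip R) al Q (%p. A p - 2)" unfolding Q_def using hol_mono[of "strip R" al "H + 0" "%p. A p + - 2" "M + 2 + H"] by simp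
 qed
 define \<tau> where "\<tau> = 1 / (4 * Q * C)"
 have t0: "\<tau> > 0" unfolding \<tau>_def using Q0 C(1) by simp
 define solv where "solv = (%s. \<forall>K f. hb (strip R) al K f --> per R P f --> (\<exists>J. solves_linear R P al (As s) f J))"
 have step: "solv s'" if s: "0 <= s" "s <= 1" and s': "s <= s'" "s' <= 1" "s' - s <= \<tau>" and so: "solv s" for s s'
  unfolding solv_def
 proof (intro allI impI)
  fix K f assume f: "hb (strip R) al K f" "per R P f"
  have K0: "K \<ge> 0" by (rule hb_nonneg[OF f(1) R])
  \<comment> \<open>Solving with \<open>As s\<close> in place of \<open>As s'\<close> leaves the
    residual \<open>(s - s') * ((A - 2) * D 3)\<close>, and \<open>\<tau>\<close> is chosen to make
    it at most half the previous one. The bound for \<open>J\<close> is the partial sum of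
    \<open>C * K / 2 ^ n\<close>. The limit is taken by compactness and not by a Cauchy
    argument.\<close>
  have approx: "\<exists>g J. hb (strip R) al (K / 2 ^ n) g \<and> per R P g \<and> solves_linear R P al (As s') (%p. f p - g p) J \<and> (\<forall>i\<le>5. hb (strip R) al (2 * C * K * (1 - 1 / 2 ^ n)) (J i))" for n
  proof (induction n)
   case 0
   have "solves_linear R P al (As s') (%p. f p - f p) (%i p. 0)"
    unfolding solves_linear_def jet_def grad_def per_def hb_def hol_def by (auto intro!: exI[of _ 0])
   moreover have "hb (strip R) al (2 * C * K * (1 - 1 / 2 ^ 0)) (%p. 0)" unfolding hb_def hol_def by simp
   ultimately show ?case using f by (intro exI[of _ f] exI[of _ "%i p. 0"]) simp
  next
   case (Suc n)
   then obtain g J where g: "hb (strip R) al (K / 2 ^ n) g" "per R P g" and J: "solves_linear R P al (As s') (%p. f p - g p) J"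
    "\<forall>i\<le>5. hb (strip R) al (2 * C * K * (1 - 1 / 2 ^ n)) (J i)" by blast
   obtain D where D: "solves_linear R P al (As s) g D" using so g unfolding solv_def by blast
   have Db: "hb (strip R) al (C * (K / 2 ^ n)) (D i)" if "i <= 5" for i by (rule C(2)[OF Ab[OF s] Ah[OF s] g(1) D that])
   define g' where "g' = (%p. (s - s') * ((A p - 2) * D 3 p))"
   have "hb (strip R) al (\<bar>s - s'\<bar> * (2 * Q * (C * (K / 2 ^ n)))) g'"
    unfolding g'_def by (intro hb_cmult hb_mult AQ Db) simp
   moreover have "\<bar>s - s'\<bar> * (2 * Q * (C * (K / 2 ^ n))) <= K / 2 ^ Suc n"
   proof -
    have "\<bar>s - s'\<bar> * (2 * Q * (C * (K / 2 ^ n))) <= \<tau> * (2 * Q * (C * (K / 2 ^ n)))"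
     using s' Q0 C(1) K0 by (intro mult_right_mono) auto
    also have "\<dots> = K / 2 ^ Suc n" unfolding \<tau>_def using Q0 C(1) by (simp add: field_simps)
    finally show ?thesis .
   qed
   ultimately have g'1: "hb (strip R) al (K / 2 ^ Suc n) g'" by (rule hb_mono)
   have "per R P (D 3)" by (rule per_jet[OF R]) (use D in \<open>simp_all add: solves_linear_def\<close>)
   then have g'2: "per R P g'" using A(3) unfolding per_def g'_def by simp
   have Ds: "solves_linear R P al (As s') (%p. g p - g' p) D"
   proof -
    have "As s' p * D 3 p + 2 * D 5 p = g p - g' p" if "p \<in> strip R" for p
    proof -
     have "As s p * D 3 p + 2 * D 5 p = g p" using D that unfolding solves_linear_def by blast
     then show ?thesis unfolding As_def g'_def by (simp add: algebra_simps)
    qed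
    then show ?thesis using D unfolding solves_linear_def by blast
   qed
   have "solves_linear R P al (As s') (%p. f p - g' p) (%i p. J i p + D i p)"
    by (rule solves_linear_cong[OF solves_linear_add[OF J(1) Ds]]) simp_all
   moreover have "hb (strip R) al (2 * C * K * (1 - 1 / 2 ^ Suc n)) (%p. J i p + D i p)" if "i <= 5" for i
   proof -
    have "hb (strip R) al (2 * C * K * (1 - 1 / 2 ^ n) + C * (K / 2 ^ n)) (%p. J i p + D i p)"
     by (rule hb_add[OF _ Db[OF that]]) (use J(2) that in blast)
    moreover have "2 * C * K * (1 - 1 / 2 ^ n) + C * (K / 2 ^ n) = 2 * C * K * (1 - 1 / 2 ^ Suc n)" by (simp add: field_simps)
    ultimately show ?thesis by simp
   qed
   ultimately show ?case using g'1 g'2 by (intro exI[of _ g'] exI[of _ "%i p. J i p + D i p"]) simp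
  qed
  define Q where "Q = (%n x. hb (strip R) al (K / 2 ^ n) (fst x) \<and> solves_linear R P al (As s') (%p. f p - fst x p) (snd x) \<and> (\<forall>i\<le>5. hb (strip R) al (2 * C * K * (1 - 1 / 2 ^ n)) (snd x i)))"
  have "\<forall>n. \<exists>x. Q n x"
  proof
   fix n
   from approx[of n] obtain g J where "hb (strip R) al (K / 2 ^ n) g" "solves_linear R P al (As s') (%p. f p - g p) J" "\<forall>i\<le>5. hb (strip R) al (2 * C * K * (1 - 1 / 2 ^ n)) (J i)"
    by (elim exE conjE) (rule that)
   then have "Q n (g, J)" unfolding Q_def by simp
   then show "\<exists>x. Q n x" by (rule exI)
  qed
  from choice[OF this] obtain X where X: "\<forall>n. Q n (X n)" by (rule exE)
  define g where "g = (%n. fst (X n))"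
  define J where "J = (%n. snd (X n))"
  have gJ: "hb (strip R) al (K / 2 ^ n) (g n)" "solves_linear R P al (As s') (%p. f p - g n p) (J n)"
   "!!i. i <= 5 ==> hb (strip R) al (2 * C * K * (1 - 1 / 2 ^ n)) (J n i)" for n
   using spec[OF X, of n] unfolding Q_def g_def J_def by simp_all
  have Jb: "hb (strip R) al (2 * C * K) (J n i)" if "i <= 5" for n i
  proof (rule hb_mono[OF gJ(3)[OF that]])
   have "0 <= 2 * C * K" using C(1) K0 by simp
   then have "2 * C * K * (1 - 1 / 2 ^ n) <= 2 * C * K * 1" by (intro mult_left_mono) auto
   then show "2 * C * K * (1 - 1 / 2 ^ n) <= 2 * C * K" by simp
  qed
  have lim: "(%n. f p - g n p) \<longlonglongrightarrow> f p" if p: "p \<in> strip R" for p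
  proof -
   have "(%n. K * (1/2) ^ n) \<longlonglongrightarrow> K * 0" by (intro tendsto_mult tendsto_const LIMSEQ_realpow_zero) auto
   then have l0: "(%n. K * (1/2) ^ n) \<longlonglongrightarrow> 0" by simp
   have "(%n. g n p) \<longlonglongrightarrow> 0"
    by (rule Lim_null_comparison[OF always_eventually l0], rule allI)
     (use gJ(1) p in \<open>auto simp: hb_def power_divide\<close>)
   from tendsto_diff[OF tendsto_const[of "f p"] this] show ?thesis by simp
  qed
  have "\<exists>G. solves_linear R P al (As s') f G \<and> (\<forall>i\<le>5. hb (strip R) al (2 * C * K) (G i))"
   by (rule solves_linear_limit[OF al(1) gJ(2) Jb _ tendsto_const lim R]) (use C(1) K0 in simp_all)
  then show "\<exists>J. solves_linear R P al (As s') f J" by blast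
 qed
 have base: "solv 0" unfolding solv_def As_def using solves_laplace[OF R P al] by simp
 have "solv (min 1 (real n * \<tau>))" for n
 proof (induction n)
  case 0 then show ?case using base by simp
 next
  case (Suc n)
  show ?case
  proof (rule step[OF _ _ _ _ _ Suc])
   have "0 <= real n * \<tau>" "real (Suc n) * \<tau> = real n * \<tau> + \<tau>" using t0 by (simp_all add: algebra_simps)
   then show "0 <= min 1 (real n * \<tau>)" "min 1 (real n * \<tau>) <= min 1 (real (Suc n) * \<tau>)"
    "min 1 (real (Suc n) * \<tau>) - min 1 (real n * \<tau>) <= \<tau>" using t0 by (auto simp: min_def)
  qed auto
 qed
 then have all: "solv (min 1 (real n * \<tau>))" for n .
 obtain n where "1 < real n * \<tau>" using reals_Archimedean3[OF t0] by blast
 then have "min 1 (real n * \<tau>) = 1" by simp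
 then have "solv 1" using all[of n] by simp
 then have "\<exists>J. solves_linear R P al (As 1) f J" using f unfolding solv_def by blast
 then show ?thesis unfolding As_def by simp
qed

subsection \<open>The nonlinearity\<close>

definition AA :: "real => real => real => real" where "AA a v y = 1 / sqrt (v\<^sup>2 + y\<^sup>2 + a\<^sup>2)"

text \<open>The derivative of \<open>AA\<close> in \<open>v\<close>, as \<open>AA_deriv\<close>
  shows.\<close>

definition AV :: "real => real => real => real" where "AV a v y = - v * AA a v y ^ 3"

definition FF :: "real => real => real => real" where "FF a v y = arsinh (v / sqrt (y\<^sup>2 + a\<^sup>2))"

lemma AA_base:
 fixes a v y :: real
 assumes "a \<noteq> 0" shows "v\<^sup>2 + y\<^sup>2 + a\<^sup>2 > 0" "y\<^sup>2 + a\<^sup>2 > 0"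
proof -
 have "a\<^sup>2 > 0" using assms by simp
 then show "v\<^sup>2 + y\<^sup>2 + a\<^sup>2 > 0" "y\<^sup>2 + a\<^sup>2 > 0"
  using zero_le_power2[of v] zero_le_power2[of y] by linarith+
qed

lemma AA_pos: "a \<noteq> 0 ==> AA a v y > 0"
 unfolding AA_def using AA_base(1)[of a v y] by simp

lemma AA_le: assumes "a \<noteq> 0" shows "AA a v y <= 1 / \<bar>a\<bar>"
proof -
 have "sqrt (a\<^sup>2) <= sqrt (v\<^sup>2 + y\<^sup>2 + a\<^sup>2)" by (rule real_sqrt_le_mono) simp
 then have "\<bar>a\<bar> <= sqrt (v\<^sup>2 + y\<^sup>2 + a\<^sup>2)" by simp
 then show ?thesis unfolding AA_def using assms AA_base(1)[OF assms, of v y] by (intro divide_left_mono) simp_all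
qed

lemma AA_ge:
 assumes "a \<noteq> 0" "\<bar>v\<bar> <= V" "\<bar>y\<bar> <= R"
 shows "AA a v y \<ge> 1 / sqrt (V\<^sup>2 + R\<^sup>2 + a\<^sup>2)"
proof -
 have "v\<^sup>2 <= V\<^sup>2" "y\<^sup>2 <= R\<^sup>2" using power_mono[OF assms(2), of 2] power_mono[OF assms(3), of 2] by simp_all
 then have "sqrt (v\<^sup>2 + y\<^sup>2 + a\<^sup>2) <= sqrt (V\<^sup>2 + R\<^sup>2 + a\<^sup>2)" by simp
 then show ?thesis unfolding AA_def using AA_base(1)[OF assms(1), of v y] AA_base(1)[OF assms(1), of V R] by (intro divide_left_mono) auto
qed

lemma AA_sq: "a \<noteq> 0 ==> (v\<^sup>2 + y\<^sup>2 + a\<^sup>2) * (AA a v y)\<^sup>2 = 1"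
 unfolding AA_def using AA_base(1)[of a v y] by (simp add: power_divide)

lemma AA_bounds:
 assumes "a \<noteq> 0" shows "\<bar>v * AA a v y\<bar> <= 1" "\<bar>y * AA a v y\<bar> <= 1" "\<bar>AA a v y\<bar> <= 1 / \<bar>a\<bar>"
proof -
 have s: "v\<^sup>2 * (AA a v y)\<^sup>2 + y\<^sup>2 * (AA a v y)\<^sup>2 + a\<^sup>2 * (AA a v y)\<^sup>2 = 1"
  using AA_sq[OF assms, of v y] by (simp add: distrib_right)
 have nn: "0 <= v\<^sup>2 * (AA a v y)\<^sup>2" "0 <= y\<^sup>2 * (AA a v y)\<^sup>2" "0 <= a\<^sup>2 * (AA a v y)\<^sup>2" by simp_all
 have "(v * AA a v y)\<^sup>2 <= 1" "(y * AA a v y)\<^sup>2 <= 1" unfolding power_mult_distrib using s nn by linarith+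
 then show "\<bar>v * AA a v y\<bar> <= 1" "\<bar>y * AA a v y\<bar> <= 1" by (simp_all add: abs_square_le_1)
 show "\<bar>AA a v y\<bar> <= 1 / \<bar>a\<bar>" using AA_le[OF assms, of v y] AA_pos[OF assms, of v y] by simp
qed

lemma AA_deriv:
 assumes "a \<noteq> 0"
 shows "((%v. AA a v y) has_real_derivative AV a v y) (at v)"
  and "((%y. AA a v y) has_real_derivative - y * AA a v y ^ 3) (at y)"
proof -
 have b: "v\<^sup>2 + y\<^sup>2 + a\<^sup>2 > 0" using AA_base[OF assms] by simp
 define s where "s = sqrt (v\<^sup>2 + y\<^sup>2 + a\<^sup>2)"
 have AAi: "AA a v y = inverse (sqrt (v\<^sup>2 + y\<^sup>2 + a\<^sup>2))" for v y by (simp add: AA_def inverse_eq_divide)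
 have s: "s > 0" unfolding s_def using b by simp
 have "((%v. sqrt (v\<^sup>2 + y\<^sup>2 + a\<^sup>2)) has_real_derivative v / s) (at v)"
  unfolding s_def using b by (auto intro!: derivative_eq_intros simp: field_simps)
 from DERIV_inverse'[OF this] have "((%v. AA a v y) has_real_derivative - (inverse s * (v / s) * inverse s)) (at v)"
  unfolding AAi using s by (simp add: s_def)
 then show "((%v. AA a v y) has_real_derivative AV a v y) (at v)"
  by (rule DERIV_cong) (simp add: AV_def AAi s_def[symmetric] power3_eq_cube divide_inverse)
 have "((%y. sqrt (v\<^sup>2 + y\<^sup>2 + a\<^sup>2)) has_real_derivative y / s) (at y)"
  unfolding s_def using b by (auto intro!: derivative_eq_intros simp: field_simps)
 from DERIV_inverse'[OF this] have "((%y. AA a v y) has_real_derivative - (inverse s * (y / s) * inverse s)) (at y)"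
  unfolding AAi using s by (simp add: s_def)
 then show "((%y. AA a v y) has_real_derivative - y * AA a v y ^ 3) (at y)"
  by (rule DERIV_cong) (simp add: AAi s_def[symmetric] power3_eq_cube divide_inverse)
qed

lemma lipschitz2:
 fixes g :: "real => real => real"
 assumes "!!v y. ((%v. g v y) has_real_derivative g1 v y) (at v)" "!!v y. ((%y. g v y) has_real_derivative g2 v y) (at y)"
  "!!v y. \<bar>g1 v y\<bar> <= L" "!!v y. \<bar>g2 v y\<bar> <= L"
 shows "\<bar>g v y - g v' y'\<bar> <= L * (\<bar>v - v'\<bar> + \<bar>y - y'\<bar>)"
proof -
 have "\<bar>g v y - g v' y\<bar> <= L * dist v v'"
  by (rule real_lipschitz[of UNIV "%v. g v y" "%v. g1 v y", OF is_interval_univ assms(1) assms(3) UNIV_I UNIV_I])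
 moreover have "\<bar>g v' y - g v' y'\<bar> <= L * dist y y'"
  by (rule real_lipschitz[of UNIV "%y. g v' y" "%y. g2 v' y", OF is_interval_univ assms(2) assms(4) UNIV_I UNIV_I])
 ultimately have "\<bar>g v y - g v' y'\<bar> <= L * dist v v' + L * dist y y'" by linarith
 then show ?thesis by (simp add: dist_real_def distrib_left)
qed

text \<open>A common Lipschitz constant: the first summand bounds the derivatives of
  \<open>AA\<close>, the second those of \<open>AV\<close>. Both come from writing these derivatives
  as products of \<open>v * AA\<close>, \<open>y * AA\<close> and \<open>AA\<close>, which are
  bounded by 1, 1 and \<open>1 / \<bar>a\<bar>\<close>.\<close>

definition LA :: "real => real" where "LA a = 1 / \<bar>a\<bar> ^ 2 + 4 / \<bar>a\<bar> ^ 3"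

lemma LA_pos: "a \<noteq> 0 ==> LA a > 0"
 unfolding LA_def by (simp add: add_pos_pos)

lemma abs_mult_le: fixes x y :: real assumes "\<bar>x\<bar> <= u" "\<bar>y\<bar> <= w" shows "\<bar>x * y\<bar> <= u * w"
 unfolding abs_mult using assms by (intro mult_mono) auto

lemma AA_lipschitz:
 assumes "a \<noteq> 0" shows "\<bar>AA a v y - AA a v' y'\<bar> <= LA a * (\<bar>v - v'\<bar> + \<bar>y - y'\<bar>)"
proof (rule lipschitz2[OF AA_deriv[OF assms]])
 have k: "\<bar>x * AA a v y ^ 3\<bar> <= LA a" if "\<bar>x * AA a v y\<bar> <= 1" for x v y
 proof -
  have "\<bar>(x * AA a v y) * (AA a v y * AA a v y)\<bar> <= 1 * ((1 / \<bar>a\<bar>) * (1 / \<bar>a\<bar>))"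
   by (intro abs_mult_le that AA_bounds[OF assms])
  moreover have "(1 / \<bar>a\<bar>) * (1 / \<bar>a\<bar>) <= LA a" unfolding LA_def by (simp add: power2_eq_square)
  ultimately show ?thesis by (simp add: power3_eq_cube mult.assoc)
 qed
 show "\<bar>AV a v y\<bar> <= LA a" for v y unfolding AV_def using k[OF AA_bounds(1)[OF assms], of v y] by simp
 show "\<bar>- y * AA a v y ^ 3\<bar> <= LA a" for v y using k[OF AA_bounds(2)[OF assms], of y v] by simp
qed

lemma AV_lipschitz:
 assumes "a \<noteq> 0" shows "\<bar>AV a v y - AV a v' y'\<bar> <= LA a * (\<bar>v - v'\<bar> + \<bar>y - y'\<bar>)"
proof (rule lipschitz2)
 fix v y
 define A where "A = AA a v y"
 have b: "\<bar>v * A\<bar> <= 1" "\<bar>y * A\<bar> <= 1" "\<bar>A\<bar> <= 1 / \<bar>a\<bar>" unfolding A_def by (rule AA_bounds[OF assms])+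
 have p3: "\<bar>A * A * A\<bar> <= 1 / \<bar>a\<bar> * (1 / \<bar>a\<bar>) * (1 / \<bar>a\<bar>)" by (intro abs_mult_le b)
 have q: "1 / \<bar>a\<bar> * (1 / \<bar>a\<bar>) * (1 / \<bar>a\<bar>) = 1 / \<bar>a\<bar> ^ 3" by (simp add: power3_eq_cube)
 have La: "4 * (1 / \<bar>a\<bar> ^ 3) <= LA a" unfolding LA_def by simp
 show "((%v. AV a v y) has_real_derivative - 1 * A ^ 3 + (3 * A\<^sup>2 * AV a v y) * (- v)) (at v)"
  unfolding AV_def A_def
  by (rule DERIV_cong[OF DERIV_mult[OF DERIV_minus[OF DERIV_ident] DERIV_power[OF AA_deriv(1)[OF assms]]]]) (simp add: AV_def)
 show "((%y. AV a v y) has_real_derivative - v * (3 * A\<^sup>2 * (- y * A ^ 3))) (at y)"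
  unfolding AV_def A_def
  by (rule DERIV_cong[OF DERIV_cmult[OF DERIV_power[OF AA_deriv(2)[OF assms]]]]) simp
 have "- 1 * A ^ 3 + (3 * A\<^sup>2 * AV a v y) * (- v) = - (A * A * A) + 3 * ((v * A) * (v * A) * (A * A * A))"
  unfolding AV_def A_def[symmetric] by (simp add: power2_eq_square power3_eq_cube algebra_simps)
 moreover have "\<bar>(v * A) * (v * A) * (A * A * A)\<bar> <= 1 * 1 * (1 / \<bar>a\<bar> * (1 / \<bar>a\<bar>) * (1 / \<bar>a\<bar>))" by (intro abs_mult_le b)
 ultimately show "\<bar>- 1 * A ^ 3 + (3 * A\<^sup>2 * AV a v y) * (- v)\<bar> <= LA a" using p3 La unfolding q by linarith
 have "- v * (3 * A\<^sup>2 * (- y * A ^ 3)) = 3 * ((v * A) * (y * A) * (A * A * A))" by (simp add: power2_eq_square power3_eq_cube algebra_simps)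
 moreover have "\<bar>(v * A) * (y * A) * (A * A * A)\<bar> <= 1 * 1 * (1 / \<bar>a\<bar> * (1 / \<bar>a\<bar>) * (1 / \<bar>a\<bar>))" by (intro abs_mult_le b)
 moreover have "0 <= 1 / \<bar>a\<bar> ^ 3" by simp
 ultimately show "\<bar>- v * (3 * A\<^sup>2 * (- y * A ^ 3))\<bar> <= LA a" using La unfolding q by linarith
qed

lemma FF_deriv: assumes "a \<noteq> 0" shows "((%v. FF a v y) has_real_derivative AA a v y) (at v within S)"
proof -
 define b where "b = sqrt (y\<^sup>2 + a\<^sup>2)"
 have b: "b > 0" "b\<^sup>2 = y\<^sup>2 + a\<^sup>2" unfolding b_def using AA_base(2)[OF assms, of y] by auto
 have d: "((%v. v / b) has_real_derivative 1 / b) (at v within S)" by (rule DERIV_cdivide[OF DERIV_ident])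
 have "((%v. arsinh (v / b)) has_real_derivative (1 / sqrt ((v / b)\<^sup>2 + 1)) * (1 / b)) (at v within S)"
  by (rule DERIV_chain2[OF arsinh_real_has_field_derivative d])
 then have "((%v. arsinh (v / b)) has_real_derivative (1 / b) * (1 / sqrt ((v / b)\<^sup>2 + 1))) (at v within S)"
  by (simp only: mult.commute)
 moreover have "(1 / b) * (1 / sqrt ((v / b)\<^sup>2 + 1)) = AA a v y"
 proof -
  have "b * sqrt ((v / b)\<^sup>2 + 1) = sqrt (b\<^sup>2 * ((v / b)\<^sup>2 + 1))" using b(1) by (simp add: real_sqrt_mult)
  also have "b\<^sup>2 * ((v / b)\<^sup>2 + 1) = v\<^sup>2 + y\<^sup>2 + a\<^sup>2" using b assms by (simp add: distrib_left power_divide)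
  finally show ?thesis unfolding AA_def by simp
 qed
 ultimately show ?thesis unfolding FF_def b_def by simp
qed

lemma FF_zero: "FF a 0 y = 0"
 unfolding FF_def by simp

text \<open>The slope of \<open>FF\<close> between \<open>v\<close> and \<open>w\<close>, see
  \<open>FF_diff\<close>. As an average and not a quotient it inherits the bounds and the Lipschitz
  continuity of \<open>AA\<close> also where \<open>v = w\<close>.\<close>

definition AB :: "real => real => real => real => real" where "AB a v w y = integral {0..1} (%s. AA a (v + s * (w - v)) y)"

lemma AA_continuous: assumes "a \<noteq> 0" shows "continuous_on S (%s. AA a (v + s * w) y)"
proof -
 have "sqrt ((v + s * w)\<^sup>2 + y\<^sup>2 + a\<^sup>2) \<noteq> 0" for s using AA_base(1)[OF assms, of "v + s * w" y] by simp
 then show ?thesis unfolding AA_def by (intro continuous_intros) simp_all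
qed

lemma FF_diff: assumes "a \<noteq> 0" shows "FF a w y - FF a v y = (w - v) * AB a v w y"
proof -
 have "((%s. AA a (v + s * (w - v)) y * (w - v)) has_integral (FF a (v + 1 * (w - v)) y - FF a (v + 0 * (w - v)) y)) {0..1}"
 proof (rule fundamental_theorem_of_calculus)
  fix s :: real
  have "((%s. FF a (v + s * (w - v)) y) has_real_derivative AA a (v + s * (w - v)) y * (w - v)) (at s within {0..1})"
   by (rule DERIV_chain2[OF FF_deriv[OF assms]]) (auto intro!: derivative_eq_intros)
  then show "((%s. FF a (v + s * (w - v)) y) has_vector_derivative AA a (v + s * (w - v)) y * (w - v)) (at s within {0..1})"
   by (simp add: has_real_derivative_iff_has_vector_derivative)
 qed simp
 from integral_unique[OF this] show ?thesis unfolding AB_def by (simp add: mult.commute)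
qed

lemma unit_integral_diff:
 fixes f g :: "real => real"
 assumes "continuous_on {0..1} f" "continuous_on {0..1} g" "!!s. s \<in> {0..1} ==> \<bar>f s - g s\<bar> <= B"
 shows "\<bar>integral {0..1} f - integral {0..1} g\<bar> <= B"
proof -
 have "integral {0..1} f - integral {0..1} g = integral {0..1} (%s. f s - g s)"
  by (rule integral_diff[symmetric]) (intro integrable_continuous_real assms(1,2))+
 moreover have "norm (integral {0..1} (%s. f s - g s)) <= B * (1 - 0)"
  by (rule integral_bound) (use assms in \<open>auto intro!: continuous_intros\<close>)
 ultimately show ?thesis by simp
qed

lemma AB_bounds:
 assumes "a \<noteq> 0" "\<bar>v\<bar> <= V" "\<bar>w\<bar> <= V" "\<bar>y\<bar> <= R"
 shows "1 / sqrt (V\<^sup>2 + R\<^sup>2 + a\<^sup>2) <= AB a v w y" "AB a v w y <= 1 / \<bar>a\<bar>"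
proof -
 have i: "(%s. AA a (v + s * (w - v)) y) integrable_on {0..1}" by (intro integrable_continuous_real AA_continuous assms(1))
 have ic: "(%s::real. c) integrable_on {0..1}" for c :: real by (intro integrable_continuous_real continuous_on_const)
 have "integral {0..1} (%s::real. 1 / sqrt (V\<^sup>2 + R\<^sup>2 + a\<^sup>2)) <= AB a v w y" unfolding AB_def
 proof (rule integral_le[OF ic i])
  fix s :: real assume s: "s \<in> {0..1}"
  have "\<bar>v + s * (w - v)\<bar> = \<bar>(1 - s) * v + s * w\<bar>" by (simp add: algebra_simps)
  also have "\<dots> <= (1 - s) * \<bar>v\<bar> + s * \<bar>w\<bar>" using s abs_triangle_ineq[of "(1 - s) * v" "s * w"] by (simp add: abs_mult)
  also have "\<dots> <= (1 - s) * V + s * V" using s assms by (intro add_mono mult_left_mono) auto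
  finally have "\<bar>v + s * (w - v)\<bar> <= V" by (simp add: algebra_simps)
  then show "1 / sqrt (V\<^sup>2 + R\<^sup>2 + a\<^sup>2) <= AA a (v + s * (w - v)) y" by (rule AA_ge[OF assms(1) _ assms(4)])
 qed
 then show "1 / sqrt (V\<^sup>2 + R\<^sup>2 + a\<^sup>2) <= AB a v w y" by simp
 have "AB a v w y <= integral {0..1} (%s::real. 1 / \<bar>a\<bar>)" unfolding AB_def by (rule integral_le[OF i ic]) (rule AA_le[OF assms(1)])
 then show "AB a v w y <= 1 / \<bar>a\<bar>" by simp
qed

lemma AB_lipschitz:
 assumes "a \<noteq> 0"
 shows "\<bar>AB a v w y - AB a v' w' y'\<bar> <= LA a * (\<bar>v - v'\<bar> + \<bar>w - w'\<bar> + \<bar>y - y'\<bar>)"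
 unfolding AB_def
proof (rule unit_integral_diff[OF AA_continuous[OF assms] AA_continuous[OF assms]])
 fix s :: real assume s: "s \<in> {0..1}"
 have "\<bar>v + s * (w - v) - (v' + s * (w' - v'))\<bar> = \<bar>(1 - s) * (v - v') + s * (w - w')\<bar>" by (simp add: algebra_simps)
 also have "\<dots> <= (1 - s) * \<bar>v - v'\<bar> + s * \<bar>w - w'\<bar>" using s abs_triangle_ineq[of "(1 - s) * (v - v')" "s * (w - w')"] by (simp add: abs_mult)
 also have "\<dots> <= 1 * \<bar>v - v'\<bar> + 1 * \<bar>w - w'\<bar>" using s by (intro add_mono mult_right_mono) auto
 finally have "\<bar>v + s * (w - v) - (v' + s * (w' - v'))\<bar> + \<bar>y - y'\<bar> <= \<bar>v - v'\<bar> + \<bar>w - w'\<bar> + \<bar>y - y'\<bar>" by simp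
 from mult_left_mono[OF this less_imp_le[OF LA_pos[OF assms]]]
 show "\<bar>AA a (v + s * (w - v)) y - AA a (v' + s * (w' - v')) y'\<bar> <= LA a * (\<bar>v - v'\<bar> + \<bar>w - w'\<bar> + \<bar>y - y'\<bar>)"
  using AA_lipschitz[OF assms, of "v + s * (w - v)" y "v' + s * (w' - v')" y'] by linarith
qed

text \<open>\<open>q * DD a v q y\<close> is the remainder of the first order expansion of
  \<open>FF\<close> at \<open>v\<close>, see \<open>FF_second_order\<close>.\<close>

definition DD :: "real => real => real => real => real" where "DD a v q y = AB a v (v + q) y - AA a v y"

lemma DD_integral: assumes "a \<noteq> 0" shows "DD a v q y = integral {0..1} (%s. AA a (v + s * q) y - AA a v y)"
proof -
 have "integral {0..1} (%s::real. AA a (v + s * q) y - AA a v y) = integral {0..1} (%s. AA a (v + s * q) y) - integral {0..1} (%s::real. AA a v y)"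
  by (rule integral_diff) (intro integrable_continuous_real AA_continuous assms continuous_intros)+
 then show ?thesis unfolding DD_def AB_def by simp
qed

lemma DD_bound: assumes "a \<noteq> 0" shows "\<bar>DD a v q y\<bar> <= LA a * \<bar>q\<bar>"
proof -
 have "\<bar>integral {0..1} (%s. AA a (v + s * q) y) - integral {0..1} (%s::real. AA a v y)\<bar> <= LA a * \<bar>q\<bar>"
 proof (rule unit_integral_diff[OF AA_continuous[OF assms] continuous_on_const])
  fix s :: real assume s: "s \<in> {0..1}"
  have "\<bar>AA a (v + s * q) y - AA a v y\<bar> <= LA a * (\<bar>v + s * q - v\<bar> + \<bar>y - y\<bar>)" by (rule AA_lipschitz[OF assms])
  also have "\<dots> <= LA a * \<bar>q\<bar>" using s LA_pos[OF assms] by (intro mult_left_mono) (auto simp: abs_mult mult_left_le_one_le)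
  finally show "\<bar>AA a (v + s * q) y - AA a v y\<bar> <= LA a * \<bar>q\<bar>" .
 qed
 then show ?thesis unfolding DD_def AB_def by simp
qed

text \<open>A change of \<open>q\<close> costs one derivative of \<open>AA\<close>. A change of
  \<open>(v, y)\<close> produces a mixed difference, from which the mean value theorem in the shift
  \<open>t\<close> extracts the factor \<open>\<bar>q\<bar>\<close> at the cost of the Lipschitz
  bound for \<open>AV\<close>.\<close>

lemma DD_lipschitz:
 assumes "a \<noteq> 0"
 shows "\<bar>DD a v q y - DD a v' q' y'\<bar> <= LA a * \<bar>q - q'\<bar> + \<bar>q\<bar> * (LA a * (\<bar>v - v'\<bar> + \<bar>y - y'\<bar>))"
 unfolding DD_integral[OF assms]
proof (rule unit_integral_diff)
 show "continuous_on {0..1} (%s. AA a (v + s * q) y - AA a v y)" "continuous_on {0..1} (%s. AA a (v' + s * q') y' - AA a v' y')"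
  by (intro continuous_intros AA_continuous assms)+
 fix s :: real assume s: "s \<in> {0..1}"
 define \<psi> where "\<psi> = (%t. AA a (v + t) y - AA a (v' + t) y')"
 have d: "(\<psi> has_real_derivative AV a (v + t) y - AV a (v' + t) y') (at t)" for t
 proof -
  have sh: "((%t. AA a (c + t) z) has_real_derivative AV a (c + t) z) (at t)" for c z
   using DERIV_shift[of "%v. AA a v z" "AV a (c + t) z" t c] AA_deriv(1)[OF assms, of z "c + t"] by (simp add: add.commute)
  show ?thesis unfolding \<psi>_def by (intro DERIV_diff sh)
 qed
 have b: "\<bar>AV a (v + t) y - AV a (v' + t) y'\<bar> <= LA a * (\<bar>v - v'\<bar> + \<bar>y - y'\<bar>)" for t
  using AV_lipschitz[OF assms, of "v + t" y "v' + t" y'] by simp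
 have "\<bar>\<psi> (s * q) - \<psi> 0\<bar> <= (LA a * (\<bar>v - v'\<bar> + \<bar>y - y'\<bar>)) * dist (s * q) 0"
  by (rule real_lipschitz[of UNIV \<psi>, OF is_interval_univ d b UNIV_I UNIV_I])
 also have "\<dots> <= (LA a * (\<bar>v - v'\<bar> + \<bar>y - y'\<bar>)) * \<bar>q\<bar>"
  using s LA_pos[OF assms] by (intro mult_left_mono) (auto simp: abs_mult mult_left_le_one_le)
 finally have 1: "\<bar>\<psi> (s * q) - \<psi> 0\<bar> <= \<bar>q\<bar> * (LA a * (\<bar>v - v'\<bar> + \<bar>y - y'\<bar>))" by (simp add: mult.commute)
 have "\<bar>AA a (v' + s * q) y' - AA a (v' + s * q') y'\<bar> <= LA a * (\<bar>v' + s * q - (v' + s * q')\<bar> + \<bar>y' - y'\<bar>)" by (rule AA_lipschitz[OF assms])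
 also have "\<dots> = LA a * (s * \<bar>q - q'\<bar>)" using s by (simp add: abs_mult flip: right_diff_distrib)
 also have "\<dots> <= LA a * \<bar>q - q'\<bar>" using s LA_pos[OF assms] by (intro mult_left_mono) (auto simp: mult_left_le_one_le)
 finally have 2: "\<bar>AA a (v' + s * q) y' - AA a (v' + s * q') y'\<bar> <= LA a * \<bar>q - q'\<bar>" .
 have "AA a (v + s * q) y - AA a v y - (AA a (v' + s * q') y' - AA a v' y') = (\<psi> (s * q) - \<psi> 0) + (AA a (v' + s * q) y' - AA a (v' + s * q') y')"
  unfolding \<psi>_def by simp
 then show "\<bar>AA a (v + s * q) y - AA a v y - (AA a (v' + s * q') y' - AA a v' y')\<bar> <= LA a * \<bar>q - q'\<bar> + \<bar>q\<bar> * (LA a * (\<bar>v - v'\<bar> + \<bar>y - y'\<bar>))"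
  using 1 2 by linarith
qed

lemma FF_second_order: assumes "a \<noteq> 0" shows "FF a (v + q) y = FF a v y + AA a v y * q + q * DD a v q y"
 using FF_diff[OF assms, of "v + q" y v] unfolding DD_def by (simp add: algebra_simps)

lemma snd_hoelder:
 assumes "0 < al" "al <= 1" "R > 0" "p \<in> strip R" "q \<in> strip R"
 shows "\<bar>snd p - snd q\<bar> <= (1 + 2 * R) * dist p q powr al"
proof -
 have "hb (strip R) al (1 + 2 * R) snd"
  by (rule hb_lipschitz[OF assms(1,2)]) (use assms(3) fst_snd_dist(2) in \<open>simp_all add: mem_strip dist_commute\<close>)
 then show ?thesis using assms unfolding hb_def hol_def by blast
qed

lemma hol_AA:
 assumes a: "a \<noteq> 0" and al: "0 < al" "al <= 1" and R: "R > 0" and v: "hol (strip R) al B v"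
 shows "hol (strip R) al (LA a * (B + (1 + 2 * R))) (%p. AA a (v p) (snd p))"
 unfolding hol_def
proof (intro ballI)
 fix p q assume pq: "p \<in> strip R" "q \<in> strip R"
 have "\<bar>v p - v q\<bar> + \<bar>snd p - snd q\<bar> <= B * dist p q powr al + (1 + 2 * R) * dist p q powr al"
  using v pq snd_hoelder[OF al R pq] unfolding hol_def by (intro add_mono) auto
 from mult_left_mono[OF this less_imp_le[OF LA_pos[OF a]]]
 show "\<bar>AA a (v p) (snd p) - AA a (v q) (snd q)\<bar> <= LA a * (B + (1 + 2 * R)) * dist p q powr al"
  using AA_lipschitz[OF a, of "v p" "snd p" "v q" "snd q"] by (simp add: algebra_simps)
qed

lemma hol_AB:
 assumes a: "a \<noteq> 0" and al: "0 < al" "al <= 1" and R: "R > 0" and v: "hol (strip R) al B v" and w: "hol (strip R) al B w"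
 shows "hol (strip R) al (LA a * (B + B + (1 + 2 * R))) (%p. AB a (v p) (w p) (snd p))"
 unfolding hol_def
proof (intro ballI)
 fix p q assume pq: "p \<in> strip R" "q \<in> strip R"
 have "\<bar>v p - v q\<bar> + \<bar>w p - w q\<bar> + \<bar>snd p - snd q\<bar> <= B * dist p q powr al + B * dist p q powr al + (1 + 2 * R) * dist p q powr al"
  using v w pq snd_hoelder[OF al R pq] unfolding hol_def by (intro add_mono) auto
 from mult_left_mono[OF this less_imp_le[OF LA_pos[OF a]]]
 show "\<bar>AB a (v p) (w p) (snd p) - AB a (v q) (w q) (snd q)\<bar> <= LA a * (B + B + (1 + 2 * R)) * dist p q powr al"
  using AB_lipschitz[OF a, of "v p" "w p" "snd p" "v q" "w q" "snd q"] by (simp add: algebra_simps)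
qed

text \<open>The bound is quadratic in \<open>r\<close> for the Hoelder seminorm as well, because the
  term of \<open>DD_lipschitz\<close> that does not measure the change of \<open>q\<close> carries
  the factor \<open>\<bar>q\<bar>\<close>.\<close>

lemma hb_remainder:
 assumes a: "a \<noteq> 0" and al: "0 < al" "al <= 1" and R: "R > 0" and v: "hol (strip R) al B v" and q: "hb (strip R) al r q"
 shows "hb (strip R) al (2 * r * (LA a * (1 + B + (1 + 2 * R)) * r)) (%p. q p * DD a (v p) (q p) (snd p))"
proof (rule hb_mult[OF q])
 define c where "c = LA a * (1 + B + (1 + 2 * R))"
 have r0: "r \<ge> 0" by (rule hb_nonneg[OF q R])
 have B0: "B \<ge> 0"
 proof -
  have "(0,0) \<in> strip R" "(1,0) \<in> strip R" using R by (simp_all add: mem_strip)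
  then have "\<bar>v (0,0) - v (1,0)\<bar> <= B * dist (0::real,0::real) (1,0) powr al" using v unfolding hol_def by blast
  then have "0 <= B * dist (0::real,0::real) (1,0) powr al" by linarith
  then show ?thesis by (simp add: dist_prod_def)
 qed
 have L: "LA a > 0" by (rule LA_pos[OF a])
 have Lc: "LA a <= c" unfolding c_def using L B0 R mult_left_mono[of 1 "1 + B + (1 + 2 * R)" "LA a"] by simp
 show "hb (strip R) al (c * r) (%p. DD a (v p) (q p) (snd p))"
  unfolding hb_def hol_def
 proof (intro conjI ballI)
  fix p assume p: "p \<in> strip R"
  have "\<bar>q p\<bar> <= r" using q p unfolding hb_def by blast
  then have "LA a * \<bar>q p\<bar> <= c * r" using Lc L r0 by (intro mult_mono) auto
  then show "\<bar>DD a (v p) (q p) (snd p)\<bar> <= c * r" using DD_bound[OF a, of "v p" "q p" "snd p"] by linarith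
 next
  fix p p' assume p: "p \<in> strip R" "p' \<in> strip R"
  define X where "X = dist p p' powr al"
  have X0: "X \<ge> 0" unfolding X_def by simp
  have q1: "\<bar>q p\<bar> <= r" "\<bar>q p - q p'\<bar> <= r * X" using q p unfolding hb_def hol_def X_def by blast+
  have "\<bar>v p - v p'\<bar> <= B * X" using v p unfolding hol_def X_def by blast
  moreover have "\<bar>snd p - snd p'\<bar> <= (1 + 2 * R) * X" unfolding X_def by (rule snd_hoelder[OF al R p])
  ultimately have "\<bar>v p - v p'\<bar> + \<bar>snd p - snd p'\<bar> <= (B + (1 + 2 * R)) * X" by (simp add: algebra_simps)
  then have "\<bar>q p\<bar> * (LA a * (\<bar>v p - v p'\<bar> + \<bar>snd p - snd p'\<bar>)) <= r * (LA a * ((B + (1 + 2 * R)) * X))"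
   using q1(1) L r0 by (intro mult_mono mult_left_mono) auto
  moreover have "LA a * \<bar>q p - q p'\<bar> <= LA a * (r * X)" using q1(2) L by (intro mult_left_mono) auto
  ultimately have "\<bar>DD a (v p) (q p) (snd p) - DD a (v p') (q p') (snd p')\<bar> <= LA a * (r * X) + r * (LA a * ((B + (1 + 2 * R)) * X))"
   using DD_lipschitz[OF a, of "v p" "q p" "snd p" "v p'" "q p'" "snd p'"] by linarith
  also have "\<dots> = c * r * X" unfolding c_def by (simp add: algebra_simps)
  finally show "\<bar>DD a (v p) (q p) (snd p) - DD a (v p') (q p') (snd p')\<bar> <= c * r * dist p p' powr al" unfolding X_def .
 qed
qed

subsection \<open>Newton iteration\<close>

definition adm :: "real => real => real => (nat => real \<times> real => real) => bool" where
 "adm R P al J \<longleftrightarrow> jet (strip R) J \<and> (\<exists>K. \<forall>i\<le>5. hb (strip R) al K (J i)) \<and> per R P (J 0)"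

lemma adm_add: assumes "adm R P al J" "adm R P al H" shows "adm R P al (%i p. J i p + H i p)"
proof -
 obtain K L where KL: "!!i. i <= 5 ==> hb (strip R) al K (J i)" "!!i. i <= 5 ==> hb (strip R) al L (H i)"
  using assms unfolding adm_def by blast
 have "hb (strip R) al (K + L) (%p. J i p + H i p)" if "i <= 5" for i by (rule hb_add[OF KL(1)[OF that] KL(2)[OF that]])
 moreover have "jet (strip R) (%i p. J i p + H i p)" by (rule jet_add) (use assms in \<open>simp_all add: adm_def\<close>)
 moreover have "per R P (%p. J 0 p + H 0 p)" using assms unfolding adm_def per_def by simp
 ultimately show ?thesis unfolding adm_def by blast
qed

lemma adm_cmult: assumes "adm R P al J" shows "adm R P al (%i p. c * J i p)"
proof -
 obtain K where K: "!!i. i <= 5 ==> hb (strip R) al K (J i)" using assms unfolding adm_def by blast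
 have "hb (strip R) al (\<bar>c\<bar> * K) (%p. c * J i p)" if "i <= 5" for i by (rule hb_cmult[OF K[OF that]])
 moreover have "jet (strip R) (%i p. c * J i p)" by (rule jet_cmult) (use assms in \<open>simp add: adm_def\<close>)
 moreover have "per R P (%p. c * J 0 p)" using assms unfolding adm_def per_def by simp
 ultimately show ?thesis unfolding adm_def by blast
qed

lemma adm_per: "adm R P al J ==> R > 0 ==> i <= 5 ==> per R P (J i)"
 unfolding adm_def using per_jet by blast

text \<open>The admissible residual \<open>\<epsilon>\<close> depends on \<open>J0\<close> and
  \<open>l\<close> only through the bound \<open>B\<close>; the continuation needs exactly this
  uniformity. Convergence of the iterates is not shown: the total corrections stay bounded, the
  residuals tend to 0, and a limit along \<open>uf\<close> solves the equation.\<close>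

lemma newton:
 assumes R: "R > 0" and P: "P > 0" and al: "0 < al" "al < 1" and a: "a \<noteq> 0" and B: "B \<ge> 0"
 shows "\<exists>\<epsilon>>0. \<forall>J0 l r. adm R P al J0 --> per R P l --> hb (strip R) al B (%p. J0 3 p + l p) -->
   hb (strip R) al r (%p. FF a (J0 3 p + l p) (snd p) + 2 * J0 5 p) --> r <= \<epsilon> -->
   (\<exists>J. adm R P al J \<and> (\<forall>p\<in>strip R. FF a (J 3 p + l p) (snd p) + 2 * J 5 p = 0) \<and>
    (\<forall>x. J 0 (x, R) = J0 0 (x, R) \<and> J 0 (x, -R) = J0 0 (x, -R)))"
proof -
 have al1: "al <= 1" using al by simp
 define V where "V = B + 1"
 define \<mu> where "\<mu> = 1 / sqrt (V\<^sup>2 + R\<^sup>2 + a\<^sup>2)"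
 have mu: "\<mu> > 0" unfolding \<mu>_def using AA_base(1)[OF a, of V R] by simp
 define Ka where "Ka = LA a * (V + (1 + 2 * R))"
 obtain C where C: "C > 0" "!!A f J G i. (\<forall>p\<in>strip R. \<mu> <= A p \<and> A p <= 1 / \<bar>a\<bar>) ==> hol (strip R) al Ka A ==> hb (strip R) al G f ==> solves_linear R P al A f J ==> i <= 5 ==> hb (strip R) al (C * G) (J i)"
  using linear_estimate[OF R P al mu, of "1 / \<bar>a\<bar>" Ka] by blast
 define c where "c = LA a * (1 + V + (1 + 2 * R))"
 have c0: "c > 0" unfolding c_def V_def using LA_pos[OF a] B R by simp
 \<comment> \<open>The first bound keeps the total correction \<open>2 * C * r\<close> at most 1, so
   that the argument of \<open>FF\<close> never leaves the ball of radius \<open>V = B + 1\<close>.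
   The second makes the quadratic remainder at most half the previous residual.\<close>
 define \<epsilon> where "\<epsilon> = min (1 / (2 * C)) (1 / (4 * c * C\<^sup>2))"
 have e0: "\<epsilon> > 0" unfolding \<epsilon>_def using C(1) c0 by simp
 have main: "\<exists>J. adm R P al J \<and> (\<forall>p\<in>strip R. FF a (J 3 p + l p) (snd p) + 2 * J 5 p = 0) \<and>
    (\<forall>x. J 0 (x, R) = J0 0 (x, R) \<and> J 0 (x, -R) = J0 0 (x, -R))"
  if J0: "adm R P al J0" and l: "per R P l" and v0: "hb (strip R) al B (%p. J0 3 p + l p)"
   and res: "hb (strip R) al r (%p. FF a (J0 3 p + l p) (snd p) + 2 * J0 5 p)" and r: "r <= \<epsilon>" for J0 l r
 proof -
  have r0: "r \<ge> 0" by (rule hb_nonneg[OF res R])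
  have r1: "2 * C * r <= 1"
  proof -
   have "r <= 1 / (2 * C)" using r unfolding \<epsilon>_def by simp
   then show ?thesis using C(1) by (simp add: field_simps)
  qed
  have r2: "4 * c * C\<^sup>2 * r <= 1"
  proof -
   have "r <= 1 / (4 * c * C\<^sup>2)" using r unfolding \<epsilon>_def by simp
   then show ?thesis using C(1) c0 by (simp add: field_simps)
  qed
  define Q where "Q = (%n G. adm R P al G \<and> (\<forall>i\<le>5. hb (strip R) al (2 * C * r * (1 - 1 / 2 ^ n)) (G i)) \<and> (\<forall>x. G 0 (x, R) = 0 \<and> G 0 (x, -R) = 0) \<and>
    hb (strip R) al (r / 2 ^ n) (%p. FF a (J0 3 p + l p + G 3 p) (snd p) + 2 * (J0 5 p + G (5::nat) p)))"
  have pw: "2 * C * r * (1 - 1 / 2 ^ n) <= 2 * C * r" for n :: nat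
  proof -
   have "2 * C * r * (1 - 1 / 2 ^ n) <= 2 * C * r * 1" using C(1) r0 by (intro mult_left_mono) auto
   then show ?thesis by simp
  qed
  have ex: "\<exists>G. Q n G" for n
  proof (induction n)
   case 0
   have "adm R P al (%i p. 0 * J0 i p)" by (rule adm_cmult[OF J0])
   then have "Q 0 (%i p. 0)" using res unfolding Q_def by (simp add: hb_def hol_def)
   then show ?case by (rule exI[where x="%i p. 0"])
  next
   case (Suc n)
   then obtain G where G: "adm R P al G" "\<forall>i\<le>5. hb (strip R) al (2 * C * r * (1 - 1 / 2 ^ n)) (G i)" "\<forall>x. G 0 (x, R) = 0 \<and> G 0 (x, -R) = 0"
    "hb (strip R) al (r / 2 ^ n) (%p. FF a (J0 3 p + l p + G 3 p) (snd p) + 2 * (J0 5 p + G 5 p))" unfolding Q_def by blast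
   define v where "v = (%p. J0 3 p + l p + G 3 p)"
   define \<rho> where "\<rho> = (%p. FF a (v p) (snd p) + 2 * (J0 5 p + G 5 p))"
   have h\<rho>: "hb (strip R) al (r / 2 ^ n) \<rho>" using G(4) unfolding \<rho>_def v_def .
   have hv: "hb (strip R) al V v"
   proof (rule hb_mono)
    show "hb (strip R) al (B + 2 * C * r * (1 - 1 / 2 ^ n)) v" unfolding v_def by (rule hb_add[OF v0]) (use G(2) in simp)
    show "B + 2 * C * r * (1 - 1 / 2 ^ n) <= V" unfolding V_def using pw[of n] r1 by linarith
   qed
   have perv: "per R P v" using adm_per[OF J0 R, of 3] adm_per[OF G(1) R, of 3] l unfolding per_def v_def by simp
   have per\<rho>: "per R P \<rho>" using perv adm_per[OF J0 R, of 5] adm_per[OF G(1) R, of 5] unfolding per_def \<rho>_def by simp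
   define A where "A = (%p. AA a (v p) (snd p))"
   have Ab: "\<forall>p\<in>strip R. \<mu> <= A p \<and> A p <= 1 / \<bar>a\<bar>"
   proof
    fix p assume p: "p \<in> strip R"
    have "\<bar>v p\<bar> <= V" "\<bar>snd p\<bar> <= R" using hv p unfolding hb_def by (auto simp: mem_strip)
    then show "\<mu> <= A p \<and> A p <= 1 / \<bar>a\<bar>" unfolding A_def \<mu>_def using AA_ge[OF a] AA_le[OF a] by blast
   qed
   have hV: "hol (strip R) al V v" using hv unfolding hb_def by blast
   have hA: "hol (strip R) al Ka A" unfolding A_def Ka_def by (rule hol_AA[OF a al(1) al1 R hV])
   have pA: "per R P A" using perv unfolding per_def A_def by simp
   have h\<rho>': "hb (strip R) al (r / 2 ^ n) (%p. - \<rho> p)" by (rule hb_minus[OF h\<rho>])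
   have "per R P (%p. - \<rho> p)" using per\<rho> unfolding per_def by simp
   from linear_solvable[OF R P al mu Ab hA pA h\<rho>' this] obtain D where D: "solves_linear R P al A (%p. - \<rho> p) D" by (rule exE)
   have Db: "hb (strip R) al (C * (r / 2 ^ n)) (D i)" if "i <= 5" for i by (rule C(2)[OF Ab hA h\<rho>' D that])
   have aD: "adm R P al D" using D unfolding solves_linear_def adm_def by blast
   have "Q (Suc n) (%i p. G i p + D i p)"
    unfolding Q_def
   proof (intro conjI)
    show "adm R P al (%i p. G i p + D i p)" by (rule adm_add[OF G(1) aD])
    show "\<forall>i\<le>5. hb (strip R) al (2 * C * r * (1 - 1 / 2 ^ Suc n)) (%p. G i p + D i p)"
    proof (intro allI impI)
     fix i :: nat assume i: "i <= 5"
     have "hb (strip R) al (2 * C * r * (1 - 1 / 2 ^ n) + C * (r / 2 ^ n)) (%p. G i p + D i p)"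
      by (rule hb_add[OF _ Db[OF i]]) (use G(2) i in simp)
     moreover have "2 * C * r * (1 - 1 / 2 ^ n) + C * (r / 2 ^ n) = 2 * C * r * (1 - 1 / 2 ^ Suc n)" by (simp add: field_simps)
     ultimately show "hb (strip R) al (2 * C * r * (1 - 1 / 2 ^ Suc n)) (%p. G i p + D i p)" by simp
    qed
    show "\<forall>x. G 0 (x, R) + D 0 (x, R) = 0 \<and> G 0 (x, -R) + D 0 (x, -R) = 0" using G(3) D unfolding solves_linear_def by simp
    have hE: "hb (strip R) al (2 * (C * (r / 2 ^ n)) * (c * (C * (r / 2 ^ n)))) (%p. D 3 p * DD a (v p) (D 3 p) (snd p))"
     unfolding c_def by (rule hb_remainder[OF a al(1) al1 R hV Db]) simp
    have small: "2 * (C * (r / 2 ^ n)) * (c * (C * (r / 2 ^ n))) <= r / 2 ^ Suc n"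
    proof -
     define x where "x = r / 2 ^ n"
     have x: "0 <= x" "x <= r" unfolding x_def using r0 by (auto simp: divide_le_eq mult_le_cancel_left1)
     have "2 * (C * x) * (c * (C * x)) = (4 * c * C\<^sup>2 * x) * (x / 2)" by (simp add: power2_eq_square)
     also have "\<dots> <= 1 * (x / 2)"
     proof (rule mult_right_mono)
      have "4 * c * C\<^sup>2 * x <= 4 * c * C\<^sup>2 * r" using x c0 by (intro mult_left_mono) auto
      then show "4 * c * C\<^sup>2 * x <= 1" using r2 by linarith
     qed (use x in simp)
     finally show ?thesis unfolding x_def by simp
    qed
    \<comment> \<open>The choice of \<open>D\<close> cancels the old residual and all linear terms,
      so the new residual is exactly the second order remainder.\<close>
    have "FF a (J0 3 p + l p + (G 3 p + D 3 p)) (snd p) + 2 * (J0 5 p + (G 5 p + D 5 p)) = D 3 p * DD a (v p) (D 3 p) (snd p)" if p: "p \<in> strip R" for p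
    proof -
     have "FF a (v p + D 3 p) (snd p) = FF a (v p) (snd p) + AA a (v p) (snd p) * D 3 p + D 3 p * DD a (v p) (D 3 p) (snd p)"
      by (rule FF_second_order[OF a])
     moreover have "AA a (v p) (snd p) * D 3 p + 2 * D 5 p = - \<rho> p" using D p unfolding solves_linear_def A_def by blast
     ultimately show ?thesis unfolding \<rho>_def v_def by (simp add: algebra_simps)
    qed
    then show "hb (strip R) al (r / 2 ^ Suc n) (%p. FF a (J0 3 p + l p + (G 3 p + D 3 p)) (snd p) + 2 * (J0 5 p + (G 5 p + D 5 p)))"
     using hb_mono[OF hE small] unfolding hb_def hol_def by simp
   qed
   then show ?case by (rule exI[where x="%i p. G i p + D i p"])
  qed
  have "\<forall>n. \<exists>G. Q n G" using ex by blast
  from choice[OF this] obtain G where G: "\<forall>n. Q n (G n)" by (rule exE)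
  have Gj: "jet (strip R) (G n)" for n using spec[OF G, of n] unfolding Q_def adm_def by blast
  have Gb: "hb (strip R) al (2 * C * r) (G n i)" if i: "i <= 5" for n i
  proof (rule hb_mono[OF _ pw])
   show "hb (strip R) al (2 * C * r * (1 - 1 / 2 ^ n)) (G n i)" using spec[OF G, of n] i unfolding Q_def by blast
  qed
  have "\<exists>H. jet (strip R) H \<and> (\<forall>i\<le>5. hb (strip R) al (2 * C * r) (H i)) \<and> (\<forall>i\<le>5. \<forall>p\<in>strip R. ((%n. G n i p) \<longlongrightarrow> H i p) uf)"
   by (rule uf_jet[OF Gj _ al(1)]) (use Gb C(1) r0 in simp_all)
  then obtain H where H: "jet (strip R) H" "\<forall>i\<le>5. hb (strip R) al (2 * C * r) (H i)" and H': "\<forall>i\<le>5. \<forall>p\<in>strip R. ((%n. G n i p) \<longlongrightarrow> H i p) uf"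
   by (rule exE) (elim conjE, rule that)
  note Hl = bspec[OF mp[OF spec[OF H']]]
  have "per R P (H 0)" unfolding per_def
  proof
   fix p assume p: "p \<in> strip R"
   have "G n 0 (p + (P, 0)) = G n 0 p" for n using spec[OF G, of n] p unfolding Q_def adm_def per_def by blast
   then have "((%n. G n 0 p) \<longlongrightarrow> H 0 (p + (P, 0))) uf" using Hl[of 0 "p + (P, 0)"] p by simp
   from uf_lim_unique[OF this Hl[of 0 p]] p show "H 0 (p + (P, 0)) = H 0 p" by simp
  qed
  then have aH: "adm R P al H" using H unfolding adm_def by blast
  have "FF a (J0 3 p + H 3 p + l p) (snd p) + 2 * (J0 5 p + H 5 p) = 0" if p: "p \<in> strip R" for p
  proof (rule uf_lim_unique)
   have l3: "((%n. J0 3 p + l p + G n 3 p) \<longlongrightarrow> J0 3 p + l p + H 3 p) uf"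
    by (intro tendsto_add tendsto_const Hl p) simp
   have "isCont (%v. FF a v (snd p)) (J0 3 p + l p + H 3 p)" by (rule DERIV_isCont[OF FF_deriv[OF a]])
   from isCont_tendsto_compose[OF this l3]
   have "((%n. FF a (J0 3 p + l p + G n 3 p) (snd p) + 2 * (J0 5 p + G n 5 p)) \<longlongrightarrow> FF a (J0 3 p + l p + H 3 p) (snd p) + 2 * (J0 5 p + H 5 p)) uf"
    by (intro tendsto_add tendsto_mult tendsto_const Hl p) simp_all
   then show "((%n. FF a (J0 3 p + l p + G n 3 p) (snd p) + 2 * (J0 5 p + G n 5 p)) \<longlongrightarrow> FF a (J0 3 p + H 3 p + l p) (snd p) + 2 * (J0 5 p + H 5 p)) uf"
    by (simp add: add_ac)
   have "(%n. r * (1/2) ^ n) \<longlonglongrightarrow> r * 0" by (intro tendsto_mult tendsto_const LIMSEQ_realpow_zero) auto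
   then have l0: "((%n. r * (1/2) ^ n) \<longlongrightarrow> 0) uf" using tendsto_uf by simp
   show "((%n. FF a (J0 3 p + l p + G n 3 p) (snd p) + 2 * (J0 5 p + G n 5 p)) \<longlongrightarrow> 0) uf"
   proof (rule Lim_null_comparison[OF always_eventually l0], rule allI)
    fix n
    have "hb (strip R) al (r / 2 ^ n) (%p. FF a (J0 3 p + l p + G n 3 p) (snd p) + 2 * (J0 5 p + G n 5 p))"
     using spec[OF G, of n] unfolding Q_def by blast
    then show "norm (FF a (J0 3 p + l p + G n 3 p) (snd p) + 2 * (J0 5 p + G n 5 p)) <= r * (1/2) ^ n"
     using p unfolding hb_def by (simp add: power_divide)
   qed
  qed
  moreover have "H 0 (x, s) = 0" if s: "s \<in> {R, -R}" for x s
  proof -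
   have m: "(x, s) \<in> strip R" using s R by (auto simp: mem_strip)
   have "G n 0 (x, s) = 0" for n using spec[OF G, of n] s unfolding Q_def by blast
   then have "((%n. 0) \<longlongrightarrow> H 0 (x, s)) uf" using Hl[OF _ m, of 0] by simp
   from uf_lim_unique[OF tendsto_const this] show ?thesis by simp
  qed
  ultimately show ?thesis
   using adm_add[OF J0 aH] by (intro exI[of _ "%i p. J0 i p + H i p"]) simp
 qed
 show ?thesis
  by (rule exI[of _ \<epsilon>], intro conjI allI impI e0, rule main)
qed

subsection \<open>Tangential regularity\<close>

lemma hbD: "hb S al K f ==> p \<in> S ==> q \<in> S ==> \<bar>f p - f q\<bar> <= K * dist p q powr al"
 unfolding hb_def hol_def by blast

text \<open>Weaker than \<open>grad\<close>: nothing is required in \<open>y\<close>, so tangential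
  smoothness can be counted before normal derivatives are available.\<close>

definition dx :: "real => (real \<times> real => real) => (real \<times> real => real) => bool" where
 "dx R f f1 \<longleftrightarrow> (\<forall>p\<in>strip R. ((%t. f (p + (t, 0))) has_real_derivative f1 p) (at 0))"

lemma dx_at: assumes "dx R f f1" "p \<in> strip R" shows "((%t. f (p + (t, 0))) has_real_derivative f1 (p + (t, 0))) (at t)"
proof -
 have "((%s. f (p + (t, 0) + (s, 0))) has_real_derivative f1 (p + (t, 0))) (at 0)" using assms unfolding dx_def by simp
 moreover have "p + (t, 0) + (s, 0) = p + (s + t, 0)" for s by (simp add: prod_eq_iff)
 ultimately have "((%s. f (p + (s + t, 0))) has_real_derivative f1 (p + (t, 0))) (at 0)" by simp
 then show ?thesis using DERIV_shift[of "%s. f (p + (s, 0))" "f1 (p + (t, 0))" 0 t] by simp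
qed

lemma grad_dx: assumes "grad (strip R) f f1 f2" shows "dx R f f1"
 unfolding dx_def
proof
 fix p assume p: "p \<in> strip R"
 have "((%s. f (p + s *\<^sub>R (1,0))) has_real_derivative fst (1::real,0::real) * f1 (p + 0 *\<^sub>R (1,0)) + snd (1::real,0::real) * f2 (p + 0 *\<^sub>R (1,0))) (at 0 within UNIV)"
  by (rule grad_line[OF assms]) (use p in simp_all)
 then show "((%t. f (p + (t, 0))) has_real_derivative f1 p) (at 0)" by simp
qed

lemma dx_unique: assumes "dx R f f1" "dx R g g1" "!!p. p \<in> strip R ==> f p = g p" "p \<in> strip R" shows "f1 p = g1 p"
proof -
 have "((%t. f (p + (t, 0))) has_real_derivative f1 p) (at 0)" using assms(1,4) unfolding dx_def by blast
 moreover have "(%t. f (p + (t, 0))) = (%t. g (p + (t, 0)))" using assms(3,4) by simp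
 moreover have "((%t. g (p + (t, 0))) has_real_derivative g1 p) (at 0)" using assms(2,4) unfolding dx_def by blast
 ultimately show ?thesis using DERIV_unique by metis
qed

definition quot :: "real => (real \<times> real => real) => real \<times> real => real" where
 "quot h f p = (1 / h) * (f (p + (h, 0)) - f p)"

lemma real_quot:
 fixes \<phi> :: "real => real"
 assumes "h > 0" "!!t. (\<phi> has_real_derivative \<phi>' t) (at t)"
 shows "\<exists>\<xi>. (1 / h) * (\<phi> h - \<phi> 0) = \<phi>' \<xi>"
proof -
 have "\<exists>z>0. z < h \<and> \<phi> h - \<phi> 0 = (h - 0) * \<phi>' z" by (rule MVT2[OF assms(1)]) (rule assms(2))
 then obtain z where "\<phi> h - \<phi> 0 = h * \<phi>' z" by auto
 then show ?thesis using assms(1) by (intro exI[of _ z]) simp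
qed

text \<open>For the seminorm, the mean value theorem is applied to the difference of
  \<open>f\<close> along two parallel lines, which yields the same shift \<open>\<xi>\<close> for
  both points.\<close>

lemma quot_hb:
 assumes d: "dx R f f1" and h: "h > 0" and K: "hb (strip R) al K f1"
 shows "hb (strip R) al K (quot h f)"
 unfolding hb_def hol_def
proof (intro conjI ballI)
 fix p assume p: "p \<in> strip R"
 obtain \<xi> where "(1 / h) * (f (p + (h, 0)) - f (p + (0, 0))) = f1 (p + (\<xi>, 0))"
  using real_quot[OF h dx_at[OF d p]] by blast
 then have "quot h f p = f1 (p + (\<xi>, 0))" unfolding quot_def by simp
 then show "\<bar>quot h f p\<bar> <= K" using K p unfolding hb_def by simp
next
 fix p q assume p: "p \<in> strip R" and q: "q \<in> strip R"
 have "((%t. f (p + (t, 0)) - f (q + (t, 0))) has_real_derivative f1 (p + (t, 0)) - f1 (q + (t, 0))) (at t)" for t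
  by (intro DERIV_diff dx_at[OF d] p q)
 from real_quot[OF h this] obtain \<xi> where
  "(1 / h) * (f (p + (h, 0)) - f (q + (h, 0)) - (f (p + (0, 0)) - f (q + (0, 0)))) = f1 (p + (\<xi>, 0)) - f1 (q + (\<xi>, 0))" by blast
 then have e: "quot h f p - quot h f q = f1 (p + (\<xi>, 0)) - f1 (q + (\<xi>, 0))" unfolding quot_def by (simp add: algebra_simps)
 have "\<bar>f1 (p + (\<xi>, 0)) - f1 (q + (\<xi>, 0))\<bar> <= K * dist (p + (\<xi>, 0)) (q + (\<xi>, 0)) powr al"
  by (rule hbD[OF K]) (simp_all add: p q)
 then show "\<bar>quot h f p - quot h f q\<bar> <= K * dist p q powr al" unfolding e by simp
qed

definition hs :: "nat => real" where "hs n = 1 / (real n + 1)"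

lemma hs_pos: "hs n > 0" unfolding hs_def by simp

lemma hs_lim: "hs \<longlonglongrightarrow> 0"
 unfolding hs_def using LIMSEQ_inverse_real_of_nat by (simp add: inverse_eq_divide add.commute)

lemma quot_lim:
 assumes "dx R f f1" "p \<in> strip R" shows "(%n. quot (hs n) f p) \<longlonglongrightarrow> f1 p"
proof -
 have "((%t. f (p + (t, 0))) has_real_derivative f1 p) (at 0)" using assms unfolding dx_def by blast
 then have 1: "((%h. (f (p + (0 + h, 0)) - f (p + (0, 0))) / h) \<longlongrightarrow> f1 p) (at 0)" unfolding DERIV_def .
 have "filterlim hs (at 0) sequentially" by (rule filterlim_atI[OF hs_lim]) (use hs_pos in \<open>auto simp: less_imp_neq[symmetric]\<close>)
 from filterlim_compose[OF 1 this] show ?thesis unfolding quot_def by simp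
qed

lemma jet_shift: assumes "jet (strip R) J" shows "jet (strip R) (%i p. J i (p + (s, 0)))"
proof -
 have g: "grad (strip R) (%p. f (p + (s, 0))) (%p. f1 (p + (s, 0))) (%p. f2 (p + (s, 0)))" if "grad (strip R) f f1 f2" for f f1 f2
 proof -
  have "grad {z. (s,0) + 1 *\<^sub>R z \<in> strip R} (%z. f ((s,0) + 1 *\<^sub>R z)) (%z. 1 * f1 ((s,0) + 1 *\<^sub>R z)) (%z. 1 * f2 ((s,0) + 1 *\<^sub>R z))"
   by (rule grad_affine[OF that])
  moreover have "{z. (s,0) + 1 *\<^sub>R z \<in> strip R} = strip R" by (simp add: mem_strip set_eq_iff)
  ultimately show ?thesis by (simp add: add.commute)
 qed
 show ?thesis using assms unfolding jet_def by (simp add: g)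
qed

lemma hb_shift: assumes "hb (strip R) al K f" shows "hb (strip R) al K (%p. f (p + (s, 0)))"
 unfolding hb_def hol_def
proof (intro conjI ballI)
 fix p assume "p \<in> strip R" then show "\<bar>f (p + (s, 0))\<bar> <= K" using assms unfolding hb_def by simp
next
 fix p q assume "p \<in> strip R" "q \<in> strip R"
 then have "\<bar>f (p + (s, 0)) - f (q + (s, 0))\<bar> <= K * dist (p + (s, 0)) (q + (s, 0)) powr al"
  by (intro hbD[OF assms]) simp_all
 then show "\<bar>f (p + (s, 0)) - f (q + (s, 0))\<bar> <= K * dist p q powr al" by simp
qed

lemma quot_jet: assumes "jet (strip R) J" shows "jet (strip R) (%i. quot h (J i))"
proof -
 have "jet (strip R) (%i p. (1 / h) * (J i (p + (h, 0)) - J i p))"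
  by (rule jet_cmult[OF jet_diff[OF jet_shift[OF assms] assms]])
 then show ?thesis unfolding quot_def .
qed

text \<open>The difference quotients of the jet solve linear equations with uniform data: their sup
  norms are controlled by \<open>J 1\<close>, their edge values by \<open>\<beta>'\<close>. The
  Schauder estimate therefore bounds them uniformly, and a limit is the jet of
  \<open>J 1\<close>.\<close>

lemma tangential:
 assumes R: "R > 0" and al: "0 < al" "al < 1" and mu: "0 < \<mu>" and J: "adm R P al J"
  and A: "!!n. \<forall>p\<in>strip R. \<mu> <= A n p \<and> A n p <= \<Lambda>" "!!n. hol (strip R) al Ka (A n)" "!!p. p \<in> strip R ==> (%n. A n p) \<longlonglongrightarrow> A' p"
  and eq: "!!n p. p \<in> strip R ==> A n p * quot (hs n) (J 3) p + 2 * quot (hs n) (J 5) p = f n p"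
  and f: "!!n. hol (strip R) al Kf (f n)" "!!p. p \<in> strip R ==> (%n. f n p) \<longlonglongrightarrow> f' p"
  and bd: "!!s x. s \<in> {R,-R} ==> J 3 (x, s) = \<beta> s x" "!!s x. s \<in> {R,-R} ==> (\<beta> s has_real_derivative \<beta>' s x) (at x)" "!!s. s \<in> {R,-R} ==> hol UNIV al Kb (\<beta>' s)"
 shows "\<exists>G. adm R P al G \<and> (\<forall>p\<in>strip R. G 0 p = J 1 p) \<and> (\<forall>p\<in>strip R. A' p * G 3 p + 2 * G 5 p = f' p)"
proof -
 obtain C where C: "C > 0" "!!J A f G i. schauder_setting al \<mu> \<Lambda> Ka G R J A f ==> i <= 5 ==> hb (strip R) al (C * G) (J i)"
  using schauder_full[OF al mu R, of \<Lambda> Ka] by blast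
 obtain K where K: "!!i. i <= 5 ==> hb (strip R) al K (J i)" using J unfolding adm_def by blast
 have Jj: "jet (strip R) J" using J unfolding adm_def by blast
 have g: "grad (strip R) (J 0) (J 1) (J 2)" "grad (strip R) (J 1) (J 3) (J 4)" using Jj unfolding jet_def by auto
 define G0 where "G0 = max (max K Kf) (max Kb 0)"
 have G0: "K <= G0" "Kf <= G0" "Kb <= G0" "0 <= G0" unfolding G0_def by auto
 define D where "D = (%n i. quot (hs n) (J i))"
 have Dj: "jet (strip R) (D n)" for n unfolding D_def by (rule quot_jet[OF Jj])
 have set: "schauder_setting al \<mu> \<Lambda> Ka G0 R (D n) (A n) (f n)" for n
  unfolding schauder_setting_def
 proof (intro conjI)
  show "jet (strip R) (D n)" by (rule Dj)
  show "\<exists>K. \<forall>i\<in>{3, 4, 5}. hol (strip R) al K (D n i)"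
  proof (intro exI ballI)
   fix i :: nat assume "i \<in> {3,4,5}"
   then have "i <= 5" by auto
   then have "hb (strip R) al (\<bar>1 / hs n\<bar> * (K + K)) (D n i)"
    unfolding D_def quot_def by (intro hb_cmult hb_diff hb_shift K)
   then show "hol (strip R) al (\<bar>1 / hs n\<bar> * (K + K)) (D n i)" unfolding hb_def by blast
  qed
  show "\<forall>p\<in>strip R. \<mu> <= A n p \<and> A n p <= \<Lambda>" "hol (strip R) al Ka (A n)" by (rule A)+
  show "\<forall>p\<in>strip R. A n p * D n 3 p + 2 * D n 5 p = f n p" unfolding D_def using eq by blast
  show "hol (strip R) al G0 (f n)" by (rule hol_mono[OF f(1) G0(2)])
  show "\<forall>p\<in>strip R. \<bar>D n 0 p\<bar> <= G0"
  proof
   fix p assume p: "p \<in> strip R"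
   have "hb (strip R) al K (D n 0)" unfolding D_def by (rule quot_hb[OF grad_dx[OF g(1)] hs_pos K]) simp
   then show "\<bar>D n 0 p\<bar> <= G0" using p G0(1) unfolding hb_def by force
  qed
  show "\<forall>s\<in>{R, - R}. \<forall>x x'. \<bar>D n 3 (x, s) - D n 3 (x', s)\<bar> <= G0 * \<bar>x - x'\<bar> powr al"
  proof (intro ballI allI)
   fix s x x' assume s: "s \<in> {R, -R}"
   have "((%t. \<beta> s (x + t) - \<beta> s (x' + t)) has_real_derivative \<beta>' s (x + t) - \<beta>' s (x' + t)) (at t)" for t
   proof -
    have sh: "((%t. \<beta> s (c + t)) has_real_derivative \<beta>' s (c + t)) (at t)" for c
     using DERIV_shift[of "\<beta> s" "\<beta>' s (c + t)" t c] bd(2)[OF s, of "c + t"] by (simp add: add.commute)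
    show ?thesis by (intro DERIV_diff sh)
   qed
   from real_quot[OF hs_pos this] obtain \<xi> where
    "(1 / hs n) * (\<beta> s (x + hs n) - \<beta> s (x' + hs n) - (\<beta> s (x + 0) - \<beta> s (x' + 0))) = \<beta>' s (x + \<xi>) - \<beta>' s (x' + \<xi>)" by blast
   then have "D n 3 (x, s) - D n 3 (x', s) = \<beta>' s (x + \<xi>) - \<beta>' s (x' + \<xi>)"
    unfolding D_def quot_def using bd(1)[OF s] by (simp add: algebra_simps)
   moreover have "\<bar>\<beta>' s (x + \<xi>) - \<beta>' s (x' + \<xi>)\<bar> <= Kb * dist (x + \<xi>) (x' + \<xi>) powr al"
    using bd(3)[OF s] unfolding hol_def by blast
   moreover have "Kb * dist (x + \<xi>) (x' + \<xi>) powr al <= G0 * \<bar>x - x'\<bar> powr al"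
    using G0(3) by (simp add: dist_real_def mult_right_mono)
   ultimately show "\<bar>D n 3 (x, s) - D n 3 (x', s)\<bar> <= G0 * \<bar>x - x'\<bar> powr al" by simp
  qed
 qed
 have Db: "hb (strip R) al (C * G0) (D n i)" if "i <= 5" for n i by (rule C(2)[OF set that])
 have "\<exists>H. jet (strip R) H \<and> (\<forall>i\<le>5. hb (strip R) al (C * G0) (H i)) \<and> (\<forall>i\<le>5. \<forall>p\<in>strip R. ((%n. D n i p) \<longlongrightarrow> H i p) uf)"
  by (rule uf_jet[OF Dj _ al(1)]) (use Db C(1) G0(4) in simp_all)
 then obtain H where H: "jet (strip R) H" "\<forall>i\<le>5. hb (strip R) al (C * G0) (H i)" and H': "\<forall>i\<le>5. \<forall>p\<in>strip R. ((%n. D n i p) \<longlongrightarrow> H i p) uf"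
  by (rule exE) (elim conjE, rule that)
 note Hl = bspec[OF mp[OF spec[OF H']]]
 have H0: "H 0 p = J 1 p" if p: "p \<in> strip R" for p
 proof -
  have "((%n. D n 0 p) \<longlongrightarrow> J 1 p) uf" unfolding D_def by (rule tendsto_uf[OF quot_lim[OF grad_dx[OF g(1)] p]])
  from uf_lim_unique[OF Hl[of 0 p] this] p show ?thesis by simp
 qed
 have "A' p * H 3 p + 2 * H 5 p = f' p" if p: "p \<in> strip R" for p
 proof (rule uf_lim_unique)
  show "((%n. A n p * D n 3 p + 2 * D n 5 p) \<longlongrightarrow> A' p * H 3 p + 2 * H 5 p) uf"
   by (intro tendsto_add tendsto_mult tendsto_const tendsto_uf[OF A(3)[OF p]] Hl p) simp_all
  have "A n p * D n 3 p + 2 * D n 5 p = f n p" for n unfolding D_def by (rule eq[OF p])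
  then show "((%n. A n p * D n 3 p + 2 * D n 5 p) \<longlongrightarrow> f' p) uf" using tendsto_uf[OF f(2)[OF p]] by simp
 qed
 moreover have "per R P (H 0)"
 proof -
  have "per R P (J 1)" by (rule adm_per[OF J R]) simp
  then show ?thesis using H0 unfolding per_def by simp
 qed
 ultimately show ?thesis unfolding adm_def using H H0 by blast
qed

lemma AB_same: "AB a v v y = AA a v y"
 unfolding AB_def by simp

text \<open>With the averaged coefficient \<open>AB\<close> the difference quotient of
  \<open>FF\<close> is exactly linear, so no remainder appears; \<open>l\<close> drops out because
  it does not depend on \<open>x\<close>.\<close>

lemma first_step:
 assumes R: "R > 0" and al: "0 < al" "al < 1" and a: "a \<noteq> 0" and J: "adm R P al J"
  and l: "!!p h. l (p + (h, 0)) = l p" and lb: "hb (strip R) al Kl l"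
  and eq: "!!p. p \<in> strip R ==> FF a (J 3 p + l p) (snd p) + 2 * J 5 p = 0"
  and bd: "!!s x. s \<in> {R,-R} ==> J 3 (x, s) = \<beta> s x" "!!s x. s \<in> {R,-R} ==> (\<beta> s has_real_derivative \<beta>' s x) (at x)" "!!s. s \<in> {R,-R} ==> hol UNIV al Kb (\<beta>' s)"
 shows "\<exists>G. adm R P al G \<and> (\<forall>p\<in>strip R. G 0 p = J 1 p) \<and> (\<forall>p\<in>strip R. AA a (J 3 p + l p) (snd p) * G 3 p + 2 * G 5 p = 0)"
proof -
 have al1: "al <= 1" using al by simp
 obtain K where K: "!!i. i <= 5 ==> hb (strip R) al K (J i)" using J unfolding adm_def by blast
 define v where "v = (%p. J 3 p + l p)"
 define V where "V = K + Kl"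
 have hv: "hb (strip R) al V v" unfolding v_def V_def by (intro hb_add K lb) simp
 define \<mu> where "\<mu> = 1 / sqrt (V\<^sup>2 + R\<^sup>2 + a\<^sup>2)"
 have mu: "\<mu> > 0" unfolding \<mu>_def using AA_base(1)[OF a, of V R] by simp
 define A where "A = (%n p. AB a (v p) (v (p + (hs n, 0))) (snd p))"
 have vs: "hb (strip R) al V (%p. v (p + (hs n, 0)))" for n by (rule hb_shift[OF hv])
 have "\<exists>G. adm R P al G \<and> (\<forall>p\<in>strip R. G 0 p = J 1 p) \<and> (\<forall>p\<in>strip R. AA a (v p) (snd p) * G 3 p + 2 * G 5 p = 0)"
 proof (rule tangential[OF R al mu J _ _ _ _ _ _ bd])
  show "\<forall>p\<in>strip R. \<mu> <= A n p \<and> A n p <= 1 / \<bar>a\<bar>" for n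
  proof
   fix p assume p: "p \<in> strip R"
   have "\<bar>v p\<bar> <= V" "\<bar>v (p + (hs n, 0))\<bar> <= V" "\<bar>snd p\<bar> <= R" using hv vs p unfolding hb_def by (auto simp: mem_strip)
   from AB_bounds[OF a this] show "\<mu> <= A n p \<and> A n p <= 1 / \<bar>a\<bar>" unfolding A_def \<mu>_def by blast
  qed
  show "hol (strip R) al (LA a * (V + V + (1 + 2 * R))) (A n)" for n
   unfolding A_def by (rule hol_AB[OF a al(1) al1 R]) (use hv vs in \<open>simp_all add: hb_def\<close>)
  show "(%n. A n p) \<longlonglongrightarrow> AA a (v p) (snd p)" if p: "p \<in> strip R" for p
  proof -
   have l1: "(%n. v (p + (hs n, 0))) \<longlonglongrightarrow> v p"
   proof -
    have cv: "continuous_on (strip R) v" by (rule hb_continuous[OF hv al(1)])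
    have "(%n. p + (hs n, 0)) \<longlonglongrightarrow> p + (0, 0)" by (intro tendsto_intros hs_lim)
    then have "(%n. p + (hs n, 0)) \<longlonglongrightarrow> p" by simp
    from continuous_on_tendsto_compose[OF cv this] p show ?thesis by simp
   qed
   have l0: "(%n. LA a * \<bar>v (p + (hs n, 0)) - v p\<bar>) \<longlonglongrightarrow> LA a * \<bar>v p - v p\<bar>" by (intro tendsto_intros l1)
   have "(%n. A n p - AA a (v p) (snd p)) \<longlonglongrightarrow> 0"
   proof (rule Lim_null_comparison[OF always_eventually l0[simplified]], rule allI)
    fix n
    show "norm (A n p - AA a (v p) (snd p)) <= LA a * \<bar>v (p + (hs n, 0)) - v p\<bar>"
     using AB_lipschitz[OF a, of "v p" "v (p + (hs n, 0))" "snd p" "v p" "v p" "snd p"] unfolding A_def AB_same by simp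
   qed
   then show ?thesis by (simp add: LIM_zero_iff)
  qed
  show "A n p * quot (hs n) (J 3) p + 2 * quot (hs n) (J 5) p = 0" if p: "p \<in> strip R" for n p
  proof -
   have "FF a (v (p + (hs n, 0))) (snd p) - FF a (v p) (snd p) = (v (p + (hs n, 0)) - v p) * A n p"
    unfolding A_def by (rule FF_diff[OF a])
   moreover have "FF a (v (p + (hs n, 0))) (snd p) = - 2 * J 5 (p + (hs n, 0))" using eq[of "p + (hs n, 0)"] p unfolding v_def by simp
   moreover have "FF a (v p) (snd p) = - 2 * J 5 p" using eq[OF p] unfolding v_def by simp
   moreover have "v (p + (hs n, 0)) - v p = J 3 (p + (hs n, 0)) - J 3 p" unfolding v_def l by simp
   ultimately have e: "A n p * (J 3 (p + (hs n, 0)) - J 3 p) + 2 * (J 5 (p + (hs n, 0)) - J 5 p) = 0" by (simp add: algebra_simps)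
   have "A n p * quot (hs n) (J 3) p + 2 * quot (hs n) (J 5) p = (1 / hs n) * (A n p * (J 3 (p + (hs n, 0)) - J 3 p) + 2 * (J 5 (p + (hs n, 0)) - J 5 p))"
    unfolding quot_def by (simp add: algebra_simps)
   then show ?thesis unfolding e by simp
  qed
  show "hol (strip R) al 0 (%p. 0)" unfolding hol_def by simp
  show "(%n. 0) \<longlonglongrightarrow> 0" by simp
 qed
 then show ?thesis unfolding v_def .
qed

text \<open>The discrete product rule leaves the shifted coefficient in front of the quotient of
  \<open>J 3\<close> and moves the quotient of \<open>A\<close> to the right-hand side, where it
  multiplies \<open>J 3\<close> at the unshifted point.\<close>

lemma next_step:
 assumes R: "R > 0" and al: "0 < al" "al < 1" and mu: "0 < \<mu>" and J: "adm R P al J"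
  and A: "\<forall>p\<in>strip R. \<mu> <= A p \<and> A p <= \<Lambda>" "hb (strip R) al Ka A" "dx R A A1" "hb (strip R) al Ka1 A1"
  and f: "dx R f f1" "hb (strip R) al Kf f1"
  and eq: "!!p. p \<in> strip R ==> A p * J 3 p + 2 * J 5 p = f p"
  and bd: "!!s x. s \<in> {R,-R} ==> J 3 (x, s) = \<beta> s x" "!!s x. s \<in> {R,-R} ==> (\<beta> s has_real_derivative \<beta>' s x) (at x)" "!!s. s \<in> {R,-R} ==> hol UNIV al Kb (\<beta>' s)"
 shows "\<exists>G. adm R P al G \<and> (\<forall>p\<in>strip R. G 0 p = J 1 p) \<and> (\<forall>p\<in>strip R. A p * G 3 p + 2 * G 5 p = f1 p - A1 p * J 3 p)"
proof -
 obtain K where K: "!!i. i <= 5 ==> hb (strip R) al K (J i)" using J unfolding adm_def by blast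
 show ?thesis
 proof (rule tangential[OF R al mu J _ _ _ _ _ _ bd])
  show "\<forall>p\<in>strip R. \<mu> <= A (p + (hs n, 0)) \<and> A (p + (hs n, 0)) <= \<Lambda>" for n using A(1) by simp
  show "hol (strip R) al Ka (%p. A (p + (hs n, 0)))" for n using hb_shift[OF A(2)] unfolding hb_def by blast
  show "(%n. A (p + (hs n, 0))) \<longlonglongrightarrow> A p" if p: "p \<in> strip R" for p
  proof -
   have "(%n. A p + hs n * quot (hs n) A p) \<longlonglongrightarrow> A p + 0 * A1 p" by (intro tendsto_add tendsto_mult tendsto_const hs_lim quot_lim[OF A(3) p])
   moreover have "A p + hs n * quot (hs n) A p = A (p + (hs n, 0))" for n unfolding quot_def using hs_pos[of n] by simp
   ultimately show ?thesis by simp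
  qed
  show "A (p + (hs n, 0)) * quot (hs n) (J 3) p + 2 * quot (hs n) (J 5) p = quot (hs n) f p - quot (hs n) A p * J 3 p" if p: "p \<in> strip R" for n p
  proof -
   have "A (p + (hs n, 0)) * J 3 (p + (hs n, 0)) + 2 * J 5 (p + (hs n, 0)) = f (p + (hs n, 0))" using eq[of "p + (hs n, 0)"] p by simp
   moreover have "A p * J 3 p + 2 * J 5 p = f p" by (rule eq[OF p])
   ultimately have "f (p + (hs n, 0)) - f p - (A (p + (hs n, 0)) - A p) * J 3 p = A (p + (hs n, 0)) * (J 3 (p + (hs n, 0)) - J 3 p) + 2 * (J 5 (p + (hs n, 0)) - J 5 p)"
    by (simp add: algebra_simps)
   then have "(1 / hs n) * (f (p + (hs n, 0)) - f p - (A (p + (hs n, 0)) - A p) * J 3 p) = (1 / hs n) * (A (p + (hs n, 0)) * (J 3 (p + (hs n, 0)) - J 3 p) + 2 * (J 5 (p + (hs n, 0)) - J 5 p))" by (rule arg_cong)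
   then show ?thesis unfolding quot_def by (simp add: algebra_simps)
  qed
  have "hb (strip R) al (Kf + 2 * Ka1 * K) (%p. quot (hs n) f p - quot (hs n) A p * J 3 p)" for n
   by (intro hb_diff hb_mult quot_hb[OF f(1) hs_pos f(2)] quot_hb[OF A(3) hs_pos A(4)] K) simp
  then show "hol (strip R) al (Kf + 2 * Ka1 * K) (%p. quot (hs n) f p - quot (hs n) A p * J 3 p)" for n unfolding hb_def by blast
  show "(%n. quot (hs n) f p - quot (hs n) A p * J 3 p) \<longlonglongrightarrow> f1 p - A1 p * J 3 p" if p: "p \<in> strip R" for p
   by (intro tendsto_diff tendsto_mult tendsto_const quot_lim[OF f(1) p] quot_lim[OF A(3) p])
 qed
qed

subsection \<open>A priori bounds\<close>

lemma AV_bound: assumes "a \<noteq> 0" shows "\<bar>AV a v y\<bar> <= LA a"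
proof -
 have "\<bar>(v * AA a v y) * (AA a v y * AA a v y)\<bar> <= 1 * ((1 / \<bar>a\<bar>) * (1 / \<bar>a\<bar>))"
  by (intro abs_mult_le AA_bounds[OF assms])
 moreover have "(1 / \<bar>a\<bar>) * (1 / \<bar>a\<bar>) <= LA a" unfolding LA_def by (simp add: power2_eq_square)
 ultimately show ?thesis unfolding AV_def by (simp add: power3_eq_cube mult.assoc)
qed

text \<open>The equation for \<open>v\<close> in nondivergence form,
  \<open>A v_xx + 2 v_yy = - A_v v_x^2\<close>. The boundary values carry two derivatives because
  the Schauder estimate asks for the tangential second derivative on the edges.\<close>

definition vsol :: "real => real => real => real => (real => real => real) => (real => real => real) => (real => real => real) => (nat => real \<times> real => real) => bool" where
 "vsol R P al a \<beta> \<beta>1 \<beta>2 V \<longleftrightarrow> adm R P al V \<and>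
   (\<forall>p\<in>strip R. AA a (V 0 p) (snd p) * V 3 p + 2 * V 5 p = - AV a (V 0 p) (snd p) * (V 1 p * V 1 p)) \<and>
   (\<forall>s\<in>{R,-R}. \<forall>x. V 0 (x, s) = \<beta> s x \<and> (\<beta> s has_real_derivative \<beta>1 s x) (at x) \<and> (\<beta>1 s has_real_derivative \<beta>2 s x) (at x))"

definition data_bounds :: "real => real => real => (real => real => real) => (real => real => real) => (real => real => real) => bool" where
 "data_bounds R al M0 \<beta> \<beta>1 \<beta>2 \<longleftrightarrow> (\<forall>s\<in>{R,-R}. (\<forall>x. \<bar>\<beta> s x\<bar> <= M0 \<and> \<bar>\<beta>1 s x\<bar> <= M0) \<and> hol UNIV al M0 (\<beta>2 s))"

text \<open>Where \<open>V 1\<close> vanishes so does the quadratic right-hand side, hence the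
  maximum principle applies with \<open>F = 0\<close>.\<close>

lemma vsol_sup:
 assumes R: "R > 0" and P: "P > 0" and a: "a \<noteq> 0" and S: "vsol R P al a \<beta> \<beta>1 \<beta>2 V" and D: "data_bounds R al M0 \<beta> \<beta>1 \<beta>2" and p: "p \<in> strip R"
 shows "\<bar>V 0 p\<bar> <= M0"
proof -
 have "\<bar>V 0 p\<bar> <= M0 + 0 * R\<^sup>2 / 4"
 proof (rule max_principle[OF R P, where A="%p. AA a (V 0 p) (snd p)"])
  show "jet (strip R) V" "per R P (V 0)" using S unfolding vsol_def adm_def by blast+
  show "AA a (V 0 q) (snd q) \<ge> 0" for q using AA_pos[OF a] less_imp_le by blast
  show "\<bar>AA a (V 0 q) (snd q) * V 3 q + 2 * V 5 q\<bar> <= 0" if "q \<in> strip R" "V 1 q = 0" for q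
  proof -
   have "AA a (V 0 q) (snd q) * V 3 q + 2 * V 5 q = - AV a (V 0 q) (snd q) * (V 1 q * V 1 q)" using S that(1) unfolding vsol_def by blast
   then show ?thesis using that(2) by simp
  qed
  show "\<bar>V 0 (x, s)\<bar> <= M0" if "s \<in> {R, - R}" for x s
  proof -
   have "V 0 (x, s) = \<beta> s x" using S that unfolding vsol_def by blast
   moreover have "\<bar>\<beta> s x\<bar> <= M0" using D that unfolding data_bounds_def by blast
   ultimately show ?thesis by simp
  qed
 qed (use p in simp_all)
 then show ?thesis by simp
qed

text \<open>The power of the scaling factor that each jet entry picks up.\<close>

definition jet_order :: "nat => nat" where "jet_order i = (if i = 0 then 0 else if i <= 2 then 1 else 2)"

lemma jet_scale:
 assumes "jet (strip R) V" "\<rho> > 0"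
 shows "jet (strip (R / \<rho>)) (%i z. \<rho> ^ jet_order i * V i (\<rho> *\<^sub>R z))"
proof -
 have s: "{z. 0 + \<rho> *\<^sub>R z \<in> strip R} = strip (R / \<rho>)"
  using assms(2) by (auto simp: mem_strip abs_mult le_divide_eq mult.commute)
 have g: "grad (strip (R / \<rho>)) (%z. c * f (\<rho> *\<^sub>R z)) (%z. (c * \<rho>) * f1 (\<rho> *\<^sub>R z)) (%z. (c * \<rho>) * f2 (\<rho> *\<^sub>R z))" if "grad (strip R) f f1 f2" for f f1 f2 c
  using grad_cmult[OF grad_affine[OF that, of 0 \<rho>], of c] unfolding s by (simp add: mult.assoc)
 have V: "grad (strip R) (V 0) (V 1) (V 2)" "grad (strip R) (V 1) (V 3) (V 4)" "grad (strip R) (V 2) (V 4) (V 5)"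
  using assms(1) unfolding jet_def by blast+
 show ?thesis unfolding jet_def using g[OF V(1), of 1] g[OF V(2), of \<rho>] g[OF V(3), of \<rho>]
  by (simp add: jet_order_def power2_eq_square)
qed

text \<open>With \<open>\<rho> = 1 / M\<close> the function \<open>V 0 (\<rho> *\<^sub>R z)\<close>
  has first derivatives at most 1 on a strip at least as wide, where the Schauder constant is
  uniform. Its quadratic right-hand side involves the second derivatives again; interpolation with a
  small step \<open>r\<close> makes their share at most half the seminorm, so it can be absorbed.
  Scaling back yields the factor \<open>M^2\<close>.\<close>

lemma scaled_second_derivatives:
 assumes R: "R > 0" and P: "P > 0" and al: "0 < al" "al < 1" and a: "a \<noteq> 0" and M0: "M0 \<ge> 0"
 shows "\<exists>C>0. \<forall>V \<beta> \<beta>1 \<beta>2 M. vsol R P al a \<beta> \<beta>1 \<beta>2 V --> data_bounds R al M0 \<beta> \<beta>1 \<beta>2 --> M \<ge> 1 -->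
   (\<forall>p\<in>strip R. \<bar>V 1 p\<bar> <= M \<and> \<bar>V 2 p\<bar> <= M) --> (\<forall>i\<in>{3,4,5}. \<forall>p\<in>strip R. \<bar>V i p\<bar> <= C * M\<^sup>2)"
proof -
 have al1: "al <= 1" using al by simp
 define \<mu> where "\<mu> = 1 / sqrt (M0\<^sup>2 + R\<^sup>2 + a\<^sup>2)"
 have mu: "\<mu> > 0" unfolding \<mu>_def using AA_base(1)[OF a, of M0 R] by simp
 define L where "L = LA a"
 have L: "L > 0" unfolding L_def by (rule LA_pos[OF a])
 define Ka where "Ka = 3 * L + 2 * (1 / \<bar>a\<bar>)"
 obtain C where C: "C > 0" "!!R' J A f G i. R' \<ge> R ==> schauder_setting al \<mu> (1 / \<bar>a\<bar>) Ka G R' J A f ==> i \<in> {3,4,5} ==> hol (strip R') al (C * G) (J i)"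
  using schauder_estimate[OF al mu R, of "1 / \<bar>a\<bar>" Ka] by blast
 \<comment> \<open>The quantity to be made at most \<open>1 / 2\<close> is the factor with which the
   unknown seminorm \<open>N\<close> returns in its own bound.\<close>
 have "\<exists>r>0. 2 * r <= R \<and> C * (4 * L * (8 * (4 * r) powr al)) <= 1 / 2"
 proof -
  define e where "e = 1 / (64 * C * L)"
  have e: "e > 0" unfolding e_def using C(1) L by simp
  define r where "r = min (R / 2) (e powr (1 / al) / 4)"
  have r: "r > 0" "2 * r <= R" unfolding r_def using R e by auto
  have "4 * r <= e powr (1 / al)" unfolding r_def by (simp add: min_def)
  then have "(4 * r) powr al <= (e powr (1 / al)) powr al" using r al by (intro powr_mono2) auto
  also have "\<dots> = e" using e al by (simp add: powr_powr)
  finally have "C * (4 * L * (8 * (4 * r) powr al)) <= C * (4 * L * (8 * e))" using C(1) L by (intro mult_left_mono) auto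
  also have "\<dots> = 1 / 2" unfolding e_def using C(1) L by simp
  finally show ?thesis using r by blast
 qed
 then obtain r where r: "r > 0" "2 * r <= R" "C * (4 * L * (8 * (4 * r) powr al)) <= 1 / 2" by blast
 define X where "X = M0 + 9 * L + 4 * L * (8 * M0 / r\<^sup>2)"
 define N0 where "N0 = 2 * C * X"
 define D0 where "D0 = 8 * M0 / r\<^sup>2 + 8 * (4 * r) powr al * N0"
 have X0: "X \<ge> 0" unfolding X_def using M0 L r by simp
 have main: "\<bar>V i p\<bar> <= (D0 + 1) * M\<^sup>2" if S: "vsol R P al a \<beta> \<beta>1 \<beta>2 V" and D: "data_bounds R al M0 \<beta> \<beta>1 \<beta>2" and M: "M \<ge> 1"
  and V1: "\<forall>p\<in>strip R. \<bar>V 1 p\<bar> <= M \<and> \<bar>V 2 p\<bar> <= M" and i: "i \<in> {3,4,5}" and p: "p \<in> strip R" for V \<beta> \<beta>1 \<beta>2 M i p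
 proof -
  define \<rho> where "\<rho> = 1 / M"
  have \<rho>: "\<rho> > 0" "\<rho> <= 1" unfolding \<rho>_def using M by auto
  define R' where "R' = R / \<rho>"
  have R': "R' \<ge> R" "R' > 0" unfolding R'_def using \<rho> R by (auto simp: le_divide_eq mult_left_le)
  define W where "W = (%i z. \<rho> ^ jet_order i * V i (\<rho> *\<^sub>R z))"
  have Vj: "jet (strip R) V" using S unfolding vsol_def adm_def by blast
  have Wj: "jet (strip R') W" unfolding W_def R'_def by (rule jet_scale[OF Vj \<rho>(1)])
  have mem: "\<rho> *\<^sub>R z \<in> strip R" if "z \<in> strip R'" for z using that \<rho> unfolding R'_def by (simp add: mem_strip abs_mult le_divide_eq mult.commute)
  have Wi: "W 0 z = V 0 (\<rho> *\<^sub>R z)" "W 1 z = \<rho> * V 1 (\<rho> *\<^sub>R z)" "W 2 z = \<rho> * V 2 (\<rho> *\<^sub>R z)" "W 3 z = \<rho>\<^sup>2 * V 3 (\<rho> *\<^sub>R z)" "W 5 z = \<rho>\<^sup>2 * V 5 (\<rho> *\<^sub>R z)" for z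
   unfolding W_def jet_order_def by simp_all
  have W0: "\<bar>W 0 z\<bar> <= M0" if "z \<in> strip R'" for z unfolding Wi by (rule vsol_sup[OF R P a S D mem[OF that]])
  have W12: "\<bar>W 1 z\<bar> <= 1" "\<bar>W 2 z\<bar> <= 1" if "z \<in> strip R'" for z
   using V1 mem[OF that] M unfolding Wi \<rho>_def by (auto simp: abs_mult divide_le_eq)
  have g: "grad (strip R') (W 0) (W 1) (W 2)" "grad (strip R') (W 1) (W 3) (W 4)" using Wj unfolding jet_def by blast+
  have lip0: "\<bar>W 0 z - W 0 z'\<bar> <= 2 * 1 * dist z z'" if "z \<in> strip R'" "z' \<in> strip R'" for z z'
   by (rule grad_lipschitz[OF convex_strip g(1) W12 that])
  have lipy: "\<bar>\<rho> * snd z - \<rho> * snd z'\<bar> <= dist z z'" for z z' :: "real \<times> real"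
  proof -
   have "\<bar>\<rho> * snd z - \<rho> * snd z'\<bar> = \<rho> * \<bar>snd z - snd z'\<bar>" using \<rho> by (simp add: abs_mult flip: right_diff_distrib)
   also have "\<dots> <= 1 * \<bar>snd z - snd z'\<bar>" using \<rho> by (intro mult_right_mono) auto
   also have "\<dots> <= dist z z'" using fst_snd_dist(2)[of z z'] by (simp add: dist_commute)
   finally show ?thesis .
  qed
  have arg: "\<bar>W 0 z - W 0 z'\<bar> + \<bar>\<rho> * snd z - \<rho> * snd z'\<bar> <= 3 * dist z z'" if "z \<in> strip R'" "z' \<in> strip R'" for z z'
   using lip0[OF that] lipy[of z z'] by linarith
  define A where "A = (%z. AA a (W 0 z) (\<rho> * snd z))"
  define BV where "BV = (%z. AV a (W 0 z) (\<rho> * snd z))"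
  have hA: "hb (strip R') al Ka A" unfolding Ka_def
  proof (rule hb_lipschitz[OF al(1) al1])
   show "\<bar>A z\<bar> <= 1 / \<bar>a\<bar>" for z unfolding A_def by (rule AA_bounds(3)[OF a])
   show "\<bar>A z - A z'\<bar> <= 3 * L * dist z z'" if "z \<in> strip R'" "z' \<in> strip R'" for z z'
    using AA_lipschitz[OF a, of "W 0 z" "\<rho> * snd z" "W 0 z'" "\<rho> * snd z'"] mult_left_mono[OF arg[OF that] less_imp_le[OF L]]
    unfolding A_def L_def by simp
  qed (use L in simp_all)
  have hB: "hb (strip R') al (3 * L + 2 * L) BV"
  proof (rule hb_lipschitz[OF al(1) al1])
   show "\<bar>BV z\<bar> <= L" for z unfolding BV_def L_def by (rule AV_bound[OF a])
   show "\<bar>BV z - BV z'\<bar> <= 3 * L * dist z z'" if "z \<in> strip R'" "z' \<in> strip R'" for z z'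
    using AV_lipschitz[OF a, of "W 0 z" "\<rho> * snd z" "W 0 z'" "\<rho> * snd z'"] mult_left_mono[OF arg[OF that] less_imp_le[OF L]]
    unfolding BV_def L_def by simp
  qed (use L in simp_all)
  obtain K where K: "!!i. i <= 5 ==> hb (strip R) al K (V i)" using S unfolding vsol_def adm_def by blast
  have K0: "K \<ge> 0" by (rule hb_nonneg[OF K[of 0] R]) simp
  have hW: "hol (strip R') al K (W i)" if i: "i \<in> {3,4,5}" for i
   unfolding hol_def
  proof (intro ballI)
   fix z z' assume z: "z \<in> strip R'" "z' \<in> strip R'"
   have i5: "i <= 5" using i by auto
   have "\<bar>V i (\<rho> *\<^sub>R z) - V i (\<rho> *\<^sub>R z')\<bar> <= K * dist (\<rho> *\<^sub>R z) (\<rho> *\<^sub>R z') powr al" by (rule hbD[OF K[OF i5] mem[OF z(1)] mem[OF z(2)]])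
   also have "\<dots> <= K * dist z z' powr al"
    using K0 \<rho> al by (intro mult_left_mono powr_mono2) (auto simp: dist_norm mult_left_le_one_le simp flip: scaleR_diff_right)
   finally have le: "\<bar>V i (\<rho> *\<^sub>R z) - V i (\<rho> *\<^sub>R z')\<bar> <= K * dist z z' powr al" .
   have "\<rho> ^ jet_order i <= 1" using \<rho> by (intro power_le_one) auto
   then have "\<rho> ^ jet_order i * \<bar>V i (\<rho> *\<^sub>R z) - V i (\<rho> *\<^sub>R z')\<bar> <= 1 * (K * dist z z' powr al)" using le \<rho> by (intro mult_mono) auto
   then show "\<bar>W i z - W i z'\<bar> <= K * dist z z' powr al" unfolding W_def using \<rho> by (simp add: abs_mult flip: right_diff_distrib)
  qed
  obtain N where N: "N \<ge> 0" "!!i. i \<in> {3,4,5} ==> hol (strip R') al N (W i)" "!!N'. N' \<ge> 0 ==> (!!i. i \<in> {3,4,5} ==> hol (strip R') al N' (W i)) ==> N <= N'"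
   using best_hoelder_constant[of "{3,4,5}" "strip R'" al K W, OF hW K0] by blast
  define D' where "D' = 2 * (4 * M0 / r\<^sup>2 + 4 * N * (4 * r) powr al)"
  have rR': "2 * r <= R'" using r(2) R' by linarith
  have WD: "\<bar>W i z\<bar> <= D'" if "i \<in> {3,4,5}" "z \<in> strip R'" for i z
   unfolding D'_def by (rule jet_interpolation2[OF Wj r(1) rR' that(2) W0 N(2) al(1) N(1) that(1)])
  have D'0: "D' \<ge> 0" unfolding D'_def using M0 N(1) r by simp
  have hW1: "hb (strip R') al (2 * D' + 2 * 1) (W 1)"
  proof (rule hb_lipschitz[OF al(1) al1 W12(1)])
   show "\<bar>W 1 z - W 1 z'\<bar> <= 2 * D' * dist z z'" if "z \<in> strip R'" "z' \<in> strip R'" for z z'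
    by (rule grad_lipschitz[OF convex_strip g(2) WD WD that]) simp_all
  qed (use D'0 in simp_all)
  have hW1': "hol (strip R') al (2 * D' + 2) (W 1)" using hW1 unfolding hb_def by simp
  have hW11: "hol (strip R') al (1 * (2 * D' + 2) + 1 * (2 * D' + 2)) (%z. W 1 z * W 1 z)"
   by (rule hol_mult[OF hW1' hW1' W12(1) W12(1)])
  have W11: "\<bar>W 1 z * W 1 z\<bar> <= 1" if "z \<in> strip R'" for z using abs_mult_le[OF W12(1)[OF that] W12(1)[OF that]] by simp
  have "hol (strip R') al (L * (1 * (2 * D' + 2) + 1 * (2 * D' + 2)) + 1 * (3 * L + 2 * L)) (%z. BV z * (W 1 z * W 1 z))"
   by (rule hol_mult[OF _ hW11 _ W11]) (use hB in \<open>simp_all add: hb_def BV_def L_def AV_bound[OF a]\<close>)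
  from hol_cmult[OF this, of "-1"]
  have hf: "hol (strip R') al (L * (4 * D' + 9)) (%z. - BV z * (W 1 z * W 1 z))" by (simp add: algebra_simps)
  define G where "G = M0 + L * (4 * D' + 9)"
  have LD: "0 <= L * (4 * D' + 9)" using L D'0 by simp
  have "schauder_setting al \<mu> (1 / \<bar>a\<bar>) Ka G R' W A (%z. - BV z * (W 1 z * W 1 z))"
   unfolding schauder_setting_def
  proof (intro conjI)
   show "jet (strip R') W" by (rule Wj)
   show "\<exists>K. \<forall>i\<in>{3, 4, 5}. hol (strip R') al K (W i)" using hW by blast
   show "hol (strip R') al Ka A" using hA unfolding hb_def by blast
   show "\<forall>z\<in>strip R'. \<mu> <= A z \<and> A z <= 1 / \<bar>a\<bar>"
   proof
    fix z assume z: "z \<in> strip R'"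
    have "\<bar>\<rho> * snd z\<bar> <= R" using mem[OF z] by (simp add: mem_strip)
    from AA_ge[OF a W0[OF z] this] show "\<mu> <= A z \<and> A z <= 1 / \<bar>a\<bar>" unfolding A_def \<mu>_def using AA_le[OF a] by blast
   qed
   show "\<forall>z\<in>strip R'. A z * W 3 z + 2 * W 5 z = - BV z * (W 1 z * W 1 z)"
   proof
    fix z assume z: "z \<in> strip R'"
    have "AA a (V 0 (\<rho> *\<^sub>R z)) (snd (\<rho> *\<^sub>R z)) * V 3 (\<rho> *\<^sub>R z) + 2 * V 5 (\<rho> *\<^sub>R z) = - AV a (V 0 (\<rho> *\<^sub>R z)) (snd (\<rho> *\<^sub>R z)) * (V 1 (\<rho> *\<^sub>R z) * V 1 (\<rho> *\<^sub>R z))"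
     using S mem[OF z] unfolding vsol_def by blast
    then have "\<rho>\<^sup>2 * (AA a (V 0 (\<rho> *\<^sub>R z)) (\<rho> * snd z) * V 3 (\<rho> *\<^sub>R z) + 2 * V 5 (\<rho> *\<^sub>R z)) = \<rho>\<^sup>2 * (- AV a (V 0 (\<rho> *\<^sub>R z)) (\<rho> * snd z) * (V 1 (\<rho> *\<^sub>R z) * V 1 (\<rho> *\<^sub>R z)))"
     by simp
    then show "A z * W 3 z + 2 * W 5 z = - BV z * (W 1 z * W 1 z)" unfolding A_def BV_def Wi by (simp add: algebra_simps power2_eq_square)
   qed
   show "hol (strip R') al G (%z. - BV z * (W 1 z * W 1 z))" by (rule hol_mono[OF hf]) (use M0 in \<open>simp add: G_def\<close>)
   show "\<forall>z\<in>strip R'. \<bar>W 0 z\<bar> <= G" using W0 LD unfolding G_def by force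
   show "\<forall>s\<in>{R', - R'}. \<forall>x x'. \<bar>W 3 (x, s) - W 3 (x', s)\<bar> <= G * \<bar>x - x'\<bar> powr al"
   proof (intro ballI allI)
    fix s x x' assume s: "s \<in> {R', - R'}"
    define s' where "s' = \<rho> * s"
    have s': "s' \<in> {R, -R}" using s \<rho> unfolding s'_def R'_def by auto
    have Vg: "grad (strip R) (V 0) (V 1) (V 2)" "grad (strip R) (V 1) (V 3) (V 4)" using Vj unfolding jet_def by blast+
    have b1: "V 1 (y, s') = \<beta>1 s' y" for y by (rule boundary_derivative[OF Vg(1) R s']) (use S s' in \<open>auto simp: vsol_def\<close>)
    have b2: "V 3 (y, s') = \<beta>2 s' y" for y by (rule boundary_derivative[OF Vg(2) R s' b1]) (use S s' in \<open>auto simp: vsol_def\<close>)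
    have "\<bar>\<beta>2 s' (\<rho> * x) - \<beta>2 s' (\<rho> * x')\<bar> <= M0 * dist (\<rho> * x) (\<rho> * x') powr al" using D s' unfolding data_bounds_def hol_def by blast
    also have "\<dots> <= M0 * \<bar>x - x'\<bar> powr al"
     using M0 \<rho> al by (intro mult_left_mono powr_mono2) (auto simp: dist_real_def abs_mult mult_left_le_one_le simp flip: right_diff_distrib)
    finally have le: "\<bar>\<beta>2 s' (\<rho> * x) - \<beta>2 s' (\<rho> * x')\<bar> <= M0 * \<bar>x - x'\<bar> powr al" .
    have "W 3 (x, s) - W 3 (x', s) = \<rho>\<^sup>2 * (\<beta>2 s' (\<rho> * x) - \<beta>2 s' (\<rho> * x'))" unfolding Wi using b2 by (simp add: s'_def algebra_simps)
    then have "\<bar>W 3 (x, s) - W 3 (x', s)\<bar> = \<rho>\<^sup>2 * \<bar>\<beta>2 s' (\<rho> * x) - \<beta>2 s' (\<rho> * x')\<bar>" by (simp add: abs_mult)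
    also have "\<dots> <= 1 * (M0 * \<bar>x - x'\<bar> powr al)" using le \<rho> by (intro mult_mono) (auto simp: power_le_one)
    also have "\<dots> <= G * \<bar>x - x'\<bar> powr al" using LD unfolding G_def by (simp add: mult_right_mono)
    finally show "\<bar>W 3 (x, s) - W 3 (x', s)\<bar> <= G * \<bar>x - x'\<bar> powr al" .
   qed
  qed
  then have "hol (strip R') al (C * G) (W i)" if "i \<in> {3,4,5}" for i by (rule C(2)[OF R'(1) _ that])
  moreover have "0 <= C * G" using C(1) M0 LD unfolding G_def by simp
  ultimately have "N <= C * G" by (intro N(3))
  \<comment> \<open>\<open>X\<close> collects the terms free of \<open>N\<close>; the remainder is
    at most \<open>N / 2\<close> and moves to the left-hand side.\<close>
  also have "C * G = C * X + (C * (4 * L * (8 * (4 * r) powr al))) * N" unfolding G_def D'_def X_def by (simp add: algebra_simps)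
  also have "\<dots> <= C * X + (1 / 2) * N" using r(3) N(1) by (intro add_left_mono mult_right_mono)
  finally have "N <= N0" unfolding N0_def by linarith
  then have "8 * (4 * r) powr al * N <= 8 * (4 * r) powr al * N0" by (intro mult_left_mono) auto
  then have DD: "D' <= D0" unfolding D'_def D0_def by (simp add: algebra_simps)
  define z where "z = M *\<^sub>R p"
  have z: "z \<in> strip R'" "\<rho> *\<^sub>R z = p" using p M unfolding z_def \<rho>_def R'_def by (auto simp: mem_strip abs_mult mult_right_mono)
  have "\<bar>W i z\<bar> <= D0" using WD[OF i z(1)] DD by linarith
  moreover have "W i z = \<rho>\<^sup>2 * V i p" using i z(2) unfolding W_def jet_order_def by auto
  ultimately have "\<rho>\<^sup>2 * \<bar>V i p\<bar> <= D0" by (simp add: abs_mult)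
  then have "\<bar>V i p\<bar> <= D0 * M\<^sup>2" unfolding \<rho>_def using M by (simp add: power_divide divide_le_eq)
  also have "\<dots> <= (D0 + 1) * M\<^sup>2" by (simp add: algebra_simps)
  finally show ?thesis .
 qed
 have "D0 + 1 > 0" unfolding D0_def N0_def using M0 r X0 C(1) by (simp add: add_nonneg_pos)
 then show ?thesis using main by (intro exI[of _ "D0 + 1"]) blast
qed

section \<open>Iterated integrals over a rectangle\<close>

definition II :: "real => real => real => (real \<times> real => real) => real" where
 "II c d R F = integral {-R..R} (%y. integral {c..d} (%x. F (x, y)))"

lemma row_continuous:
 fixes F :: "real \<times> real => real"
 assumes "continuous_on ({c..d} \<times> {-R..R}) F" "y \<in> {-R..R}" shows "continuous_on {c..d} (%x. F (x, y))"
proof (rule continuous_on_compose2[OF assms(1), of _ "%x. (x, y)"])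
 show "continuous_on {c..d} (%x. (x, y))" by (intro continuous_on_Pair continuous_on_id continuous_on_const)
 show "(%x. (x, y)) ` {c..d} \<subseteq> {c..d} \<times> {-R..R}" using assms(2) by auto
qed

lemma II_inner_continuous:
 fixes F :: "real \<times> real => real"
 assumes "continuous_on ({c..d} \<times> {-R..R}) F" shows "continuous_on {-R..R} (%y. integral {c..d} (%x. F (x, y)))"
proof -
 have "continuous_on ({-R..R} \<times> cbox c d) (%(y, x). F (x, y))"
  unfolding split_def
  by (rule continuous_on_compose2[OF assms, of _ "%z. (snd z, fst z)"]) (intro continuous_intros, auto)
 from integral_continuous_on_param[OF this] show ?thesis by simp
qed

lemma II_mono:
 assumes F: "continuous_on ({c..d} \<times> {-R..R}) F" and G: "continuous_on ({c..d} \<times> {-R..R}) G"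
  and le: "!!x y. x \<in> {c..d} ==> y \<in> {-R..R} ==> F (x, y) <= G (x, y)"
 shows "II c d R F <= II c d R G"
 unfolding II_def
 by (intro integral_le integrable_continuous_real II_inner_continuous row_continuous[OF F] row_continuous[OF G] F G le)

lemma II_add:
 assumes F: "continuous_on ({c..d} \<times> {-R..R}) F" and G: "continuous_on ({c..d} \<times> {-R..R}) G"
 shows "II c d R (%p. F p + G p) = II c d R F + II c d R G"
proof -
 have "II c d R (%p. F p + G p) = integral {-R..R} (%y. integral {c..d} (%x. F (x, y)) + integral {c..d} (%x. G (x, y)))"
  unfolding II_def by (intro integral_cong integral_add integrable_continuous_real row_continuous[OF F] row_continuous[OF G])
 also have "\<dots> = II c d R F + II c d R G"
  unfolding II_def by (intro integral_add integrable_continuous_real II_inner_continuous F G)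
 finally show ?thesis .
qed

lemma II_lower:
 assumes F: "continuous_on ({c..d} \<times> {-R..R}) F" "!!x y. x \<in> {c..d} ==> y \<in> {-R..R} ==> 0 <= F (x, y)"
  and sub: "c <= x1" "x1 <= x2" "x2 <= d" "-R <= y1" "y1 <= y2" "y2 <= R"
  and k: "!!x y. x \<in> {x1..x2} ==> y \<in> {y1..y2} ==> k <= F (x, y)"
 shows "k * (x2 - x1) * (y2 - y1) <= II c d R F"
proof -
 have inner: "k * (x2 - x1) <= integral {c..d} (%x. F (x, y))" if y: "y \<in> {y1..y2}" for y
 proof -
  have yR: "y \<in> {-R..R}" using y sub by auto
  have ci: "continuous_on {c..d} (%x. F (x, y))" by (rule row_continuous[OF F(1) yR])
  have ci1: "continuous_on {x1..x2} (%x. F (x, y))" by (rule continuous_on_subset[OF ci]) (use sub in auto)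
  have "k * (x2 - x1) = integral {x1..x2} (%x. k)" using sub by simp
  also have "\<dots> <= integral {x1..x2} (%x. F (x, y))"
   by (intro integral_le integrable_continuous_real continuous_on_const ci1 k y)
  also have "\<dots> <= integral {c..d} (%x. F (x, y))"
   by (rule integral_subset_le) (use sub F(2) yR integrable_continuous_real[OF ci] integrable_continuous_real[OF ci1] in auto)
  finally show ?thesis .
 qed
 have co: "continuous_on {-R..R} (%y. integral {c..d} (%x. F (x, y)))" by (rule II_inner_continuous[OF F(1)])
 have co1: "continuous_on {y1..y2} (%y. integral {c..d} (%x. F (x, y)))" by (rule continuous_on_subset[OF co]) (use sub in auto)
 have nn: "0 <= integral {c..d} (%x. F (x, y))" if y: "y \<in> {-R..R}" for y
  by (rule integral_nonneg[OF integrable_continuous_real[OF row_continuous[OF F(1) y]]]) (use F(2) y in auto)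
 have "k * (x2 - x1) * (y2 - y1) = integral {y1..y2} (%y. k * (x2 - x1))" using sub by simp
 also have "\<dots> <= integral {y1..y2} (%y. integral {c..d} (%x. F (x, y)))"
  by (intro integral_le integrable_continuous_real continuous_on_const co1 inner)
 also have "\<dots> <= II c d R F" unfolding II_def
  by (rule integral_subset_le) (use sub nn integrable_continuous_real[OF co] integrable_continuous_real[OF co1] in auto)
 finally show ?thesis .
qed

text \<open>Each part vanishes by the fundamental theorem of calculus in its own variable; for the
  \<open>y\<close> part the order of integration is exchanged.\<close>

lemma II_divergence_zero:
 assumes cd: "c <= d" and R: "R > 0"
  and a: "!!x y. x \<in> {c..d} ==> y \<in> {-R..R} ==> ((%x. aa (x, y)) has_real_derivative ax (x, y)) (at x within {c..d})"
  and b: "!!x y. x \<in> {c..d} ==> y \<in> {-R..R} ==> ((%y. bb (x, y)) has_real_derivative bx (x, y)) (at y within {-R..R})"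
  and ca: "continuous_on ({c..d} \<times> {-R..R}) ax" and cb: "continuous_on ({c..d} \<times> {-R..R}) bx"
  and pa: "!!y. y \<in> {-R..R} ==> aa (d, y) = aa (c, y)" and pb: "!!x. x \<in> {c..d} ==> bb (x, R) = bb (x, -R)"
 shows "II c d R (%p. ax p + bx p) = 0"
proof -
 have 1: "integral {c..d} (%x. ax (x, y)) = 0" if y: "y \<in> {-R..R}" for y
 proof -
  have "((%x. ax (x, y)) has_integral (aa (d, y) - aa (c, y))) {c..d}"
   by (rule fundamental_theorem_of_calculus[OF cd]) (use a y in \<open>simp add: has_real_derivative_iff_has_vector_derivative\<close>)
  then show ?thesis using pa[OF y] by (simp add: integral_unique)
 qed
 have 2: "integral {-R..R} (%y. bx (x, y)) = 0" if x: "x \<in> {c..d}" for x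
 proof -
  have "((%y. bx (x, y)) has_integral (bb (x, R) - bb (x, -R))) {-R..R}"
   by (rule fundamental_theorem_of_calculus) (use b x R in \<open>simp_all add: has_real_derivative_iff_has_vector_derivative\<close>)
  then show ?thesis using pb[OF x] by (simp add: integral_unique)
 qed
 have "II c d R ax = integral {-R..R} (%y. 0)" unfolding II_def by (intro integral_cong 1)
 then have A0: "II c d R ax = 0" by simp
 have cbb: "continuous_on (cbox (c, -R) (d, R)) (%(x, y). bx (x, y))" using cb by (simp add: cbox_Pair_eq)
 have "II c d R bx = integral (cbox c d) (%x. integral (cbox (-R) R) (%y. bx (x, y)))"
  unfolding II_def using integral_swap_continuous[OF cbb] by simp
 also have "\<dots> = integral {c..d} (%x. 0)" unfolding box_real(2) by (intro integral_cong 2)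
 finally have "II c d R bx = 0" by simp
 then show ?thesis using II_add[OF ca cb] A0 by simp
qed

section \<open>The logarithmic kernel and the energy inequality\<close>

lemma arsinh_le: fixes t :: real assumes "t \<ge> 0" shows "arsinh t <= ln (2 * t + 1)"
proof -
 have "sqrt (t\<^sup>2 + 1) <= sqrt ((t + 1)\<^sup>2)" using assms by (intro real_sqrt_le_mono) (simp add: power2_sum)
 then have "t + sqrt (t\<^sup>2 + 1) <= 2 * t + 1" using assms by simp
 moreover have "0 < t + sqrt (t\<^sup>2 + 1)" using assms by (intro add_nonneg_pos) (auto simp: add_nonneg_pos)
 ultimately show ?thesis unfolding arsinh_real_def by simp
qed

text \<open>The \<open>x\<close> integral is a difference of arctangents, at most
  \<open>pi / sqrt ((y - y0)^2 + \<delta>^2)\<close>. Integrating this in \<open>y\<close> gives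
  \<open>arsinh\<close>, hence a single logarithm of \<open>1 / \<delta>\<close>. \<open>AA\<close>
  and \<open>FF\<close> with \<open>\<delta>\<close> in the role of \<open>a\<close> are reused as
  this function and its primitive.\<close>

lemma II_log_kernel:
 assumes R: "R > 0" and cd: "c <= d" and \<delta>: "\<delta> > 0" and y0: "\<bar>y0\<bar> <= R"
 shows "II c d R (%p. 1 / ((fst p - x0)\<^sup>2 + (snd p - y0)\<^sup>2 + \<delta>\<^sup>2)) <= 2 * pi * ln (4 * R / \<delta> + 1)"
proof -
 have pos: "(x - x0)\<^sup>2 + (y - y0)\<^sup>2 + \<delta>\<^sup>2 > 0" for x y using AA_base(1)[of \<delta> "x - x0" "y - y0"] \<delta> by simp
 have inner: "integral {c..d} (%x. 1 / ((x - x0)\<^sup>2 + (y - y0)\<^sup>2 + \<delta>\<^sup>2)) <= pi * AA \<delta> (y - y0) 0" for y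
 proof -
  define b where "b = sqrt ((y - y0)\<^sup>2 + \<delta>\<^sup>2)"
  have b: "b > 0" "b\<^sup>2 = (y - y0)\<^sup>2 + \<delta>\<^sup>2" unfolding b_def using AA_base(2)[of \<delta> "y - y0"] \<delta> by auto
  have "((%x. 1 / ((x - x0)\<^sup>2 + (y - y0)\<^sup>2 + \<delta>\<^sup>2)) has_integral ((1 / b) * arctan ((d - x0) / b) - (1 / b) * arctan ((c - x0) / b))) {c..d}"
  proof (rule fundamental_theorem_of_calculus[OF cd])
   fix x
   have d1: "((%x. (x - x0) / b) has_real_derivative 1 / b) (at x within {c..d})"
    by (rule DERIV_cdivide) (auto intro!: derivative_eq_intros)
   have "((%x. arctan ((x - x0) / b)) has_real_derivative inverse (1 + ((x - x0) / b)\<^sup>2) * (1 / b)) (at x within {c..d})"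
    by (rule DERIV_chain2[OF DERIV_arctan d1])
   from DERIV_cmult[OF this, of "1 / b"]
   have "((%x. (1 / b) * arctan ((x - x0) / b)) has_real_derivative 1 / ((x - x0)\<^sup>2 + (y - y0)\<^sup>2 + \<delta>\<^sup>2)) (at x within {c..d})"
   proof (rule DERIV_cong)
    have "(1 / b) * (inverse (1 + ((x - x0) / b)\<^sup>2) * (1 / b)) = 1 / (b\<^sup>2 * (1 + ((x - x0) / b)\<^sup>2))" by (simp add: power2_eq_square inverse_eq_divide)
    also have "b\<^sup>2 * (1 + ((x - x0) / b)\<^sup>2) = (x - x0)\<^sup>2 + b\<^sup>2" using b(1) by (simp add: distrib_left power_divide)
    finally show "(1 / b) * (inverse (1 + ((x - x0) / b)\<^sup>2) * (1 / b)) = 1 / ((x - x0)\<^sup>2 + (y - y0)\<^sup>2 + \<delta>\<^sup>2)" unfolding b(2) by (simp add: add.assoc)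
   qed
   then show "((%x. (1 / b) * arctan ((x - x0) / b)) has_vector_derivative 1 / ((x - x0)\<^sup>2 + (y - y0)\<^sup>2 + \<delta>\<^sup>2)) (at x within {c..d})"
    by (simp add: has_real_derivative_iff_has_vector_derivative)
  qed
  from integral_unique[OF this]
  have "integral {c..d} (%x. 1 / ((x - x0)\<^sup>2 + (y - y0)\<^sup>2 + \<delta>\<^sup>2)) = (1 / b) * (arctan ((d - x0) / b) - arctan ((c - x0) / b))" by (simp add: right_diff_distrib)
  also have "\<dots> <= (1 / b) * pi" using b(1) arctan_ubound[of "(d - x0) / b"] arctan_lbound[of "(c - x0) / b"] by (intro mult_left_mono) auto
  also have "\<dots> = pi * AA \<delta> (y - y0) 0" unfolding AA_def b_def by simp
  finally show ?thesis .
 qed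
 have d0: "\<delta> \<noteq> 0" using \<delta> by simp
 have hi: "((%y. AA \<delta> (y - y0) 0) has_integral (FF \<delta> (R - y0) 0 - FF \<delta> (-R - y0) 0)) {-R..R}"
 proof (rule fundamental_theorem_of_calculus)
  fix y
  have "((%y. FF \<delta> (y - y0) 0) has_real_derivative AA \<delta> (y - y0) 0 * 1) (at y within {-R..R})"
   by (rule DERIV_chain2[OF FF_deriv[OF d0]]) (auto intro!: derivative_eq_intros)
  then show "((%y. FF \<delta> (y - y0) 0) has_vector_derivative AA \<delta> (y - y0) 0) (at y within {-R..R})"
   by (simp add: has_real_derivative_iff_has_vector_derivative)
 qed (use R in simp)
 have cF: "continuous_on ({c..d} \<times> {-R..R}) (%p. 1 / ((fst p - x0)\<^sup>2 + (snd p - y0)\<^sup>2 + \<delta>\<^sup>2))"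
  by (intro continuous_intros) (use pos in \<open>simp add: less_imp_neq[symmetric]\<close>)
 have "II c d R (%p. 1 / ((fst p - x0)\<^sup>2 + (snd p - y0)\<^sup>2 + \<delta>\<^sup>2)) <= integral {-R..R} (%y. pi * AA \<delta> (y - y0) 0)"
  unfolding II_def fst_conv snd_conv
 proof (intro integral_le inner)
  show "(%y. integral {c..d} (%x. 1 / ((x - x0)\<^sup>2 + (y - y0)\<^sup>2 + \<delta>\<^sup>2))) integrable_on {-R..R}"
   using integrable_continuous_real[OF II_inner_continuous[OF cF]] by simp
  show "(%y. pi * AA \<delta> (y - y0) 0) integrable_on {-R..R}"
   using has_integral_mult_right[OF hi, of pi] by (rule has_integral_integrable)
 qed
 also have "\<dots> = pi * (FF \<delta> (R - y0) 0 - FF \<delta> (-R - y0) 0)" using integral_unique[OF hi] by simp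
 also have "\<dots> <= pi * (2 * ln (4 * R / \<delta> + 1))"
 proof (rule mult_left_mono)
  have b: "arsinh (t / \<delta>) <= ln (4 * R / \<delta> + 1)" if t: "0 <= t" "t <= 2 * R" for t
  proof -
   have "arsinh (t / \<delta>) <= ln (2 * (t / \<delta>) + 1)" using t \<delta> by (intro arsinh_le) simp
   also have "\<dots> <= ln (4 * R / \<delta> + 1)"
   proof (rule ln_mono)
    have "2 * t / \<delta> <= 4 * R / \<delta>" using t \<delta> by (intro divide_right_mono) auto
    then show "2 * (t / \<delta>) + 1 <= 4 * R / \<delta> + 1" by simp
    show "0 < 2 * (t / \<delta>) + 1" using t \<delta> by (simp add: add_nonneg_pos)
   qed
   finally show ?thesis .
  qed
  have F0: "FF \<delta> t 0 = arsinh (t / \<delta>)" for t unfolding FF_def using \<delta> by simp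
  have m: "FF \<delta> (-R - y0) 0 = - arsinh ((R + y0) / \<delta>)"
  proof -
   have "(-R - y0) / \<delta> = - ((R + y0) / \<delta>)" using minus_divide_left[of "R + y0" \<delta>] by simp
   then show ?thesis unfolding F0 by (simp only: arsinh_minus_real)
  qed
  have "arsinh ((R - y0) / \<delta>) <= ln (4 * R / \<delta> + 1)" "arsinh ((R + y0) / \<delta>) <= ln (4 * R / \<delta> + 1)" by (rule b; use y0 in linarith)+
  then show "FF \<delta> (R - y0) 0 - FF \<delta> (-R - y0) 0 <= 2 * ln (4 * R / \<delta> + 1)" unfolding m F0[of "R - y0"] by linarith
 qed simp
 finally show ?thesis by simp
qed

lemma young_square: "0 <= (1/2) * e\<^sup>2 * X\<^sup>2 + 2 * e * x * w * X - e\<^sup>2 * X * h + e\<^sup>2 * h\<^sup>2 + 4 * w\<^sup>2 * x\<^sup>2" for e X x w h :: real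
proof -
 have "(1/2) * e\<^sup>2 * X\<^sup>2 + 2 * e * x * w * X - e\<^sup>2 * X * h + e\<^sup>2 * h\<^sup>2 + 4 * w\<^sup>2 * x\<^sup>2 = ((1/2) * e * X + 2 * w * x)\<^sup>2 + ((1/2) * e * X - e * h)\<^sup>2"
  by (simp add: power2_eq_square algebra_simps)
 then show ?thesis by simp
qed

text \<open>In the application \<open>X\<close>, \<open>Y\<close> are the derivatives of the
  solution, \<open>e\<close> is the cutoff and \<open>w\<close> the solution minus a boundary
  extension with derivatives \<open>hx\<close>, \<open>hy\<close>. The first two products on the
  right come from testing with \<open>e^2 * w\<close>; completing squares absorbs the mixed terms
  into half of the energy density.\<close>

lemma energy_pointwise:
 fixes e :: real
 assumes "A \<ge> 0"
 shows "(1/2) * e\<^sup>2 * (A * X\<^sup>2 + 2 * Y\<^sup>2) <= A * X * (2 * e * ex * w + e\<^sup>2 * (X - hx)) + 2 * Y * (2 * e * ey * w + e\<^sup>2 * (Y - hy))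
  + (e\<^sup>2 * (A * hx\<^sup>2 + 2 * hy\<^sup>2) + 4 * w\<^sup>2 * (A * ex\<^sup>2 + 2 * ey\<^sup>2))"
proof -
 have "0 <= A * ((1/2) * e\<^sup>2 * X\<^sup>2 + 2 * e * ex * w * X - e\<^sup>2 * X * hx + e\<^sup>2 * hx\<^sup>2 + 4 * w\<^sup>2 * ex\<^sup>2)"
  by (rule mult_nonneg_nonneg[OF assms young_square])
 moreover have "0 <= 2 * ((1/2) * e\<^sup>2 * Y\<^sup>2 + 2 * e * ey * w * Y - e\<^sup>2 * Y * hy + e\<^sup>2 * hy\<^sup>2 + 4 * w\<^sup>2 * ey\<^sup>2)"
  by (rule mult_nonneg_nonneg[OF _ young_square]) simp
 ultimately show ?thesis by (simp add: power2_eq_square algebra_simps)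
qed

lemma ln_square_le: fixes t :: real assumes "t \<ge> 1" shows "(ln t)\<^sup>2 <= 4 * t"
proof -
 have "ln t = 2 * ln (sqrt t)" using assms by (simp add: ln_sqrt)
 also have "\<dots> <= 2 * sqrt t" using ln_bound[of "sqrt t"] assms by simp
 finally have "ln t <= 2 * sqrt t" .
 moreover have "0 <= ln t" using assms by simp
 ultimately have "(ln t)\<^sup>2 <= (2 * sqrt t)\<^sup>2" by (intro power_mono)
 then show ?thesis using assms by (simp add: power_mult_distrib)
qed

lemma row_derivative:
 assumes "grad (strip R) f f1 f2" "y \<in> {-R..R}" shows "((%x. f (x, y)) has_real_derivative f1 (x, y)) (at x within T)"
proof -
 have "((%t. f ((0, y) + t *\<^sub>R (1, 0))) has_real_derivative fst (1::real,0::real) * f1 ((0, y) + x *\<^sub>R (1, 0)) + snd (1::real,0::real) * f2 ((0, y) + x *\<^sub>R (1, 0))) (at x within UNIV)"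
  by (rule grad_line[OF assms(1)]) (use assms(2) in \<open>auto simp: mem_strip abs_le_iff\<close>)
 then have "((%x. f (x, y)) has_real_derivative f1 (x, y)) (at x)" by simp
 then show ?thesis by (rule has_field_derivative_at_within)
qed

lemma column_derivative:
 assumes "grad (strip R) f f1 f2" "y \<in> {-R..R}" shows "((%y. f (x, y)) has_real_derivative f2 (x, y)) (at y within {-R..R})"
proof -
 have "((%t. f ((x, 0) + t *\<^sub>R (0, 1))) has_real_derivative fst (0::real,1::real) * f1 ((x, 0) + y *\<^sub>R (0, 1)) + snd (0::real,1::real) * f2 ((x, 0) + y *\<^sub>R (0, 1))) (at y within {-R..R})"
  by (rule grad_line[OF assms(1)]) (use assms(2) in \<open>auto simp: mem_strip abs_le_iff\<close>)
 then show ?thesis by simp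
qed

lemma AA_continuous_on:
 assumes "a \<noteq> 0" "continuous_on S f" shows "continuous_on S (%p. AA a (f p) (snd p))"
proof -
 have "sqrt ((f p)\<^sup>2 + (snd p)\<^sup>2 + a\<^sup>2) \<noteq> 0" for p using AA_base(1)[OF assms(1), of "f p" "snd p"] by simp
 then show ?thesis unfolding AA_def by (intro continuous_intros assms(2)) simp_all
qed

text \<open>The test function is \<open>eta^2 * (V 0 - h)\<close>, where \<open>h\<close>
  interpolates the boundary values linearly in \<open>y\<close>, so that it vanishes on the edges.
  The cutoff \<open>eta = ln (K / rho) / L\<close> does not have to vanish at the ends of the
  rectangle, since the boundary terms there cancel by periodicity. Both \<open>eta^2\<close> and the
  squared gradient of \<open>eta\<close> are at most a multiple of \<open>1 / (L^2 * rho)\<close>,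
  which \<open>II_log_kernel\<close> integrates.\<close>

lemma caccioppoli:
 assumes R: "R > 0" and P: "P > 0" and al: "0 < al" and a: "a \<noteq> 0" and M0: "M0 \<ge> 0"
  and S: "vsol R P al a \<beta> \<beta>1 \<beta>2 V" and D: "data_bounds R al M0 \<beta> \<beta>1 \<beta>2"
  and \<beta>P: "!!s x. s \<in> {R,-R} ==> \<beta> s (x + P) = \<beta> s x"
  and y0: "\<bar>y0\<bar> <= R" and \<delta>: "0 < \<delta>" "\<delta> <= 1" and L: "L > 0" and K: "K = P\<^sup>2 + 4 * R\<^sup>2 + 2"
 shows "II (x0 - P/2) (x0 + P/2) R (%p. (1/2) * ((1/L) * (ln K - ln ((fst p - x0)\<^sup>2 + (snd p - y0)\<^sup>2 + \<delta>\<^sup>2)))\<^sup>2 * (AA a (V 0 p) (snd p) * (V 1 p)\<^sup>2 + 2 * (V 2 p)\<^sup>2))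
   <= ((4 * K * ((1 / \<bar>a\<bar>) * M0\<^sup>2 + 2 * (M0 / R)\<^sup>2) + 64 * M0\<^sup>2 * (1 / \<bar>a\<bar> + 2)) / L\<^sup>2) * (2 * pi * ln (4 * R / \<delta> + 1))"
proof -
 define c where "c = x0 - P/2"
 define d where "d = x0 + P/2"
 have cd: "c <= d" unfolding c_def d_def using P by simp
 let ?X = "{c..d} \<times> {-R..R}"
 have XS: "?X \<subseteq> strip R" by (auto simp: mem_strip abs_le_iff)
 have Vj: "jet (strip R) V" and Vp: "per R P (V 0)" and Va: "adm R P al V" using S unfolding vsol_def adm_def by blast+
 have Vg: "grad (strip R) (V 0) (V 1) (V 2)" "grad (strip R) (V 1) (V 3) (V 4)" "grad (strip R) (V 2) (V 4) (V 5)" using Vj unfolding jet_def by blast+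
 obtain KV where KV: "!!i. i <= 5 ==> hb (strip R) al KV (V i)" using Va unfolding adm_def by blast
 have Vc: "continuous_on ?X (V i)" if "i <= 5" for i by (rule continuous_on_subset[OF hb_continuous[OF KV[OF that] al] XS])
 define rho where "rho = (%p. (fst p - x0)\<^sup>2 + (snd p - y0)\<^sup>2 + \<delta>\<^sup>2)"
 have rho: "rho p > 0" for p unfolding rho_def using AA_base(1)[of \<delta> "fst p - x0" "snd p - y0"] \<delta> by simp
 define eta where "eta = (%p. (1/L) * (ln K - ln (rho p)))"
 define etx where "etx = (%p. (1/L) * (- (2 * (fst p - x0) / rho p)))"
 define ety where "ety = (%p. (1/L) * (- (2 * (snd p - y0) / rho p)))"
 define h where "h = (%p. ((R + snd p) * \<beta> R (fst p) + (R - snd p) * \<beta> (-R) (fst p)) / (2 * R))"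
 define hx where "hx = (%p. ((R + snd p) * \<beta>1 R (fst p) + (R - snd p) * \<beta>1 (-R) (fst p)) / (2 * R))"
 define hy where "hy = (%p::real\<times>real. (\<beta> R (fst p) - \<beta> (-R) (fst p)) / (2 * R))"
 have mR: "R \<in> {R,-R}" "-R \<in> {R,-R}" by auto
 have b1: "(\<beta> s has_real_derivative \<beta>1 s x) (at x within T)" if "s \<in> {R,-R}" for s x T
  using S that unfolding vsol_def by (blast intro: has_field_derivative_at_within)
 have b2: "(\<beta>1 s has_real_derivative \<beta>2 s x) (at x within T)" if "s \<in> {R,-R}" for s x T
  using S that unfolding vsol_def by (blast intro: has_field_derivative_at_within)
 have cb: "continuous_on UNIV (\<beta> s)" "continuous_on UNIV (\<beta>1 s)" if "s \<in> {R,-R}" for s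
  by (rule DERIV_continuous_on[OF b1[OF that]], rule DERIV_continuous_on[OF b2[OF that]])
 have cbf: "continuous_on ?X (%p. \<beta> s (fst p))" "continuous_on ?X (%p. \<beta>1 s (fst p))" if "s \<in> {R,-R}" for s
  by (rule continuous_on_compose2[OF cb(1)[OF that]], intro continuous_intros, simp, rule continuous_on_compose2[OF cb(2)[OF that]], intro continuous_intros, simp)
 have ch: "continuous_on ?X h" "continuous_on ?X hx" "continuous_on ?X hy"
  unfolding h_def hx_def hy_def using R by (intro continuous_intros cbf mR; simp)+
 have crho: "continuous_on ?X rho" unfolding rho_def by (intro continuous_intros)
 have rne: "rho p \<noteq> 0" for p using rho[of p] by simp
 have ceta: "continuous_on ?X eta" "continuous_on ?X etx" "continuous_on ?X ety"
  unfolding eta_def etx_def ety_def using rne rho by (intro continuous_intros crho; simp)+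
 define A where "A = (%p. AA a (V 0 p) (snd p))"
 define Av where "Av = (%p. AV a (V 0 p) (snd p))"
 have cA: "continuous_on ?X A" unfolding A_def by (rule AA_continuous_on[OF a Vc]) simp
 have cAv: "continuous_on ?X Av" unfolding Av_def AV_def using cA unfolding A_def by (intro continuous_intros Vc) simp_all
 define w where "w = (%p. V 0 p - h p)"
 have cw: "continuous_on ?X w" unfolding w_def by (intro continuous_intros Vc ch) simp
 define aa where "aa = (%p. (A p * V 1 p) * ((eta p)\<^sup>2 * w p))"
 define bb where "bb = (%p. (2 * V 2 p) * ((eta p)\<^sup>2 * w p))"
 define ax where "ax = (%p. (A p * V 3 p + Av p * (V 1 p * V 1 p)) * ((eta p)\<^sup>2 * w p) + A p * V 1 p * (2 * eta p * etx p * w p + (eta p)\<^sup>2 * (V 1 p - hx p)))"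
 define bx where "bx = (%p. (2 * V 5 p) * ((eta p)\<^sup>2 * w p) + 2 * V 2 p * (2 * eta p * ety p * w p + (eta p)\<^sup>2 * (V 2 p - hy p)))"
 define E where "E = (%p. (1/2) * (eta p)\<^sup>2 * (A p * (V 1 p)\<^sup>2 + 2 * (V 2 p)\<^sup>2))"
 define B where "B = (%p. (eta p)\<^sup>2 * (A p * (hx p)\<^sup>2 + 2 * (hy p)\<^sup>2) + 4 * (w p)\<^sup>2 * (A p * (etx p)\<^sup>2 + 2 * (ety p)\<^sup>2))"
 have cax: "continuous_on ?X ax" unfolding ax_def by (intro continuous_intros cA cAv Vc ceta cw ch) simp_all
 have cbx: "continuous_on ?X bx" unfolding bx_def by (intro continuous_intros cA cAv Vc ceta cw ch) simp_all
 have cE: "continuous_on ?X E" unfolding E_def by (intro continuous_intros cA Vc ceta) simp_all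
 have cB: "continuous_on ?X B" unfolding B_def by (intro continuous_intros cA ceta cw ch)
 have dex: "((%x. eta (x, y)) has_real_derivative etx (x, y)) (at x within T)" for x y T
  unfolding eta_def etx_def
 proof (intro DERIV_cmult)
  have "((%x. rho (x, y)) has_real_derivative 2 * (x - x0)) (at x within T)" unfolding rho_def by (auto intro!: derivative_eq_intros)
  from DERIV_diff[OF DERIV_const DERIV_chain2[OF DERIV_ln[OF rho] this]]
  show "((%x. ln K - ln (rho (x, y))) has_real_derivative - (2 * (fst (x, y) - x0) / rho (x, y))) (at x within T)"
   by (rule DERIV_cong) (simp add: divide_inverse)
 qed
 have dey: "((%y. eta (x, y)) has_real_derivative ety (x, y)) (at y within T)" for x y T
  unfolding eta_def ety_def
 proof (intro DERIV_cmult)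
  have "((%y. rho (x, y)) has_real_derivative 2 * (y - y0)) (at y within T)" unfolding rho_def by (auto intro!: derivative_eq_intros)
  from DERIV_diff[OF DERIV_const DERIV_chain2[OF DERIV_ln[OF rho] this]]
  show "((%y. ln K - ln (rho (x, y))) has_real_derivative - (2 * (snd (x, y) - y0) / rho (x, y))) (at y within T)"
   by (rule DERIV_cong) (simp add: divide_inverse)
 qed
 have dhx: "((%x. h (x, y)) has_real_derivative hx (x, y)) (at x within T)" for x y T
  unfolding h_def hx_def fst_conv snd_conv by (intro DERIV_cdivide DERIV_add DERIV_cmult b1 mR)
 have dhy: "((%y. h (x, y)) has_real_derivative hy (x, y)) (at y within T)" for x y T
  unfolding h_def hy_def fst_conv snd_conv by (intro DERIV_cdivide) (auto intro!: derivative_eq_intros)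
 have zero: "II c d R (%p. ax p + bx p) = 0"
 proof (rule II_divergence_zero[OF cd R _ _ cax cbx])
  fix x y assume y: "y \<in> {-R..R}"
  let ?T = "{c..d}"
  have d0: "((%x. V 0 (x, y)) has_real_derivative V 1 (x, y)) (at x within ?T)" by (rule row_derivative[OF Vg(1) y])
  have d1: "((%x. V 1 (x, y)) has_real_derivative V 3 (x, y)) (at x within ?T)" by (rule row_derivative[OF Vg(2) y])
  have dA: "((%x. A (x, y)) has_real_derivative Av (x, y) * V 1 (x, y)) (at x within ?T)"
   unfolding A_def Av_def snd_conv by (rule DERIV_chain2[OF AA_deriv(1)[OF a] d0])
  have dw: "((%x. w (x, y)) has_real_derivative V 1 (x, y) - hx (x, y)) (at x within ?T)" unfolding w_def by (intro DERIV_diff d0 dhx)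
  have dp: "((%x. (eta (x, y))\<^sup>2) has_real_derivative 2 * eta (x, y) * etx (x, y)) (at x within ?T)"
   by (rule DERIV_cong[OF DERIV_power[OF dex]]) simp
  show "((%x. aa (x, y)) has_real_derivative ax (x, y)) (at x within ?T)"
   unfolding aa_def
   by (rule DERIV_cong[OF DERIV_mult[OF DERIV_mult[OF dA d1] DERIV_mult[OF dp dw]]]) (simp add: ax_def algebra_simps)
 next
  fix x y assume y: "y \<in> {-R..R}"
  let ?T = "{-R..R}"
  have d0: "((%y. V 0 (x, y)) has_real_derivative V 2 (x, y)) (at y within ?T)" by (rule column_derivative[OF Vg(1) y])
  have d1: "((%y. V 2 (x, y)) has_real_derivative V 5 (x, y)) (at y within ?T)" by (rule column_derivative[OF Vg(3) y])
  have dw: "((%y. w (x, y)) has_real_derivative V 2 (x, y) - hy (x, y)) (at y within ?T)" unfolding w_def by (intro DERIV_diff d0 dhy)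
  have dp: "((%y. (eta (x, y))\<^sup>2) has_real_derivative 2 * eta (x, y) * ety (x, y)) (at y within ?T)"
   by (rule DERIV_cong[OF DERIV_power[OF dey]]) simp
  show "((%y. bb (x, y)) has_real_derivative bx (x, y)) (at y within ?T)"
   unfolding bb_def
   by (rule DERIV_cong[OF DERIV_mult[OF DERIV_cmult[OF d1] DERIV_mult[OF dp dw]]]) (simp add: bx_def algebra_simps)
 next
  fix y assume y: "y \<in> {-R..R}"
  have m: "(c, y) \<in> strip R" using y by (auto simp: mem_strip abs_le_iff)
  have dc: "(c, y) + (P, 0) = (d, y)" unfolding c_def d_def by simp
  have v: "V 0 (d, y) = V 0 (c, y)" "V 1 (d, y) = V 1 (c, y)"
   using perD[OF Vp m] perD[OF adm_per[OF Va R, of 1] m] unfolding dc by simp_all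
  have "\<beta> s d = \<beta> s c" if "s \<in> {R,-R}" for s using \<beta>P[OF that, of c] unfolding c_def d_def by (simp add: add.commute)
  then have hh: "h (d, y) = h (c, y)" unfolding h_def using mR by simp
  \<comment> \<open>The rectangle is centred at \<open>x0\<close>, so the cutoff agrees at its two
    ends although it is not periodic.\<close>
  have "rho (d, y) = rho (c, y)" unfolding rho_def c_def d_def by (simp add: power2_eq_square)
  then have "eta (d, y) = eta (c, y)" unfolding eta_def by simp
  then show "aa (d, y) = aa (c, y)" unfolding aa_def A_def w_def using v hh by simp
 next
  fix x
  have "V 0 (x, s) = \<beta> s x" if "s \<in> {R,-R}" for s using S that unfolding vsol_def by blast
  then have "w (x, R) = 0" "w (x, -R) = 0" unfolding w_def h_def using R mR by simp_all
  then show "bb (x, R) = bb (x, -R)" unfolding bb_def by simp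
 qed
 have A01: "0 <= A p" "A p <= 1 / \<bar>a\<bar>" for p unfolding A_def using AA_pos[OF a] AA_le[OF a] less_imp_le by blast+
 have EB: "E p <= (ax p + bx p) + B p" if p: "p \<in> ?X" for p
 proof -
  have "A p * V 3 p + 2 * V 5 p = - Av p * (V 1 p * V 1 p)" using S p XS unfolding vsol_def A_def Av_def by blast
  then have s0: "A p * V 3 p + Av p * (V 1 p * V 1 p) + 2 * V 5 p = 0" by simp
  have z: "(A p * V 3 p + Av p * (V 1 p * V 1 p)) * ((eta p)\<^sup>2 * w p) + (2 * V 5 p) * ((eta p)\<^sup>2 * w p) = 0"
   unfolding distrib_right[symmetric] s0 by simp
  have "ax p + bx p = A p * V 1 p * (2 * eta p * etx p * w p + (eta p)\<^sup>2 * (V 1 p - hx p)) + 2 * V 2 p * (2 * eta p * ety p * w p + (eta p)\<^sup>2 * (V 2 p - hy p))"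
   unfolding ax_def bx_def using z by linarith
  then show ?thesis unfolding E_def B_def using energy_pointwise[OF A01(1)] by simp
 qed
 define k1 where "k1 = (1 / \<bar>a\<bar>) * M0\<^sup>2 + 2 * (M0 / R)\<^sup>2"
 define k2 where "k2 = 1 / \<bar>a\<bar> + 2"
 have k0: "k1 \<ge> 0" "k2 \<ge> 0" unfolding k1_def k2_def by simp_all
 define C where "C = (4 * K * k1 + 64 * M0\<^sup>2 * k2) / L\<^sup>2"
 have BC: "B p <= C * (1 / rho p)" if p: "p \<in> ?X" for p
 proof -
  have pS: "p \<in> strip R" using p XS by blast
  obtain x y where xy: "p = (x, y)" "x \<in> {c..d}" "y \<in> {-R..R}" using p by auto
  have bM: "\<bar>\<beta> s x\<bar> <= M0" "\<bar>\<beta>1 s x\<bar> <= M0" if "s \<in> {R,-R}" for s x using D that unfolding data_bounds_def by blast+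
  have comb: "\<bar>((R + y) * u + (R - y) * v) / (2 * R)\<bar> <= M0" if "\<bar>u\<bar> <= M0" "\<bar>v\<bar> <= M0" for u v
  proof -
   have "\<bar>(R + y) * u + (R - y) * v\<bar> <= (R + y) * \<bar>u\<bar> + (R - y) * \<bar>v\<bar>"
    using abs_triangle_ineq[of "(R + y) * u" "(R - y) * v"] xy(3) by (simp add: abs_mult)
   also have "\<dots> <= (R + y) * M0 + (R - y) * M0" using that xy(3) by (intro add_mono mult_left_mono) auto
   also have "\<dots> = M0 * (2 * R)" by (simp add: algebra_simps)
   finally show ?thesis using R by (simp add: divide_le_eq)
  qed
  have hb: "\<bar>h p\<bar> <= M0" "\<bar>hx p\<bar> <= M0" unfolding h_def hx_def xy(1) fst_conv snd_conv by (intro comb bM mR)+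
  have hyb: "\<bar>hy p\<bar> <= M0 / R"
  proof -
   have "\<bar>\<beta> R x - \<beta> (-R) x\<bar> <= 2 * M0" using bM(1)[OF mR(1), of x] bM(1)[OF mR(2), of x] by linarith
   then have "\<bar>\<beta> R x - \<beta> (-R) x\<bar> / (2 * R) <= 2 * M0 / (2 * R)" using R by (intro divide_right_mono) auto
   then show ?thesis unfolding hy_def xy(1) using R by simp
  qed
  have wb: "\<bar>w p\<bar> <= 2 * M0" unfolding w_def using hb(1) vsol_sup[OF R P a S D pS] by linarith
  have sq: "u\<^sup>2 <= v\<^sup>2" if "\<bar>u\<bar> <= v" for u v :: real using power_mono[OF that, of 2] by simp
  have s1: "A p * (hx p)\<^sup>2 + 2 * (hy p)\<^sup>2 <= k1" unfolding k1_def
   using sq[OF hb(2)] sq[OF hyb] A01[of p] by (intro add_mono mult_mono mult_left_mono) auto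
  have rK: "rho p <= K"
  proof -
   have "\<bar>x - x0\<bar> <= P" using xy(2) P unfolding c_def d_def by (auto simp: abs_le_iff)
   moreover have "\<bar>y - y0\<bar> <= 2 * R" using xy(3) y0 by (auto simp: abs_le_iff)
   moreover have "\<delta>\<^sup>2 <= 1" using \<delta> by (simp add: power_le_one)
   ultimately show ?thesis unfolding rho_def K xy(1) using sq[of "x - x0" P] sq[of "y - y0" "2 * R"] by (simp add: power_mult_distrib)
  qed
  have K0: "K > 0" using rK rho[of p] by linarith
  \<comment> \<open>\<open>K\<close> dominates \<open>rho\<close> term by term, so the logarithm is
    nonnegative, and \<open>(ln t)^2 <= 4 * t\<close> trades its square for \<open>1 / rho\<close>,
    the kernel whose integral is known.\<close>
  have e1: "(eta p)\<^sup>2 <= (4 * K / L\<^sup>2) * (1 / rho p)"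
  proof -
   have "eta p = (1/L) * ln (K / rho p)" unfolding eta_def using ln_div[of K "rho p"] K0 rho[of p] by simp
   then have "(eta p)\<^sup>2 = (1 / L\<^sup>2) * (ln (K / rho p))\<^sup>2" by (simp add: power_mult_distrib power_divide)
   also have "\<dots> <= (1 / L\<^sup>2) * (4 * (K / rho p))" using rK rho[of p] by (intro mult_left_mono ln_square_le) simp_all
   finally show ?thesis by simp
  qed
  have e2: "(etx p)\<^sup>2 + (ety p)\<^sup>2 <= (4 / L\<^sup>2) * (1 / rho p)"
  proof -
   have qq: "((1 / L) * (- (2 * u / r)))\<^sup>2 = (4 / L\<^sup>2) * (u\<^sup>2 / r\<^sup>2)" for u r by (simp add: power_mult_distrib power_divide)
   have "(etx p)\<^sup>2 + (ety p)\<^sup>2 = (4 / L\<^sup>2) * (((x - x0)\<^sup>2 + (y - y0)\<^sup>2) / (rho p)\<^sup>2)"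
    unfolding etx_def ety_def xy(1) fst_conv snd_conv qq add_divide_distrib distrib_left ..
   also have "\<dots> <= (4 / L\<^sup>2) * (rho p / (rho p)\<^sup>2)"
    by (intro mult_left_mono divide_right_mono) (simp_all add: rho_def xy(1))
   also have "rho p / (rho p)\<^sup>2 = 1 / rho p" using rho[of p] by (simp add: power2_eq_square)
   finally show ?thesis .
  qed
  have s2: "A p * (etx p)\<^sup>2 + 2 * (ety p)\<^sup>2 <= k2 * ((etx p)\<^sup>2 + (ety p)\<^sup>2)"
  proof -
   have "A p * (etx p)\<^sup>2 <= k2 * (etx p)\<^sup>2" "2 * (ety p)\<^sup>2 <= k2 * (ety p)\<^sup>2"
    using A01[of p] unfolding k2_def by (intro mult_right_mono; simp)+
   then show ?thesis by (simp add: distrib_left)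
  qed
  have "(eta p)\<^sup>2 * (A p * (hx p)\<^sup>2 + 2 * (hy p)\<^sup>2) <= ((4 * K / L\<^sup>2) * (1 / rho p)) * k1"
   by (rule mult_mono[OF e1 s1 order_trans[OF zero_le_power2 e1]]) (use A01[of p] in simp)
  moreover have "4 * (w p)\<^sup>2 * (A p * (etx p)\<^sup>2 + 2 * (ety p)\<^sup>2) <= (16 * M0\<^sup>2) * (k2 * ((4 / L\<^sup>2) * (1 / rho p)))"
  proof (rule mult_mono)
   show "4 * (w p)\<^sup>2 <= 16 * M0\<^sup>2" using sq[OF wb] by (simp add: power_mult_distrib)
   show "A p * (etx p)\<^sup>2 + 2 * (ety p)\<^sup>2 <= k2 * ((4 / L\<^sup>2) * (1 / rho p))" using s2 mult_left_mono[OF e2 k0(2)] by linarith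
  qed (use A01[of p] in auto)
  ultimately have "B p <= ((4 * K / L\<^sup>2) * (1 / rho p)) * k1 + (16 * M0\<^sup>2) * (k2 * ((4 / L\<^sup>2) * (1 / rho p)))" unfolding B_def by linarith
  also have "\<dots> = C * (1 / rho p)" unfolding C_def by (simp add: add_divide_distrib algebra_simps)
  finally show ?thesis .
 qed
 have cr: "continuous_on ?X (%p. 1 / rho p)" using rne by (intro continuous_intros crho) simp
 have "II c d R E <= II c d R (%p. (ax p + bx p) + B p)"
  by (rule II_mono[OF cE]) (intro continuous_intros cax cbx cB, use EB in auto)
 also have "\<dots> = II c d R (%p. ax p + bx p) + II c d R B" by (rule II_add[OF continuous_on_add[OF cax cbx] cB])
 also have "\<dots> = II c d R B" unfolding zero by simp
 also have "\<dots> <= II c d R (%p. C * (1 / rho p))"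
  by (rule II_mono[OF cB]) (intro continuous_intros cr, use BC in auto)
 also have "\<dots> = C * II c d R (%p. 1 / rho p)" unfolding II_def by (simp only: integral_mult_right)
 also have "\<dots> <= C * (2 * pi * ln (4 * R / \<delta> + 1))"
 proof (rule mult_left_mono)
  show "II c d R (%p. 1 / rho p) <= 2 * pi * ln (4 * R / \<delta> + 1)" unfolding rho_def by (rule II_log_kernel[OF R cd \<delta>(1) y0])
  show "0 <= C" unfolding C_def K using k0 by simp
 qed
 finally show ?thesis unfolding E_def eta_def rho_def A_def C_def k1_def k2_def c_def d_def .
qed

text \<open>Near a point where the gradient has size \<open>M\<close> it stays of that size on a square of side
 comparable to \<open>1 / M\<close>, which costs a fixed amount of energy; the logarithmic cutoff in
 \<open>caccioppoli\<close> allows only an amount of order \<open>1 / ln M\<close>.\<close>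
lemma gradient_bound:
 assumes R: "R > 0" and P: "P > 0" and al: "0 < al" "al < 1" and a: "a \<noteq> 0" and M0: "M0 \<ge> 0"
 shows "\<exists>B. \<forall>V \<beta> \<beta>1 \<beta>2. vsol R P al a \<beta> \<beta>1 \<beta>2 V --> data_bounds R al M0 \<beta> \<beta>1 \<beta>2 -->
   (\<forall>s\<in>{R,-R}. \<forall>x. \<beta> s (x + P) = \<beta> s x) --> (\<forall>p\<in>strip R. \<bar>V 1 p\<bar> <= B \<and> \<bar>V 2 p\<bar> <= B)"
proof -
 obtain C where C: "C > 0" "!!V \<beta> \<beta>1 \<beta>2 M i p. vsol R P al a \<beta> \<beta>1 \<beta>2 V ==> data_bounds R al M0 \<beta> \<beta>1 \<beta>2 ==> M \<ge> 1 ==>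
   (\<forall>p\<in>strip R. \<bar>V 1 p\<bar> <= M \<and> \<bar>V 2 p\<bar> <= M) ==> i \<in> {3,4,5} ==> p \<in> strip R ==> \<bar>V i p\<bar> <= C * M\<^sup>2"
  using scaled_second_derivatives[OF R P al a M0] by blast
 define \<mu> where "\<mu> = 1 / sqrt (M0\<^sup>2 + R\<^sup>2 + a\<^sup>2)"
 have mu: "\<mu> > 0" unfolding \<mu>_def using AA_base(1)[OF a, of M0 R] by simp
 define m where "m = min \<mu> 2"
 have m0: "m > 0" "m <= \<mu>" "m <= 2" unfolding m_def using mu by auto
 \<comment> \<open>The square will have side \<open>\<kappa> / M\<close>. The bound
   \<open>1/2\<close> puts it where the cutoff is at least 1, \<open>P/2\<close> and
   \<open>R\<close> make it fit into the rectangle, and \<open>1 / (16 * C)\<close> keeps the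
   oscillation of the gradient on it at most \<open>M / 4\<close>.\<close>
 define \<kappa> where "\<kappa> = min (min (1/2) (P/2)) (min R (1 / (16 * C)))"
 have k: "\<kappa> > 0" "\<kappa> <= 1/2" "\<kappa> <= P/2" "\<kappa> <= R" "\<kappa> <= 1 / (16 * C)" unfolding \<kappa>_def using R P C(1) by auto
 define c1 where "c1 = (m / 32) * \<kappa>\<^sup>2"
 have c1: "c1 > 0" unfolding c1_def using m0 k by simp
 define K where "K = P\<^sup>2 + 4 * R\<^sup>2 + 2"
 define C3 where "C3 = 4 * K * ((1 / \<bar>a\<bar>) * M0\<^sup>2 + 2 * (M0 / R)\<^sup>2) + 64 * M0\<^sup>2 * (1 / \<bar>a\<bar> + 2)"
 have C30: "C3 \<ge> 0" unfolding C3_def K_def by (intro add_nonneg_nonneg mult_nonneg_nonneg) simp_all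
 define C4 where "C4 = ln (4 * R + 1) / ln 2 + 1"
 define C5 where "C5 = C3 * pi * C4 / 2"
 define B where "B = max 2 (exp (C5 / c1))"
 have main: "\<bar>V j p\<bar> <= B" if S: "vsol R P al a \<beta> \<beta>1 \<beta>2 V" and D: "data_bounds R al M0 \<beta> \<beta>1 \<beta>2"
  and \<beta>P: "\<forall>s\<in>{R,-R}. \<forall>x. \<beta> s (x + P) = \<beta> s x" and jp: "j \<in> {1,2}" "p \<in> strip R" for V \<beta> \<beta>1 \<beta>2 j p
 proof -
  obtain KV where KV: "!!i. i <= 5 ==> hb (strip R) al KV (V i)" using S unfolding vsol_def adm_def by blast
  define T where "T = (%(j, p). \<bar>V j p\<bar>) ` ({1,2} \<times> strip R)"
  have Tb: "bdd_above T"
  proof (rule bdd_aboveI[of _ KV])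
   fix t assume "t \<in> T"
   then obtain j p where t: "t = \<bar>V j p\<bar>" "j \<in> {1,2}" "p \<in> strip R" unfolding T_def by auto
   have "j <= 5" using t(2) by auto
   then show "t <= KV" using KV[of j] t unfolding hb_def by blast
  qed
  have Tne: "T \<noteq> {}" using jp unfolding T_def by blast
  \<comment> \<open>The supremum is finite by the qualitative bound \<open>KV\<close>. It may not be
    attained, so the square is placed at a point with value above \<open>M / 2\<close>, which leaves
    at least \<open>M / 4\<close> on all of it.\<close>
  define M where "M = Sup T"
  have up: "\<bar>V j p\<bar> <= M" if "j \<in> {1,2}" "p \<in> strip R" for j p
   unfolding M_def by (rule cSup_upper[OF _ Tb]) (use that in \<open>auto simp: T_def\<close>)
  have "M <= B"
  proof (cases "M < 2")
   case True then show ?thesis unfolding B_def by simp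
  next
   case False
   then have M2: "M \<ge> 2" by simp
   have "M / 2 < Sup T" using M2 unfolding M_def[symmetric] by simp
   from less_cSupD[OF Tne this] obtain i q where iq: "i \<in> {1,2}" "q \<in> strip R" "M / 2 < \<bar>V i q\<bar>" unfolding T_def by auto
   obtain x0 y0 where q: "q = (x0, y0)" by (cases q)
   have y0: "\<bar>y0\<bar> <= R" using iq(2) unfolding q by (simp add: mem_strip)
   have Vb: "\<forall>p\<in>strip R. \<bar>V 1 p\<bar> <= M \<and> \<bar>V 2 p\<bar> <= M" using up by simp
   have M1: "M \<ge> 1" using M2 by simp
   have V2: "\<bar>V i' p\<bar> <= C * M\<^sup>2" if "i' \<in> {3,4,5}" "p \<in> strip R" for i' p by (rule C(2)[OF S D M1 Vb that])
   define s where "s = \<kappa> / M"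
   have s: "s > 0" "s <= \<kappa>" unfolding s_def using k(1) M2 by (auto simp: divide_le_eq mult_le_cancel_left1)
   define y1 where "y1 = (if y0 <= 0 then y0 else y0 - s)"
   have y1: "-R <= y1" "y1 + s <= R" using y0 s k(4) unfolding y1_def by (auto simp: abs_le_iff)
   have Vj: "jet (strip R) V" using S unfolding vsol_def adm_def by blast
   have Vg: "grad (strip R) (V 1) (V 3) (V 4)" "grad (strip R) (V 2) (V 4) (V 5)" using Vj unfolding jet_def by blast+
   have near: "M / 4 <= \<bar>V i (x, y)\<bar>" if xy: "x \<in> {x0..x0 + s}" "y \<in> {y1..y1 + s}" for x y
   proof -
    have yy: "\<bar>y - y0\<bar> <= s" "\<bar>x - x0\<bar> <= s" using xy s unfolding y1_def by (auto simp: abs_le_iff split: if_splits)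
    have mem: "(x, y) \<in> strip R" using xy y1 by (auto simp: mem_strip abs_le_iff)
    have "dist (x, y) q <= \<bar>x - x0\<bar> + \<bar>y - y0\<bar>" using norm_Pair_le[of "x - x0" "y - y0"] unfolding q dist_norm by simp
    then have dq: "dist (x, y) q <= 2 * s" using yy by linarith
    have "\<bar>V i (x, y) - V i q\<bar> <= 2 * (C * M\<^sup>2) * dist (x, y) q"
    proof (cases "i = 1")
     case True
     show ?thesis unfolding True by (rule grad_lipschitz[OF convex_strip Vg(1) V2 V2 mem iq(2)]) simp_all
    next
     case False
     then have "i = 2" using iq(1) by simp
     show ?thesis unfolding \<open>i = 2\<close> by (rule grad_lipschitz[OF convex_strip Vg(2) V2 V2 mem iq(2)]) simp_all
    qed
    also have "\<dots> <= 2 * (C * M\<^sup>2) * (2 * s)" using dq C(1) by (intro mult_left_mono) auto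
    also have "\<dots> = 4 * C * M * \<kappa>" unfolding s_def using M2 by (simp add: power2_eq_square)
    also have "\<dots> <= 4 * C * M * (1 / (16 * C))" using k(5) C(1) M2 by (intro mult_left_mono) auto
    also have "\<dots> = M / 4" using C(1) by simp
    finally show ?thesis using iq(3) by linarith
   qed
   define \<delta> where "\<delta> = 1 / M"
   have \<delta>: "0 < \<delta>" "\<delta> <= 1" unfolding \<delta>_def using M2 by auto
   \<comment> \<open>With \<open>\<delta> = 1 / M\<close> the cutoff is at least 1 as soon as
     \<open>rho <= K / M^2\<close>. The upper bound from \<open>caccioppoli\<close> then is of the
     order \<open>ln M / L^2\<close>, that is, \<open>1 / ln M\<close>.\<close>
   define L where "L = 2 * ln M"
   have lnM: "ln M > 0" using M2 by simp
   then have L: "L > 0" unfolding L_def by simp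
   define F where "F = (%p. (1/2) * ((1/L) * (ln K - ln ((fst p - x0)\<^sup>2 + (snd p - y0)\<^sup>2 + \<delta>\<^sup>2)))\<^sup>2 * (AA a (V 0 p) (snd p) * (V 1 p)\<^sup>2 + 2 * (V 2 p)\<^sup>2))"
   define c where "c = x0 - P/2"
   define d where "d = x0 + P/2"
   have upper: "II c d R F <= (C3 / L\<^sup>2) * (2 * pi * ln (4 * R / \<delta> + 1))"
    unfolding F_def c_def d_def C3_def
    by (rule caccioppoli[OF R P al(1) a M0 S D _ y0 \<delta> L K_def]) (use \<beta>P in blast)
   have AA0: "0 <= AA a v y" for v y using AA_pos[OF a] less_imp_le by blast
   have lower: "(m / 32 * M\<^sup>2) * ((x0 + s) - x0) * ((y1 + s) - y1) <= II c d R F"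
   proof (rule II_lower)
    let ?X = "{c..d} \<times> {-R..R}"
    have XS: "?X \<subseteq> strip R" by (auto simp: mem_strip abs_le_iff)
    have Vc: "continuous_on ?X (V i)" if "i <= 5" for i by (rule continuous_on_subset[OF hb_continuous[OF KV[OF that] al(1)] XS])
    have rne: "(fst p - x0)\<^sup>2 + (snd p - y0)\<^sup>2 + \<delta>\<^sup>2 > 0" for p :: "real \<times> real" using AA_base(1)[of \<delta> "fst p - x0" "snd p - y0"] \<delta> by simp
    have nz: "(fst p - x0)\<^sup>2 + (snd p - y0)\<^sup>2 + \<delta>\<^sup>2 \<noteq> 0" for p :: "real \<times> real" using rne[of p] by simp
    show "continuous_on ?X F" unfolding F_def
     by (intro continuous_intros AA_continuous_on[OF a] Vc) (use rne nz in simp_all)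
    show "0 <= F (x, y)" for x y unfolding F_def using AA0 by simp
    show "c <= x0" "x0 <= x0 + s" "x0 + s <= d" "-R <= y1" "y1 <= y1 + s" "y1 + s <= R"
     unfolding c_def d_def using P s k(3) y1 by auto
    fix x y assume xy: "x \<in> {x0..x0 + s}" "y \<in> {y1..y1 + s}"
    have mem: "(x, y) \<in> strip R" using xy y1 by (auto simp: mem_strip abs_le_iff)
    have yy: "\<bar>y - y0\<bar> <= s" "\<bar>x - x0\<bar> <= s" using xy s unfolding y1_def by (auto simp: abs_le_iff split: if_splits)
    have s\<delta>: "s <= \<delta> / 2" unfolding s_def \<delta>_def using k(2) M2 by (simp add: divide_le_eq)
    define rho where "rho = (x - x0)\<^sup>2 + (y - y0)\<^sup>2 + \<delta>\<^sup>2"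
    have r0: "rho > 0" unfolding rho_def using rne[of "(x, y)"] by simp
    have "(x - x0)\<^sup>2 <= (\<delta> / 2)\<^sup>2" "(y - y0)\<^sup>2 <= (\<delta> / 2)\<^sup>2"
     using power_mono[of "\<bar>x - x0\<bar>" "\<delta> / 2" 2] power_mono[of "\<bar>y - y0\<bar>" "\<delta> / 2" 2] yy s\<delta> by simp_all
    moreover have "(\<delta> / 2)\<^sup>2 = \<delta>\<^sup>2 / 4" by (simp add: power_divide)
    ultimately have "rho <= 2 * \<delta>\<^sup>2" unfolding rho_def using zero_le_power2[of \<delta>] by linarith
    also have "\<dots> <= K * \<delta>\<^sup>2" unfolding K_def by (intro mult_right_mono) auto
    finally have "rho <= K / M\<^sup>2" unfolding \<delta>_def by (simp add: power_divide)
    moreover have K0: "K > 0" unfolding K_def by (simp add: add_nonneg_pos)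
    ultimately have "ln rho <= ln (K / M\<^sup>2)" using r0 by (intro ln_mono)
    also have "\<dots> = ln K - L" unfolding L_def using K0 M2 by (simp add: ln_div ln_realpow)
    finally have "1 <= (1 / L) * (ln K - ln rho)" using L by simp
    then have e1: "1 <= ((1 / L) * (ln K - ln rho))\<^sup>2" by (rule one_le_power)
    have V0: "\<bar>V 0 (x, y)\<bar> <= M0" by (rule vsol_sup[OF R P a S D mem])
    have "\<mu> <= AA a (V 0 (x, y)) y" unfolding \<mu>_def by (rule AA_ge[OF a V0]) (use mem in \<open>simp add: mem_strip\<close>)
    then have mA: "m <= AA a (V 0 (x, y)) y" using m0 by linarith
    have "(M / 4)\<^sup>2 <= (V i (x, y))\<^sup>2" using power_mono[OF near[OF xy], of 2] M2 by simp
    then have "(M / 4)\<^sup>2 <= (V 1 (x, y))\<^sup>2 + (V 2 (x, y))\<^sup>2" using iq(1) by (auto intro: order_trans)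
    then have "m * (M / 4)\<^sup>2 <= m * ((V 1 (x, y))\<^sup>2 + (V 2 (x, y))\<^sup>2)" using m0 by (intro mult_left_mono) auto
    also have "\<dots> <= AA a (V 0 (x, y)) y * (V 1 (x, y))\<^sup>2 + 2 * (V 2 (x, y))\<^sup>2"
     unfolding distrib_left using mA m0 by (intro add_mono mult_right_mono) auto
    finally have q1: "m * (M / 4)\<^sup>2 <= AA a (V 0 (x, y)) y * (V 1 (x, y))\<^sup>2 + 2 * (V 2 (x, y))\<^sup>2" .
    have "m / 32 * M\<^sup>2 = (1/2) * 1 * (m * (M / 4)\<^sup>2)" by (simp add: power_divide)
    also have "\<dots> <= (1/2) * ((1 / L) * (ln K - ln rho))\<^sup>2 * (AA a (V 0 (x, y)) y * (V 1 (x, y))\<^sup>2 + 2 * (V 2 (x, y))\<^sup>2)"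
     using e1 q1 m0 by (intro mult_mono) auto
    finally show "m / 32 * M\<^sup>2 <= F (x, y)" unfolding F_def rho_def by simp
   qed
   have "(m / 32 * M\<^sup>2) * ((x0 + s) - x0) * ((y1 + s) - y1) = c1" unfolding c1_def s_def using M2 by (simp add: power2_eq_square)
   then have le: "c1 <= (C3 / L\<^sup>2) * (2 * pi * ln (4 * R / \<delta> + 1))" using lower upper by linarith
   \<comment> \<open>As \<open>M >= 2\<close>, the constant \<open>ln (4 * R + 1)\<close> is at most
     a multiple of \<open>ln M\<close>; this is the origin of \<open>C4\<close>.\<close>
   have "ln (4 * R / \<delta> + 1) <= ln ((4 * R + 1) * M)" unfolding \<delta>_def using R M2 by (intro ln_mono) (auto simp: algebra_simps add_pos_pos)
   also have "\<dots> = ln (4 * R + 1) + ln M" using R M2 by (intro ln_mult_pos) auto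
   also have "\<dots> <= C4 * ln M"
   proof -
    have "ln (4 * R + 1) = (ln (4 * R + 1) / ln 2) * ln 2" by simp
    also have "\<dots> <= (ln (4 * R + 1) / ln 2) * ln M" using R M2 by (intro mult_left_mono) auto
    finally show ?thesis unfolding C4_def by (simp add: algebra_simps)
   qed
   finally have "2 * pi * ln (4 * R / \<delta> + 1) <= 2 * pi * (C4 * ln M)" by simp
   then have "c1 <= (C3 / L\<^sup>2) * (2 * pi * (C4 * ln M))" using le mult_left_mono[of _ _ "C3 / L\<^sup>2"] C30 by (meson divide_nonneg_nonneg order_trans zero_le_power2)
   also have "\<dots> = C5 / ln M" unfolding C5_def L_def using lnM by (simp add: power2_eq_square field_simps)
   finally have "ln M <= C5 / c1" using lnM c1 by (simp add: field_simps)
   then have "M <= exp (C5 / c1)" using M2 by (metis exp_le_cancel_iff exp_ln less_le_trans zero_less_numeral)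
   then show ?thesis unfolding B_def by simp
  qed
  then show ?thesis using up[OF jp] by linarith
 qed
 show ?thesis
 proof (intro exI[of _ B] allI impI ballI)
  fix V \<beta> \<beta>1 \<beta>2 p assume h: "vsol R P al a \<beta> \<beta>1 \<beta>2 V" "data_bounds R al M0 \<beta> \<beta>1 \<beta>2" "\<forall>s\<in>{R,-R}. \<forall>x. \<beta> s (x + P) = \<beta> s x" "p \<in> strip R"
  show "\<bar>V 1 p\<bar> <= B \<and> \<bar>V 2 p\<bar> <= B" using main[OF h(1-3) _ h(4), of 1] main[OF h(1-3) _ h(4), of 2] by simp
 qed
qed

subsection \<open>Hoelder classes on the strip\<close>

text \<open>Hoelder classes by iterated gradients, relational like \<open>grad\<close>. The
  companion \<open>xk\<close> additionally counts derivatives in \<open>x\<close> alone, because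
  tangential derivatives are obtained first and normal ones are then read off from the
  equation.\<close>

primrec ck :: "real => real => nat => (real \<times> real => real) => bool" where
 "ck R al 0 f = (\<exists>K. hb (strip R) al K f)"
| "ck R al (Suc m) f = ((\<exists>K. hb (strip R) al K f) \<and> (\<exists>f1 f2. grad (strip R) f f1 f2 \<and> ck R al m f1 \<and> ck R al m f2))"

primrec xk :: "real => real => nat => nat => (real \<times> real => real) => bool" where
 "xk R al 0 m f = ck R al m f"
| "xk R al (Suc j) m f = (ck R al m f \<and> (\<exists>f1. dx R f f1 \<and> xk R al j m f1))"

lemma hb_cong: assumes "hb S al K f" "!!p. p \<in> S ==> g p = f p" shows "hb S al K g"
 using assms unfolding hb_def hol_def by simp

lemma ck_hb: "ck R al m f ==> \<exists>K. hb (strip R) al K f"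
 by (cases m) simp_all

lemma ck_SucI: "\<exists>K. hb (strip R) al K f ==> grad (strip R) f f1 f2 ==> ck R al m f1 ==> ck R al m f2 ==> ck R al (Suc m) f"
 by auto

lemma xk_ck: "xk R al j m f ==> ck R al m f"
 by (cases j) simp_all

lemma ck_cong: assumes "ck R al m f" "!!p. p \<in> strip R ==> g p = f p" shows "ck R al m g"
proof (cases m)
 case 0
 then obtain K where "hb (strip R) al K f" using assms(1) by auto
 from hb_cong[OF this assms(2)] show ?thesis unfolding 0 by auto
next
 case (Suc n)
 then obtain K f1 f2 where f: "hb (strip R) al K f" "grad (strip R) f f1 f2" "ck R al n f1" "ck R al n f2" using assms(1) by auto
 have "hb (strip R) al K g" by (rule hb_cong[OF f(1) assms(2)])
 moreover have "grad (strip R) g f1 f2" by (rule grad_cong[OF f(2) assms(2)]) simp_all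
 ultimately show ?thesis unfolding Suc ck.simps using f(3,4) by blast
qed

lemma dx_cong: assumes "dx R f f1" "!!p. p \<in> strip R ==> g p = f p" "!!p. p \<in> strip R ==> g1 p = f1 p" shows "dx R g g1"
 using assms unfolding dx_def by simp

lemma xk_cong: assumes "xk R al j m f" "!!p. p \<in> strip R ==> g p = f p" shows "xk R al j m g"
proof (cases j)
 case 0
 then show ?thesis using assms(1) ck_cong[OF _ assms(2)] by simp
next
 case (Suc n)
 then obtain f1 where f: "ck R al m f" "dx R f f1" "xk R al n m f1" using assms(1) by auto
 have "ck R al m g" by (rule ck_cong[OF f(1) assms(2)])
 moreover have "dx R g f1" by (rule dx_cong[OF f(2) assms(2)]) simp_all
 ultimately show ?thesis unfolding Suc xk.simps using f(3) by blast
qed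

lemma ck_Suc_D: "ck R al (Suc m) f ==> ck R al m f"
proof (induction m arbitrary: f)
 case 0 then show ?case by simp
next
 case (Suc m)
 obtain f1 f2 where f: "grad (strip R) f f1 f2" "ck R al (Suc m) f1" "ck R al (Suc m) f2" using iffD1[OF ck.simps(2) Suc.prems] by blast
 have "\<exists>K. hb (strip R) al K f" by (rule ck_hb[OF Suc.prems])
 then show ?case unfolding ck.simps(2)[of R al m] using f(1) Suc.IH[OF f(2)] Suc.IH[OF f(3)] by blast
qed

lemma xk_Suc_D: "xk R al (Suc j) m f ==> xk R al j m f"
proof (induction j arbitrary: f)
 case 0 then show ?case by simp
next
 case (Suc j)
 obtain f1 where f: "ck R al m f" "dx R f f1" "xk R al (Suc j) m f1" using iffD1[OF xk.simps(2) Suc.prems] by blast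
 then show ?case unfolding xk.simps(2)[of R al j] using Suc.IH[OF f(3)] by blast
qed

lemma ck_add: "ck R al m f ==> ck R al m g ==> ck R al m (%p. f p + g p)"
proof (induction m arbitrary: f g)
 case 0
 then obtain K L where "hb (strip R) al K f" "hb (strip R) al L g" by auto
 from hb_add[OF this] show ?case by auto
next
 case (Suc m)
 obtain f1 f2 where f: "grad (strip R) f f1 f2" "ck R al m f1" "ck R al m f2" using Suc.prems(1) by auto
 obtain g1 g2 where g: "grad (strip R) g g1 g2" "ck R al m g1" "ck R al m g2" using Suc.prems(2) by auto
 obtain K L where "hb (strip R) al K f" "hb (strip R) al L g" using ck_hb[OF Suc.prems(1)] ck_hb[OF Suc.prems(2)] by blast
 from hb_add[OF this] have "\<exists>K. hb (strip R) al K (%p. f p + g p)" ..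
 then show ?case unfolding ck.simps using grad_add[OF f(1) g(1)] Suc.IH[OF f(2) g(2)] Suc.IH[OF f(3) g(3)] by blast
qed

lemma ck_mult: "ck R al m f ==> ck R al m g ==> ck R al m (%p. f p * g p)"
proof (induction m arbitrary: f g)
 case 0
 then obtain K L where "hb (strip R) al K f" "hb (strip R) al L g" by auto
 from hb_mult[OF this] show ?case by auto
next
 case (Suc m)
 obtain f1 f2 where f: "grad (strip R) f f1 f2" "ck R al m f1" "ck R al m f2" using Suc.prems(1) by auto
 obtain g1 g2 where g: "grad (strip R) g g1 g2" "ck R al m g1" "ck R al m g2" using Suc.prems(2) by auto
 note f0 = ck_Suc_D[OF Suc.prems(1)] and g0 = ck_Suc_D[OF Suc.prems(2)]
 obtain K L where "hb (strip R) al K f" "hb (strip R) al L g" using ck_hb[OF Suc.prems(1)] ck_hb[OF Suc.prems(2)] by blast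
 from hb_mult[OF this] have 1: "\<exists>K. hb (strip R) al K (%p. f p * g p)" ..
 have "ck R al m (%p. f p * g1 p + f1 p * g p)" "ck R al m (%p. f p * g2 p + f2 p * g p)"
  by (intro ck_add Suc.IH f0 g0 f g)+
 then show ?case unfolding ck.simps using grad_mult[OF f(1) g(1)] 1 by blast
qed

lemma grad_const: "grad S (%_. c) (%_. 0) (%_. 0)"
 unfolding grad_def by simp

lemma ck_const: "ck R al m (%_. c)"
proof (induction m arbitrary: c)
 case 0
 have "hb (strip R) al \<bar>c\<bar> (%_. c)" unfolding hb_def hol_def by simp
 then show ?case by auto
next
 case (Suc m)
 have "hb (strip R) al \<bar>c\<bar> (%_. c)" unfolding hb_def hol_def by simp
 then show ?case unfolding ck.simps using grad_const Suc[of 0] by blast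
qed

lemma grad_snd_id: "grad S snd (%_. 0) (%_. 1)"
 unfolding grad_def by (simp add: has_derivative_snd)

lemma ck_snd: assumes "0 < al" "al <= 1" "R > 0" shows "ck R al m snd"
proof -
 have h: "hb (strip R) al (1 + 2 * R) snd"
  unfolding hb_def hol_def using snd_hoelder[OF assms] assms(3) by (auto simp: mem_strip)
 show ?thesis
 proof (cases m)
  case 0 then show ?thesis using h by auto
 next
  case (Suc n)
  then show ?thesis unfolding Suc ck.simps using h grad_snd_id ck_const by blast
 qed
qed

lemma ck_uminus: "ck R al m f ==> ck R al m (%p. - f p)"
 using ck_mult[OF ck_const[of R al m "-1"], of f] by simp

text \<open>The gradient of \<open>A\<close> is a polynomial in \<open>A\<close>, \<open>v\<close>,
  the derivatives of \<open>v\<close> and \<open>y\<close>, so membership in \<open>ck\<close> can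
  be propagated by induction using sums and products alone.\<close>

lemma grad_AA:
 assumes a: "a \<noteq> 0" and v: "grad S v v1 v2"
 defines "A \<equiv> %p. AA a (v p) (snd p)"
 shows "grad S A (%p. - (A p * A p * A p) * (v p * v1 p)) (%p. - (A p * A p * A p) * (v p * v2 p + snd p))"
proof -
 define g where "g p = v p * v p + snd p * snd p + a\<^sup>2" for p :: "real \<times> real"
 have gg: "grad S g (%p. (v p * v1 p + v1 p * v p) + (snd p * 0 + 0 * snd p) + 0) (%p. (v p * v2 p + v2 p * v p) + (snd p * 1 + 1 * snd p) + 0)"
  unfolding g_def by (rule grad_add[OF grad_add[OF grad_mult[OF v v] grad_mult[OF grad_snd_id grad_snd_id]] grad_const])
 have g0: "g p > 0" for p unfolding g_def using AA_base(1)[OF a, of "v p" "snd p"] by (simp add: power2_eq_square)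
 have A: "A = (%p. inverse (sqrt (g p)))" unfolding A_def g_def AA_def by (simp add: power2_eq_square inverse_eq_divide)
 show ?thesis unfolding grad_def
 proof
  fix p assume p: "p \<in> S"
  have sq: "((%t. inverse (sqrt t)) has_real_derivative - (inverse (sqrt (g p)) * (inverse (sqrt (g p)) / 2) * inverse (sqrt (g p)))) (at (g p))"
   by (rule DERIV_inverse'[OF DERIV_real_sqrt[OF g0]]) (use g0[of p] in simp)
  show "(A has_derivative (%h. fst h * (- (A p * A p * A p) * (v p * v1 p)) + snd h * (- (A p * A p * A p) * (v p * v2 p + snd p)))) (at p within S)"
   unfolding A
   by (rule has_derivative_eq_rhs[OF DERIV_compose_FDERIV[OF sq bspec[OF gg[unfolded grad_def] p]]]) (simp add: algebra_simps)
 qed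
qed

lemma dx_AA:
 assumes a: "a \<noteq> 0" and v: "dx R v v1"
 defines "A \<equiv> %p. AA a (v p) (snd p)"
 shows "dx R A (%p. - (A p * A p * A p) * (v p * v1 p))"
 unfolding dx_def
proof
 fix p assume p: "p \<in> strip R"
 have "((%t. AA a (v (p + (t, 0))) (snd p)) has_real_derivative AV a (v (p + (0, 0))) (snd p) * v1 p) (at 0)"
  by (rule DERIV_chain2[OF AA_deriv(1)[OF a] bspec[OF v[unfolded dx_def] p]])
 then show "((%t. A (p + (t, 0))) has_real_derivative - (A p * A p * A p) * (v p * v1 p)) (at 0)"
  unfolding A_def AV_def by (simp add: power3_eq_cube algebra_simps)
qed

lemma dx_add: assumes "dx R f f1" "dx R g g1" shows "dx R (%p. f p + g p) (%p. f1 p + g1 p)"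
 unfolding dx_def by (intro ballI DERIV_add bspec[OF assms(1)[unfolded dx_def]] bspec[OF assms(2)[unfolded dx_def]])

lemma dx_mult: assumes "dx R f f1" "dx R g g1" shows "dx R (%p. f p * g p) (%p. f1 p * g p + g1 p * f p)"
 unfolding dx_def
proof
 fix p assume p: "p \<in> strip R"
 from DERIV_mult[OF bspec[OF assms(1)[unfolded dx_def] p] bspec[OF assms(2)[unfolded dx_def] p]]
 show "((%t. f (p + (t, 0)) * g (p + (t, 0))) has_real_derivative f1 p * g p + g1 p * f p) (at 0)" by simp
qed

lemma dx_const: "dx R (%_. c) (%_. 0)"
 unfolding dx_def by simp

lemma hb_AA:
 assumes a: "a \<noteq> 0" and al: "0 < al" "al <= 1" and R: "R > 0" and v: "hb (strip R) al B v"
 shows "\<exists>K. hb (strip R) al K (%p. AA a (v p) (snd p))"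
proof -
 have "hol (strip R) al (LA a * (B + (1 + 2 * R))) (%p. AA a (v p) (snd p))"
  by (rule hol_AA[OF a al R]) (use v in \<open>simp add: hb_def\<close>)
 then have "hol (strip R) al (max (LA a * (B + (1 + 2 * R))) (1 / \<bar>a\<bar>)) (%p. AA a (v p) (snd p))"
  by (rule hol_mono) simp
 then have "hb (strip R) al (max (LA a * (B + (1 + 2 * R))) (1 / \<bar>a\<bar>)) (%p. AA a (v p) (snd p))"
  unfolding hb_def using AA_bounds(3)[OF a] by (simp add: le_max_iff_disj)
 then show ?thesis ..
qed

lemma ck_AA:
 assumes a: "a \<noteq> 0" and al: "0 < al" "al <= 1" and R: "R > 0"
 shows "ck R al m v ==> ck R al m (%p. AA a (v p) (snd p))"
proof (induction m)
 case 0
 then obtain B where "hb (strip R) al B v" by auto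
 from hb_AA[OF a al R this] show ?case by simp
next
 case (Suc m)
 obtain v1 v2 B where v: "grad (strip R) v v1 v2" "ck R al m v1" "ck R al m v2" "hb (strip R) al B v" using Suc.prems by auto
 note v0 = ck_Suc_D[OF Suc.prems]
 note A = Suc.IH[OF v0]
 have "ck R al m (%p. - (AA a (v p) (snd p) * AA a (v p) (snd p) * AA a (v p) (snd p)) * (v p * v1 p))"
  "ck R al m (%p. - (AA a (v p) (snd p) * AA a (v p) (snd p) * AA a (v p) (snd p)) * (v p * v2 p + snd p))"
  by (intro ck_mult ck_uminus ck_add ck_snd[OF al R] A v0 v)+
 then show ?case by (rule ck_SucI[OF hb_AA[OF a al R v(4)] grad_AA[OF a v(1)]])
qed

lemma xk_add: "xk R al j m f ==> xk R al j m g ==> xk R al j m (%p. f p + g p)"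
proof (induction j arbitrary: f g)
 case 0 then show ?case using ck_add by simp
next
 case (Suc j)
 obtain f1 g1 where f: "dx R f f1" "xk R al j m f1" "ck R al m f" and g: "dx R g g1" "xk R al j m g1" "ck R al m g" using Suc.prems by auto
 show ?case unfolding xk.simps using ck_add[OF f(3) g(3)] dx_add[OF f(1) g(1)] Suc.IH[OF f(2) g(2)] by blast
qed

lemma xk_mult: "xk R al j m f ==> xk R al j m g ==> xk R al j m (%p. f p * g p)"
proof (induction j arbitrary: f g)
 case 0 then show ?case using ck_mult by simp
next
 case (Suc j)
 obtain f1 g1 where f: "dx R f f1" "xk R al j m f1" "ck R al m f" and g: "dx R g g1" "xk R al j m g1" "ck R al m g" using Suc.prems by auto
 have "xk R al j m (%p. f1 p * g p + g1 p * f p)"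
  by (intro xk_add Suc.IH f g xk_Suc_D[OF Suc.prems(1)] xk_Suc_D[OF Suc.prems(2)])
 then show ?case unfolding xk.simps using ck_mult[OF f(3) g(3)] dx_mult[OF f(1) g(1)] by blast
qed

lemma xk_const: "xk R al j m (%_. c)"
proof (induction j arbitrary: c)
 case 0 then show ?case using ck_const by simp
next
 case (Suc j)
 show ?case unfolding xk.simps using ck_const dx_const Suc[of 0] by blast
qed

lemma xk_uminus: "xk R al j m f ==> xk R al j m (%p. - f p)"
 using xk_mult[OF xk_const[of R al j m "-1"], of f] by simp

lemma xk_AA:
 assumes a: "a \<noteq> 0" and al: "0 < al" "al <= 1" and R: "R > 0"
 shows "xk R al j m v ==> xk R al j m (%p. AA a (v p) (snd p))"
proof (induction j)
 case 0 then show ?case using ck_AA[OF a al R] by simp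
next
 case (Suc j)
 obtain v1 where v: "dx R v v1" "xk R al j m v1" "ck R al m v" using Suc.prems by auto
 note v0 = xk_Suc_D[OF Suc.prems]
 note A = Suc.IH[OF v0]
 have "xk R al j m (%p. - (AA a (v p) (snd p) * AA a (v p) (snd p) * AA a (v p) (snd p)) * (v p * v1 p))"
  by (intro xk_mult xk_uminus A v0 v)
 then show ?case unfolding xk.simps using dx_AA[OF a v(1)] ck_AA[OF a al R v(3)] by blast
qed

lemma xk_mono: assumes "xk R al n m f" "j <= n" shows "xk R al j m f"
 using assms(2,1)
proof (induction rule: dec_induct)
 case base then show ?case .
next
 case (step i)
 show ?case by (rule step.IH[OF xk_Suc_D[OF step.prems]])
qed

lemma xk_dx: assumes "xk R al (Suc j) m f" "dx R f f1" shows "xk R al j m f1"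
proof -
 obtain g where g: "dx R f g" "xk R al j m g" using assms(1) by auto
 show ?thesis by (rule xk_cong[OF g(2) dx_unique[OF assms(2) g(1) refl]])
qed

subsection \<open>Higher regularity\<close>

declare ck.simps(2) [simp del] xk.simps(2) [simp del]

lemma xk_seq: "(!!i. i < j ==> dx R (w i) (w (Suc i))) ==> (!!i. i <= j ==> ck R al m (w i)) ==> xk R al j m (w 0)"
proof (induction j arbitrary: w)
 case 0
 from "0.prems"(2)[of 0] show ?case by simp
next
 case (Suc j)
 have "xk R al j m (w (Suc 0))" by (rule Suc.IH[of "%i. w (Suc i)"]) (simp_all add: Suc.prems)
 then show ?case unfolding xk.simps using Suc.prems(1)[of 0] Suc.prems(2)[of 0] by auto
qed

lemma xk_SucI: "ck R al m f ==> dx R f f1 ==> xk R al j m f1 ==> xk R al (Suc j) m f"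
 unfolding xk.simps by blast

lemma adm_hb: assumes "adm R P al J" "i <= 5" shows "\<exists>K. hb (strip R) al K (J i)"
 using assms unfolding adm_def by blast

lemma adm_grad:
 assumes "adm R P al J"
 shows "grad (strip R) (J 0) (J 1) (J 2)" "grad (strip R) (J 1) (J 3) (J 4)" "grad (strip R) (J 2) (J 4) (J 5)"
 using assms unfolding adm_def jet_def by simp_all

text \<open>\<open>X j\<close> is the jet of the \<open>j\<close>-th \<open>x\<close> derivative of
  \<open>v\<close>, and \<open>f j\<close> is what remains on the right after differentiating the
  equation. The next application of \<open>next_step\<close> asks for a Hoelder continuous
  \<open>x\<close> derivative of \<open>f j\<close>, which costs \<open>j + 2\<close> derivatives of
  \<open>v\<close> in \<open>x\<close>; the jet \<open>X j\<close> already supplies them.\<close>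

lemma tower:
 assumes R: "R > 0" and P: "P > 0" and al: "0 < al" "al < 1" and a: "a \<noteq> 0" and V: "vsol R P al a (%s. c s 0) (%s. c s 1) (%s. c s 2) V"
  and c: "!!s i x. s \<in> {R,-R} ==> i < k + 2 ==> (c s i has_real_derivative c s (Suc i) x) (at x)" "!!s i. s \<in> {R,-R} ==> i <= k + 2 ==> hol UNIV al Kb (c s i)"
 defines "A \<equiv> %p. AA a (V 0 p) (snd p)"
 shows "\<exists>X f. X 0 = V \<and> (\<forall>j\<le>k. adm R P al (X j) \<and> (\<forall>p\<in>strip R. A p * X j 3 p + 2 * X j 5 p = f j p) \<and>
   (\<forall>m n. xk R al (j + 1 + m) n (V 0) --> xk R al m n (f j))) \<and> (\<forall>j<k. \<forall>p\<in>strip R. X (Suc j) 0 p = X j 1 p)"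
proof -
 let ?v = "V 0"
 note al1 = al(1) less_imp_le[OF al(2)]
 have admV: "adm R P al V" and Veq: "!!p. p \<in> strip R ==> A p * V 3 p + 2 * V 5 p = - AV a (V 0 p) (snd p) * (V 1 p * V 1 p)"
  and Vb: "!!s x. s \<in> {R,-R} ==> V 0 (x, s) = c s 0 x" using V unfolding vsol_def A_def by blast+
 define A1 where "A1 = (%p. - (A p * A p * A p) * (?v p * V 1 p))"
 have dV: "dx R ?v (V 1)" by (rule grad_dx[OF adm_grad(1)[OF admV]])
 have dA: "dx R A A1" unfolding A1_def A_def by (rule dx_AA[OF a dV])
 have xA: "xk R al m n A" if "xk R al m n ?v" for m n unfolding A_def by (rule xk_AA[OF a al1 R that])
 have xA1: "xk R al m n A1" if "xk R al (Suc m) n ?v" for m n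
  unfolding A1_def by (intro xk_mult xk_uminus xA xk_Suc_D[OF that] xk_dx[OF that dV])
 obtain Kv where Kv: "hb (strip R) al Kv ?v" using adm_hb[OF admV, of 0] by auto
 have Ab: "\<forall>p\<in>strip R. 1 / sqrt (Kv\<^sup>2 + R\<^sup>2 + a\<^sup>2) <= A p \<and> A p <= 1 / \<bar>a\<bar>"
 proof
  fix p assume p: "p \<in> strip R"
  have "\<bar>?v p\<bar> <= Kv" using Kv p unfolding hb_def by blast
  from AA_ge[OF a this, of "snd p" R] AA_le[OF a] p
  show "1 / sqrt (Kv\<^sup>2 + R\<^sup>2 + a\<^sup>2) <= A p \<and> A p <= 1 / \<bar>a\<bar>" unfolding A_def by (simp add: mem_strip)
 qed
 have mu: "0 < 1 / sqrt (Kv\<^sup>2 + R\<^sup>2 + a\<^sup>2)" using AA_base(1)[OF a, of Kv R] by simp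
 \<comment> \<open>The implications on \<open>xk\<close> translate tangential smoothness between
   \<open>v\<close> and the current stage in both directions. The guard \<open>j <= k\<close> makes
   \<open>Q\<close> trivial once the boundary data are exhausted, as the choice principle runs over
   all \<open>j\<close>.\<close>
 define Q where "Q j Y \<longleftrightarrow> j <= k --> adm R P al (fst Y) \<and> (\<forall>p\<in>strip R. A p * fst Y 3 p + 2 * fst Y 5 p = snd Y p) \<and>
   (\<forall>m n. xk R al (j + 1 + m) n ?v --> xk R al m n (snd Y)) \<and> (\<forall>s\<in>{R,-R}. \<forall>x. fst Y 0 (x, s) = c s j x) \<and>
   (\<forall>m n. xk R al (j + m) n ?v --> xk R al m n (fst Y 0)) \<and> (\<forall>m. xk R al m 0 (fst Y 0) --> xk R al (j + m) 0 ?v)"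
  for j and Y :: "(nat => real \<times> real => real) \<times> (real \<times> real => real)"
 define T where "T j Y Z \<longleftrightarrow> j < k --> (\<forall>p\<in>strip R. fst Z 0 p = fst Y 1 p)"
  for j :: nat and Y Z :: "(nat => real \<times> real => real) \<times> (real \<times> real => real)"
 define f0 where "f0 = (%p. (?v p * (A p * A p * A p)) * (V 1 p * V 1 p))"
 have f0: "xk R al m n f0" if "xk R al (Suc m) n ?v" for m n
  unfolding f0_def by (intro xk_mult xA xk_Suc_D[OF that] xk_dx[OF that dV])
 have Q0: "Q 0 (V, f0)" unfolding Q_def
 proof (intro impI conjI allI ballI)
  show "A p * fst (V, f0) 3 p + 2 * fst (V, f0) 5 p = snd (V, f0) p" if "p \<in> strip R" for p
   using Veq[OF that] unfolding f0_def A_def AV_def by (simp add: power3_eq_cube)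
 qed (use admV Vb f0 in simp_all)
 have step: "\<exists>Z. Q (Suc j) Z \<and> T j Y Z" if QY: "Q j Y" for j Y
 proof (cases "Suc j <= k")
  case False
  then show ?thesis unfolding Q_def T_def by simp
 next
  case True
  define X where "X = fst Y"
  define f where "f = snd Y"
  have X: "adm R P al X" "!!p. p \<in> strip R ==> A p * X 3 p + 2 * X 5 p = f p" "!!m n. xk R al (j + 1 + m) n ?v ==> xk R al m n f"
   "!!s x. s \<in> {R,-R} ==> X 0 (x, s) = c s j x" "!!m n. xk R al (j + m) n ?v ==> xk R al m n (X 0)" "!!m. xk R al m 0 (X 0) ==> xk R al (j + m) 0 ?v"
   using mp[OF QY[unfolded Q_def] Suc_leD[OF True], folded X_def f_def] by blast+
  note g = adm_grad[OF X(1)]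
  note d1 = grad_dx[OF g(1)] and d3 = grad_dx[OF g(2)]
  have h: "ck R al 0 (X i)" if "i <= 5" for i using adm_hb[OF X(1) that] by simp
  \<comment> \<open>Entries 0, 1 and 3 of a jet are the function and its first two \<open>x\<close>
    derivatives, all Hoelder continuous.\<close>
  have "xk R al 2 0 (X 0)" unfolding numeral_2_eq_2
   by (rule xk_SucI[OF h d1 xk_SucI[OF h d3]]) (use h[of 3] in simp_all)
  then have xv: "xk R al (j + 2) 0 ?v" by (rule X(6))
  have xf: "xk R al (Suc 0) 0 f" by (rule X(3)) (use xv in simp)
  obtain f1 where f1: "dx R f f1" using xf unfolding xk.simps by blast
  have xf1: "xk R al m n f1" if "xk R al (j + 2 + m) n ?v" for m n
   by (rule xk_dx[OF X(3) f1]) (use that in simp)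
  have x3: "xk R al m n (X 3)" if "xk R al (j + 2 + m) n ?v" for m n
   by (rule xk_dx[OF xk_dx[OF X(5) d1] d3]) (use that in simp)
  have "ck R al 0 f1" using xf1[of 0 0] xv by simp
  then obtain Kf where Kf: "hb (strip R) al Kf f1" by auto
  have v1: "xk R al (Suc 0) 0 ?v" by (rule xk_mono[OF xv]) simp
  obtain Ka where Ka: "hb (strip R) al Ka A" using xA[of 0 0] xk_Suc_D[OF v1] by auto
  obtain Ka1 where Ka1: "hb (strip R) al Ka1 A1" using xA1[OF v1] by auto
  have b1: "X 1 (x, s) = c s (Suc j) x" if s: "s \<in> {R,-R}" for s x
   by (rule boundary_derivative[OF g(1) R s X(4)[OF s] c(1)[OF s]]) (use True in simp)
  have b3: "X 3 (x, s) = c s (Suc (Suc j)) x" if s: "s \<in> {R,-R}" for s x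
   by (rule boundary_derivative[OF g(2) R s b1[OF s] c(1)[OF s]]) (use True in simp)
  have c1: "(c s (Suc (Suc j)) has_real_derivative c s (Suc (Suc (Suc j))) x) (at x)" "hol UNIV al Kb (c s (Suc (Suc (Suc j))))" if "s \<in> {R,-R}" for s x
   using c(1)[OF that, of "Suc (Suc j)"] c(2)[OF that, of "Suc (Suc (Suc j))"] True by simp_all
  obtain G where G: "adm R P al G" "\<forall>p\<in>strip R. G 0 p = X 1 p" "\<forall>p\<in>strip R. A p * G 3 p + 2 * G 5 p = f1 p - A1 p * X 3 p"
   using next_step[OF R al mu X(1) Ab Ka dA Ka1 f1 Kf X(2) b3 c1] by blast
  have "Q (Suc j) (G, %p. f1 p + - (A1 p * X 3 p))" unfolding Q_def fst_conv snd_conv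
  proof (intro impI conjI allI ballI)
   show "adm R P al G" by (rule G(1))
   show "A p * G 3 p + 2 * G 5 p = f1 p + - (A1 p * X 3 p)" if "p \<in> strip R" for p using G(3) that by simp
   show "xk R al m n (%p. f1 p + - (A1 p * X 3 p))" if "xk R al (Suc j + 1 + m) n ?v" for m n
   proof -
    have q: "xk R al (j + 2 + m) n ?v" using that by simp
    have "xk R al (Suc m) n ?v" by (rule xk_mono[OF q]) simp
    then show ?thesis by (intro xk_add xk_uminus xk_mult xf1[OF q] x3[OF q] xA1)
   qed
   show "G 0 (x, s) = c s (Suc j) x" if "s \<in> {R,-R}" for x s
    using G(2) b1[OF that] that R by (auto simp: mem_strip)
   show "xk R al m n (G 0)" if "xk R al (Suc j + m) n ?v" for m n
    by (rule xk_cong[OF xk_dx[OF X(5) d1] bspec[OF G(2)]]) (use that in simp_all)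
   show "xk R al (Suc j + m) 0 ?v" if "xk R al m 0 (G 0)" for m
   proof -
    have "xk R al m 0 (X 1)" by (rule xk_cong[OF that]) (use G(2) in simp)
    from X(6)[OF xk_SucI[OF h[of 0] d1 this]] show ?thesis by simp
   qed
  qed
  moreover have "T j Y (G, %p. f1 p + - (A1 p * X 3 p))" unfolding T_def using G(2) unfolding X_def by simp
  ultimately show ?thesis by blast
 qed
 obtain Y where Y: "!!n. Q n (Y n) \<and> T n (Y n) (Y (Suc n))" and Y0: "Y 0 = (V, f0)"
 proof -
  have "\<exists>Y. \<forall>n. (Q n (Y n) \<and> (n = 0 --> Y n = (V, f0))) \<and> T n (Y n) (Y (Suc n))"
   by (rule dependent_nat_choice) (use Q0 step in auto)
  then show ?thesis using that by blast
 qed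
 show ?thesis
  by (rule exI[where x="%j. fst (Y j)"], rule exI[where x="%j. snd (Y j)"]) (use Y Y0 in \<open>simp add: Q_def T_def\<close>)
qed

text \<open>Normal derivatives are traded for tangential ones: the equation gives
  \<open>X i 5 = (f i - A * X i 3) / 2\<close>, and \<open>X i 4\<close> is the \<open>y\<close>
  derivative of \<open>X i 1\<close>. The induction over the order \<open>m\<close> treats all
  \<open>x\<close> derivatives \<open>w i\<close> with \<open>i + m <= k + 2\<close>
  together.\<close>

lemma vsol_regular:
 assumes R: "R > 0" and P: "P > 0" and al: "0 < al" "al < 1" and a: "a \<noteq> 0" and V: "vsol R P al a (%s. c s 0) (%s. c s 1) (%s. c s 2) V"
  and c: "!!s i x. s \<in> {R,-R} ==> i < k + 2 ==> (c s i has_real_derivative c s (Suc i) x) (at x)" "!!s i. s \<in> {R,-R} ==> i <= k + 2 ==> hol UNIV al Kb (c s i)"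
 shows "ck R al (k + 2) (V 0)"
proof -
 let ?v = "V 0"
 define A where "A = (%p. AA a (?v p) (snd p))"
 obtain X f where X0: "X 0 = V" and X: "!!j. j <= k ==> adm R P al (X j)" "!!j p. j <= k ==> p \<in> strip R ==> A p * X j 3 p + 2 * X j 5 p = f j p"
   "!!j m n. j <= k ==> xk R al (j + 1 + m) n ?v ==> xk R al m n (f j)" "!!j p. j < k ==> p \<in> strip R ==> X (Suc j) 0 p = X j 1 p"
 proof -
  have "\<exists>X f. X 0 = V \<and> (\<forall>j\<le>k. adm R P al (X j) \<and> (\<forall>p\<in>strip R. A p * X j 3 p + 2 * X j 5 p = f j p) \<and>
   (\<forall>m n. xk R al (j + 1 + m) n ?v --> xk R al m n (f j))) \<and> (\<forall>j<k. \<forall>p\<in>strip R. X (Suc j) 0 p = X j 1 p)"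
   unfolding A_def by (rule tower[where k=k, OF R P al a V]) (rule c, assumption, assumption)+
  then obtain X f where XX: "X 0 = V" "\<forall>j\<le>k. adm R P al (X j) \<and> (\<forall>p\<in>strip R. A p * X j 3 p + 2 * X j 5 p = f j p) \<and>
   (\<forall>m n. xk R al (j + 1 + m) n ?v --> xk R al m n (f j))" "\<forall>j<k. \<forall>p\<in>strip R. X (Suc j) 0 p = X j 1 p"
   by (elim exE conjE) (rule that)
  show ?thesis
  proof (rule that[of X f, OF XX(1)])
   fix j assume j: "j <= k"
   show "adm R P al (X j)" using XX(2) j by blast
   show "A p * X j 3 p + 2 * X j 5 p = f j p" if "p \<in> strip R" for p using XX(2) j that by blast
   show "xk R al m n (f j)" if "xk R al (j + 1 + m) n ?v" for m n using XX(2) j that by blast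
  qed (use XX(3) in blast)
 qed
 \<comment> \<open>On the strip \<open>w i\<close> is the \<open>i\<close>-th \<open>x\<close>
   derivative of \<open>v\<close> for \<open>i <= k + 2\<close>: the tower ends at stage
   \<open>k\<close>, and its last jet supplies the remaining two.\<close>
 define w where "w i = (if i <= k then X i 0 else if i = Suc k then X k 1 else X k 3)" for i
 have w1: "w (Suc i) p = X i 1 p" if "i <= k" "p \<in> strip R" for i p using that X(4)[of i p] unfolding w_def by (cases "i = k") auto
 have w2: "w (Suc (Suc i)) p = X i 3 p" if i: "i <= k" and p: "p \<in> strip R" for i p
 proof (cases "i = k")
  case True then show ?thesis unfolding w_def by simp
 next
  case False
  then have i': "Suc i <= k" using i by simp
  have "X (Suc i) 1 p = X i 3 p"
   by (rule grad_unique(1)[OF R adm_grad(1)[OF X(1)[OF i']] adm_grad(2)[OF X(1)[OF i]] X(4) p]) (use i' in simp_all)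
  then show ?thesis using w1[OF i' p] by simp
 qed
 have dw: "dx R (w i) (w (Suc i))" if "i <= Suc k" for i
 proof (cases "i = Suc k")
  case True
  then show ?thesis using grad_dx[OF adm_grad(2)[OF X(1)[of k]]] unfolding w_def by simp
 next
  case False
  then have i: "i <= k" using that by simp
  have "w i = X i 0" using i unfolding w_def by simp
  then show ?thesis using dx_cong[OF grad_dx[OF adm_grad(1)[OF X(1)[OF i]]] refl w1[OF i]] by simp
 qed
 have "\<forall>i. i + m <= k + 2 --> ck R al m (w i)" for m
 proof (induction m rule: less_induct)
  case (less m)
  have IH: "ck R al n (w i)" if "n < m" "i + n <= k + 2" for n i using less that by blast
  show ?case
  proof (intro allI impI)
   fix i assume im: "i + m <= k + 2"
   show "ck R al m (w i)"
   proof (cases m)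
    case 0
    have "\<exists>K. hb (strip R) al K (w i)"
     using adm_hb[OF X(1)[of i], of 0] adm_hb[OF X(1)[of k], of 1] adm_hb[OF X(1)[of k], of 3] unfolding w_def by simp
    then show ?thesis using 0 by simp
   next
    case m: (Suc m')
    show ?thesis
    proof (cases "i <= k")
     case False
     then have i: "i = Suc k" "m' = 0" using im m by auto
     have "ck R al (Suc 0) (X k 1)"
      by (rule ck_SucI[OF adm_hb[OF X(1)] adm_grad(2)[OF X(1)]]) (use adm_hb[OF X(1)[of k]] in simp_all)
     then show ?thesis using i m unfolding w_def by simp
    next
     case i: True
     note g = adm_grad[OF X(1)[OF i]] and hbX = adm_hb[OF X(1)[OF i]]
     have wi: "w i = X i 0" using i unfolding w_def by simp
     have c1: "ck R al m' (X i 1)" by (rule ck_cong[OF IH[of m' "Suc i"]]) (use m im w1[OF i] in simp_all)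
     have c2: "ck R al m' (X i 2)"
     proof (cases m')
      case 0 then show ?thesis using hbX[of 2] by simp
     next
      case n: (Suc n)
      obtain h1 h2 where h: "grad (strip R) (X i 1) h1 h2" "ck R al n h2" using c1 unfolding n ck.simps by blast
      have c4: "ck R al n (X i 4)" by (rule ck_cong[OF h(2) grad_unique(2)[OF R g(2) h(1) refl]])
      have c3: "ck R al n (X i 3)" by (rule ck_cong[OF IH[of n "Suc (Suc i)"]]) (use m n im w2[OF i] in simp_all)
      \<comment> \<open>\<open>f i\<close> uses \<open>i + 1\<close> derivatives of \<open>v\<close>
        in \<open>x\<close>. With \<open>m = n + 2\<close>, all of \<open>w 0\<close> up to
        \<open>w (i + 1)\<close> fall under the induction hypothesis for the order
        \<open>n\<close>.\<close>
      have xv: "xk R al (i + 1) n (w 0)" by (rule xk_seq) (use dw IH m n im i in simp_all)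
      have w0: "w 0 = ?v" unfolding w_def X0[symmetric] by simp
      have cf: "ck R al n (f i)" using X(3)[OF i, of 0 n] xv unfolding w0 by simp
      have cA: "ck R al n A" unfolding A_def by (rule ck_AA[OF a al(1) less_imp_le[OF al(2)] R xk_ck[OF xv[unfolded w0]]])
      have "ck R al n (%p. (1/2) * (f i p + - (A p * X i 3 p)))"
       by (intro ck_mult[OF ck_const] ck_add cf ck_uminus ck_mult cA c3)
      then have c5: "ck R al n (X i 5)" by (rule ck_cong) (use X(2)[OF i] in force)
      show ?thesis unfolding n by (rule ck_SucI[OF hbX g(3) c4 c5]) simp
     qed
     show ?thesis unfolding m wi by (rule ck_SucI[OF hbX g(1) c1 c2]) simp
    qed
   qed
  qed
 qed
 from this[of "k + 2"] have "ck R al (k + 2) (w 0)" by simp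
 then show ?thesis unfolding w_def X0[symmetric] by simp
qed

subsection \<open>Existence by continuation\<close>

lemma hb_uniform:
 assumes "!!i. i <= (n::nat) ==> \<exists>K. hb S al K (f i)" shows "\<exists>K\<ge>0. \<forall>i\<le>n. hb S al K (f i)"
proof -
 have "\<forall>i. \<exists>K. i <= n --> hb S al K (f i)" using assms by blast
 from choice[OF this] obtain K where K: "\<forall>i. i <= n --> hb S al (K i) (f i)" ..
 have "hb S al (\<Sum>j\<le>n. \<bar>K j\<bar>) (f i)" if i: "i <= n" for i
 proof (rule hb_mono)
  show "hb S al (K i) (f i)" using K i by blast
  have "\<bar>K i\<bar> <= (\<Sum>j\<le>n. \<bar>K j\<bar>)" by (rule member_le_sum) (use i in auto)
  then show "K i <= (\<Sum>j\<le>n. \<bar>K j\<bar>)" by linarith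
 qed
 then show ?thesis by (intro exI[of _ "\<Sum>j\<le>n. \<bar>K j\<bar>"]) (auto intro: sum_nonneg)
qed

lemma admI:
 assumes "jet (strip R) J" "!!i. i <= 5 ==> ck R al 0 (J i)" "per R P (J 0)" shows "adm R P al J"
 using hb_uniform[of 5 "strip R" al J] assms unfolding adm_def by auto

lemma affine_jet:
 assumes "R > 0" "0 < al" "al <= 1"
 shows "adm R P al (%i p. if i = 0 then c0 + c1 * snd p else if i = 2 then c1 else 0)" (is "adm _ _ _ ?J")
proof (rule admI)
 have g: "grad (strip R) (%p. c0 + c1 * snd p) (%_. 0) (%_. c1)" by (rule grad_snd) (auto intro!: derivative_eq_intros)
 have e: "?J 0 = (%p. c0 + c1 * snd p)" "?J 1 = (%_. 0)" "?J 2 = (%_. c1)" "?J 3 = (%_. 0)" "?J 4 = (%_. 0)" "?J 5 = (%_. 0)" by simp_all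
 show "jet (strip R) ?J" unfolding jet_def e using g grad_const by blast
 show "per R P (?J 0)" unfolding per_def by simp
 show "ck R al 0 (?J i)" for i
 proof -
  have "ck R al 0 (%p. c0 + c1 * snd p)" by (rule ck_add[OF ck_const ck_mult[OF ck_const ck_snd[OF assms(2,3,1)]]])
  then show ?thesis using ck_const[of R al 0 c1] ck_const[of R al 0 0] by (cases "i = 0"; cases "i = 2") simp_all
 qed
qed

text \<open>\<open>first_step\<close> produces a jet based at \<open>u_x\<close> and
  \<open>next_step\<close> one based at \<open>u_xx\<close>, so \<open>v = u_xx + l\<close> has
  Hoelder continuous second derivatives, and the potential equation differentiated twice in
  \<open>x\<close> is the equation for \<open>v\<close>. This uses the edge data up to the fourth
  derivative.\<close>

lemma nsol_vsol:
 assumes R: "R > 0" and al: "0 < al" "al < 1" and a: "a \<noteq> 0" and J: "adm R P al J"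
  and eq: "!!p. p \<in> strip R ==> FF a (J 3 p + (c0 + c1 * snd p)) (snd p) + 2 * J 5 p = 0"
  and bd: "!!s x. s \<in> {R,-R} ==> J 0 (x, s) = d s 0 x"
  and d: "!!s i x. s \<in> {R,-R} ==> i < (4::nat) ==> (d s i has_real_derivative d s (Suc i) x) (at x)" "!!s i. s \<in> {R,-R} ==> i <= 4 ==> hol UNIV al Kb (d s i)"
 shows "\<exists>V. vsol R P al a (%s x. d s 2 x + (c0 + c1 * s)) (%s. d s 3) (%s. d s 4) V \<and> (\<forall>p\<in>strip R. V 0 p = J 3 p + (c0 + c1 * snd p))"
proof -
 let ?l = "%p::real \<times> real. c0 + c1 * snd p"
 note al1 = al(1) less_imp_le[OF al(2)]
 define L where "L = (%i (p::real\<times>real). if i = (0::nat) then c0 + c1 * snd p else if i = 2 then c1 else 0)"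
 have L: "adm R P al L" unfolding L_def by (rule affine_jet[OF R al1])
 obtain Kl where Kl: "hb (strip R) al Kl ?l" using adm_hb[OF L, of 0] unfolding L_def by auto
 define v where "v p = J 3 p + ?l p" for p
 note gJ = adm_grad[OF J]
 have d': "(d s 0 has_real_derivative d s 1 x) (at x)" "(d s 1 has_real_derivative d s 2 x) (at x)" "(d s 2 has_real_derivative d s 3 x) (at x)" "(d s 3 has_real_derivative d s 4 x) (at x)"
  "hol UNIV al Kb (d s 3)" "hol UNIV al Kb (d s 4)" if "s \<in> {R,-R}" for s x
  using d(1)[OF that, of 0] d(1)[OF that, of 1] d(1)[OF that, of 2] d(1)[OF that, of 3] d(2)[OF that, of 3] d(2)[OF that, of 4] by (simp_all add: eval_nat_numeral)
 have b1: "J 1 (x, s) = d s 1 x" if s: "s \<in> {R,-R}" for s x by (rule boundary_derivative[OF gJ(1) R s bd[OF s] d'(1)[OF s]])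
 have b3: "J 3 (x, s) = d s 2 x" if s: "s \<in> {R,-R}" for s x by (rule boundary_derivative[OF gJ(2) R s b1[OF s] d'(2)[OF s]])
 have "\<exists>G. adm R P al G \<and> (\<forall>p\<in>strip R. G 0 p = J 1 p) \<and> (\<forall>p\<in>strip R. AA a (v p) (snd p) * G 3 p + 2 * G 5 p = 0)"
  unfolding v_def by (rule first_step[OF R al a J _ Kl eq b3 d'(3) d'(5)]) simp_all
 then obtain G where G: "adm R P al G" "\<forall>p\<in>strip R. G 0 p = J 1 p" "\<forall>p\<in>strip R. AA a (v p) (snd p) * G 3 p + 2 * G 5 p = 0"
  by (elim exE conjE) (rule that)
 note gG = adm_grad[OF G(1)]
 have G1: "G 1 p = J 3 p" if "p \<in> strip R" for p by (rule grad_unique(1)[OF R gG(1) gJ(2) bspec[OF G(2)] that])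
 have dv: "dx R v (G 3)"
 proof -
  have "dx R (%p. G 1 p + L 0 p) (%p. G 3 p + L 1 p)" by (rule dx_add[OF grad_dx[OF gG(2)] grad_dx[OF adm_grad(1)[OF L]]])
  then show ?thesis by (rule dx_cong) (simp_all add: v_def L_def G1[symmetric])
 qed
 have cv: "ck R al 0 v"
 proof -
  have "ck R al 0 (%p. J 3 p + L 0 p)" by (rule ck_add) (use adm_hb[OF J, of 3] adm_hb[OF L, of 0] in simp_all)
  then show ?thesis unfolding v_def L_def by simp
 qed
 then obtain Kv where Kv: "hb (strip R) al Kv v" by auto
 define A where "A = (%p. AA a (v p) (snd p))"
 define A1 where "A1 = (%p. - (A p * A p * A p) * (v p * G 3 p))"
 have dA: "dx R A A1" unfolding A_def A1_def by (rule dx_AA[OF a dv])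
 have cA: "ck R al 0 A" unfolding A_def by (rule ck_AA[OF a al1 R cv])
 then obtain Ka where Ka: "hb (strip R) al Ka A" by auto
 have cG: "ck R al 0 (G 3)" using adm_hb[OF G(1), of 3] by simp
 have "ck R al 0 A1" unfolding A1_def by (intro ck_mult ck_uminus cA cv cG)
 then obtain Ka1 where Ka1: "hb (strip R) al Ka1 A1" by auto
 have Ab: "\<forall>p\<in>strip R. 1 / sqrt (Kv\<^sup>2 + R\<^sup>2 + a\<^sup>2) <= A p \<and> A p <= 1 / \<bar>a\<bar>"
 proof
  fix p assume p: "p \<in> strip R"
  have "\<bar>v p\<bar> <= Kv" using Kv p unfolding hb_def by blast
  from AA_ge[OF a this, of "snd p" R] AA_le[OF a] p
  show "1 / sqrt (Kv\<^sup>2 + R\<^sup>2 + a\<^sup>2) <= A p \<and> A p <= 1 / \<bar>a\<bar>" unfolding A_def by (simp add: mem_strip)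
 qed
 have mu: "0 < 1 / sqrt (Kv\<^sup>2 + R\<^sup>2 + a\<^sup>2)" using AA_base(1)[OF a, of Kv R] by simp
 have c0: "G 0 (x, s) = d s 1 x" if s: "s \<in> {R,-R}" for s x using G(2) b1[OF s] s R by (auto simp: mem_strip)
 have c1: "G 1 (x, s) = d s 2 x" if s: "s \<in> {R,-R}" for s x by (rule boundary_derivative[OF gG(1) R s c0[OF s] d'(2)[OF s]])
 have c3: "G 3 (x, s) = d s 3 x" if s: "s \<in> {R,-R}" for s x by (rule boundary_derivative[OF gG(2) R s c1[OF s] d'(3)[OF s]])
 have z: "dx R (%_. 0) (%_. 0)" "hb (strip R) al 0 (%_. 0)" by (simp_all add: dx_const hb_def hol_def)
 have "\<exists>H. adm R P al H \<and> (\<forall>p\<in>strip R. H 0 p = G 1 p) \<and> (\<forall>p\<in>strip R. A p * H 3 p + 2 * H 5 p = 0 - A1 p * G 3 p)"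
  by (rule next_step[OF R al mu G(1) Ab Ka dA Ka1 z(1) z(2) _ c3 d'(4) d'(6)])
   (use G(3) in \<open>simp_all add: A_def\<close>)
 then obtain H where H: "adm R P al H" "\<forall>p\<in>strip R. H 0 p = G 1 p" "\<forall>p\<in>strip R. A p * H 3 p + 2 * H 5 p = 0 - A1 p * G 3 p"
  by (elim exE conjE) (rule that)
 have H1: "H 1 p = G 3 p" if "p \<in> strip R" for p by (rule grad_unique(1)[OF R adm_grad(1)[OF H(1)] gG(2) bspec[OF H(2)] that])
 define V where "V = (%i p. H i p + L i p)"
 have V0: "V 0 p = v p" if "p \<in> strip R" for p unfolding V_def L_def v_def using that H(2) G1 by simp
 have "vsol R P al a (%s x. d s 2 x + (c0 + c1 * s)) (%s. d s 3) (%s. d s 4) V" unfolding vsol_def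
 proof (intro conjI ballI allI)
  show "adm R P al V" unfolding V_def by (rule adm_add[OF H(1) L])
  fix p assume p: "p \<in> strip R"
  have e: "V 1 p = G 3 p" "V 3 p = H 3 p" "V 5 p = H 5 p" unfolding V_def L_def using H1[OF p] by simp_all
  have "A p * H 3 p + 2 * H 5 p = 0 - A1 p * G 3 p" using H(3) p by blast
  then show "AA a (V 0 p) (snd p) * V 3 p + 2 * V 5 p = - AV a (V 0 p) (snd p) * (V 1 p * V 1 p)"
   unfolding e V0[OF p] A1_def A_def AV_def by (simp add: power3_eq_cube)
 next
  fix s x assume s: "s \<in> {R,-R}"
  have "(x, s) \<in> strip R" using s R by (auto simp: mem_strip)
  then show "V 0 (x, s) = d s 2 x + (c0 + c1 * s)" using V0 b3[OF s] unfolding v_def by simp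
  show "((%x. d s 2 x + (c0 + c1 * s)) has_real_derivative d s 3 x) (at x)" using DERIV_add[OF d'(3)[OF s] DERIV_const] by simp
  show "(d s 3 has_real_derivative d s 4 x) (at x)" by (rule d'(4)[OF s])
 qed
 moreover have "\<forall>p\<in>strip R. V 0 p = J 3 p + ?l p" using V0 unfolding v_def by blast
 ultimately show ?thesis by blast
qed

text \<open>Boundary data and affine part are both multiplied by \<open>t\<close>, so
  \<open>t = 0\<close> is solved by 0, and the boundary values of \<open>v\<close> scale with
  \<open>t\<close> and keep their bounds.\<close>

definition nsol where
 "nsol R P al a c0 c1 d t J \<longleftrightarrow> adm R P al J \<and> (\<forall>p\<in>strip R. FF a (J 3 p + t * (c0 + c1 * snd p)) (snd p) + 2 * J 5 p = 0) \<and>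
   (\<forall>s\<in>{R,-R}. \<forall>x. J 0 (x, s) = t * d s (0::nat) x)"

text \<open>The sup and gradient bounds for \<open>v\<close> depend only on \<open>M0\<close>, which
  serves all \<open>t\<close> at once; a Lipschitz bound then implies the Hoelder bound that
  \<open>newton\<close> asks for.\<close>

lemma a_priori:
 assumes R: "R > 0" and P: "P > 0" and al: "0 < al" "al < 1" and a: "a \<noteq> 0" and K: "K \<ge> 0"
  and d: "!!s i x. s \<in> {R,-R} ==> i < (4::nat) ==> (d s i has_real_derivative d s (Suc i) x) (at x)" "!!s i. s \<in> {R,-R} ==> i <= 4 ==> hb UNIV al K (d s i)"
   "!!s x. s \<in> {R,-R} ==> d s 2 (x + P) = d s 2 x"
 shows "\<exists>B\<ge>0. \<forall>t\<in>{0..1}. \<forall>J. nsol R P al a c0 c1 d t J --> hb (strip R) al B (%p. J 3 p + t * (c0 + c1 * snd p))"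
proof -
 define M0 where "M0 = K + \<bar>c0\<bar> + \<bar>c1\<bar> * R"
 have M0: "M0 \<ge> 0" "K <= M0" unfolding M0_def using K R by auto
 obtain B where B: "!!V \<beta> \<beta>1 \<beta>2. vsol R P al a \<beta> \<beta>1 \<beta>2 V --> data_bounds R al M0 \<beta> \<beta>1 \<beta>2 -->
   (\<forall>s\<in>{R,-R}. \<forall>x. \<beta> s (x + P) = \<beta> s x) --> (\<forall>p\<in>strip R. \<bar>V 1 p\<bar> <= B \<and> \<bar>V 2 p\<bar> <= B)"
  using gradient_bound[OF R P al a M0(1)] by blast
 define B' where "B' = 2 * \<bar>B\<bar> + 2 * M0"
 have "hb (strip R) al B' (%p. J 3 p + t * (c0 + c1 * snd p))" if t: "t \<in> {0..1}" and J: "nsol R P al a c0 c1 d t J" for t J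
 proof -
  have J': "adm R P al J" "!!p. p \<in> strip R ==> FF a (J 3 p + (t * c0 + t * c1 * snd p)) (snd p) + 2 * J 5 p = 0"
   "!!s x. s \<in> {R,-R} ==> J 0 (x, s) = t * d s 0 x"
  proof -
   show "FF a (J 3 p + (t * c0 + t * c1 * snd p)) (snd p) + 2 * J 5 p = 0" if "p \<in> strip R" for p
   proof -
    have "t * (c0 + c1 * snd p) = t * c0 + t * c1 * snd p" by (simp add: algebra_simps)
    then show ?thesis using J that unfolding nsol_def by metis
   qed
  qed (use J in \<open>unfold nsol_def, blast+\<close>)
  have small: "\<bar>t * r\<bar> <= C" if "\<bar>r\<bar> <= C" for r C
   using mult_mono[of "\<bar>t\<bar>" 1 "\<bar>r\<bar>" C] t that by (simp add: abs_mult)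
  have hd: "hol UNIV al K (%x. t * d s i x)" if "s \<in> {R,-R}" "i <= 4" for s i
   unfolding hol_def
  proof (intro ballI)
   fix x y :: real
   have "\<bar>t * (d s i x - d s i y)\<bar> <= K * dist x y powr al" by (rule small) (use hbD[OF d(2)[OF that]] in simp)
   then show "\<bar>t * d s i x - t * d s i y\<bar> <= K * dist x y powr al" by (simp add: right_diff_distrib)
  qed
  have dd: "((%x. t * d s i x) has_real_derivative t * d s (Suc i) x) (at x)" if "s \<in> {R,-R}" "i < 4" for s i x
   by (rule DERIV_cmult[OF d(1)[OF that]])
  define \<beta> where "\<beta> = (%s x. t * d s 2 x + (t * c0 + t * c1 * s))"
  have "\<exists>V. vsol R P al a \<beta> (%s x. t * d s 3 x) (%s x. t * d s 4 x) V \<and> (\<forall>p\<in>strip R. V 0 p = J 3 p + (t * c0 + t * c1 * snd p))"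
   unfolding \<beta>_def by (rule nsol_vsol[where d="%s i x. t * d s i x", OF R al a J' dd hd])
  then obtain V where V: "vsol R P al a \<beta> (%s x. t * d s 3 x) (%s x. t * d s 4 x) V" "\<forall>p\<in>strip R. V 0 p = J 3 p + (t * c0 + t * c1 * snd p)"
   by (elim exE conjE) (rule that)
  have D: "data_bounds R al M0 \<beta> (%s x. t * d s 3 x) (%s x. t * d s 4 x)" unfolding data_bounds_def
  proof (intro ballI conjI allI)
   fix s x assume s: "s \<in> {R,-R}"
   have db: "\<bar>d s i x\<bar> <= K" if "i <= 4" for i using d(2)[OF s that] unfolding hb_def by blast
   have "\<bar>t * (d s 2 x + c0 + c1 * s)\<bar> <= M0"
   proof (rule small)
    have "\<bar>c1 * s\<bar> = \<bar>c1\<bar> * R" using s R by (auto simp: abs_mult)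
    then show "\<bar>d s 2 x + c0 + c1 * s\<bar> <= M0" using db[of 2] unfolding M0_def by linarith
   qed
   then show "\<bar>\<beta> s x\<bar> <= M0" unfolding \<beta>_def by (simp add: algebra_simps)
   show "\<bar>t * d s 3 x\<bar> <= M0" by (rule small) (use db[of 3] M0 in linarith)
   show "hol UNIV al M0 (%x. t * d s 4 x)" by (rule hol_mono[OF hd M0(2)]) (use s in simp_all)
  qed
  have pe: "\<forall>s\<in>{R,-R}. \<forall>x. \<beta> s (x + P) = \<beta> s x" unfolding \<beta>_def using d(3) by auto
  have g: "\<bar>V 1 p\<bar> <= \<bar>B\<bar>" "\<bar>V 2 p\<bar> <= \<bar>B\<bar>" if "p \<in> strip R" for p
   using bspec[OF mp[OF mp[OF mp[OF B V(1)] D] pe] that] by linarith+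
  have aV: "adm R P al V" using V(1) unfolding vsol_def by blast
  have "hb (strip R) al B' (V 0)" unfolding B'_def
   by (rule hb_lipschitz[OF al(1) less_imp_le[OF al(2)] vsol_sup[OF R P a V(1) D] grad_lipschitz[OF convex_strip adm_grad(1)[OF aV] g]]) (use M0 in simp_all)
  then show ?thesis by (rule hb_cong) (use V(2) in \<open>simp add: algebra_simps\<close>)
 qed
 then show ?thesis using M0 by (intro exI[of _ B']) (auto simp: B'_def)
qed

text \<open>Linear interpolation in \<open>y\<close> has vanishing second \<open>y\<close>
  derivative, so adding a multiple of \<open>H\<close> disturbs the equation only through
  \<open>FF\<close>.\<close>

lemma interpolation_jet:
 assumes R: "R > 0" and al: "0 < al" "al <= 1" and K: "K \<ge> 0"
  and d: "!!s i x. s \<in> {R,-R} ==> i < (2::nat) ==> (d s i has_real_derivative d s (Suc i) x) (at x)" "!!s i. s \<in> {R,-R} ==> i <= 2 ==> hb UNIV al K (d s i)"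
   "!!s x. s \<in> {R,-R} ==> d s 0 (x + P) = d s 0 x"
 shows "\<exists>H. adm R P al H \<and> (\<forall>p. H 5 p = 0) \<and> (\<forall>s\<in>{R,-R}. \<forall>x. H 0 (x, s) = d s 0 x)"
proof -
 define r where "r = 1 / (2 * R)"
 define E where "E = (%p::real\<times>real. 1/2 + r * snd p)"
 define F where "F = (%p::real\<times>real. 1/2 + - r * snd p)"
 define G where "G i p = E p * d R i (fst p) + F p * d (-R) i (fst p)" for i p
 define D where "D i p = r * d R i (fst p) + - r * d (-R) i (fst p)" for i and p :: "real \<times> real"
 have gT: "grad (strip R) (%p. d s i (fst p)) (%p. d s (Suc i) (fst p)) (%_. 0)" if "s \<in> {R,-R}" "i < 2" for s i
  by (rule grad_fst[OF d(1)[OF that]])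
 have gE: "grad (strip R) E (%_. 0) (%_. r)" "grad (strip R) F (%_. 0) (%_. - r)"
  unfolding E_def F_def by (rule grad_snd; auto intro!: derivative_eq_intros)+
 have gG: "grad (strip R) (G i) (G (Suc i)) (D i)" if i: "i < 2" for i
  by (rule grad_cong[OF grad_add[OF grad_mult[OF gE(1) gT] grad_mult[OF gE(2) gT]]]) (use i in \<open>simp_all add: G_def D_def\<close>)
 have gD: "grad (strip R) (D i) (D (Suc i)) (%_. 0)" if i: "i < 2" for i
  by (rule grad_cong[OF grad_add[OF grad_mult[OF grad_const[of _ r] gT[of R]] grad_mult[OF grad_const[of _ "- r"] gT[of "-R"]]]]) (use i in \<open>simp_all add: D_def\<close>)
 have cT: "ck R al 0 (%p. d s i (fst p))" if "s \<in> {R,-R}" "i <= 2" for s i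
  using hb_fst[OF d(2)[OF that] al(1) K, of "strip R"] by auto
 have cE: "ck R al 0 E" "ck R al 0 F" unfolding E_def F_def
  by (rule ck_add[OF ck_const ck_mult[OF ck_const ck_snd[OF al R]]])+
 have cG: "ck R al 0 (G i)" if "i <= 2" for i unfolding G_def
  by (rule ck_add[OF ck_mult[OF cE(1) cT] ck_mult[OF cE(2) cT]]) (use that in simp_all)
 have cD: "ck R al 0 (D i)" if "i <= 2" for i unfolding D_def
  by (rule ck_add[OF ck_mult[OF ck_const cT] ck_mult[OF ck_const cT]]) (use that in simp_all)
 define H where "H = (%i::nat. if i = 0 then G 0 else if i = 1 then G 1 else if i = 2 then D 0 else if i = 3 then G 2 else if i = 4 then D 1 else (%_. 0))"
 have "adm R P al H"
 proof (rule admI)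
  show "jet (strip R) H" unfolding jet_def H_def using gG[of 0] gG[of 1] gD[of 0] by (simp add: numeral_2_eq_2)
  show "ck R al 0 (H i)" for i unfolding H_def using cG[of 0] cG[of 1] cG[of 2] cD[of 0] cD[of 1] ck_const[of R al 0 0] by simp
  show "per R P (H 0)" unfolding per_def H_def G_def E_def F_def using d(3) by simp
 qed
 moreover have "\<forall>p. H 5 p = 0" unfolding H_def by simp
 moreover have "\<forall>s\<in>{R,-R}. \<forall>x. H 0 (x, s) = d s 0 x" unfolding H_def G_def E_def F_def r_def using R by auto
 ultimately show ?thesis by blast
qed

text \<open>The initial guess at \<open>t + \<tau>\<close> is \<open>J + \<tau> * H\<close>, whose
  residual \<open>\<tau> * (z * AB)\<close> has norm at most \<open>\<tau> * C\<close>. As neither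
  \<open>C\<close> nor \<open>\<epsilon>\<close> depends on \<open>t\<close>, equal steps
  \<open>\<tau> = 1 / N\<close> lead from 0 to 1.\<close>

lemma existence:
 assumes R: "R > 0" and P: "P > 0" and al: "0 < al" "al < 1" and a: "a \<noteq> 0" and K: "K \<ge> 0"
  and d: "!!s i x. s \<in> {R,-R} ==> i < (4::nat) ==> (d s i has_real_derivative d s (Suc i) x) (at x)" "!!s i. s \<in> {R,-R} ==> i <= 4 ==> hb UNIV al K (d s i)"
   "!!s x. s \<in> {R,-R} ==> d s 2 (x + P) = d s 2 x" "!!s x. s \<in> {R,-R} ==> d s 0 (x + P) = d s 0 x"
 shows "\<exists>J. nsol R P al a c0 c1 d 1 J"
proof -
 let ?l = "%p::real \<times> real. c0 + c1 * snd p"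
 note al1 = al(1) less_imp_le[OF al(2)]
 have "\<exists>B\<ge>0. \<forall>t\<in>{0..1}. \<forall>J. nsol R P al a c0 c1 d t J --> hb (strip R) al B (%p. J 3 p + t * ?l p)"
  by (rule a_priori[OF R P al a K d(1) d(2) d(3)])
 then obtain B where B: "B \<ge> 0" "!!t J. t \<in> {0..1} ==> nsol R P al a c0 c1 d t J ==> hb (strip R) al B (%p. J 3 p + t * ?l p)" by blast
 have "\<exists>H. adm R P al H \<and> (\<forall>p. H 5 p = 0) \<and> (\<forall>s\<in>{R,-R}. \<forall>x. H 0 (x, s) = d s 0 x)"
  by (rule interpolation_jet[OF R al1 K]) (use d in simp_all)
 then obtain H where H: "adm R P al H" "\<forall>p. H 5 p = 0" "\<forall>s\<in>{R,-R}. \<forall>x. H 0 (x, s) = d s 0 x"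
  by (elim exE conjE) (rule that)
 have "ck R al 0 (%p. H 3 p + ?l p)"
  by (rule ck_add[OF _ ck_add[OF ck_const ck_mult[OF ck_const ck_snd[OF al1 R]]]]) (use adm_hb[OF H(1), of 3] in simp)
 then obtain KH where "hb (strip R) al KH (%p. H 3 p + ?l p)" by auto
 then have KH: "hb (strip R) al \<bar>KH\<bar> (%p. H 3 p + ?l p)" by (rule hb_mono) simp
 \<comment> \<open>Since \<open>\<tau> <= 1\<close>, this also bounds the argument
   \<open>v + \<tau> * z\<close> of the initial guess.\<close>
 define B' where "B' = B + \<bar>KH\<bar>"
 have B': "B' \<ge> 0" unfolding B'_def using B(1) by simp
 obtain \<epsilon> where \<epsilon>: "\<epsilon> > 0" "\<forall>J0 l r. adm R P al J0 --> per R P l --> hb (strip R) al B' (%p. J0 3 p + l p) -->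
   hb (strip R) al r (%p. FF a (J0 3 p + l p) (snd p) + 2 * J0 5 p) --> r <= \<epsilon> -->
   (\<exists>J. adm R P al J \<and> (\<forall>p\<in>strip R. FF a (J 3 p + l p) (snd p) + 2 * J 5 p = 0) \<and>
    (\<forall>x. J 0 (x, R) = J0 0 (x, R) \<and> J 0 (x, -R) = J0 0 (x, -R)))"
  using newton[OF R P al a B'] by (elim exE conjE) (rule that)
 define KA where "KA = max (LA a * (B' + B' + (1 + 2 * R))) (1 / \<bar>a\<bar>)"
 define C where "C = 2 * \<bar>KH\<bar> * KA"
 obtain N :: nat where N: "N > 0" "C < real N * \<epsilon>"
  using reals_Archimedean3[OF \<epsilon>(1), rule_format, of "\<bar>C\<bar>"] by (metis abs_ge_self abs_ge_zero mult_zero_left not_gr_zero not_le of_nat_0 order_le_less_trans)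
 define \<tau> where "\<tau> = 1 / real N"
 have \<tau>: "\<tau> > 0" "\<tau> <= 1" "\<tau> * C <= \<epsilon>" unfolding \<tau>_def using N by (auto simp: field_simps)
 have "i <= N ==> \<exists>J. nsol R P al a c0 c1 d (real i * \<tau>) J" for i
 proof (induction i)
  case 0
  have "adm R P al (%i p. 0)" using adm_cmult[OF H(1), of 0] by simp
  then have "nsol R P al a c0 c1 d 0 (%i p. 0)" unfolding nsol_def by (simp add: FF_zero a)
  then show ?case by auto
 next
  case (Suc i)
  then obtain J where J: "nsol R P al a c0 c1 d (real i * \<tau>) J" by auto
  define t where "t = real i * \<tau>"
  have t: "t \<in> {0..1}" unfolding t_def \<tau>_def using Suc.prems by (auto simp: field_simps)
  have Suct: "real (Suc i) * \<tau> = t + \<tau>" unfolding t_def by (simp add: algebra_simps)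
  define v where "v = (%p. J 3 p + t * ?l p)"
  define z where "z = (%p. H 3 p + ?l p)"
  define J0 where "J0 = (%i p. J i p + \<tau> * H i p)"
  have v: "hb (strip R) al B v" unfolding v_def by (rule B(2)[OF t]) (use J in \<open>simp add: t_def\<close>)
  have J': "adm R P al J" "!!p. p \<in> strip R ==> FF a (v p) (snd p) + 2 * J 5 p = 0" "!!s x. s \<in> {R,-R} ==> J 0 (x, s) = t * d s 0 x"
   using J unfolding nsol_def t_def[symmetric] v_def by blast+
  have w: "J0 3 p + (t + \<tau>) * ?l p = v p + \<tau> * z p" for p unfolding J0_def v_def z_def by (simp add: algebra_simps)
  have aJ: "adm R P al J0" unfolding J0_def by (rule adm_add[OF J'(1) adm_cmult[OF H(1)]])
  have "hb (strip R) al (B + \<bar>\<tau>\<bar> * \<bar>KH\<bar>) (%p. v p + \<tau> * z p)" by (rule hb_add[OF v hb_cmult[OF KH[folded z_def]]])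
  then have wb: "hb (strip R) al B' (%p. v p + \<tau> * z p)"
   by (rule hb_mono) (use \<tau> mult_right_mono[of \<tau> 1 "\<bar>KH\<bar>"] in \<open>simp add: B'_def\<close>)
  have vb: "hb (strip R) al B' v" by (rule hb_mono[OF v]) (simp add: B'_def)
  have ab: "hb (strip R) al KA (%p. AB a (v p) (v p + \<tau> * z p) (snd p))" unfolding hb_def
  proof (intro conjI ballI)
   show "hol (strip R) al KA (%p. AB a (v p) (v p + \<tau> * z p) (snd p))"
    by (rule hol_mono[OF hol_AB[OF a al1 R conjunct2[OF vb[unfolded hb_def]] conjunct2[OF wb[unfolded hb_def]]]]) (simp add: KA_def)
   fix p assume p: "p \<in> strip R"
   have "\<bar>v p\<bar> <= B'" "\<bar>v p + \<tau> * z p\<bar> <= B'" "\<bar>snd p\<bar> <= R" using vb wb p unfolding hb_def by (auto simp: mem_strip)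
   from AB_bounds[OF a this] have "0 <= AB a (v p) (v p + \<tau> * z p) (snd p)" "AB a (v p) (v p + \<tau> * z p) (snd p) <= 1 / \<bar>a\<bar>"
    by (auto intro: order_trans[rotated])
   then show "\<bar>AB a (v p) (v p + \<tau> * z p) (snd p)\<bar> <= KA" unfolding KA_def by simp
  qed
  have "hb (strip R) al (\<bar>\<tau>\<bar> * C) (%p. \<tau> * (z p * AB a (v p) (v p + \<tau> * z p) (snd p)))"
   unfolding C_def by (rule hb_cmult[OF hb_mult[OF KH[folded z_def] ab]])
  then have res: "hb (strip R) al (\<bar>\<tau>\<bar> * C) (%p. FF a (J0 3 p + (t + \<tau>) * ?l p) (snd p) + 2 * J0 5 p)"
  proof (rule hb_cong)
   fix p assume p: "p \<in> strip R"
   have "FF a (v p + \<tau> * z p) (snd p) - FF a (v p) (snd p) = \<tau> * z p * AB a (v p) (v p + \<tau> * z p) (snd p)"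
    using FF_diff[OF a, of "v p + \<tau> * z p" "snd p" "v p"] by simp
   moreover have "J0 5 p = J 5 p" unfolding J0_def using spec[OF H(2), of p] by simp
   ultimately show "FF a (J0 3 p + (t + \<tau>) * ?l p) (snd p) + 2 * J0 5 p = \<tau> * (z p * AB a (v p) (v p + \<tau> * z p) (snd p))"
    unfolding w using J'(2)[OF p] by simp
  qed
  have pl: "per R P (%p. (t + \<tau>) * ?l p)" unfolding per_def by simp
  have "\<bar>\<tau>\<bar> * C <= \<epsilon>" using \<tau> by simp
  then have "\<exists>J. adm R P al J \<and> (\<forall>p\<in>strip R. FF a (J 3 p + (t + \<tau>) * ?l p) (snd p) + 2 * J 5 p = 0) \<and>
    (\<forall>x. J 0 (x, R) = J0 0 (x, R) \<and> J 0 (x, -R) = J0 0 (x, -R))"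
   using \<epsilon>(2)[THEN spec, THEN spec, THEN spec, THEN mp, THEN mp, THEN mp, THEN mp, THEN mp, OF aJ pl _ res] wb unfolding w by blast
  then obtain J1 where J1: "adm R P al J1" "\<forall>p\<in>strip R. FF a (J1 3 p + (t + \<tau>) * ?l p) (snd p) + 2 * J1 5 p = 0"
    "\<forall>x. J1 0 (x, R) = J0 0 (x, R) \<and> J1 0 (x, -R) = J0 0 (x, -R)" by (elim exE conjE) (rule that)
  have "nsol R P al a c0 c1 d (t + \<tau>) J1" unfolding nsol_def
  proof (intro conjI ballI allI)
   fix s x assume s: "s \<in> {R,-R}"
   then have "J1 0 (x, s) = J0 0 (x, s)" using J1(3) by auto
   also have "\<dots> = (t + \<tau>) * d s 0 x" unfolding J0_def using J'(3)[OF s] spec[OF bspec[OF H(3) s], of x] by (simp add: algebra_simps)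
   finally show "J1 0 (x, s) = (t + \<tau>) * d s 0 x" .
  qed (use J1 in blast)+
  then show ?case unfolding Suct by blast
 qed
 from this[of N] show ?thesis unfolding \<tau>_def using N by simp
qed

subsection \<open>Uniqueness\<close>

text \<open>The difference \<open>W\<close> of two solutions satisfies \<open>(c W)\<^sub>x\<^sub>x + 2 W\<^sub>y\<^sub>y = 0\<close>. Testing with the solution \<open>Q\<close> of the
 adjoint problem \<open>c Q\<^sub>x\<^sub>x + 2 Q\<^sub>y\<^sub>y = W\<close> shows that \<open>W\<^sup>2\<close> is a divergence.\<close>

lemma dist_le_sum: "dist (x::real, y::real) (x', y') <= \<bar>x - x'\<bar> + \<bar>y - y'\<bar>"
 unfolding dist_Pair_Pair dist_real_def by (rule order_trans[OF sqrt_sum_squares_le_sum_abs]) simp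

lemma uniqueness:
 assumes R: "R > 0" and P: "P > 0" and al: "0 < al" "al < 1" and a: "a \<noteq> 0"
  and V: "adm R P al V" "!!p. p \<in> strip R ==> AA a (V 0 p) (snd p) * V 3 p + 2 * V 5 p = - AV a (V 0 p) (snd p) * (V 1 p * V 1 p)"
  and U: "adm R P al U" "!!p. p \<in> strip R ==> AA a (U 0 p) (snd p) * U 3 p + 2 * U 5 p = - AV a (U 0 p) (snd p) * (U 1 p * U 1 p)"
  and bd: "!!s x. s \<in> {R,-R} ==> V 0 (x, s) = U 0 (x, s)" and q: "q \<in> strip R"
 shows "V 0 q = U 0 q"
proof (rule ccontr)
 assume ne: "V 0 q \<noteq> U 0 q"
 note al1 = al(1) less_imp_le[OF al(2)]
 define W where "W = (%i p. V i p + - 1 * U i p)"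
 have W: "adm R P al W" unfolding W_def by (rule adm_add[OF V(1) adm_cmult[OF U(1)]])
 obtain K1 K2 where "hb (strip R) al K1 (V 0)" "hb (strip R) al K2 (U 0)" using adm_hb[OF V(1), of 0] adm_hb[OF U(1), of 0] by auto
 then have KB: "hb (strip R) al (max K1 K2) (V 0)" "hb (strip R) al (max K1 K2) (U 0)" by (auto elim: hb_mono)
 define B where "B = max K1 K2"
 define c where "c = (%p. AB a (U 0 p) (V 0 p) (snd p))"
 have cb: "\<forall>p\<in>strip R. 1 / sqrt (B\<^sup>2 + R\<^sup>2 + a\<^sup>2) <= c p \<and> c p <= 1 / \<bar>a\<bar>"
 proof
  fix p assume p: "p \<in> strip R"
  have "\<bar>U 0 p\<bar> <= B" "\<bar>V 0 p\<bar> <= B" "\<bar>snd p\<bar> <= R" using KB p unfolding hb_def B_def by (auto simp: mem_strip)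
  from AB_bounds[OF a this] show "1 / sqrt (B\<^sup>2 + R\<^sup>2 + a\<^sup>2) <= c p \<and> c p <= 1 / \<bar>a\<bar>" unfolding c_def by simp
 qed
 have mu: "0 < 1 / sqrt (B\<^sup>2 + R\<^sup>2 + a\<^sup>2)" using AA_base(1)[OF a, of B R] by simp
 have ch: "hol (strip R) al (LA a * (B + B + (1 + 2 * R))) c" unfolding c_def B_def
  by (rule hol_AB[OF a al1 R conjunct2[OF KB(2)[unfolded hb_def]] conjunct2[OF KB(1)[unfolded hb_def]]])
 have perW: "per R P (W i)" if "i <= 5" for i by (rule adm_per[OF W R that])
 have perV: "per R P (V i)" "per R P (U i)" if "i <= 5" for i by (rule adm_per[OF V(1) R that], rule adm_per[OF U(1) R that])
 have cp: "per R P c" unfolding per_def c_def using perD[OF perV(1)[of 0]] perD[OF perV(2)[of 0]] by simp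
 obtain KW where KW: "hb (strip R) al KW (W 0)" using adm_hb[OF W, of 0] by auto
 \<comment> \<open>The averaged coefficient \<open>c\<close> is bounded below by a positive number,
   Hoelder continuous and periodic, so the nondivergence problem with right-hand side
   \<open>W 0\<close> is solvable.\<close>
 obtain Q where "solves_linear R P al c (W 0) Q" using linear_solvable[OF R P al mu cb ch cp KW perW] by auto
 then have Qa: "adm R P al Q" and Qe: "!!p. p \<in> strip R ==> c p * Q 3 p + 2 * Q 5 p = W 0 p" and Qb: "!!x. Q 0 (x, R) = 0" "!!x. Q 0 (x, -R) = 0"
  unfolding solves_linear_def adm_def by auto
 note gV = adm_grad[OF V(1)] and gU = adm_grad[OF U(1)] and gQ = adm_grad[OF Qa] and gW = adm_grad[OF W]
 \<comment> \<open>By \<open>FF_diff\<close>, \<open>Z\<close> equals \<open>c\<close> times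
   \<open>W 0\<close>. It is differentiated as a difference of values of \<open>FF\<close>, so no
   derivative of \<open>c\<close> is formed, and the two equations give its second \<open>x\<close>
   derivative as \<open>- 2 * W 5\<close>.\<close>
 define Z where "Z p = FF a (V 0 p) (snd p) - FF a (U 0 p) (snd p)" for p
 define Z1 where "Z1 p = AA a (V 0 p) (snd p) * V 1 p - AA a (U 0 p) (snd p) * U 1 p" for p
 have dZ: "((%x. Z (x, y)) has_real_derivative Z1 (x, y)) (at x within T)" if y: "y \<in> {-R..R}" for x y T
  unfolding Z_def Z1_def using DERIV_diff[OF DERIV_chain2[OF FF_deriv[OF a, of y _ UNIV] row_derivative[OF gV(1) y, of x T]]
   DERIV_chain2[OF FF_deriv[OF a, of y _ UNIV] row_derivative[OF gU(1) y, of x T]]] by simp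
 have dZ1: "((%x. Z1 (x, y)) has_real_derivative - 2 * W 5 (x, y)) (at x within T)" if y: "y \<in> {-R..R}" for x y T
 proof -
  have mem: "(x, y) \<in> strip R" using y by (auto simp: mem_strip)
  have "((%x. Z1 (x, y)) has_real_derivative
   (AV a (V 0 (x, y)) y * V 1 (x, y) * V 1 (x, y) + V 3 (x, y) * AA a (V 0 (x, y)) y) -
   (AV a (U 0 (x, y)) y * U 1 (x, y) * U 1 (x, y) + U 3 (x, y) * AA a (U 0 (x, y)) y)) (at x within T)"
   unfolding Z1_def using DERIV_diff[OF DERIV_mult[OF DERIV_chain2[OF AA_deriv(1)[OF a, of y] row_derivative[OF gV(1) y, of x T]] row_derivative[OF gV(2) y, of x T]]
    DERIV_mult[OF DERIV_chain2[OF AA_deriv(1)[OF a, of y] row_derivative[OF gU(1) y, of x T]] row_derivative[OF gU(2) y, of x T]]] by simp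
  moreover have "(AV a (V 0 (x, y)) y * V 1 (x, y) * V 1 (x, y) + V 3 (x, y) * AA a (V 0 (x, y)) y) -
   (AV a (U 0 (x, y)) y * U 1 (x, y) * U 1 (x, y) + U 3 (x, y) * AA a (U 0 (x, y)) y) = - 2 * W 5 (x, y)"
   using V(2)[OF mem] U(2)[OF mem] unfolding W_def by (simp add: algebra_simps)
  ultimately show ?thesis by simp
 qed
 \<comment> \<open>Green's identity for \<open>W\<close> and \<open>Q\<close>: in the sum the terms
   with \<open>Q 0 * W 5\<close> cancel, and \<open>W 0 * (c * Q 3 + 2 * Q 5) = W 0 * W 0\<close>
   remains.\<close>
 define ax where "ax p = Z p * Q 3 p + 2 * (Q 0 p * W 5 p)" for p
 define bx where "bx p = 2 * (W 0 p * Q 5 p - Q 0 p * W 5 p)" for p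
 define x0 where "x0 = fst q"
 define y0 where "y0 = snd q"
 let ?X = "{x0..x0 + P} \<times> {-R..R}"
 have XS: "?X \<subseteq> strip R" by (auto simp: mem_strip abs_le_iff)
 have cont: "continuous_on ?X (J i)" if J: "adm R P al J" and i: "i <= 5" for J i
 proof -
  obtain K where "hb (strip R) al K (J i)" using adm_hb[OF J i] by blast
  from continuous_on_subset[OF hb_continuous[OF this al(1)] XS] show ?thesis .
 qed
 have Zc: "Z p = W 0 p * c p" for p unfolding Z_def W_def c_def using FF_diff[OF a, of "V 0 p" "snd p" "U 0 p"] by simp
 have contc: "continuous_on ?X c" by (rule continuous_on_subset[OF hol_continuous[OF ch al(1)] XS])
 have "II x0 (x0 + P) R (%p. ax p + bx p) = 0"
 proof (rule II_divergence_zero[where aa="%p. Z p * Q 1 p - Z1 p * Q 0 p" and bb="%p. 2 * (W 0 p * Q 2 p - W 2 p * Q 0 p)"])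
  show "x0 <= x0 + P" "R > 0" using P R by simp_all
  fix x y assume y: "y \<in> {-R..R}"
  show "((%x. Z (x, y) * Q 1 (x, y) - Z1 (x, y) * Q 0 (x, y)) has_real_derivative ax (x, y)) (at x within {x0..x0 + P})"
   by (rule DERIV_cong[OF DERIV_diff[OF DERIV_mult[OF dZ[OF y] row_derivative[OF gQ(2) y]] DERIV_mult[OF dZ1[OF y] row_derivative[OF gQ(1) y]]]])
    (simp add: ax_def algebra_simps)
  show "((%y. 2 * (W 0 (x, y) * Q 2 (x, y) - W 2 (x, y) * Q 0 (x, y))) has_real_derivative bx (x, y)) (at y within {-R..R})"
   by (rule DERIV_cong[OF DERIV_cmult[OF DERIV_diff[OF DERIV_mult[OF column_derivative[OF gW(1) y] column_derivative[OF gQ(3) y]]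
     DERIV_mult[OF column_derivative[OF gW(3) y] column_derivative[OF gQ(1) y]]]]]) (simp add: bx_def algebra_simps)
 next
  show "continuous_on ?X ax" unfolding ax_def Zc by (intro continuous_intros cont[OF W] cont[OF Qa] contc) simp_all
  show "continuous_on ?X bx" unfolding bx_def by (intro continuous_intros cont[OF W] cont[OF Qa]) simp_all
  show "Z (x0 + P, y) * Q 1 (x0 + P, y) - Z1 (x0 + P, y) * Q 0 (x0 + P, y) = Z (x0, y) * Q 1 (x0, y) - Z1 (x0, y) * Q 0 (x0, y)" if y: "y \<in> {-R..R}" for y
  proof -
   have mem: "(x0, y) \<in> strip R" using y by (auto simp: mem_strip)
   have "J i (x0 + P, y) = J i (x0, y)" if "adm R P al J" "i <= 5" for J i using perD[OF adm_per[OF that(1) R that(2)] mem] by simp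
   from this[OF V(1)] this[OF U(1)] this[OF Qa] show ?thesis unfolding Z_def Z1_def by simp
  qed
  show "2 * (W 0 (x, R) * Q 2 (x, R) - W 2 (x, R) * Q 0 (x, R)) = 2 * (W 0 (x, -R) * Q 2 (x, -R) - W 2 (x, -R) * Q 0 (x, -R))" for x
   using bd[of R x] bd[of "-R" x] Qb unfolding W_def by simp
 qed
 moreover have "ax p + bx p = W 0 p * W 0 p" if "p \<in> strip R" for p
  unfolding ax_def bx_def Zc using arg_cong[OF Qe[OF that], of "%t. W 0 p * t"] by (simp add: algebra_simps)
 moreover have cW: "continuous_on ?X (%p. W 0 p * W 0 p)" by (intro continuous_intros cont[OF W]) simp_all
 ultimately have II0: "II x0 (x0 + P) R (%p. W 0 p * W 0 p) <= 0"
 proof -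
  assume z: "II x0 (x0 + P) R (%p. ax p + bx p) = 0" and e: "!!p. p \<in> strip R ==> ax p + bx p = W 0 p * W 0 p"
  have "II x0 (x0 + P) R (%p. W 0 p * W 0 p) = II x0 (x0 + P) R (%p. ax p + bx p)" unfolding II_def
   by (intro integral_cong e[symmetric]) (auto simp: mem_strip)
  then show ?thesis using z by simp
 qed
 define m where "m = \<bar>W 0 q\<bar> / 2"
 have m: "m > 0" unfolding m_def W_def using ne by simp
 have "continuous_on (strip R) (W 0)" by (rule hb_continuous[OF KW al(1)])
 then obtain \<delta> where \<delta>: "\<delta> > 0" "!!p. p \<in> strip R ==> dist p q < \<delta> ==> \<bar>W 0 p - W 0 q\<bar> < m"
  using q m unfolding continuous_on_iff dist_real_def by blast
 define s where "s = min (min P R) (\<delta> / 3)"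
 have s: "s > 0" "s <= P" "s <= R" "2 * s < \<delta>" unfolding s_def using P R \<delta> by auto
 define y1 where "y1 = (if y0 <= 0 then y0 else y0 - s)"
 have y0: "\<bar>y0\<bar> <= R" using q unfolding y0_def by (simp add: mem_strip)
 have y1: "-R <= y1" "y1 + s <= R" unfolding y1_def using y0 s by (auto simp: abs_le_iff)
 have "(m * m) * ((x0 + s) - x0) * ((y1 + s) - y1) <= II x0 (x0 + P) R (%p. W 0 p * W 0 p)"
 proof (rule II_lower[OF cW])
  fix x y assume xy: "x \<in> {x0..x0 + s}" "y \<in> {y1..y1 + s}"
  have mem: "(x, y) \<in> strip R" using xy y1 by (auto simp: mem_strip abs_le_iff)
  have qe: "q = (x0, y0)" unfolding x0_def y0_def by simp
  have "\<bar>y - y0\<bar> <= s" "\<bar>x - x0\<bar> <= s" using xy s unfolding y1_def by (auto simp: abs_le_iff split: if_splits)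
  then have "dist (x, y) q < \<delta>" unfolding qe using dist_le_sum[of x y x0 y0] s(4) by linarith
  from \<delta>(2)[OF mem this] have "m <= \<bar>W 0 (x, y)\<bar>" unfolding m_def by linarith
  then have "m * m <= \<bar>W 0 (x, y)\<bar> * \<bar>W 0 (x, y)\<bar>" using m by (intro mult_mono) auto
  then show "m * m <= W 0 (x, y) * W 0 (x, y)" by simp
 qed (use s y1 in auto)
 moreover have "(m * m) * ((x0 + s) - x0) * ((y1 + s) - y1) > 0" using m s by simp
 ultimately show False using II0 by linarith
qed

subsection \<open>One-dimensional data\<close>

lemma continuous_antiderivative:
 fixes f :: "real => real" assumes "continuous_on UNIV f"
 shows "\<exists>F. \<forall>x. (F has_real_derivative f x) (at x)"
proof (intro exI allI)
 fix x :: real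
 have "((%u. interval_lebesgue_integral lborel (ereal 0) (ereal u) f) has_vector_derivative f x) (at x within {min x 0 - 1..max x 0 + 1})"
  by (rule interval_integral_FTC2) (auto intro: continuous_on_subset[OF assms])
 then show "((%u. interval_lebesgue_integral lborel (ereal 0) (ereal u) f) has_real_derivative f x) (at x)"
  by (simp add: at_within_Icc_at has_real_derivative_iff_has_vector_derivative min_def max_def split: if_splits)
qed

text \<open>Subtracting the mean \<open>m\<close> makes the increment of the primitive over a period
  vanish.\<close>

lemma periodic_primitive:
 fixes f :: "real => real"
 assumes "continuous_on UNIV f" "!!x. f (x + P) = f x" and P: "P > 0"
 shows "\<exists>F m. (\<forall>x. (F has_real_derivative f x - m) (at x)) \<and> (\<forall>x. F (x + P) = F x)"
proof -
 obtain G where G: "!!x. (G has_real_derivative f x) (at x)" using continuous_antiderivative[OF assms(1)] by blast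
 define m where "m = (G P - G 0) / P"
 define F where "F x = G x - m * x" for x
 have F: "(F has_real_derivative f x - m) (at x)" for x unfolding F_def using DERIV_diff[OF G DERIV_cmult_Id] by simp
 have "((%x. F (x + P) - F x) has_real_derivative 0) (at x)" for x
 proof -
  have "((%x. F (x + P)) has_real_derivative f (x + P) - m) (at x)" using F[of "x + P"] by (simp add: DERIV_shift)
  from DERIV_diff[OF this F] show ?thesis using assms(2) by simp
 qed
 then have "\<forall>x. ((%x. F (x + P) - F x) has_real_derivative 0) (at x)" by blast
 from DERIV_isconst_all[OF this, of _ 0] have "F (x + P) - F x = F P - F 0" for x by simp
 moreover have "F P = F 0" unfolding F_def m_def using P by simp
 ultimately show ?thesis using F by auto
qed

lemma periodic_bounded:
 fixes f :: "real => real"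
 assumes "continuous_on UNIV f" "!!x. f (x + P) = f x" and P: "P > 0"
 shows "\<exists>B\<ge>0. \<forall>x. \<bar>f x\<bar> <= B"
proof -
 have "bounded (f ` {0..0 + P})" by (intro compact_imp_bounded compact_continuous_image continuous_on_subset[OF assms(1)]) simp_all
 then obtain B where "\<forall>y\<in>f ` {0..0 + P}. norm y <= B" unfolding bounded_iff by blast
 then have B: "\<bar>f x\<bar> <= B" if "x \<in> {0..0 + P}" for x using that by simp
 have pf: "per 1 P (%p. f (fst p))" unfolding per_def using assms(2) by simp
 have "\<bar>f x\<bar> <= \<bar>B\<bar>" for x
 proof -
  obtain x' where "x' \<in> {0..0 + P}" "f (fst (x', 0::real)) = f (fst (x, 0::real))"
   by (rule per_reduce[OF pf P, of x 0 0]) (auto simp: mem_strip)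
  then show ?thesis using B[of x'] by simp
 qed
 then show ?thesis by (intro exI[of _ "\<bar>B\<bar>"]) simp
qed

lemma real_hb:
 fixes f :: "real => real"
 assumes "0 < al" "al <= 1" "!!x. (f has_real_derivative f1 x) (at x)" "!!x. \<bar>f x\<bar> <= B" "!!x. \<bar>f1 x\<bar> <= L"
 shows "hb UNIV al (L + 2 * B) f"
proof (rule hb_lipschitz[OF assms(1,2)])
 show "\<bar>f x\<bar> <= B" for x by (rule assms(4))
 show "\<bar>f x - f y\<bar> <= L * dist x y" for x y by (rule real_lipschitz[of UNIV f f1]) (use assms in simp_all)
 show "L \<ge> 0" "B \<ge> 0" using assms(4)[of 0] assms(5)[of 0] by linarith+
qed

lemma hoelder_real:
 fixes \<phi> :: "real => real"
 assumes h: "hoelder_space n al UNIV \<phi>" and al: "0 < al" "al <= 1"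
 shows "\<exists>c. c 0 = \<phi> \<and> (\<forall>i<n. \<forall>x. (c i has_real_derivative c (Suc i) x) (at x)) \<and> (\<forall>i\<le>n. \<exists>K. hb UNIV al K (c i))"
proof -
 define c where "c i = (deriv ^^ i) \<phi>" for i
 have cS: "c (Suc i) = deriv (c i)" for i unfolding c_def by simp
 have step: "(c i has_real_derivative c (Suc i) x) (at x)" "pderiv_of UNIV \<phi> (Suc i) (c (Suc i))" if i: "i < n" and pd: "pderiv_of UNIV \<phi> i (c i)" for i x
 proof -
  obtain g where g: "\<forall>p\<in>UNIV. (c i has_derivative g p) (at p within UNIV)" using h i pd unfolding hoelder_space_def by blast
  have d: "(c i has_real_derivative g p 1) (at p)" for p
  proof -
   have gp: "(c i has_derivative g p) (at p)" using g by simp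
   have "g p h = g p 1 * h" for h using linear_scale[OF has_derivative_linear[OF gp], of h 1] by simp
   then have "g p = (*) (g p 1)" by (intro ext)
   then show ?thesis using gp unfolding has_field_derivative_def by simp
  qed
  have e: "c (Suc i) = (%p. g p 1)" unfolding cS using DERIV_imp_deriv[OF d] by (intro ext)
  show "(c i has_real_derivative c (Suc i) x) (at x)" unfolding e by (rule d)
  show "pderiv_of UNIV \<phi> (Suc i) (c (Suc i))" unfolding e by (rule pderiv_of.step[OF pd g]) simp
 qed
 have pd: "i <= n ==> pderiv_of UNIV \<phi> i (c i)" for i
 proof (induction i)
  case 0 show ?case unfolding c_def by (simp add: pderiv_of.base)
 next
  case (Suc i) then show ?case using step(2)[of i] by simp
 qed
 have der: "(c i has_real_derivative c (Suc i) x) (at x)" if "i < n" for i x using step(1)[OF that pd] that by simp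
 have bnd: "\<exists>B. \<forall>x. \<bar>c i x\<bar> <= B" if "i <= n" for i
 proof -
  have "bounded (c i ` UNIV)" using h pd[OF that] that unfolding hoelder_space_def by blast
  then show ?thesis unfolding bounded_iff by auto
 qed
 have "\<exists>K. hb UNIV al K (c i)" if i: "i <= n" for i
 proof (cases "i = n")
  case True
  obtain C where C: "\<forall>p\<in>UNIV. \<forall>q\<in>UNIV. \<bar>c n p - c n q\<bar> <= C * dist p q powr al" using h pd[of n] unfolding hoelder_space_def by blast
  obtain B where B: "!!x. \<bar>c n x\<bar> <= B" using bnd[of n] by blast
  have "hol UNIV al C (c n)" using C unfolding hol_def .
  then have "hol UNIV al (max B C) (c n)" by (rule hol_mono) simp
  then have "hb UNIV al (max B C) (c n)" unfolding hb_def using B by (simp add: le_max_iff_disj)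
  then show ?thesis unfolding True ..
 next
  case False
  then have i': "i < n" using i by simp
  obtain B L where "!!x. \<bar>c i x\<bar> <= B" "!!x. \<bar>c (Suc i) x\<bar> <= L" using bnd[OF i] bnd[of "Suc i"] i' by auto
  from real_hb[OF al der[OF i'] this] show ?thesis ..
 qed
 moreover have "c 0 = \<phi>" unfolding c_def by simp
 ultimately show ?thesis using der by blast
qed

text \<open>The mean of \<open>\<phi>\<close> is removed before the first integration and the mean
  of the result before the second, so \<open>d 0\<close> is again periodic. Beyond index 2 the
  functions \<open>d\<close> are the derivatives of \<open>\<phi>\<close> shifted by two.\<close>

lemma double_primitive:
 fixes \<phi> :: "real => real"
 assumes h: "hoelder_space n al UNIV \<phi>" and al: "0 < al" "al <= 1" and P: "P > 0" and p: "!!x. \<phi> (x + P) = \<phi> x" and n: "n \<ge> 1"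
 shows "\<exists>d m. (\<forall>x. d 2 x + m = \<phi> x) \<and> (\<forall>i<n + 2. \<forall>x. (d i has_real_derivative d (Suc i) x) (at x)) \<and> (\<forall>i\<le>n + 2. \<exists>K. hb UNIV al K (d i)) \<and> (\<forall>x. d 0 (x + P) = d 0 x)"
proof -
 obtain c where c: "c 0 = \<phi>" "!!i x. i < n ==> (c i has_real_derivative c (Suc i) x) (at x)" "!!i. i <= n ==> \<exists>K. hb UNIV al K (c i)"
  using hoelder_real[OF h al] by blast
 have D\<phi>: "(\<phi> has_real_derivative c 1 x) (at x)" for x using c(2)[of 0 x] c(1) n by simp
 have cont: "continuous_on UNIV f" if "!!x. (f has_real_derivative f' x) (at x)" for f f' :: "real => real"
  by (rule continuous_at_imp_continuous_on) (blast intro: DERIV_isCont that)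
 obtain F m where F: "!!x. (F has_real_derivative \<phi> x - m) (at x)" "!!x. F (x + P) = F x"
  using periodic_primitive[OF cont[OF D\<phi>] p P] by blast
 obtain E l where E: "!!x. (E has_real_derivative F x - l) (at x)" "!!x. E (x + P) = E x"
  using periodic_primitive[OF cont[OF F(1)] F(2) P] by blast
 obtain B1 where B1: "!!x. \<bar>\<phi> x\<bar> <= B1" using periodic_bounded[OF cont[OF D\<phi>] p P] by blast
 obtain B2 where B2: "!!x. \<bar>F x\<bar> <= B2" using periodic_bounded[OF cont[OF F(1)] F(2) P] by blast
 obtain B3 where B3: "!!x. \<bar>E x\<bar> <= B3" using periodic_bounded[OF cont[OF E(1)] E(2) P] by blast
 have b: "\<bar>\<phi> x - m\<bar> <= B1 + \<bar>m\<bar>" "\<bar>F x - l\<bar> <= B2 + \<bar>l\<bar>" for x using B1[of x] B2[of x] by linarith+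
 define d where "d i = (if i = 0 then E else if i = 1 then (%x. F x - l) else if i = 2 then (%x. \<phi> x - m) else c (i - 2))" for i
 have F': "((%x. F x - l) has_real_derivative \<phi> x - m) (at x)" for x using DERIV_diff[OF F(1) DERIV_const] by simp
 have \<phi>': "((%x. \<phi> x - m) has_real_derivative c 1 x) (at x)" for x using DERIV_diff[OF D\<phi> DERIV_const] by simp
 have "(d i has_real_derivative d (Suc i) x) (at x)" if "i < n + 2" for i x
 proof -
  consider "i = 0" | "i = 1" | "i = 2" | "i > 2" by linarith
  then show ?thesis
  proof cases
   case 4
   then have "i - Suc 0 = Suc (i - 2)" by arith
   then have "d i = c (i - 2)" "d (Suc i) = c (Suc (i - 2))" unfolding d_def using 4 by simp_all
   then show ?thesis using c(2)[of "i - 2" x] that 4 by simp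
  qed (use E(1) F' \<phi>' in \<open>simp_all add: d_def\<close>)
 qed
 moreover have "\<exists>K. hb UNIV al K (d i)" if "i <= n + 2" for i
 proof -
  consider "i = 0" | "i = 1" | "i = 2" | "i > 2" by linarith
  then show ?thesis
  proof cases
   case 1 then show ?thesis using real_hb[OF al E(1) B3 b(2)] unfolding d_def by auto
  next
   case 2 then show ?thesis using real_hb[OF al F' b(2) b(1)] unfolding d_def by auto
  next
   case 3
   obtain K where "hb UNIV al K \<phi>" using c(1) c(3)[of 0] by auto
   then have "hb UNIV al (K + \<bar>m\<bar>) (%x. \<phi> x - m)" unfolding hb_def
   proof (intro conjI ballI)
    assume a: "(\<forall>p\<in>UNIV. \<bar>\<phi> p\<bar> <= K) \<and> hol UNIV al K \<phi>"
    show "\<bar>\<phi> p - m\<bar> <= K + \<bar>m\<bar>" for p using a abs_triangle_ineq4[of "\<phi> p" m] by (meson UNIV_I add_right_mono order_trans)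
    have "hol UNIV al (K + \<bar>m\<bar>) \<phi>" by (rule hol_mono[OF conjunct2[OF a]]) simp
    then show "hol UNIV al (K + \<bar>m\<bar>) (%x. \<phi> x - m)" unfolding hol_def by simp
   qed
   then show ?thesis using 3 unfolding d_def by auto
  next
   case 4 then show ?thesis using c(3)[of "i - 2"] that unfolding d_def by simp
  qed
 qed
 moreover have "\<forall>x. d 2 x + m = \<phi> x" "\<forall>x. d 0 (x + P) = d 0 x" unfolding d_def using E(2) by simp_all
 ultimately show ?thesis by blast
qed

subsection \<open>Hoelder spaces and iterated gradients\<close>

lemma derivative_grad:
 fixes g :: "real \<times> real => real"
 assumes "\<forall>p\<in>S. (g has_derivative g' p) (at p within S)"
 shows "grad S g (%p. g' p (1, 0)) (%p. g' p (0, 1))"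
 unfolding grad_def
proof
 fix p assume "p \<in> S"
 then have d: "(g has_derivative g' p) (at p within S)" using assms by blast
 note l = has_derivative_linear[OF d]
 have "g' p h = fst h * g' p (1, 0) + snd h * g' p (0, 1)" for h
  using linear_add[OF l, of "fst h *\<^sub>R (1, 0)" "snd h *\<^sub>R (0, 1)"] linear_scale[OF l, of "fst h" "(1, 0)"] linear_scale[OF l, of "snd h" "(0, 1)"] by simp
 then have "g' p = (%h. fst h * g' p (1, 0) + snd h * g' p (0, 1))" by (intro ext)
 then show "(g has_derivative (%h. fst h * g' p (1, 0) + snd h * g' p (0, 1))) (at p within S)" using d by simp
qed

lemma Basis_plane: "(1, 0) \<in> (Basis :: (real \<times> real) set)" "(0, 1) \<in> (Basis :: (real \<times> real) set)"
 "b \<in> (Basis :: (real \<times> real) set) ==> b = (1, 0) \<or> b = (0, 1)"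
 by (auto simp: Basis_prod_def)

text \<open>The bound in \<^const>\<open>hoelder_space\<close> is uniform over all derivatives of the top order, and there are finitely many of them only
 up to their values outside the strip.\<close>

lemma pderiv_finite:
 assumes R: "R > 0" and f: "ck R al n f"
 shows "j <= n ==> \<exists>S. finite S \<and> (\<forall>h\<in>S. ck R al (n - j) h) \<and> (\<forall>g. pderiv_of (strip R) f j g --> (\<exists>h\<in>S. \<forall>p\<in>strip R. g p = h p))"
proof (induction j)
 case 0
 have "g = f" if "pderiv_of (strip R) f 0 g" for g using that by (cases rule: pderiv_of.cases) simp_all
 then show ?case using f by (intro exI[of _ "{f}"]) auto
next
 case (Suc j)
 then obtain S where S: "finite S" "!!h. h \<in> S ==> ck R al (n - j) h" "!!g. pderiv_of (strip R) f j g ==> \<exists>h\<in>S. \<forall>p\<in>strip R. g p = h p" by auto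
 have nj: "n - j = Suc (n - Suc j)" using Suc.prems by simp
 have "\<forall>h. \<exists>D. h \<in> S --> grad (strip R) h (fst D) (snd D) \<and> ck R al (n - Suc j) (fst D) \<and> ck R al (n - Suc j) (snd D)"
  using S(2) unfolding nj ck.simps by (metis fst_conv snd_conv)
 from choice[OF this] obtain D where D: "!!h. h \<in> S ==> grad (strip R) h (fst (D h)) (snd (D h))"
  "!!h. h \<in> S ==> ck R al (n - Suc j) (fst (D h))" "!!h. h \<in> S ==> ck R al (n - Suc j) (snd (D h))" by blast
 define T where "T = (%h. fst (D h)) ` S \<union> (%h. snd (D h)) ` S"
 have "\<exists>h\<in>T. \<forall>p\<in>strip R. g p = h p" if "pderiv_of (strip R) f (Suc j) g" for g
  using that
 proof (cases rule: pderiv_of.cases)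
  case (step g0 g' b)
  obtain h where h: "h \<in> S" "\<forall>p\<in>strip R. g0 p = h p" using S(3)[OF step(2)] by blast
  note u = grad_unique[OF R derivative_grad[OF step(3)] D(1)[OF h(1)] bspec[OF h(2)]]
  from Basis_plane(3)[OF step(4)] show ?thesis
  proof
   assume "b = (1, 0)"
   then have "\<forall>p\<in>strip R. g p = fst (D h) p" using u(1) step(1) by simp
   then show ?thesis unfolding T_def using h(1) by blast
  next
   assume "b = (0, 1)"
   then have "\<forall>p\<in>strip R. g p = snd (D h) p" using u(2) step(1) by simp
   then show ?thesis unfolding T_def using h(1) by blast
  qed
 qed
 moreover have "finite T" "\<forall>h\<in>T. ck R al (n - Suc j) h" unfolding T_def using S(1) D(2,3) by auto
 ultimately show ?case by blast
qed

text \<open>The finite set of representatives from \<open>pderiv_finite\<close> supplies one Hoelder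
  constant for the top order, namely the sum of theirs.\<close>

lemma ck_hoelder_space:
 assumes R: "R > 0" and al: "0 < al" and f: "ck R al n f" shows "hoelder_space n al (strip R) f"
 unfolding hoelder_space_def
proof (intro conjI allI impI)
 have ckg: "ck R al (n - j) g" if j: "j <= n" and g: "pderiv_of (strip R) f j g" for j g
 proof -
  obtain h where h: "ck R al (n - j) h" "\<forall>p\<in>strip R. g p = h p" using pderiv_finite[OF R f j] g by blast
  show ?thesis by (rule ck_cong[OF h(1) bspec[OF h(2)]])
 qed
 fix j g
 show "\<exists>g'. \<forall>p\<in>strip R. (g has_derivative g' p) (at p within strip R)" if j: "j < n" and g: "pderiv_of (strip R) f j g"
 proof -
  have nj: "n - j = Suc (n - Suc j)" using j by simp
  obtain g1 g2 where "grad (strip R) g g1 g2" using ckg[OF less_imp_le[OF j] g, unfolded nj ck.simps] by blast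
  then show ?thesis unfolding grad_def by (intro exI)
 qed
 show "continuous_on (strip R) g" "bounded (g ` strip R)" if j: "j <= n" and g: "pderiv_of (strip R) f j g"
 proof -
  obtain K where K: "hb (strip R) al K g" using ck_hb[OF ckg[OF j g]] by blast
  show "continuous_on (strip R) g" by (rule hb_continuous[OF K al])
  show "bounded (g ` strip R)" using K unfolding hb_def bounded_iff by auto
 qed
next
 obtain S where S: "finite S" "!!h. h \<in> S ==> ck R al (n - n) h" "!!g. pderiv_of (strip R) f n g ==> \<exists>h\<in>S. \<forall>p\<in>strip R. g p = h p"
  using pderiv_finite[OF R f order_refl] by blast
 have "\<forall>h. \<exists>K. h \<in> S --> hb (strip R) al K h" using S(2) by auto
 from choice[OF this] obtain K where K: "!!h. h \<in> S ==> hb (strip R) al (K h) h" by blast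
 show "\<exists>C. \<forall>g. pderiv_of (strip R) f n g --> (\<forall>p\<in>strip R. \<forall>q\<in>strip R. \<bar>g p - g q\<bar> <= C * dist p q powr al)"
 proof (rule exI[of _ "\<Sum>h\<in>S. \<bar>K h\<bar>"], intro allI impI ballI)
  fix g p q assume g: "pderiv_of (strip R) f n g" and pq: "p \<in> strip R" "q \<in> strip R"
  obtain h where h: "h \<in> S" "\<forall>p\<in>strip R. g p = h p" using S(3)[OF g] by blast
  have "K h <= \<bar>K h\<bar>" by simp
  also have "\<dots> <= (\<Sum>h\<in>S. \<bar>K h\<bar>)" by (rule member_le_sum) (use S(1) h(1) in auto)
  finally have "hb (strip R) al (\<Sum>h\<in>S. \<bar>K h\<bar>) h" by (rule hb_mono[OF K[OF h(1)]])
  from hbD[OF this pq] show "\<bar>g p - g q\<bar> <= (\<Sum>h\<in>S. \<bar>K h\<bar>) * dist p q powr al" using h(2) pq by simp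
 qed
qed

text \<open>Below the top order the definition imposes no Hoelder condition; it follows from the
  bounded derivatives of the next order, by the mean value theorem on the convex strip.\<close>

lemma hoelder_hb:
 assumes al: "0 < al" "al <= 1" and h: "hoelder_space n al (strip R) f" and j: "j <= n" and g: "pderiv_of (strip R) f j g"
 shows "\<exists>K. hb (strip R) al K g"
proof -
 have bnd: "\<exists>B\<ge>0. \<forall>p\<in>strip R. \<bar>g p\<bar> <= B" if "j <= n" "pderiv_of (strip R) f j g" for j g
 proof -
  have "bounded (g ` strip R)" using h that unfolding hoelder_space_def by blast
  then obtain B where B: "\<forall>y\<in>g ` strip R. norm y <= B" unfolding bounded_iff by blast
  then have "\<forall>p\<in>strip R. \<bar>g p\<bar> <= \<bar>B\<bar>" by fastforce
  then show ?thesis by (intro exI[of _ "\<bar>B\<bar>"]) simp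
 qed
 obtain B where B: "B \<ge> 0" "\<forall>p\<in>strip R. \<bar>g p\<bar> <= B" using bnd[OF j g] by blast
 show ?thesis
 proof (cases "j = n")
  case True
  obtain C where "\<forall>p\<in>strip R. \<forall>q\<in>strip R. \<bar>g p - g q\<bar> <= C * dist p q powr al" using h g unfolding hoelder_space_def True by blast
  then have "hol (strip R) al C g" unfolding hol_def .
  then have "hol (strip R) al (max B C) g" by (rule hol_mono) simp
  then have "hb (strip R) al (max B C) g" unfolding hb_def using B by (simp add: le_max_iff_disj)
  then show ?thesis ..
 next
  case False
  then have j': "j < n" using j by simp
  obtain g' where g': "\<forall>p\<in>strip R. (g has_derivative g' p) (at p within strip R)" using h j' g unfolding hoelder_space_def by blast
  obtain C D where C: "C \<ge> 0" "\<forall>p\<in>strip R. \<bar>g' p (1, 0)\<bar> <= C" and D: "D \<ge> 0" "\<forall>p\<in>strip R. \<bar>g' p (0, 1)\<bar> <= D"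
   using bnd[OF _ pderiv_of.step[OF g g' Basis_plane(1)]] bnd[OF _ pderiv_of.step[OF g g' Basis_plane(2)]] j' by auto
  have CD: "\<bar>g' p (1, 0)\<bar> <= C + D" "\<bar>g' p (0, 1)\<bar> <= C + D" if "p \<in> strip R" for p
   using bspec[OF C(2) that] bspec[OF D(2) that] C(1) D(1) by linarith+
  have "hb (strip R) al (2 * (C + D) + 2 * B) g"
   by (rule hb_lipschitz[OF al bspec[OF B(2)] grad_lipschitz[OF convex_strip derivative_grad[OF g'] CD]]) (use B C D in simp_all)
  then show ?thesis ..
 qed
qed

text \<open>The mixed difference over a small square is evaluated by the mean value theorem in both
  orders. The square has a corner at \<open>q\<close> and lies on its side towards the axis, so edge
  points with their one-sided derivatives are included.\<close>

lemma mixed_derivatives_symmetric: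
 assumes R: "R > 0" and g: "grad (strip R) w w1 w2" "grad (strip R) w1 w11 w12" "grad (strip R) w2 w21 w22"
  and c: "continuous_on (strip R) w12" "continuous_on (strip R) w21" and q: "q \<in> strip R"
 shows "w12 q = w21 q"
proof (rule ccontr)
 assume ne: "w12 q \<noteq> w21 q"
 define m where "m = \<bar>w12 q - w21 q\<bar> / 2"
 have m: "m > 0" unfolding m_def using ne by simp
 obtain \<delta>1 where d1: "\<delta>1 > 0" "!!p. p \<in> strip R ==> dist p q < \<delta>1 ==> \<bar>w12 p - w12 q\<bar> < m"
  using c(1) q m unfolding continuous_on_iff dist_real_def by blast
 obtain \<delta>2 where d2: "\<delta>2 > 0" "!!p. p \<in> strip R ==> dist p q < \<delta>2 ==> \<bar>w21 p - w21 q\<bar> < m"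
  using c(2) q m unfolding continuous_on_iff dist_real_def by blast
 define s where "s = min R (min \<delta>1 \<delta>2 / 3)"
 have s: "s > 0" "s <= R" "2 * s < \<delta>1" "2 * s < \<delta>2" unfolding s_def using R d1 d2 by auto
 define x0 where "x0 = fst q"
 define y0 where "y0 = snd q"
 have qe: "q = (x0, y0)" unfolding x0_def y0_def by simp
 define y where "y = (if y0 <= 0 then y0 else y0 - s)"
 have y0: "\<bar>y0\<bar> <= R" using q unfolding y0_def by (simp add: mem_strip)
 have yI: "{y..y + s} \<subseteq> {-R..R}" unfolding y_def using y0 s by (auto simp: abs_le_iff)
 have near: "(\<xi>, \<eta>) \<in> strip R \<and> dist (\<xi>, \<eta>) q <= 2 * s" if "\<xi> \<in> {x0..x0 + s}" "\<eta> \<in> {y..y + s}" for \<xi> \<eta>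
 proof -
  have "\<bar>\<xi> - x0\<bar> <= s" "\<bar>\<eta> - y0\<bar> <= s" using that s unfolding y_def by (auto simp: abs_le_iff split: if_splits)
  then have "dist (\<xi>, \<eta>) q <= 2 * s" unfolding qe using dist_le_sum[of \<xi> \<eta> x0 y0] by linarith
  moreover have "\<eta> \<in> {-R..R}" using yI that(2) by blast
  ultimately show ?thesis by (auto simp: mem_strip)
 qed
 have yy: "y \<in> {-R..R}" "y + s \<in> {-R..R}" using yI s by auto
 let ?\<Delta> = "w (x0 + s, y + s) - w (x0, y + s) - (w (x0 + s, y) - w (x0, y))"
 obtain \<xi> where \<xi>: "\<xi> \<in> {x0..x0 + s}" "(w (x0 + s, y + s) - w (x0 + s, y)) - (w (x0, y + s) - w (x0, y)) = (x0 + s - x0) * (w1 (\<xi>, y + s) - w1 (\<xi>, y))"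
  using mvt_interval[of x0 "x0 + s" UNIV "%x. w (x, y + s) - w (x, y)" "%x. w1 (x, y + s) - w1 (x, y)"]
   DERIV_diff[OF row_derivative[OF g(1) yy(2)] row_derivative[OF g(1) yy(1)]] s(1) by auto
 obtain \<eta> where \<eta>: "\<eta> \<in> {y..y + s}" "w1 (\<xi>, y + s) - w1 (\<xi>, y) = (y + s - y) * w12 (\<xi>, \<eta>)"
  using mvt_interval[of y "y + s" "{-R..R}" "%y. w1 (\<xi>, y)" "%y. w12 (\<xi>, y)"] column_derivative[OF g(2)] s(1) yI by auto
 obtain \<eta>' where \<eta>': "\<eta>' \<in> {y..y + s}" "(w (x0 + s, y + s) - w (x0, y + s)) - (w (x0 + s, y) - w (x0, y)) = (y + s - y) * (w2 (x0 + s, \<eta>') - w2 (x0, \<eta>'))"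
  using mvt_interval[of y "y + s" "{-R..R}" "%y. w (x0 + s, y) - w (x0, y)" "%y. w2 (x0 + s, y) - w2 (x0, y)"]
   DERIV_diff[OF column_derivative[OF g(1)] column_derivative[OF g(1)]] s(1) yI by auto
 have yy': "\<eta>' \<in> {-R..R}" using \<eta>'(1) yI by blast
 obtain \<xi>' where \<xi>': "\<xi>' \<in> {x0..x0 + s}" "w2 (x0 + s, \<eta>') - w2 (x0, \<eta>') = (x0 + s - x0) * w21 (\<xi>', \<eta>')"
  using mvt_interval[of x0 "x0 + s" UNIV "%x. w2 (x, \<eta>')" "%x. w21 (x, \<eta>')"] row_derivative[OF g(3) yy'] s(1) by auto
 have "?\<Delta> = s * (s * w12 (\<xi>, \<eta>))" using \<xi>(2) \<eta>(2) by simp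
 moreover have "?\<Delta> = s * (s * w21 (\<xi>', \<eta>'))" using \<xi>'(2) \<eta>'(2) by simp
 ultimately have "s * (s * w12 (\<xi>, \<eta>)) = s * (s * w21 (\<xi>', \<eta>'))" by (rule trans[OF sym])
 then have "w12 (\<xi>, \<eta>) = w21 (\<xi>', \<eta>')" using s(1) by simp
 moreover have "\<bar>w12 (\<xi>, \<eta>) - w12 q\<bar> < m" using near[OF \<xi>(1) \<eta>(1)] s(3) by (intro d1(2)) auto
 moreover have "\<bar>w21 (\<xi>', \<eta>') - w21 q\<bar> < m" using near[OF \<xi>'(1) \<eta>'(1)] s(4) by (intro d2(2)) auto
 moreover have "m + m = \<bar>w12 q - w21 q\<bar>" unfolding m_def by simp
 ultimately show False using abs_triangle_ineq[of "w12 q - w12 (\<xi>, \<eta>)" "w21 (\<xi>', \<eta>') - w21 q"] by (simp add: abs_minus_commute)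
qed

text \<open>Brings an arbitrary competitor into jet form. The two mixed second derivatives have to
  be identified, since a jet has the single entry 4 for both.\<close>

lemma hoelder_adm:
 assumes R: "R > 0" and al: "0 < al" "al <= 1" and h: "hoelder_space n al (strip R) w" and n: "2 <= n" and p: "per R P w"
 shows "\<exists>U. adm R P al U \<and> U 0 = w"
proof -
 have der: "\<exists>g'. \<forall>p\<in>strip R. (g has_derivative g' p) (at p within strip R)" if "j < 2" "pderiv_of (strip R) w j g" for j g
  using h that n unfolding hoelder_space_def by (meson order_less_le_trans)
 obtain D where D: "\<forall>p\<in>strip R. (w has_derivative D p) (at p within strip R)" using der[OF _ pderiv_of.base] by auto
 note p1 = pderiv_of.step[OF pderiv_of.base D]
 obtain D1 where D1: "\<forall>p\<in>strip R. ((%p. D p (1, 0)) has_derivative D1 p) (at p within strip R)" using der[OF _ p1[OF Basis_plane(1)]] by auto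
 obtain D2 where D2: "\<forall>p\<in>strip R. ((%p. D p (0, 1)) has_derivative D2 p) (at p within strip R)" using der[OF _ p1[OF Basis_plane(2)]] by auto
 note p2 = pderiv_of.step[OF p1[OF Basis_plane(1)] D1] pderiv_of.step[OF p1[OF Basis_plane(2)] D2]
 note g = derivative_grad[OF D] derivative_grad[OF D1] derivative_grad[OF D2]
 have h0: "\<exists>K. hb (strip R) al K f" if "pderiv_of (strip R) w j f" "j <= 2" for j f
  by (rule hoelder_hb[OF al h _ that(1)]) (use that n in simp)
 have c: "continuous_on (strip R) f" if "pderiv_of (strip R) w j f" "j <= 2" for j f
  using h0[OF that] hb_continuous al(1) by blast
 have sym: "D1 p (0, 1) = D2 p (1, 0)" if "p \<in> strip R" for p
  by (rule mixed_derivatives_symmetric[OF R g c[OF p2(1)[OF Basis_plane(2)]] c[OF p2(2)[OF Basis_plane(1)]] that]) simp_all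
 define U where "U i = (if i = (0::nat) then w else if i = 1 then (%p. D p (1, 0)) else if i = 2 then (%p. D p (0, 1)) else
  if i = 3 then (%p. D1 p (1, 0)) else if i = 4 then (%p. D1 p (0, 1)) else (%p. D2 p (0, 1)))" for i
 have "adm R P al U"
 proof (rule admI)
  have "grad (strip R) (%p. D p (0, 1)) (%p. D1 p (0, 1)) (%p. D2 p (0, 1))" by (rule grad_cong[OF g(3)]) (simp_all add: sym)
  then show "jet (strip R) U" unfolding jet_def U_def using g(1,2) by simp
  show "ck R al 0 (U i)" for i
   using h0[OF pderiv_of.base] h0[OF p1[OF Basis_plane(1)]] h0[OF p1[OF Basis_plane(2)]] h0[OF p2(1)[OF Basis_plane(1)]] h0[OF p2(1)[OF Basis_plane(2)]] h0[OF p2(2)[OF Basis_plane(2)]]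
   unfolding U_def by simp
  show "per R P (U 0)" unfolding U_def using p by simp
 qed
 then show ?thesis unfolding U_def by (intro exI conjI) (assumption, simp)
qed

lemma partial_grad:
 assumes R: "R > 0" and g: "grad (strip R) f f1 f2" and p: "p \<in> strip R"
 shows "partial_x (strip R) f p = f1 p" "partial_y (strip R) f p = f2 p"
proof -
 have d: "(f has_derivative (%h. fst h * f1 p + snd h * f2 p)) (at p within strip R)" using g p unfolding grad_def by blast
 then have "f differentiable (at p within strip R)" by (rule differentiableI)
 then have "(f has_derivative frechet_derivative f (at p within strip R)) (at p within strip R)" by (simp add: frechet_derivative_works)
 from has_derivative_unique_strip[OF R p this d]
 show "partial_x (strip R) f p = f1 p" "partial_y (strip R) f p = f2 p" unfolding partial_x_def partial_y_def by simp_all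
qed

text \<open>Connects the equation as posed, with \<open>powr\<close> and iterated partial
  derivatives, to its expanded jet form. Both existence and uniqueness pass through this
  identity.\<close>

lemma equation_jet:
 assumes R: "R > 0" and a: "a \<noteq> 0" and V: "adm R P al V" and p: "p \<in> strip R"
 shows "partial_x (strip R) (%q. (V 0 q ^ 2 + snd q ^ 2 + a ^ 2) powr (-1/2) * partial_x (strip R) (V 0) q) p
    + 2 * partial_y (strip R) (partial_y (strip R) (V 0)) p
  = AA a (V 0 p) (snd p) * V 3 p + 2 * V 5 p + AV a (V 0 p) (snd p) * (V 1 p * V 1 p)"
proof -
 note g = adm_grad[OF V]
 have pw: "(V 0 q ^ 2 + snd q ^ 2 + a ^ 2) powr (-1/2) = AA a (V 0 q) (snd q)" for q
 proof -
  have "(V 0 q ^ 2 + snd q ^ 2 + a ^ 2) powr (-1/2) = inverse ((V 0 q ^ 2 + snd q ^ 2 + a ^ 2) powr (1/2))"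
   by (simp add: powr_minus[symmetric])
  then show ?thesis unfolding AA_def using AA_base(1)[OF a, of "V 0 q" "snd q"] by (simp add: powr_half_sqrt inverse_eq_divide)
 qed
 note gm = grad_mult[OF grad_AA[OF a g(1)] g(2)]
 have 1: "partial_x (strip R) (%q. AA a (V 0 q) (snd q) * partial_x (strip R) (V 0) q) p = AA a (V 0 p) (snd p) * V 3 p + AV a (V 0 p) (snd p) * (V 1 p * V 1 p)"
  by (rule trans[OF partial_grad(1)[OF R grad_cong[OF gm _ refl refl] p]])
   (simp_all add: partial_grad(1)[OF R g(1)] AV_def power3_eq_cube)
 have 2: "partial_y (strip R) (partial_y (strip R) (V 0)) p = V 5 p"
  by (rule partial_grad(2)[OF R grad_cong[OF g(3) partial_grad(2)[OF R g(1)] refl refl] p])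
 show ?thesis unfolding pw 1 2 by simp
qed

theorem theorem7p1:
  fixes R P a \<alpha> :: real and k :: nat and \<phi>p \<phi>m :: "real \<Rightarrow> real"
  assumes "R > 0" and "P > 0" and "a \<noteq> 0" and "0 < \<alpha>" and "\<alpha> < 1"
    and "hoelder_space (k + 2) \<alpha> UNIV \<phi>p" and "hoelder_space (k + 2) \<alpha> UNIV \<phi>m"
    and "\<And>x. \<phi>p (x + P) = \<phi>p x" and "\<And>x. \<phi>m (x + P) = \<phi>m x"
  shows "\<exists>v. hoelder_space (k + 2) \<alpha> (strip R) v \<and> solves_problem R P a \<phi>p \<phi>m v \<and>
           (\<forall>w. hoelder_space (k + 2) \<alpha> (strip R) w \<and> solves_problem R P a \<phi>p \<phi>m w \<longrightarrow>
                (\<forall>p\<in>strip R. w p = v p))"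
proof -
  note R = assms(1) and P = assms(2) and a = assms(3) and \<alpha> = assms(4,5)
  note \<alpha>1 = \<alpha>(1) less_imp_le[OF \<alpha>(2)]
  \<comment> \<open>Indexing the two edges by their height \<open>s\<close> lets every argument
    treat both at once; \<open>R > 0\<close> keeps the indices \<open>R\<close> and
    \<open>-R\<close> apart.\<close>
  define \<phi> where "\<phi> s = (if s = R then \<phi>p else \<phi>m)" for s
  have \<phi>: "hoelder_space (k + 2) \<alpha> UNIV (\<phi> s)" "\<phi> s (x + P) = \<phi> s x" for s x unfolding \<phi>_def using assms by simp_all
  have "\<forall>s. \<exists>D. (\<forall>x. fst D 2 x + snd D = \<phi> s x) \<and> (\<forall>i<k + 2 + 2. \<forall>x. (fst D i has_real_derivative fst D (Suc i) x) (at x)) \<and>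
      (\<forall>i\<le>k + 2 + 2. \<exists>K. hb UNIV \<alpha> K (fst D i)) \<and> (\<forall>x. fst D 0 (x + P) = fst D 0 x)"
  proof
    fix s
    obtain d m where "(\<forall>x. d 2 x + m = \<phi> s x) \<and> (\<forall>i<k + 2 + 2. \<forall>x. (d i has_real_derivative d (Suc i) x) (at x)) \<and>
      (\<forall>i\<le>k + 2 + 2. \<exists>K. hb UNIV \<alpha> K (d i)) \<and> (\<forall>x. d 0 (x + P) = d 0 x)"
      using double_primitive[OF \<phi>(1) \<alpha>1 P \<phi>(2), of s] by auto
    then show "\<exists>D. (\<forall>x. fst D 2 x + snd D = \<phi> s x) \<and> (\<forall>i<k + 2 + 2. \<forall>x. (fst D i has_real_derivative fst D (Suc i) x) (at x)) \<and>
      (\<forall>i\<le>k + 2 + 2. \<exists>K. hb UNIV \<alpha> K (fst D i)) \<and> (\<forall>x. fst D 0 (x + P) = fst D 0 x)" by (intro exI[of _ "(d, m)"]) simp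
  qed
  from choice[OF this] obtain D where D: "\<forall>s. (\<forall>x. fst (D s) 2 x + snd (D s) = \<phi> s x) \<and> (\<forall>i<k + 2 + 2. \<forall>x. (fst (D s) i has_real_derivative fst (D s) (Suc i) x) (at x)) \<and>
      (\<forall>i\<le>k + 2 + 2. \<exists>K. hb UNIV \<alpha> K (fst (D s) i)) \<and> (\<forall>x. fst (D s) 0 (x + P) = fst (D s) 0 x)" ..
  define d where "d s = fst (D s)" for s
  define m where "m s = snd (D s)" for s
  have d: "d s 2 x + m s = \<phi> s x" "\<And>i. i < k + 4 \<Longrightarrow> (d s i has_real_derivative d s (Suc i) x) (at x)" "\<And>i. i \<le> k + 4 \<Longrightarrow> \<exists>K. hb UNIV \<alpha> K (d s i)" "d s 0 (x + P) = d s 0 x" for s x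
    using D[rule_format, of s] unfolding d_def m_def by simp_all
  have hu: "\<exists>K\<ge>0. \<forall>i\<le>k + 4. hb UNIV \<alpha> K (d s i)" for s by (rule hb_uniform) (rule d(3))
  obtain K1 where K1: "K1 \<ge> 0" "\<forall>i\<le>k + 4. hb UNIV \<alpha> K1 (d R i)" using hu[of R] by (elim exE conjE) (rule that)
  obtain K2 where K2: "K2 \<ge> 0" "\<forall>i\<le>k + 4. hb UNIV \<alpha> K2 (d (-R) i)" using hu[of "-R"] by (elim exE conjE) (rule that)
  define K where "K = max K1 K2"
  have K0: "K \<ge> 0" unfolding K_def using K1(1) by simp
  have K: "hb UNIV \<alpha> K (d s i)" if "s \<in> {R,-R}" "i \<le> k + 4" for s i
  proof -
    have "hb UNIV \<alpha> K (d R i)" by (rule hb_mono[of _ _ K1]) (use K1 that in \<open>simp_all add: K_def\<close>)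
    moreover have "hb UNIV \<alpha> K (d (-R) i)" by (rule hb_mono[of _ _ K2]) (use K2 that in \<open>simp_all add: K_def\<close>)
    ultimately show ?thesis using that by auto
  qed
  \<comment> \<open>\<open>c0 + c1 * y\<close> interpolates the constants \<open>m s\<close> that
    were split off before the double integration; this is the affine part of
    \<open>v\<close>.\<close>
  define c0 where "c0 = (m R + m (-R)) / 2"
  define c1 where "c1 = (m R - m (-R)) / (2 * R)"
  have ms: "c0 + c1 * s = m s" if "s \<in> {R,-R}" for s
    using that R unfolding c0_def c1_def by (auto simp: field_simps)
  have d2: "d s 2 (x + P) = d s 2 x" for s x using d(1)[of s x] d(1)[of s "x + P"] \<phi>(2)[of s x] by simp
  have "\<exists>J. nsol R P \<alpha> a c0 c1 d 1 J"
    by (rule existence[OF R P \<alpha> a K0]) (simp_all add: d(2) d(4) d2 K)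
  then obtain J where J: "nsol R P \<alpha> a c0 c1 d 1 J" ..
  have "\<exists>V. vsol R P \<alpha> a (\<lambda>s x. d s 2 x + (c0 + c1 * s)) (\<lambda>s. d s 3) (\<lambda>s. d s 4) V \<and> (\<forall>p\<in>strip R. V 0 p = J 3 p + (c0 + c1 * snd p))"
  proof (rule nsol_vsol[OF R \<alpha> a, where Kb=K])
    show "adm R P \<alpha> J" using J unfolding nsol_def by blast
    show "FF a (J 3 p + (c0 + c1 * snd p)) (snd p) + 2 * J 5 p = 0" if "p \<in> strip R" for p using J that unfolding nsol_def by simp
    show "J 0 (x, s) = d s 0 x" if "s \<in> {R,-R}" for s x using J that unfolding nsol_def by auto
    show "hol UNIV \<alpha> K (d s i)" if "s \<in> {R,-R}" "i \<le> 4" for s i using K[OF that(1), of i] that(2) unfolding hb_def by simp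
  qed (simp add: d(2))
  then obtain V where V: "vsol R P \<alpha> a (\<lambda>s x. d s 2 x + (c0 + c1 * s)) (\<lambda>s. d s 3) (\<lambda>s. d s 4) V" by blast
  have aV: "adm R P \<alpha> V" and eV: "\<And>p. p \<in> strip R \<Longrightarrow> AA a (V 0 p) (snd p) * V 3 p + 2 * V 5 p = - AV a (V 0 p) (snd p) * (V 1 p * V 1 p)"
    and bV: "\<And>s x. s \<in> {R,-R} \<Longrightarrow> V 0 (x, s) = d s 2 x + (c0 + c1 * s)" using V unfolding vsol_def by blast+
  have V\<phi>: "V 0 (x, s) = \<phi> s x" if "s \<in> {R,-R}" for s x using bV[OF that] ms[OF that] d(1)[of s x] by simp
  \<comment> \<open>The derivatives of the boundary data themselves: those of \<open>d\<close>
    shifted by two, with the constant \<open>m s\<close> restored at order 0 only.\<close>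
  define c where "c s i x = d s (i + 2) x + (if i = 0 then m s else 0)" for s i x
  have cd: "(c s i has_real_derivative c s (Suc i) x) (at x)" if "i < k + 2" for s i x
    unfolding c_def using DERIV_add[OF d(2)[of "i + 2" s x] DERIV_const[of "if i = 0 then m s else 0"]] that by simp
  have vc: "vsol R P \<alpha> a (\<lambda>s. c s 0) (\<lambda>s. c s 1) (\<lambda>s. c s 2) V" unfolding vsol_def
  proof (intro conjI ballI allI)
    fix s x assume s: "s \<in> {R,-R}"
    show "V 0 (x, s) = c s 0 x" unfolding V\<phi>[OF s] c_def using d(1)[of s x] by (simp add: numeral_2_eq_2)
    show "(c s 0 has_real_derivative c s 1 x) (at x)" "(c s 1 has_real_derivative c s 2 x) (at x)" using cd[of 0 s x] cd[of 1 s x] by (simp_all add: numeral_2_eq_2)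
  qed (use aV eV in simp_all)
  have "ck R \<alpha> (k + 2) (V 0)"
  proof (rule vsol_regular[OF R P \<alpha> a vc])
    show "hol UNIV \<alpha> K (c s i)" if "s \<in> {R,-R}" "i \<le> k + 2" for s i
      using K[OF that(1), of "i + 2"] that(2) unfolding hb_def hol_def c_def by simp
  qed (rule cd)
  then have hV: "hoelder_space (k + 2) \<alpha> (strip R) (V 0)" by (rule ck_hoelder_space[OF R \<alpha>(1)])
  have "solves_problem R P a \<phi>p \<phi>m (V 0)" unfolding solves_problem_def
  proof (intro conjI ballI allI impI)
    fix p assume p: "p \<in> strip R"
    show "partial_x (strip R) (\<lambda>q. (V 0 q ^ 2 + snd q ^ 2 + a ^ 2) powr (-1/2) * partial_x (strip R) (V 0) q) p
        + 2 * partial_y (strip R) (partial_y (strip R) (V 0)) p = 0"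
      unfolding equation_jet[OF R a aV p] using eV[OF p] by simp
  next
    fix x y assume "(x, y) \<in> strip R"
    then show "V 0 (x + P, y) = V 0 (x, y)" using perD[OF adm_per[OF aV R], of 0 "(x, y)"] by simp
  next
    fix x
    show "V 0 (x, R) = \<phi>p x" "V 0 (x, -R) = \<phi>m x" using V\<phi>[of R x] V\<phi>[of "-R" x] R unfolding \<phi>_def by simp_all
  qed
  moreover have "w p = V 0 p" if w: "hoelder_space (k + 2) \<alpha> (strip R) w" and sw: "solves_problem R P a \<phi>p \<phi>m w" and p: "p \<in> strip R" for w p
  proof -
    have "per R P w" unfolding per_def
    proof
      fix q assume "q \<in> strip R"
      then show "w (q + (P, 0)) = w q" using sw unfolding solves_problem_def by (cases q) simp
    qed
    then obtain U where U: "adm R P \<alpha> U" "U 0 = w" using hoelder_adm[OF R \<alpha>1 w] by auto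
    show ?thesis unfolding U(2)[symmetric]
    proof (rule uniqueness[OF R P \<alpha> a U(1) _ aV eV _ p])
      show "AA a (U 0 q) (snd q) * U 3 q + 2 * U 5 q = - AV a (U 0 q) (snd q) * (U 1 q * U 1 q)" if q: "q \<in> strip R" for q
      proof -
        have "partial_x (strip R) (\<lambda>q. (U 0 q ^ 2 + snd q ^ 2 + a ^ 2) powr (-1/2) * partial_x (strip R) (U 0) q) q
          + 2 * partial_y (strip R) (partial_y (strip R) (U 0)) q = 0"
          unfolding U(2) using sw q unfolding solves_problem_def by blast
        then show ?thesis unfolding equation_jet[OF R a U(1) q] by simp
      qed
      show "U 0 (x, s) = V 0 (x, s)" if s: "s \<in> {R,-R}" for s x
        unfolding V\<phi>[OF s] U(2) using sw s R unfolding solves_problem_def \<phi>_def by auto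
    qed
  qed
  ultimately show ?thesis using hV by (intro exI[of _ "V 0"]) blast
qed

end
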